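(* Let $\mathcal{O}$ be the imaginary quadratic order of discriminant $D=f^2d_0$ and conductor $f$, where $d_0$ is the fundamental discriminant. In the proper ideal class group of $\mathcal{O}$, suppose $\mathcal{C}$ and $\mathcal{C}'$ are well-rounded ideal classes. Consider the following condition on a rational prime $\ell$: $$(\ast)\quad\text{a proper prime ideal }\mathfrak{p}_\ell\text{ of }\mathcal{O}\text{ of norm }\ell\text{ is in the class }\mathcal{C}^{-1}\mathcal{C}'.$$ Then for all rational primes $\ell$ satisfying $(\ast)$ there exists a $2$-and-$2$ form of index $\ell$ in which the lattices $M\subset L$ are respectively in the classes $\mathcal{C}'$ and $\mathcal{C}$. Infinitely many primes $\ell$ satisfy $(\ast)$. In the special case where $\mathcal{O}$ has only one ideal class per genus, there is a non-empty set of congruence classes modulo $D$ such that $(\ast)$ holds if and only if $\ell$ is in one of those congruence classes (apart from a finite number of $\ell$ that are exceptions).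
   Context: A lattice in $\mathbb{R}^2\cong\mathbb{C}$ is the $\mathbb{Z}$-span of an $\mathbb{R}$-basis; $\langle\,,\rangle$ is the standard dot product. Let $\ell$ be a prime, $L$ a lattice and $M\subset L$ a sublattice of index $\ell$. The pair $(L,M)$ is a tempered perfect lattice (or form) of index $\ell$ if, after rescaling $L$ and $M$ by a common positive scalar, there exist non-empty sets $S\subset L-M$ and $S'\subset M-\{0\}$ such that, with $A(v)=\langle v,v\rangle$: (i) $A(v)=1$ for all $v\in S$; (ii) $A(v)>1$ for all $v\in L-M$ with $v\notin S$; (iii) $A(v)$ has a common value $u\geqslant 1$ for all $v\in S'$; (iv) $A(v)>u$ for all $v\in M-\{0\}$ with $v\notin S'$; (v) if $B$ is any positive definite quadratic form on $\mathbb{R}^2$ satisfying (i)--(iv) in place of $A$ with the same $S,S'$ and with common value $u'$ on $S'$, then $B=A$ and $u'=u$. It is called an $s$-and-$s'$ form if $S$ consists of $s$ pairs $\pm v$ and $S'$ consists of $s'$ pairs $\pm v$. For an imaginary quadratic field $K\subset\mathbb{C}$, a fractional ideal in $K$ is a finitely generated $\mathbb{Z}$-submodule $L$ of $K$ spanning $K$ over $\mathbb{Q}$; its coefficient ring is $\{\alpha\in K\mid\alpha L\subseteq L\}$. It is a proper fractional ideal of the order $\mathcal{O}$ if its coefficient ring equals $\mathcal{O}$. Fractional ideals $L_1,L_2$ are similar if $L_2=\alpha L_1$ for some nonzero $\alpha\in K$. The similarity classes of proper fractional ideals of $\mathcal{O}$ form a finite abelian group under multiplication, the proper ideal class group. A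 lattice is well rounded if its nonzero vectors of minimal length contain a $\mathbb{Z}$-basis of it; an ideal class is well rounded if its members are well-rounded lattices in $\mathbb{C}$ (this depends only on the class). The genera are the cosets of the subgroup of squares in the class group; "one class per genus" means that each such coset has one element.
   Formalization: The 2-and-2 form is asserted for D ≠ −3 only; for D = −3 both lattices are hexagonal, each with three pairs of minimal vectors, so no 2-and-2 form exists and a 3-and-3 form of index ℓ is asserted instead. *)

theory Defs
  imports
    "HOL-Analysis.Analysis"
    "HOL-Computational_Algebra.Polynomial"
    "HOL-Computational_Algebra.Squarefree"
    "HOL-Number_Theory.Cong"
    "HOL-Algebra.Coset"
    "HOL-Algebra.Ideal"
begin

global_interpretation int_complex: module "\<lambda>(k::int) (z::complex). of_int k * z"
  by unfold_locales (simp_all add: algebra_simps)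

global_interpretation rat_complex: vector_space "\<lambda>(q::rat) (z::complex). of_rat q * z"
  by unfold_locales (simp_all add: algebra_simps of_rat_add of_rat_mult)

definition complex_lattice :: "complex set \<Rightarrow> bool" where
  "complex_lattice L \<longleftrightarrow> (\<exists>B. independent B \<and> span B = (UNIV :: complex set) \<and> L = int_complex.span B)"

text \<open>The number of cosets of \<open>M\<close> in \<open>L\<close>, for \<open>M \<subseteq> L\<close>; it is 0 if the index is infinite.\<close>

definition lattice_index :: "complex set \<Rightarrow> complex set \<Rightarrow> nat" where
  "lattice_index L M = card (L // {(x, y). x \<in> L \<and> y \<in> L \<and> x - y \<in> M})"

definition minimal_vectors :: "complex set \<Rightarrow> complex set" where
  "minimal_vectors L = {v \<in> L - {0}. \<forall>w \<in> L - {0}. norm v \<le> norm w}"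

definition well_rounded :: "complex set \<Rightarrow> bool" where
  "well_rounded L \<longleftrightarrow> complex_lattice L \<and>
     (\<exists>B \<subseteq> minimal_vectors L. int_complex.independent B \<and> int_complex.span B = L)"

definition quadratic_form :: "(complex \<Rightarrow> real) \<Rightarrow> bool" where
  "quadratic_form q \<longleftrightarrow>
     (\<exists>\<beta>. bilinear \<beta> \<and> (\<forall>x y. \<beta> x y = \<beta> y x) \<and> (\<forall>v. q v = \<beta> v v))"

definition pos_def_form :: "(complex \<Rightarrow> real) \<Rightarrow> bool" where
  "pos_def_form q \<longleftrightarrow> quadratic_form q \<and> (\<forall>v. v \<noteq> 0 \<longrightarrow> q v > 0)"

text \<open>
  \<open>S\<close> and \<open>S'\<close> are the complete sets of minimal vectors of \<open>q\<close> in \<open>L - M\<close> (with minimum 1) and in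
  \<open>M - {0}\<close> (with minimum \<open>u \<ge> 1\<close>).
\<close>

definition tempered_minima ::
    "(complex \<Rightarrow> real) \<Rightarrow> complex set \<Rightarrow> complex set \<Rightarrow> complex set \<Rightarrow> complex set \<Rightarrow> real \<Rightarrow> bool" where
  "tempered_minima q L M S S' u \<longleftrightarrow>
     (\<forall>v\<in>S. q v = 1) \<and>
     (\<forall>v\<in>L - M. v \<notin> S \<longrightarrow> q v > 1) \<and>
     (u \<ge> 1 \<and> (\<forall>v\<in>S'. q v = u)) \<and>
     (\<forall>v\<in>M - {0}. v \<notin> S' \<longrightarrow> q v > u)"

text \<open>
  \<open>L\<close> and \<open>M\<close> are already rescaled here. The form \<open>v \<bullet> v\<close> and the value \<open>u\<close> have to be determined
  uniquely by the minimal vectors.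
\<close>

definition normalized_tempered_perfect ::
    "complex set \<Rightarrow> complex set \<Rightarrow> complex set \<Rightarrow> complex set \<Rightarrow> bool" where
  "normalized_tempered_perfect L M S S' \<longleftrightarrow>
     S \<noteq> {} \<and> S \<subseteq> L - M \<and> S' \<noteq> {} \<and> S' \<subseteq> M - {0} \<and>
     (\<exists>u. tempered_minima (\<lambda>v. v \<bullet> v) L M S S' u \<and>
        (\<forall>B u'. pos_def_form B \<and> tempered_minima B L M S S' u' \<longrightarrow>
           B = (\<lambda>v. v \<bullet> v) \<and> u' = u))"

definition consists_of_pairs :: "complex set \<Rightarrow> nat \<Rightarrow> bool" where
  "consists_of_pairs S s \<longleftrightarrow>
     finite S \<and> (\<forall>v\<in>S. - v \<in> S) \<and> card ((\<lambda>v. {v, - v}) ` S) = s"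

text \<open>\<open>(L, M)\<close> is an \<open>s\<close>-and-\<open>s'\<close> form of index \<open>l\<close>.\<close>

definition tempered_form :: "nat \<Rightarrow> nat \<Rightarrow> nat \<Rightarrow> complex set \<Rightarrow> complex set \<Rightarrow> bool" where
  "tempered_form s s' l L M \<longleftrightarrow>
     prime l \<and> complex_lattice L \<and> complex_lattice M \<and> M \<subseteq> L \<and> lattice_index L M = l \<and>
     (\<exists>c>0. \<exists>S S'.
        normalized_tempered_perfect ((\<lambda>v. c *\<^sub>R v) ` L) ((\<lambda>v. c *\<^sub>R v) ` M) S S' \<and>
        consists_of_pairs S s \<and> consists_of_pairs S' s')"

definition fundamental_discriminant :: "int \<Rightarrow> bool" where
  "fundamental_discriminant d \<longleftrightarrow> d \<noteq> 1 \<and>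
     (d mod 4 = 1 \<and> squarefree d \<or>
      4 dvd d \<and> squarefree (d div 4) \<and> (d div 4) mod 4 \<in> {2, 3})"

definition quad_field :: "int \<Rightarrow> complex set" where
  "quad_field d = {of_rat a + of_rat b * csqrt (of_int d) | a b. True}"

text \<open>
  The order of conductor \<open>f\<close> in the field of fundamental discriminant \<open>d\<close> is \<open>\<int> + f \<O>\<close>, where
  \<open>\<O>\<close> is the ring of all algebraic integers of the field; its discriminant is \<open>f\<^sup>2 d\<close>.
\<close>

definition quad_order :: "int \<Rightarrow> nat \<Rightarrow> complex set" where
  "quad_order d f = {of_int a + of_nat f * x | a x. x \<in> quad_field d \<and> algebraic_int x}"

definition order_ring :: "int \<Rightarrow> nat \<Rightarrow> complex ring" where
  "order_ring d f =
     \<lparr>carrier = quad_order d f, monoid.mult = (*), one = 1, ring.zero = 0, add = (+)\<rparr>"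

definition fractional_ideal :: "int \<Rightarrow> complex set \<Rightarrow> bool" where
  "fractional_ideal d L \<longleftrightarrow>
     (\<exists>X. finite X \<and> X \<subseteq> quad_field d \<and> L = int_complex.span X) \<and>
     rat_complex.span L = quad_field d"

definition coefficient_ring :: "int \<Rightarrow> complex set \<Rightarrow> complex set" where
  "coefficient_ring d L = {\<alpha> \<in> quad_field d. (\<lambda>x. \<alpha> * x) ` L \<subseteq> L}"

definition proper_ideal :: "int \<Rightarrow> nat \<Rightarrow> complex set \<Rightarrow> bool" where
  "proper_ideal d f L \<longleftrightarrow> fractional_ideal d L \<and> coefficient_ring d L = quad_order d f"

definition similarity :: "int \<Rightarrow> nat \<Rightarrow> (complex set \<times> complex set) set" where
  "similarity d f =
     {(L1, L2). proper_ideal d f L1 \<and> proper_ideal d f L2 \<and>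
        (\<exists>\<alpha> \<in> quad_field d - {0}. L2 = (\<lambda>x. \<alpha> * x) ` L1)}"

definition ideal_product :: "complex set \<Rightarrow> complex set \<Rightarrow> complex set" where
  "ideal_product I J = int_complex.span {x * y | x y. x \<in> I \<and> y \<in> J}"

definition class_group :: "int \<Rightarrow> nat \<Rightarrow> complex set set monoid" where
  "class_group d f =
     \<lparr>carrier = {L. proper_ideal d f L} // similarity d f,
      monoid.mult = (\<lambda>X Y. \<Union>I\<in>X. \<Union>J\<in>Y. similarity d f `` {ideal_product I J}),
      one = similarity d f `` {quad_order d f}\<rparr>"

definition well_rounded_class :: "complex set set \<Rightarrow> bool" where
  "well_rounded_class X \<longleftrightarrow> (\<forall>L\<in>X. well_rounded L)"

definition genera :: "int \<Rightarrow> nat \<Rightarrow> complex set set set set" where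
  "genera d f =
     rcosets\<^bsub>class_group d f\<^esub>
       {X \<otimes>\<^bsub>class_group d f\<^esub> X | X. X \<in> carrier (class_group d f)}"

definition one_class_per_genus :: "int \<Rightarrow> nat \<Rightarrow> bool" where
  "one_class_per_genus d f \<longleftrightarrow> (\<forall>g \<in> genera d f. card g = 1)"

text \<open>
  Two different meanings of ``proper'' must not be confused: \<open>proper_ideal\<close> says that the
  coefficient ring is the whole order. The norm of an ideal is its index in the order.
\<close>

definition prime_ideal_in_class :: "int \<Rightarrow> nat \<Rightarrow> complex set set \<Rightarrow> nat \<Rightarrow> bool" where
  "prime_ideal_in_class d f X l \<longleftrightarrow>
     (\<exists>P. primeideal P (order_ring d f) \<and> proper_ideal d f P \<and>
        lattice_index (quad_order d f) P = l \<and> P \<in> X)"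

end

theory Submission
 imports Defs "HOL-Complex_Analysis.Complex_Analysis" "HOL-Number_Theory.Number_Theory" "HOL-Algebra.Multiplicative_Group"
begin

text \<open>
 Multiplication by \<open>v1 v2 / |v1|\<^sup>2\<close>, for minimal basis vectors \<open>v1\<close>, \<open>v2\<close> of a well-rounded ideal, maps the
 conjugate ideal to the ideal itself. So well-rounded classes have order at most 2, and so has the
 class \<open>X\<close> of \<open>(*)\<close>. If \<open>P\<close> is a prime ideal of norm \<open>l\<close> in \<open>X\<close> and \<open>L\<close> is in the first class, then
 \<open>P L\<close> is in the second one, and the minimal vectors of both lattices determine the form since \<open>l\<close> is prime.

 That \<open>X\<close> contains infinitely many primes is Dirichlet's argument for the characters of the class group.
 It needs the pole of the zeta function of a class, which is found without counting lattice points: the second differences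
 in \<open>z\<close> of the sum of \<open>|z + v|\<close> to the power \<open>-2s\<close> over a lattice converge for \<open>Re s > 0\<close>. Hence the sums over
 two cosets by torsion points differ by a holomorphic function, and the division of a lattice by 2 gives the continuation.

 With one class per genus all classes have order at most 2, so that ideals of the same norm coprime to \<open>D\<close> are
 equivalent. If two primes congruent modulo \<open>D\<close> split, their product is a square modulo \<open>D\<close>, and Legendre's
 theorem shows that it is a norm up to a square coprime to \<open>D\<close>. So the primes above them are equivalent.
 Whether a prime splits depends on its residue modulo \<open>D\<close> by quadratic reciprocity.
\<close>

text \<open>For \<open>D = -3\<close> both lattices are hexagonal with three pairs of minimal
  vectors each, so the form is 3-and-3 there; in all other cases it is 2-and-2. Proper ideals of a
  non-maximal order are invertible because their norm form is primitive, but they factor uniquely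
  only away from the conductor. Hence all counting concerns ideals with norm coprime to
  \<open>D\<close>, which still occur in every class and give each class the same residue. In
  Dirichlet's argument the order of the class \<open>X\<close> helps: characters take real values at
  \<open>X\<close>, so absolute values of L-series suffice and no argument has to be controlled.
  Landau's theorem excludes zeros at 1 for real and complex characters at once. It fixes the domain
  of the analytic statements, the disc of centre 2 and radius 2, which reaches every positive
  \<open>1 / n\<close> from the region of convergence. The obstacle in the last claim is the prime
  2: Legendre's zero must be given a coordinate coprime to \<open>D\<close>, and lifting square
  roots at 2 requires a congruence modulo 8, which a congruence of primes modulo \<open>D\<close>
  does not always provide.\<close>

lemmas square_simps = power2_eq_square algebra_simps

(* The simp rules of the two global interpretations loop with of_int_mult and with
  distributivity. *)
declare int_complex.scale_scale [simp del] rat_complex.scale_scale [simp del]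
declare int_complex.scale_right_distrib [algebra_simps del, algebra_split_simps del]
 int_complex.scale_left_distrib [algebra_simps del, algebra_split_simps del]
 int_complex.scale_left_diff_distrib [algebra_simps del, algebra_split_simps del]
 int_complex.scale_right_diff_distrib [algebra_simps del, algebra_split_simps del]
 rat_complex.scale_right_distrib [algebra_simps del, algebra_split_simps del]
 rat_complex.scale_left_distrib [algebra_simps del, algebra_split_simps del]
 rat_complex.scale_left_diff_distrib [algebra_simps del, algebra_split_simps del]
 rat_complex.scale_right_diff_distrib [algebra_simps del, algebra_split_simps del]

section \<open>Rank-two lattices in the complex plane\<close>

definition lat :: "complex => complex => complex set" where
 "lat a b = {of_int x * a + of_int y * b | x y. True}"

lemma latI: "of_int x * a + of_int y * b \<in> lat a b"
 by (auto simp: lat_def)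

lemma latE:
 assumes "z \<in> lat a b" obtains x y where "z = of_int x * a + of_int y * b"
 using assms by (auto simp: lat_def)

lemma lat_mem1 [simp]: "a \<in> lat a b" and lat_mem2 [simp]: "b \<in> lat a b"
 using latI[of 1 a 0 b] latI[of 0 a 1 b] by auto

lemma subspace_lat [simp]: "int_complex.subspace (lat a b)"
proof (unfold int_complex.subspace_def, intro conjI ballI allI)
 show "0 \<in> lat a b" using latI[of 0 a 0 b] by simp
next
 fix u v assume "u \<in> lat a b" "v \<in> lat a b"
 then obtain x y x' y' where "u = of_int x * a + of_int y * b" "v = of_int x' * a + of_int y' * b"
  by (auto elim!: latE)
 then show "u + v \<in> lat a b" using latI[of "x + x'" a "y + y'" b] by (simp add: algebra_simps)
next
 fix k :: int and v assume "v \<in> lat a b"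
 then obtain x y where "v = of_int x * a + of_int y * b" by (auto elim!: latE)
 then show "of_int k * v \<in> lat a b" using latI[of "k * x" a "k * y" b] by (simp add: algebra_simps)
qed

lemma subspace_add: "int_complex.subspace H ==> u \<in> H ==> v \<in> H ==> u + v \<in> H"
 and subspace_of_int_mult: "int_complex.subspace H ==> u \<in> H ==> of_int k * u \<in> H"
 and subspace_zero: "int_complex.subspace H ==> 0 \<in> H"
 by (auto simp: int_complex.subspace_def)

lemma subspace_uminus: "int_complex.subspace H ==> u \<in> H ==> - u \<in> H"
 using subspace_of_int_mult[of H u "-1"] by simp

lemma subspace_diff: "int_complex.subspace H ==> u \<in> H ==> v \<in> H ==> u - v \<in> H"
 using subspace_add[of H u "- v"] subspace_uminus[of H v] by simp

lemma lat_subset: "int_complex.subspace H ==> a \<in> H ==> b \<in> H ==> lat a b \<subseteq> H"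
 by (auto elim!: latE intro!: subspace_add subspace_of_int_mult)

lemma lat_eq_span: "lat a b = int_complex.span {a, b}"
proof
 show "lat a b \<subseteq> int_complex.span {a, b}"
  by (rule lat_subset) (auto intro: int_complex.span_base)
 show "int_complex.span {a, b} \<subseteq> lat a b"
  by (rule int_complex.span_minimal) auto
qed

lemma subspace_image_mult:
 assumes "int_complex.subspace H" shows "int_complex.subspace ((\<lambda>v. c * v) ` H)"
proof (unfold int_complex.subspace_def, intro conjI ballI allI)
 show "0 \<in> (\<lambda>v. c * v) ` H" using subspace_zero[OF assms] by force
next
 fix u v assume "u \<in> (\<lambda>v. c * v) ` H" "v \<in> (\<lambda>v. c * v) ` H"
 then obtain u' v' where "u' \<in> H" "v' \<in> H" "u = c * u'" "v = c * v'" by auto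
 then show "u + v \<in> (\<lambda>v. c * v) ` H"
  using subspace_add[OF assms, of u' v'] by (auto intro!: image_eqI[of _ _ "u' + v'"] simp: algebra_simps)
next
 fix k :: int and v assume "v \<in> (\<lambda>v. c * v) ` H"
 then obtain v' where "v' \<in> H" "v = c * v'" by auto
 then show "of_int k * v \<in> (\<lambda>v. c * v) ` H"
  using subspace_of_int_mult[OF assms, of v' k] by fastforce
qed

lemma subspace_preimage_mult:
 assumes "int_complex.subspace H" shows "int_complex.subspace {v. c * v \<in> H}"
proof (unfold int_complex.subspace_def mem_Collect_eq, intro conjI ballI allI impI)
 show "c * 0 \<in> H" using subspace_zero[OF assms] by simp
next
 fix u v assume "u \<in> {v. c * v \<in> H}" "v \<in> {v. c * v \<in> H}"
 then show "c * (u + v) \<in> H" using subspace_add[OF assms] by (simp add: distrib_left)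
next
 fix k :: int and v assume "v \<in> {v. c * v \<in> H}"
 then show "c * (of_int k * v) \<in> H" using subspace_of_int_mult[OF assms] by (metis mem_Collect_eq mult.left_commute)
qed

lemma image_mult_lat: "(\<lambda>v. c * v) ` lat a b = lat (c * a) (c * b)"
proof (intro Set.set_eqI iffI)
 fix z assume "z \<in> (\<lambda>v. c * v) ` lat a b"
 then show "z \<in> lat (c * a) (c * b)"
 proof -
  obtain x y where "z = c * (of_int x * a + of_int y * b)" using \<open>z \<in> (\<lambda>v. c * v) ` lat a b\<close> unfolding lat_def by blast
  then have "z = of_int x * (c * a) + of_int y * (c * b)" by (simp add: algebra_simps)
  then show ?thesis using latI by simp
 qed
next
 fix z assume "z \<in> lat (c * a) (c * b)"
 then obtain x y where "z = of_int x * (c * a) + of_int y * (c * b)" by (rule latE)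
 then have "z = c * (of_int x * a + of_int y * b)" by (simp add: algebra_simps)
 then show "z \<in> (\<lambda>v. c * v) ` lat a b" using latI by blast
qed

text \<open>\<open>Im (a * cnj b)\<close> is, up to sign, the area of the period parallelogram, and
  a change of generators multiplies it by a determinant. Its being nonzero is how linear
  independence over the reals is expressed throughout.\<close>

lemma Im_mult_cnj_comb:
 "Im ((of_int x * a + of_int y * b) * cnj (of_int x' * a + of_int y' * b)) = of_int (x * y' - y * x') * Im (a * cnj b)"
 by (simp add: algebra_simps)

lemma lat_coord_unique:
 assumes "Im (a * cnj b) \<noteq> 0" and "of_int x * a + of_int y * b = of_int x' * a + of_int y' * (b::complex)"
 shows "x = x'" "y = y'"
proof -
 define p q where "p = x - x'" and "q = y - y'"
 have *: "of_int p * a + of_int q * b = 0" using assms(2) by (simp add: p_def q_def algebra_simps)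
 have "Im ((of_int p * a + of_int q * b) * cnj b) = of_int p * Im (a * cnj b)"
  using Im_mult_cnj_comb[of p a q b 0 1] by simp
 with * assms(1) have "p = 0" by simp
 moreover have "Im (a * cnj (of_int p * a + of_int q * b)) = of_int q * Im (a * cnj b)"
  using Im_mult_cnj_comb[of 1 a 0 b p q] by simp
 with * assms(1) have "q = 0" by simp
 ultimately show "x = x'" "y = y'" by (auto simp: p_def q_def)
qed

lemma int_subgroup_generator:
 fixes S :: "int set"
 assumes "z \<in> S" "z \<noteq> 0" and diff: "\<And>x y. x \<in> S ==> y \<in> S ==> x - y \<in> S"
  and mult: "\<And>k x. x \<in> S ==> k * x \<in> S"
 obtains g where "g > 0" "g \<in> S" "\<And>x. x \<in> S \<longleftrightarrow> g dvd x"
proof -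
 define n where "n = (LEAST n::nat. n > 0 \<and> int n \<in> S)"
 have "\<bar>z\<bar> \<in> S" using assms(1) mult[of z "-1"] by (auto simp: abs_if)
 then have "nat \<bar>z\<bar> > 0 \<and> int (nat \<bar>z\<bar>) \<in> S" using assms(2) by simp
 then have n: "n > 0" "int n \<in> S" and least: "\<And>m. m > 0 ==> int m \<in> S ==> n \<le> m"
  unfolding n_def by (metis (mono_tags, lifting) LeastI, metis (mono_tags, lifting) LeastI, auto intro: Least_le)
 show thesis
 proof (rule that[of "int n"])
  fix x show "x \<in> S \<longleftrightarrow> int n dvd x"
  proof
   assume "x \<in> S"
   then have "x - (x div int n) * int n \<in> S" using n mult diff by auto
   then have "x mod int n \<in> S" by (simp add: minus_div_mult_eq_mod)
   moreover have "0 \<le> x mod int n" "x mod int n < int n" using n by auto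
   ultimately have "x mod int n = 0"
    using least[of "nat (x mod int n)"] by (cases "x mod int n = 0") auto
   then show "int n dvd x" by auto
  next
   assume "int n dvd x" then show "x \<in> S" using n(2) mult by (auto elim!: dvdE simp: mult.commute)
  qed
 qed (use n in auto)
qed

text \<open>Hermite normal form: \<open>e\<close> generates the multiples of \<open>a\<close> that
  lie in \<open>H\<close>, and \<open>g\<close> generates the second coordinates that occur in
  \<open>H\<close>. The independent pair \<open>h1\<close>, \<open>h2\<close> guarantees that
  neither of these subgroups of the integers is zero.\<close>

lemma sublattice_hermite:
 assumes ab: "Im (a * cnj b) \<noteq> 0" and H: "int_complex.subspace H" "H \<subseteq> lat a b"
  and h: "h1 \<in> H" "h2 \<in> H" "Im (h1 * cnj h2) \<noteq> 0"
 obtains e g x :: int where "e > 0" "g > 0" "H = lat (of_int e * a) (of_int x * a + of_int g * b)"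
proof -
 obtain x1 y1 x2 y2 where h12: "h1 = of_int x1 * a + of_int y1 * b" "h2 = of_int x2 * a + of_int y2 * b"
  using h H(2) by (metis latE subsetD)
 have det: "x1 * y2 - y1 * x2 \<noteq> 0"
  using h(3) Im_mult_cnj_comb[of x1 a y1 b x2 y2, folded h12] by fastforce
 define E where "E = {x. of_int x * a \<in> H}"
 define Y where "Y = {y. \<exists>x. of_int x * a + of_int y * b \<in> H}"
 \<comment> \<open>Eliminating \<open>b\<close> leaves the determinant times \<open>a\<close>, which
   gives a nonzero member of \<open>E\<close>.\<close>
 have "of_int y2 * h1 - of_int y1 * h2 \<in> H" by (intro subspace_diff subspace_of_int_mult H h)
 also have "of_int y2 * h1 - of_int y1 * h2 = of_int (x1 * y2 - y1 * x2) * a"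
  by (simp add: h12 algebra_simps)
 finally have 1: "x1 * y2 - y1 * x2 \<in> E" by (simp add: E_def)
 obtain e where e: "e > 0" "\<And>x. x \<in> E \<longleftrightarrow> e dvd x"
 proof (rule int_subgroup_generator[OF 1 det])
  show "x - y \<in> E" if "x \<in> E" "y \<in> E" for x y
   using subspace_diff[OF H(1)] that by (fastforce simp: E_def algebra_simps)
  show "k * x \<in> E" if "x \<in> E" for k x
   using subspace_of_int_mult[OF H(1)] that by (fastforce simp: E_def algebra_simps)
 qed auto
 have 2: "y1 \<in> Y" "y2 \<in> Y" using h h12 by (auto simp: Y_def)
 with det obtain y0 where y0: "y0 \<in> Y" "y0 \<noteq> 0" by (metis diff_self mult_zero_left mult_zero_right)
 obtain g where g: "g > 0" "g \<in> Y" "\<And>x. x \<in> Y \<longleftrightarrow> g dvd x"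
 proof (rule int_subgroup_generator[OF y0])
  show "x - y \<in> Y" if xy: "x \<in> Y" "y \<in> Y" for x y
  proof -
   obtain p q where "of_int p * a + of_int x * b \<in> H" "of_int q * a + of_int y * b \<in> H"
    using xy by (auto simp: Y_def)
   then have "of_int (p - q) * a + of_int (x - y) * b \<in> H"
    using subspace_diff[OF H(1)] by (fastforce simp: algebra_simps)
   then show ?thesis unfolding Y_def by blast
  qed
  show "k * x \<in> Y" if x: "x \<in> Y" for k x
  proof -
   obtain p where "of_int p * a + of_int x * b \<in> H" using x by (auto simp: Y_def)
   then have "of_int (k * p) * a + of_int (k * x) * b \<in> H"
    using subspace_of_int_mult[OF H(1)] by (fastforce simp: algebra_simps)
   then show ?thesis unfolding Y_def by blast
  qed
 qed auto
 obtain x0 where x0: "of_int x0 * a + of_int g * b \<in> H" using g(2) by (auto simp: Y_def)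
 have "H = lat (of_int e * a) (of_int x0 * a + of_int g * b)"
 proof
  show "lat (of_int e * a) (of_int x0 * a + of_int g * b) \<subseteq> H"
   using x0 e(2)[of e] by (intro lat_subset H) (auto simp: E_def)
  show "H \<subseteq> lat (of_int e * a) (of_int x0 * a + of_int g * b)"
  proof
   fix z assume z: "z \<in> H"
   then obtain x y where xy: "z = of_int x * a + of_int y * b" using H(2) by (metis latE subsetD)
   then have "y \<in> Y" using z by (auto simp: Y_def)
   then obtain k where k: "y = g * k" using g(3) by blast
   have "z - of_int k * (of_int x0 * a + of_int g * b) \<in> H"
    by (intro subspace_diff subspace_of_int_mult H z x0)
   also have "z - of_int k * (of_int x0 * a + of_int g * b) = of_int (x - k * x0) * a"
    by (simp add: xy k algebra_simps)
   finally have "x - k * x0 \<in> E" by (simp add: E_def)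
   then obtain j where "x - k * x0 = e * j" using e(2) by blast
   then have "x = e * j + k * x0" by simp
   then have "z = of_int j * (of_int e * a) + of_int k * (of_int x0 * a + of_int g * b)"
    by (simp add: xy k algebra_simps)
   then show "z \<in> lat (of_int e * a) (of_int x0 * a + of_int g * b)" using latI by simp
  qed
 qed
 then show thesis using that e(1) g(1) by simp
qed

lemma of_real_of_rat: "complex_of_real (of_rat r) = of_rat r"
 by (cases r) (simp add: of_rat_rat)

section \<open>Imaginary quadratic orders\<close>

locale quad =
 fixes d0 :: int and f :: nat
 assumes fund: "fundamental_discriminant d0" and neg: "d0 < 0" and f1: "f \<ge> 1"
begin

abbreviation K :: "complex set" where "K \<equiv> quad_field d0"
abbreviation O' :: "complex set" where "O' \<equiv> quad_order d0 f"

definition w :: complex where "w = csqrt (of_int d0)"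
definition D :: int where "D = (int f)\<^sup>2 * d0"
definition rD :: complex where "rD = of_nat f * w"
text \<open>The generator \<open>(D + sqrt D) / 2\<close> serves \<open>D\<close> congruent to 0 and
  to 1 modulo 4 alike, so the order has the basis \<open>1\<close>, \<open>\<theta>\<close> without
  a distinction of parity.\<close>

definition \<theta> :: complex where "\<theta> = (of_int D + rD) / 2"

lemma w_eq: "w = \<i> * of_real (sqrt (- of_int d0))"
proof -
 have "of_int d0 = (- of_real (- of_int d0) :: complex)" by simp
 then have "w = csqrt (- of_real (- of_int d0))" by (simp add: w_def)
 also have "\<dots> = \<i> * csqrt (of_real (- of_int d0))"
  using neg by (intro csqrt_minus) auto
 also have "csqrt (of_real (- of_int d0)) = of_real (sqrt (- of_int d0))"
  using neg by (intro of_real_sqrt [symmetric]) auto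
 finally show ?thesis .
qed

lemma Re_w [simp]: "Re w = 0" and Im_w: "Im w = sqrt (- of_int d0)" and Im_w_pos: "Im w > 0"
 using neg by (simp_all add: w_eq)

lemma cnj_w [simp]: "cnj w = - w"
 by (simp add: complex_eq_iff)

lemma w_sq: "w * w = of_int d0"
 using power2_csqrt[of "of_int d0"] by (simp add: w_def power2_eq_square)

lemma K_I: "of_rat a + of_rat b * w \<in> K"
 by (auto simp: quad_field_def w_def)

lemma K_E: assumes "z \<in> K" obtains a b where "z = of_rat a + of_rat b * w"
 using assms by (auto simp: quad_field_def w_def)

lemma K_add [intro]: "x \<in> K ==> y \<in> K ==> x + y \<in> K"
proof -
 assume "x \<in> K" "y \<in> K"
 then obtain a b c d where "x = of_rat a + of_rat b * w" "y = of_rat c + of_rat d * w" by (auto elim!: K_E)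
 then have "x + y = of_rat (a + c) + of_rat (b + d) * w" by (simp add: of_rat_add algebra_simps)
 then show ?thesis using K_I by simp
qed

lemma K_mult [intro]: "x \<in> K ==> y \<in> K ==> x * y \<in> K"
proof -
 assume "x \<in> K" "y \<in> K"
 then obtain a b c d where xy: "x = of_rat a + of_rat b * w" "y = of_rat c + of_rat d * w" by (auto elim!: K_E)
 have "x * y = of_rat a * of_rat c + of_rat b * of_rat d * (w * w) + (of_rat a * of_rat d + of_rat b * of_rat c) * w"
  by (simp add: xy algebra_simps)
 also have "\<dots> = of_rat (a * c + b * d * of_int d0) + of_rat (a * d + b * c) * w"
  by (simp add: w_sq of_rat_add of_rat_mult)
 finally show ?thesis using K_I by simp
qed

lemma K_of_rat [simp]: "of_rat a \<in> K"
 using K_I[of a 0] by simp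

lemma K_of_int [simp]: "of_int a \<in> K"
 using K_of_rat[of "of_int a"] by simp

lemma K_of_nat [simp]: "of_nat a \<in> K"
 using K_of_rat[of "of_nat a"] by simp

lemma K_0 [simp]: "0 \<in> K" and K_1 [simp]: "1 \<in> K" and K_numeral [simp]: "numeral n \<in> K"
 using K_of_int[of 0] K_of_int[of 1] K_of_int[of "numeral n"] by simp_all

lemma K_w [simp]: "w \<in> K"
 using K_I[of 0 1] by simp

lemma K_uminus [intro]: "x \<in> K ==> - x \<in> K"
 using K_mult[of "of_int (-1)" x] K_of_int[of "-1"] by simp

lemma K_cnj [intro]: "x \<in> K ==> cnj x \<in> K"
proof -
 assume "x \<in> K"
 then obtain a b where "x = of_rat a + of_rat b * w" by (auto elim!: K_E)
 moreover have "cnj (of_rat r) = of_rat r" for r :: rat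
  by (metis complex_cnj_complex_of_real of_real_of_rat)
 ultimately have "cnj x = of_rat a + of_rat (- b) * w" by simp
 then show ?thesis using K_I by metis
qed

lemma K_cnj_iff [simp]: "cnj x \<in> K \<longleftrightarrow> x \<in> K"
 using K_cnj[of x] K_cnj[of "cnj x"] by auto

lemma Re_of_rat: "Re (of_rat r) = of_rat r" and Im_of_rat: "Im (of_rat r) = 0"
 by (metis of_real_of_rat Re_complex_of_real, metis of_real_of_rat Im_complex_of_real)

lemma K_real: assumes "x \<in> K" "Im x = 0" obtains r where "x = of_rat r"
proof -
 obtain a b where x: "x = of_rat a + of_rat b * w" using assms(1) by (rule K_E)
 with assms(2) have "of_rat b * Im w = (0::real)" by (simp add: Re_of_rat Im_of_rat)
 then have "b = 0" using Im_w_pos by simp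
 with x that show thesis by simp
qed

lemma K_inverse [intro]: "x \<in> K ==> inverse x \<in> K"
proof -
 assume x: "x \<in> K"
 obtain r where r: "x * cnj x = of_rat r" by (rule K_real[of "x * cnj x"]) (use x in auto)
 have "inverse x = cnj x * of_rat (inverse r)"
 proof (cases "x = 0")
  case False
  then have "of_rat r \<noteq> (0::complex)" by (metis r complex_cnj_zero_iff mult_eq_0_iff)
  moreover have "x * (cnj x * inverse (of_rat r)) = 1" using calculation r by (metis mult.assoc right_inverse)
  ultimately show ?thesis by (simp add: of_rat_inverse inverse_unique)
 qed simp
 then show ?thesis using x by auto
qed

lemma K_divide [intro]: "x \<in> K ==> y \<in> K ==> x / y \<in> K"
 by (auto simp: divide_inverse)

lemma K_Im_ratio: assumes "x \<in> K" obtains r where "Im x = of_rat r * Im w"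
proof -
 obtain a b where "x = of_rat a + of_rat b * w" using assms(1) by (rule K_E)
 then have "Im x = of_rat b * Im w" by (simp add: Re_of_rat Im_of_rat)
 then show thesis by (rule that)
qed

text \<open>Cramer's rule: the coordinates are quotients of imaginary parts of elements of
  \<open>K\<close>. Each of these is a rational multiple of \<open>Im w\<close>, so the irrational
  factor cancels.\<close>

lemma K_cramer:
 assumes "a \<in> K" "b \<in> K" "z \<in> K" "Im (a * cnj b) \<noteq> 0"
 obtains r s where "z = of_rat r * a + of_rat s * b"
proof -
 define u where "u = Im (a * cnj b)"
 have "z = of_real (Im (z * cnj b) / u) * a + of_real (Im (a * cnj z) / u) * b"
 proof -
  have "of_real u * z = of_real (Im (z * cnj b)) * a + of_real (Im (a * cnj z)) * b"
   by (simp add: u_def complex_eq_iff algebra_simps)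
  moreover have "u \<noteq> 0" using assms(4) by (simp add: u_def)
  ultimately have "z = (of_real (Im (z * cnj b)) * a + of_real (Im (a * cnj z)) * b) / of_real u"
   by (simp add: eq_divide_eq mult.commute)
  then show ?thesis by (simp add: add_divide_distrib)
 qed
 then have z: "z = of_real (Im (z * cnj b) / u) * a + of_real (Im (a * cnj z) / u) * b" .
 obtain r1 where r1: "Im (z * cnj b) = of_rat r1 * Im w" by (rule K_Im_ratio[of "z * cnj b"]) (use assms in auto)
 obtain r2 where r2: "Im (a * cnj z) = of_rat r2 * Im w" by (rule K_Im_ratio[of "a * cnj z"]) (use assms in auto)
 obtain r3 where r3: "u = of_rat r3 * Im w" by (rule K_Im_ratio[of "a * cnj b"]) (use assms in \<open>auto simp: u_def\<close>)
 have "Im (z * cnj b) / u = of_rat (r1 / r3)" "Im (a * cnj z) / u = of_rat (r2 / r3)"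
  unfolding r1 r2 r3 using Im_w_pos by (simp_all add: of_rat_divide)
 with z have "z = of_real (of_rat (r1 / r3)) * a + of_real (of_rat (r2 / r3)) * b" by metis
 then show thesis using that[of "r1/r3" "r2/r3"] by (simp add: of_real_of_rat)
qed

lemma lat_in_K: "a \<in> K ==> b \<in> K ==> z \<in> lat a b ==> z \<in> K"
 by (erule latE) (simp add: K_add K_mult)

lemma common_denominator:
 assumes "finite X" "X \<subseteq> K"
 obtains n :: int where "n > 0" "\<And>x. x \<in> X ==> of_int n * x \<in> lat 1 w"
proof -
 have "\<exists>n::int. n > 0 \<and> (\<forall>x\<in>X. of_int n * x \<in> lat 1 w)"
  using assms
 proof (induction X rule: finite_induct)
  case empty
  then show ?case by (auto intro: exI[of _ 1])
 next
  case (insert x X)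
  then obtain n where n: "n > 0" "\<And>x. x \<in> X ==> of_int n * x \<in> lat 1 w" by blast
  obtain a b where ab: "x = of_rat a + of_rat b * w" using insert.prems K_E by blast
  obtain p q where pq: "quotient_of a = (p, q)" by fastforce
  obtain r s where rs: "quotient_of b = (r, s)" by fastforce
  have q: "q > 0" "s > 0" using pq rs quotient_of_denom_pos by auto
  have ab': "a = of_int p / of_int q" "b = of_int r / of_int s"
   using pq rs quotient_of_div by auto
  have "of_int (q * s) * x = of_int (p * s) * 1 + of_int (r * q) * w"
   using q unfolding ab ab' by (simp add: of_rat_divide ring_distribs)
  then have x: "of_int (q * s) * x \<in> lat 1 w" using latI by metis
  show ?case
  proof (intro exI[of _ "n * (q * s)"] conjI ballI)
   show "n * (q * s) > 0" using n(1) q by simp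
   fix y assume "y \<in> insert x X"
   then consider "y = x" | "y \<in> X" by auto
   then show "of_int (n * (q * s)) * y \<in> lat 1 w"
   proof cases
    case 1
    have "of_int (n * (q * s)) * y = of_int n * (of_int (q * s) * x)" unfolding 1 by simp
    then show ?thesis using subspace_of_int_mult[OF subspace_lat x, of n] by (simp only:)
   next
    case 2
    have "of_int (n * (q * s)) * y = of_int (q * s) * (of_int n * y)" by simp
    then show ?thesis using subspace_of_int_mult[OF subspace_lat n(2)[OF 2], of "q * s"] by (simp only:)
   qed
  qed
 qed
 then show thesis using that by blast
qed

text \<open>A common denominator moves the module into \<open>lat 1 w\<close>, where the Hermite
  form gives a basis of two elements; dividing by the denominator moves it back.\<close>

lemma finite_span_is_lat:
 assumes X: "finite X" "X \<subseteq> K" and h: "h1 \<in> int_complex.span X" "h2 \<in> int_complex.span X" "Im (h1 * cnj h2) \<noteq> 0"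
 obtains a b where "a \<in> K" "b \<in> K" "Im (a * cnj b) \<noteq> 0" "int_complex.span X = lat a b"
proof -
 obtain n :: int where n: "n > 0" "\<And>x. x \<in> X ==> of_int n * x \<in> lat 1 w"
  using common_denominator[OF X] by blast
 define H where "H = (\<lambda>v. of_int n * v) ` int_complex.span X"
 have Hs: "int_complex.subspace H" unfolding H_def by (intro subspace_image_mult int_complex.subspace_span)
 have "int_complex.span X \<subseteq> {v. of_int n * v \<in> lat 1 w}"
 proof (rule int_complex.span_minimal)
  show "X \<subseteq> {v. of_int n * v \<in> lat 1 w}" using n by auto
  show "int_complex.subspace {v. of_int n * v \<in> lat 1 w}" by (intro subspace_preimage_mult subspace_lat)
 qed
 then have Hl: "H \<subseteq> lat 1 w" by (auto simp: H_def)
 have i: "Im (1 * cnj w) \<noteq> 0" using Im_w_pos by simp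
 have "of_int n * h1 \<in> H" "of_int n * h2 \<in> H" using h by (auto simp: H_def)
 moreover have "Im ((of_int n * h1) * cnj (of_int n * h2)) \<noteq> 0"
  using h(3) n(1) Im_mult_cnj_comb[of n h1 0 h2 0 n] by simp
 ultimately obtain e g x where H: "H = lat (of_int e * 1) (of_int x * 1 + of_int g * w)" and eg: "e > 0" "g > 0"
  by (rule sublattice_hermite[OF i Hs Hl]) auto
 define a b :: complex where "a = of_int e / of_int n" and "b = (of_int x + of_int g * w) / of_int n"
 have "int_complex.span X = (\<lambda>v. inverse (of_int n) * v) ` H"
 proof -
  have "inverse (of_int n) * (of_int n * v) = v" for v :: complex using n(1) by simp
  then show ?thesis by (simp only: H_def image_image image_ident)
 qed
 also have "\<dots> = lat a b"
  unfolding H image_mult_lat a_def b_def by (simp add: divide_inverse mult.commute)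
 finally have "int_complex.span X = lat a b" .
 moreover have "a \<in> K" "b \<in> K" unfolding a_def b_def by (intro K_divide K_add K_mult; simp)+
 moreover have "Im (a * cnj b) = - (of_int (e * g) / of_int (n*n)) * Im w"
 proof -
  have "a = of_real (of_int e / of_int n)" "b = of_real (of_int x / of_int n) + of_real (of_int g / of_int n) * w"
   by (simp_all add: a_def b_def add_divide_distrib)
  then show ?thesis by simp
 qed
 then have "Im (a * cnj b) \<noteq> 0" using eg n(1) Im_w_pos by simp
 ultimately show thesis using that by simp
qed

text \<open>Rank two comes from the rational span: if all elements of \<open>L\<close> lay on one
  real line, so would \<open>1\<close> and \<open>w\<close>.\<close>

lemma fractional_ideal_lat:
 assumes "fractional_ideal d0 L"
 obtains a b where "a \<in> K" "b \<in> K" "Im (a * cnj b) \<noteq> 0" "L = lat a b"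
proof -
 obtain X where X: "finite X" "X \<subseteq> K" "L = int_complex.span X" and sp: "rat_complex.span L = K"
  using assms by (auto simp: fractional_ideal_def)
 have "\<exists>h1\<in>L. \<exists>h2\<in>L. Im (h1 * cnj h2) \<noteq> 0"
 proof (rule ccontr)
  assume "\<not> ?thesis"
  then have 0: "\<And>u v. u \<in> L ==> v \<in> L ==> Im (u * cnj v) = 0" by simp
  have 1: "Im (u * cnj v) = 0" if "u \<in> rat_complex.span L" "v \<in> L" for u v
   using that(1)
  proof (induction rule: rat_complex.span_induct_alt)
   case (step c x y)
   then show ?case using 0[OF _ that(2), of x] by (simp add: Re_of_rat Im_of_rat algebra_simps)
  qed simp
  have 2: "Im (u * cnj v) = 0" if "u \<in> rat_complex.span L" "v \<in> rat_complex.span L" for u v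
   using that(2)
  proof (induction rule: rat_complex.span_induct_alt)
   case (step c x y)
   then show ?case using 1[OF that(1), of x] by (simp add: Re_of_rat Im_of_rat algebra_simps)
  qed simp
  have "Im (w * cnj 1) = 0" by (intro 2) (auto simp: sp)
  then show False using Im_w_pos by simp
 qed
 then obtain h1 h2 where "h1 \<in> int_complex.span X" "h2 \<in> int_complex.span X" "Im (h1 * cnj h2) \<noteq> 0"
  using X(3) by auto
 from finite_span_is_lat[OF X(1,2) this] show thesis using that X(3) by metis
qed

lemma lat_fractional_ideal:
 assumes "a \<in> K" "b \<in> K" "Im (a * cnj b) \<noteq> 0"
 shows "fractional_ideal d0 (lat a b)"
proof -
 have "rat_complex.span (lat a b) \<subseteq> K"
  using lat_in_K[OF assms(1,2)] by (intro rat_complex.span_minimal) (auto simp: rat_complex.subspace_def)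
 moreover have "K \<subseteq> rat_complex.span (lat a b)"
 proof
  fix z assume "z \<in> K"
  with assms obtain r s where "z = of_rat r * a + of_rat s * b" by (metis K_cramer)
  then show "z \<in> rat_complex.span (lat a b)"
   using rat_complex.span_add rat_complex.span_scale rat_complex.span_base by simp
 qed
 ultimately show ?thesis
  unfolding fractional_ideal_def lat_eq_span using assms by (auto intro!: exI[of _ "{a, b}"])
qed

end

text \<open>The square of the denominator of \<open>r\<close> divides \<open>m\<close>, hence the
  denominator is 1.\<close>

lemma rat_sq_mult_squarefree_int:
 fixes r :: rat and m k :: int
 assumes sf: "squarefree m" and eq: "r\<^sup>2 * of_int m = of_int k"
 obtains s :: int where "r = of_int s"
proof -
 obtain p q where pq: "quotient_of r = (p, q)" by fastforce
 have q: "q > 0" "coprime p q" and r: "r = of_int p / of_int q"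
  using pq quotient_of_denom_pos quotient_of_coprime quotient_of_div by auto
 have "(of_int (p\<^sup>2 * m) :: rat) = of_int (k * q\<^sup>2)"
  using eq q by (simp add: r power_divide field_simps)
 then have "p\<^sup>2 * m = k * q\<^sup>2" by (simp only: of_int_eq_iff)
 then have "q\<^sup>2 dvd p\<^sup>2 * m" by simp
 moreover have "coprime (q\<^sup>2) (p\<^sup>2)" using q(2) by (simp add: coprime_commute)
 ultimately have "q\<^sup>2 dvd m" using coprime_dvd_mult_right_iff by blast
 then have "q dvd 1" using sf by (auto simp: squarefree_def)
 then have "q = 1" using q(1) by simp
 then show thesis using that r by simp
qed

lemma poly_roots_span:
 assumes "poly p x = 0" "lead_coeff p = 1" "\<forall>i. Polynomial.coeff p i \<in> \<int>" "v \<in> int_complex.span ((\<lambda>i. x ^ i) ` {..<degree p})"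
 shows "x * v \<in> int_complex.span ((\<lambda>i. x ^ i) ` {..<degree p})"
proof -
 let ?X = "(\<lambda>i. x ^ i) ` {..<degree p}"
 have top: "x ^ degree p \<in> int_complex.span ?X"
 proof -
  have "(\<Sum>i\<le>degree p. Polynomial.coeff p i * x ^ i) = 0" using assms(1) by (simp add: poly_altdef)
  also have "{..degree p} = insert (degree p) {..<degree p}" by auto
  finally have "x ^ degree p = - (\<Sum>i<degree p. Polynomial.coeff p i * x ^ i)"
   using assms(2) by (simp add: eq_neg_iff_add_eq_0)
  also have "\<dots> = (\<Sum>i<degree p. of_int (- \<lfloor>Re (Polynomial.coeff p i)\<rfloor>) * x ^ i)"
  proof -
   have "of_int \<lfloor>Re (Polynomial.coeff p i)\<rfloor> = Polynomial.coeff p i" for i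
    using assms(3) by (metis Ints_cases Re_complex_of_real floor_of_int of_real_of_int_eq)
   then show ?thesis by (simp add: sum_negf)
  qed
  also have "\<dots> \<in> int_complex.span ?X"
   by (intro int_complex.span_sum int_complex.span_scale int_complex.span_base) auto
  finally show ?thesis .
 qed
 have "int_complex.span ?X \<subseteq> {v. x * v \<in> int_complex.span ?X}"
 proof (rule int_complex.span_minimal)
  show "?X \<subseteq> {v. x * v \<in> int_complex.span ?X}"
  proof
   fix v assume "v \<in> ?X"
   then obtain i where i: "i < degree p" "v = x ^ i" by auto
   show "v \<in> {v. x * v \<in> int_complex.span ?X}"
   proof (cases "Suc i = degree p")
    case True
    then show ?thesis using top i by (metis mem_Collect_eq power_Suc)
   next
    case False
    then have "x ^ Suc i \<in> ?X" using i by (intro imageI) auto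
    then show ?thesis using i int_complex.span_base by simp
   qed
  qed
 qed (intro subspace_preimage_mult int_complex.subspace_span)
 then show ?thesis using assms(4) by blast
qed

text \<open>Multiplication by \<open>x\<close> acts on the lattice by an integer matrix, and
  \<open>x\<close> is a root of its characteristic polynomial. The imaginary part of that equation
  identifies the trace with \<open>x + cnj x\<close>, and then the determinant is
  \<open>x * cnj x\<close>.\<close>

lemma lat_stable_quadratic:
 assumes ab: "Im (a * cnj b) \<noteq> 0" and st: "x * a \<in> lat a b" "x * b \<in> lat a b" and x: "Im x \<noteq> 0"
 obtains t n :: int where "x + cnj x = of_int t" "x * cnj x = of_int n"
proof -
 obtain p q where 1: "x * a = of_int p * a + of_int q * b" using st(1) by (rule latE)
 obtain r s where 2: "x * b = of_int r * a + of_int s * b" using st(2) by (rule latE)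
 have nz: "a \<noteq> 0" "b \<noteq> 0" using ab by auto
 have "(x - of_int p) * a = of_int q * b" "(x - of_int s) * b = of_int r * a"
  using 1 2 by (simp_all add: algebra_simps)
 then have "((x - of_int p) * (x - of_int s)) * (a * b) = (of_int q * of_int r) * (a * b)"
  by (metis (no_types, lifting) mult.assoc mult.left_commute)
 then have eq: "(x - of_int p) * (x - of_int s) = of_int q * of_int r" using nz by simp
 then have "Im ((x - of_int p) * (x - of_int s)) = 0" by simp
 then have "Im x * (2 * Re x - of_int (p + s)) = 0" by (simp add: algebra_simps)
 then have tr: "2 * Re x = of_int (p + s)" using x by simp
 have t: "x + cnj x = of_int (p + s)"
  unfolding complex_add_cnj tr by simp
 then have cx: "cnj x = of_int (p + s) - x" by (simp add: eq_diff_eq add.commute)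
 have "x * cnj x = of_int (p * s - q * r)"
  using eq unfolding cx by (simp add: algebra_simps)
 with t that show thesis by blast
qed

context quad
begin

text \<open>For nonreal \<open>x\<close> the powers of \<open>x\<close> below the degree of a monic
  integral equation span a rank-two lattice stable under \<open>x\<close>, so
  \<open>lat_stable_quadratic\<close> applies; a real \<open>x\<close> is rational and therefore
  already an integer.\<close>

lemma algebraic_int_trace_norm:
 assumes "x \<in> K" "algebraic_int x"
 obtains t n :: int where "x + cnj x = of_int t" "x * cnj x = of_int n"
proof (cases "Im x = 0")
 case True
 then obtain r where "x = of_rat r" using assms(1) K_real by blast
 then have "x \<in> \<rat>" by simp
 then have "x \<in> \<int>" using assms(2) rational_algebraic_int_is_int by blast
 then obtain k where "x = of_int k" by (auto elim: Ints_cases)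
 then show thesis using that[of "2 * k" "k * k"] by simp
next
 case False
 obtain p where p: "lead_coeff p = 1" "\<forall>i. Polynomial.coeff p i \<in> \<int>" "poly p x = 0"
  using assms(2) by (auto elim: algebraic_int.cases)
 define X where "X = (\<lambda>i. x ^ i) ` {..<degree p}"
 have st: "\<And>v. v \<in> int_complex.span X ==> x * v \<in> int_complex.span X"
  unfolding X_def by (rule poly_roots_span[OF p(3) p(1) p(2)])
 have "degree p \<noteq> 0"
 proof
  assume "degree p = 0"
  then have "p = [:1:]" using p(1) by (metis degree_0_id lead_coeff_pCons(2) coeff_pCons_0)
  with p(3) show False by simp
 qed
 then have one: "1 \<in> int_complex.span X" unfolding X_def
  by (intro int_complex.span_base image_eqI[of _ _ 0]) auto
 then have xin: "x \<in> int_complex.span X" using st[OF one] by simp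
 have XK: "X \<subseteq> K"
 proof -
  have "x ^ i \<in> K" for i by (induction i) (use assms(1) in auto)
  then show ?thesis by (auto simp: X_def)
 qed
 have fX: "finite X" by (simp add: X_def)
 obtain a b where ab: "Im (a * cnj b) \<noteq> 0" "int_complex.span X = lat a b"
  using finite_span_is_lat[OF fX XK xin one] False by (metis complex_cnj_one mult.right_neutral)
 have "x * a \<in> lat a b" "x * b \<in> lat a b" using st unfolding ab(2) by auto
 from lat_stable_quadratic[OF ab(1) this False] that show thesis by blast
qed

lemma fund_cases:
 obtains "d0 mod 4 = 1" "squarefree d0" | m where "d0 = 4 * m" "squarefree m" "m mod 4 = 2 \<or> m mod 4 = 3"
 using fund unfolding fundamental_discriminant_def by (auto elim!: dvdE)

text \<open>For \<open>x = a + b w\<close>, integral trace and norm make \<open>2 a\<close> and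
  \<open>(2 b)\<^sup>2 d0\<close> integers. Squarefreeness clears the denominator of
  \<open>2 b\<close>, or of \<open>4 b\<close> if \<open>d0 = 4 m\<close>, where the residue of
  \<open>m\<close> modulo 4 removes the remaining factor 2. Parity then permits the basis with
  \<open>(d0 + w) / 2\<close>.\<close>

lemma maximal_order_form:
 assumes "x \<in> K" "algebraic_int x"
 obtains u v :: int where "x = of_int u + of_int v * ((of_int d0 + w) / 2)"
proof -
 obtain t n where tn: "x + cnj x = of_int t" "x * cnj x = of_int n"
  using algebraic_int_trace_norm[OF assms] .
 obtain a b where x: "x = of_rat a + of_rat b * w" using assms(1) by (rule K_E)
 have cx: "cnj x = of_rat a - of_rat b * w"
  unfolding x by (metis complex_cnj_add complex_cnj_complex_of_real complex_cnj_mult cnj_w mult_minus_right of_real_of_rat uminus_add_conv_diff add.commute)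
 have "(of_rat (2 * a) :: complex) = of_rat (of_int t)"
  using tn(1) unfolding cx unfolding x by (simp add: of_rat_mult)
 then have a: "2 * a = of_int t" by (simp only: of_rat_eq_iff)
 have "x * cnj x = of_rat a * of_rat a - of_rat b * of_rat b * (w * w)"
  unfolding cx unfolding x by (simp add: algebra_simps)
 then have "(of_rat (a * a - b * b * of_int d0) :: complex) = of_rat (of_int n)"
  using tn(2) by (simp add: w_sq of_rat_mult of_rat_diff)
 then have nn: "a * a - b * b * of_int d0 = of_int n" by (simp only: of_rat_eq_iff)
 have "4 * (a * a) = (2 * a) * (2 * a)" by simp
 then have b: "(2 * b)\<^sup>2 * of_int d0 = of_int (t * t - 4 * n)"
  using nn unfolding a by (simp add: square_simps)
 obtain s where s: "2 * b = of_int s" and par: "even (t - s * d0)"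
 proof (cases rule: fund_cases)
  case 1
  obtain s where s: "2 * b = of_int s" using rat_sq_mult_squarefree_int[OF 1(2) b] .
  have "(of_int (s * s * d0) :: rat) = of_int (t * t - 4 * n)"
   using b unfolding s by (simp add: power2_eq_square)
  then have "s * s * d0 = t * t - 4 * n" by (simp only: of_int_eq_iff)
  moreover have "odd d0" using 1(1) by presburger
  ultimately have "even (s * s * d0) = even (t * t - 4 * n)" by simp
  then have "even t = even s" using \<open>odd d0\<close> by auto
  then have "even (t - s * d0)" using \<open>odd d0\<close> by simp
  with s that show thesis by simp
 next
  case (2 m)
  have "(4 * b)\<^sup>2 * of_int m = of_int (t * t - 4 * n)"
   using b unfolding 2(1) by simp
  then obtain s where s: "4 * b = of_int s" using rat_sq_mult_squarefree_int[OF 2(2)] by metis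
  have "(of_int (s * s * m) :: rat) = of_int (t * t - 4 * n)"
   using b unfolding s[symmetric] 2(1) by (simp add: power2_eq_square flip: s)
  then have e: "s * s * m = t * t - 4 * n" by (simp only: of_int_eq_iff)
  \<comment> \<open>If \<open>s\<close> were odd, \<open>m\<close> would be congruent modulo 4 to
    the square \<open>t * t\<close>, but \<open>m\<close> is 2 or 3 modulo 4.\<close>
  have "even s"
  proof (rule ccontr)
   assume "odd s"
   then obtain i where i: "s = 2 * i + 1" by (auto elim: oddE)
   have "s * s * m = 4 * ((i * i + i) * m) + m" by (simp add: i algebra_simps)
   then have m: "(t * t) mod 4 = m mod 4" using e by presburger
   have "(t * t) mod 4 = 0 \<or> (t * t) mod 4 = 1"
   proof (cases "even t")
    case True
    then obtain j where "t = 2 * j" by blast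
    then show ?thesis by simp
   next
    case False
    then obtain j where "t = 2 * j + 1" by (auto elim: oddE)
    then have "t * t = 4 * (j * j + j) + 1" by (simp add: algebra_simps)
    then show ?thesis by presburger
   qed
   then show False using m 2(3) by auto
  qed
  then obtain s' where s': "s = 2 * s'" by blast
  then have "2 * b = of_int s'" using s by simp
  moreover have "t * t = 2 * (2 * n + 2 * (s' * s' * m))" using e s' by simp
  then have "even (t * t)" by simp
  then have "even (t - s' * d0)" using 2(1) by simp
  ultimately show thesis using that by simp
 qed
 obtain u where u: "t - s * d0 = 2 * u" using par by blast
 have a': "of_rat a = (of_int t / 2 :: complex)" and b': "of_rat b = (of_int s / 2 :: complex)"
 proof -
  have "a = of_int t / 2" "b = of_int s / 2" using a s by simp_all
  then show "of_rat a = (of_int t / 2 :: complex)" "of_rat b = (of_int s / 2 :: complex)"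
   by (simp_all only: of_rat_divide of_rat_of_int_eq of_rat_numeral_eq)
 qed
 have t: "t = 2 * u + s * d0" using u by simp
 have "x = of_int u + of_int s * ((of_int d0 + w) / 2)"
  unfolding x a' b' t by (simp add: field_simps)
 then show thesis by (rule that)
qed

lemma d0_mod4: "d0 mod 4 = 0 \<or> d0 mod 4 = 1"
 by (cases rule: fund_cases) auto

lemma algebraic_int_maximal_order:
 "algebraic_int (of_int u + of_int v * ((of_int d0 + w) / 2))" (is "algebraic_int ?x")
proof -
 have "d0 * (d0 - 1) mod 4 = 0" using d0_mod4
 proof
  assume "d0 mod 4 = 0" then show ?thesis by fastforce
 next
  assume "d0 mod 4 = 1" then have "(d0 - 1) mod 4 = 0" by presburger
  then show ?thesis by fastforce
 qed
 then obtain k where k: "d0 * (d0 - 1) = 4 * k" by blast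
 define t n where "t = 2 * u + v * d0" and "n = u * u + u * v * d0 + v * v * k"
 have kk: "of_int d0 * (of_int d0 - 1) = (4 * of_int k :: complex)"
  using arg_cong[OF k, of "of_int :: int => complex"] by simp
 have w2: "w * w = of_int d0" by (rule w_sq)
 define y where "y = (of_int d0 + w) / 2"
 have y2: "y * y = of_int d0 * y - of_int k"
 proof -
  have "4 * (y * y) = of_int d0 * of_int d0 + 2 * of_int d0 * w + w * w" by (simp add: y_def algebra_simps)
  also have "\<dots> = 4 * (of_int d0 * y - of_int k)" unfolding w2 right_diff_distrib kk[symmetric]
   by (simp add: y_def algebra_simps)
  finally show ?thesis by (simp only: mult_cancel_left) simp
 qed
 have "poly [:of_int n, - of_int t, 1:] ?x = (of_int v)\<^sup>2 * (y * y) - of_int v * of_int v * of_int d0 * y + of_int n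
   - of_int u * of_int u - of_int u * of_int v * of_int d0"
  unfolding y_def[symmetric] t_def by (simp add: algebra_simps power2_eq_square)
 also have "\<dots> = 0" unfolding y2 n_def by (simp add: algebra_simps power2_eq_square)
 finally have "poly [:of_int n, - of_int t, 1:] ?x = 0" .
 then show ?thesis
  by (intro algebraic_int.intros[of "[:of_int n, - of_int t, 1:]"])
    (auto simp: coeff_pCons split: nat.splits)
qed

text \<open>The two candidates for a generator of the order differ by
  \<open>f (f - 1) d0 / 2\<close>, an integer.\<close>

lemma theta_shift: "\<exists>k. of_nat f * ((of_int d0 + w) / 2) = \<theta> - of_int k"
proof -
 have "even (int f * (int f - 1))" by simp
 then obtain j where "int f * (int f - 1) = 2 * j" by blast
 then have "int f * (int f - 1) * d0 = 2 * (j * d0)" by simp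
 then have "D - int f * d0 = 2 * (j * d0)" by (simp add: D_def square_simps)
 then have "(of_int D :: complex) = of_nat f * of_int d0 + 2 * of_int (j * d0)"
  by (metis (no_types, lifting) diff_eq_eq add.commute of_int_add of_int_mult of_int_numeral of_int_of_nat_eq)
 then have "of_nat f * ((of_int d0 + w) / 2) = \<theta> - of_int (j * d0)"
  by (simp add: \<theta>_def rD_def field_simps)
 then show ?thesis by blast
qed

lemma O_eq_lat: "O' = lat 1 \<theta>"
proof -
 obtain k where k: "of_nat f * ((of_int d0 + w) / 2) = \<theta> - of_int k" using theta_shift by blast
 show ?thesis
 proof
  show "O' \<subseteq> lat 1 \<theta>"
  proof
   fix z assume "z \<in> O'"
   then obtain a x where z: "z = of_int a + of_nat f * x" "x \<in> K" "algebraic_int x" by (auto simp: quad_order_def)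
   obtain u v where x: "x = of_int u + of_int v * ((of_int d0 + w) / 2)" using maximal_order_form z by blast
   have "z = of_int a + of_nat f * of_int u + of_int v * (of_nat f * ((of_int d0 + w) / 2))"
    unfolding z x by (simp only: ring_distribs mult.left_commute add.assoc)
   also have "\<dots> = of_int (a + int f * u - v * k) * 1 + of_int v * \<theta>" unfolding k by (simp add: algebra_simps)
   finally show "z \<in> lat 1 \<theta>" using latI by metis
  qed
  show "lat 1 \<theta> \<subseteq> O'"
  proof
   fix z assume "z \<in> lat 1 \<theta>"
   then obtain x y where z: "z = of_int x * 1 + of_int y * \<theta>" by (rule latE)
   have "z = of_int (x + y * k) + of_nat f * (of_int 0 + of_int y * ((of_int d0 + w) / 2))"
   proof -
    have "of_nat f * (of_int y * ((of_int d0 + w) / 2)) = of_int y * (\<theta> - of_int k)"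
     unfolding k[symmetric] by simp
    then show ?thesis unfolding z by (simp add: right_diff_distrib del: times_divide_eq_right)
   qed
   moreover have "of_int 0 + of_int y * ((of_int d0 + w) / 2) \<in> K"
    by (intro K_add K_mult K_divide) auto
   ultimately show "z \<in> O'" using algebraic_int_maximal_order[of 0 y] unfolding quad_order_def by blast
  qed
 qed
qed

lemma D_neg: "D < 0" using neg f1 by (simp add: D_def mult_less_0_iff zero_less_power2)

lemma D_mod4: "D mod 4 = 0 \<or> D mod 4 = 1"
proof -
 have "(int f)\<^sup>2 mod 4 = 0 \<or> (int f)\<^sup>2 mod 4 = 1"
 proof (cases "even (int f)")
  case True
  then obtain j where "int f = 2 * j" by blast
  then show ?thesis by simp
 next
  case False
  then obtain j where "int f = 2 * j + 1" by (rule oddE)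
  then have "(int f)\<^sup>2 = 4 * (j * j + j) + 1" by (simp add: algebra_simps power2_eq_square)
  then show ?thesis by presburger
 qed
 then show ?thesis using d0_mod4 unfolding D_def
  by (metis mod_mult_eq mult.right_neutral mult_zero_left mult_zero_right mod_0 mod_mod_trivial)
qed

lemma rD_sq: "rD * rD = of_int D"
proof -
 have "rD * rD = of_nat f * of_nat f * (w * w)" by (simp add: rD_def)
 then show ?thesis by (simp add: w_sq D_def power2_eq_square)
qed

lemma cnj_rD [simp]: "cnj rD = - rD" by (simp add: rD_def)
lemma rD_K [simp]: "rD \<in> K" by (auto simp: rD_def)
lemma theta_K [simp]: "\<theta> \<in> K" by (auto simp: \<theta>_def intro!: K_divide K_add)
lemma Im_rD_pos: "Im rD > 0" using Im_w_pos f1 by (simp add: rD_def)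
lemma Im_rD: "Im rD = sqrt (- of_int D)"
proof -
 have "- of_int D = (real f)\<^sup>2 * (- of_int d0)" by (simp add: D_def)
 then have "sqrt (- of_int D) = real f * sqrt (- of_int d0)" by (simp only: real_sqrt_mult real_sqrt_abs abs_of_nat)
 then show ?thesis by (simp add: rD_def Im_w)
qed
lemma Im_theta: "Im \<theta> = Im rD / 2" by (simp add: \<theta>_def)

lemma quarter: obtains q where "D * D - D = 4 * q"
proof -
 have "4 dvd D * (D - 1)" using D_mod4
 proof
  assume "D mod 4 = 0" then show ?thesis by auto
 next
  assume "D mod 4 = 1" then have "4 dvd D - 1" by presburger then show ?thesis by simp
 qed
 then show thesis using that by (auto simp: algebra_simps elim!: dvdE)
qed

lemma theta_quadratic:
 obtains q where "D * D - D = 4 * q" "\<theta> * \<theta> = of_int D * \<theta> - of_int q" "\<theta> * cnj \<theta> = of_int q"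
proof -
 obtain q where q: "D * D - D = 4 * q" by (rule quarter)
 have q': "4 * of_int q = (of_int D * of_int D - of_int D :: complex)"
  using arg_cong[OF q, of "of_int :: int => complex"] by simp
 have "4 * (\<theta> * \<theta>) = of_int D * of_int D + 2 * of_int D * rD + rD * rD" by (simp add: \<theta>_def algebra_simps)
 also have "\<dots> = 4 * (of_int D * \<theta> - of_int q)" unfolding rD_sq right_diff_distrib q'
  by (simp add: \<theta>_def algebra_simps)
 finally have 1: "\<theta> * \<theta> = of_int D * \<theta> - of_int q" by (simp only: mult_cancel_left) simp
 have "4 * (\<theta> * cnj \<theta>) = (of_int D + rD) * (of_int D - rD)" by (simp add: \<theta>_def)
 also have "\<dots> = of_int D * of_int D - rD * rD" by (simp add: algebra_simps)
 also have "\<dots> = 4 * of_int q" unfolding rD_sq q' ..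
 finally have 2: "\<theta> * cnj \<theta> = of_int q" by (simp only: mult_cancel_left) simp
 from q 1 2 show thesis by (rule that)
qed

lemma cnj_theta: "cnj \<theta> = of_int D - \<theta>"
 by (simp add: \<theta>_def field_simps)

lemma O_subspace [simp]: "int_complex.subspace O'" by (simp add: O_eq_lat)
lemma O_1 [simp]: "1 \<in> O'" by (simp add: O_eq_lat)
lemma O_theta [simp]: "\<theta> \<in> O'" by (simp add: O_eq_lat)
lemma O_of_int [simp]: "of_int k \<in> O'" using subspace_of_int_mult[OF O_subspace O_1, of k] by simp
lemma O_add: "x \<in> O' ==> y \<in> O' ==> x + y \<in> O'" by (rule subspace_add) auto
lemma O_diff: "x \<in> O' ==> y \<in> O' ==> x - y \<in> O'" by (rule subspace_diff) auto

lemma O_mult: assumes "x \<in> O'" "y \<in> O'" shows "x * y \<in> O'"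
proof -
 obtain a b where x: "x = of_int a * 1 + of_int b * \<theta>" using assms(1) unfolding O_eq_lat by (rule latE)
 obtain c d where y: "y = of_int c * 1 + of_int d * \<theta>" using assms(2) unfolding O_eq_lat by (rule latE)
 obtain q where q: "\<theta> * \<theta> = of_int D * \<theta> - of_int q" by (rule theta_quadratic)
 have "x * y = of_int a * of_int c + (of_int a * of_int d + of_int b * of_int c) * \<theta> + of_int b * of_int d * (\<theta> * \<theta>)"
  unfolding x y by (simp add: algebra_simps)
 also have "\<dots> = of_int (a * c - b * d * q) * 1 + of_int (a * d + b * c + b * d * D) * \<theta>"
  unfolding q by (simp add: algebra_simps)
 finally show ?thesis unfolding O_eq_lat using latI by metis
qed

lemma O_cnj: assumes "x \<in> O'" shows "cnj x \<in> O'"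
proof -
 obtain a b where x: "x = of_int a * 1 + of_int b * \<theta>" using assms(1) unfolding O_eq_lat by (rule latE)
 have "cnj x = of_int (a + b * D) * 1 + of_int (- b) * \<theta>" by (simp add: x cnj_theta algebra_simps)
 then show ?thesis unfolding O_eq_lat using latI by metis
qed

lemma O_K: "x \<in> O' ==> x \<in> K" unfolding O_eq_lat by (erule lat_in_K[rotated 2]) auto

lemma O_real: assumes "x \<in> O'" "Im x = 0" obtains k where "x = of_int k"
proof -
 obtain a b where x: "x = of_int a * 1 + of_int b * \<theta>" using assms(1) unfolding O_eq_lat by (rule latE)
 with assms(2) have "of_int b * Im \<theta> = 0" by simp
 then have "b = 0" using Im_rD_pos by (simp add: Im_theta)
 then have "x = of_int a" using x by simp
 then show thesis by (rule that)
qed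

end

section \<open>Proper ideals and the class group\<close>

notation ideal_product (infixl "\<odot>" 70)

abbreviation sc :: "complex => complex set => complex set" where
 "sc c L \<equiv> (\<lambda>v. c * v) ` L"

lemma sc_sc: "sc c (sc d L) = sc (c * d) L"
 by fastforce

lemma subspace_image_cnj:
 assumes "int_complex.subspace H" shows "int_complex.subspace (cnj ` H)"
proof (unfold int_complex.subspace_def, intro conjI ballI allI)
 show "0 \<in> cnj ` H" using subspace_zero[OF assms] by simp
next
 fix u v assume "u \<in> cnj ` H" "v \<in> cnj ` H"
 then obtain u' v' where "u' \<in> H" "v' \<in> H" "u = cnj u'" "v = cnj v'" by auto
 then show "u + v \<in> cnj ` H"
  using subspace_add[OF assms, of u' v'] by (auto intro!: image_eqI[of _ _ "u' + v'"])
next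
 fix k :: int and v assume "v \<in> cnj ` H"
 then obtain v' where "v' \<in> H" "v = cnj v'" by auto
 then show "of_int k * v \<in> cnj ` H"
  using subspace_of_int_mult[OF assms, of v' k] by (auto intro!: image_eqI[of _ _ "of_int k * v'"])
qed

lemma cnj_image_cnj [simp]: "cnj ` cnj ` L = L" by (simp add: image_image)

lemma cnj_sc: "cnj ` sc c L = sc (cnj c) (cnj ` L)" by (simp add: image_image)

lemma cnj_lat: "cnj ` lat a b = lat (cnj a) (cnj b)"
proof -
 have "cnj ` lat a b \<subseteq> lat (cnj a) (cnj b)" for a b
  by (auto elim!: latE intro: latI)
 from this[of a b] this[of "cnj a" "cnj b"] show ?thesis
  using image_mono[of "cnj ` lat (cnj a) (cnj b)" "lat a b" cnj] by auto
qed

lemma subspace_ip [simp]: "int_complex.subspace (I \<odot> J)"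
 unfolding ideal_product_def by simp

lemma ip_mem: "x \<in> I ==> y \<in> J ==> x * y \<in> I \<odot> J"
 unfolding ideal_product_def by (rule int_complex.span_base) auto

lemma ip_subset:
 assumes "int_complex.subspace H" "\<And>x y. x \<in> I ==> y \<in> J ==> x * y \<in> H"
 shows "I \<odot> J \<subseteq> H"
 unfolding ideal_product_def using assms by (intro int_complex.span_minimal) auto

lemma ip_comm: "I \<odot> J = J \<odot> I"
proof -
 have "{x * y | x y. x \<in> I \<and> y \<in> J} = {x * y | x y. x \<in> J \<and> y \<in> I}"
  by (auto simp: mult.commute) (metis mult.commute)+
 then show ?thesis by (simp add: ideal_product_def)
qed

lemma ip_mono: "I \<subseteq> I' ==> J \<subseteq> J' ==> I \<odot> J \<subseteq> I' \<odot> J'"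
 by (intro ip_subset subspace_ip) (auto intro: ip_mem)

lemma ip_span_left:
 assumes H: "int_complex.subspace H" and "\<And>x y. x \<in> X ==> y \<in> J ==> x * y \<in> H"
 shows "int_complex.span X \<odot> J \<subseteq> H"
proof (rule ip_subset[OF H])
 fix x y assume x: "x \<in> int_complex.span X" and y: "y \<in> J"
 have "int_complex.span X \<subseteq> {x. y * x \<in> H}"
  using assms(2) y by (intro int_complex.span_minimal subspace_preimage_mult H) (auto simp: mult.commute)
 then show "x * y \<in> H" using x by (auto simp: mult.commute)
qed

lemma ip_span_span:
 assumes H: "int_complex.subspace H" and g: "\<And>x y. x \<in> X ==> y \<in> Y ==> x * y \<in> H"
 shows "int_complex.span X \<odot> int_complex.span Y \<subseteq> H"
proof (rule ip_span_left[OF H])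
 fix x y assume x: "x \<in> X" and y: "y \<in> int_complex.span Y"
 have "int_complex.span Y \<subseteq> {y. x * y \<in> H}"
  using g x by (intro int_complex.span_minimal subspace_preimage_mult H) auto
 then show "x * y \<in> H" using y by auto
qed

lemma ip_lat_lat:
 assumes "int_complex.subspace H" "a * c \<in> H" "a * d \<in> H" "b * c \<in> H" "b * d \<in> H"
 shows "lat a b \<odot> lat c d \<subseteq> H"
 unfolding lat_eq_span using assms by (intro ip_span_span) auto

lemma ip_assoc: "(I \<odot> J) \<odot> M = I \<odot> (J \<odot> M)"
proof -
 have sub: "(I \<odot> J) \<odot> M \<subseteq> I \<odot> (J \<odot> M)" for I J M
  unfolding ideal_product_def[of I J]
 proof (rule ip_span_left[OF subspace_ip])
  fix x y assume "x \<in> {x * y | x y. x \<in> I \<and> y \<in> J}" "y \<in> M"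
  then show "x * y \<in> I \<odot> (J \<odot> M)" using ip_mem by (force simp: mult.assoc)
 qed
 have "I \<odot> (J \<odot> M) = (M \<odot> J) \<odot> I" by (simp only: ip_comm)
 also have "\<dots> \<subseteq> M \<odot> (J \<odot> I)" by (rule sub)
 also have "\<dots> = (I \<odot> J) \<odot> M" by (simp only: ip_comm)
 finally show ?thesis using sub by blast
qed

lemma ip_left_comm: "I \<odot> (J \<odot> M) = J \<odot> (I \<odot> M)"
 by (metis ip_assoc ip_comm)

lemma ip_sc: "sc c I \<odot> J = sc c (I \<odot> J)"
proof
 show "sc c I \<odot> J \<subseteq> sc c (I \<odot> J)"
  by (intro ip_subset subspace_image_mult subspace_ip) (auto simp: mult.assoc intro!: imageI ip_mem)
 have "I \<odot> J \<subseteq> {v. c * v \<in> sc c I \<odot> J}"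
  by (intro ip_subset subspace_preimage_mult subspace_ip) (auto simp: mult.assoc[symmetric] intro!: ip_mem)
 then show "sc c (I \<odot> J) \<subseteq> sc c I \<odot> J" by auto
qed

lemma ip_sc_right: "I \<odot> sc c J = sc c (I \<odot> J)"
 by (metis ip_comm ip_sc)

lemma cnj_ip: "cnj ` (I \<odot> J) = cnj ` I \<odot> cnj ` J"
proof -
 have sub: "cnj ` I \<odot> cnj ` J \<subseteq> cnj ` (I \<odot> J)" for I J
 proof (intro ip_subset subspace_image_cnj subspace_ip)
  fix x y assume "x \<in> cnj ` I" "y \<in> cnj ` J"
  then obtain u v where "u \<in> I" "v \<in> J" "x = cnj u" "y = cnj v" by auto
  then show "x * y \<in> cnj ` (I \<odot> J)" using ip_mem by (metis complex_cnj_mult imageI)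
 qed
 from sub[of I J] sub[of "cnj ` I" "cnj ` J"] show ?thesis
  using image_mono[OF sub[of "cnj ` I" "cnj ` J"], of cnj] by auto
qed

text \<open>The product is spanned by \<open>a * cnj a\<close>, \<open>a * cnj b\<close>,
  \<open>b * cnj a\<close> and \<open>b * cnj b\<close>. Primitivity of the form
  \<open>(A, B, C)\<close> and Bezout put \<open>m\<close> itself into it, and what remains is
  \<open>m\<close> times the module spanned by \<open>1\<close> and \<open>a * cnj b / m\<close>.
  The invertibility of proper ideals rests on this identity.\<close>

lemma form_product:
 fixes m :: complex and A B C :: int
 assumes m: "m \<noteq> 0" and gcd: "gcd A (gcd B C) = 1"
  and A: "a * cnj a = m * of_int A" and B: "a * cnj b + cnj a * b = m * of_int B" and C: "b * cnj b = m * of_int C"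
 shows "lat a b \<odot> cnj ` lat a b = sc m (lat 1 (a * cnj b / m))"
  and "v \<in> lat a b ==> a * cnj b / m * v \<in> lat a b"
proof -
 define \<gamma> where "\<gamma> = a * cnj b / m"
 have ab: "a * cnj b = m * \<gamma>" using m by (simp add: \<gamma>_def)
 have ba: "b * cnj a = m * of_int B - m * \<gamma>" using B ab by (simp add: algebra_simps)
 have H: "sc m (lat 1 \<gamma>) = lat m (m * \<gamma>)" by (simp add: image_mult_lat)
 show "lat a b \<odot> cnj ` lat a b = sc m (lat 1 (a * cnj b / m))"
  unfolding \<gamma>_def[symmetric] H cnj_lat
 proof
  have "m * of_int A \<in> lat m (m * \<gamma>)" "m * of_int C \<in> lat m (m * \<gamma>)" "m * of_int B - m * \<gamma> \<in> lat m (m * \<gamma>)"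
   using latI[of A m 0 "m * \<gamma>"] latI[of C m 0 "m * \<gamma>"] latI[of B m "-1" "m * \<gamma>"] by (simp_all add: mult.commute)
  then show "lat a b \<odot> lat (cnj a) (cnj b) \<subseteq> lat m (m * \<gamma>)"
   using A C ab ba by (intro ip_lat_lat subspace_lat) simp_all
  let ?P = "lat a b \<odot> lat (cnj a) (cnj b)"
  obtain x y where xy: "x * A + y * gcd B C = 1" using bezout_int[of A "gcd B C"] gcd by auto
  obtain u v where uv: "u * B + v * C = gcd B C" using bezout_int[of B C] by auto
  have "m = of_int x * (m * of_int A) + of_int (y * u) * (m * of_int B) + of_int (y * v) * (m * of_int C)"
  proof -
   have "of_int x * (m * of_int A) + of_int (y * u) * (m * of_int B) + of_int (y * v) * (m * of_int C)
     = m * of_int (x * A + y * (u * B + v * C))" by (simp add: algebra_simps)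
   then show ?thesis unfolding uv xy by simp
  qed
  also have "\<dots> = of_int x * (a * cnj a) + of_int (y * u) * (a * cnj b + b * cnj a) + of_int (y * v) * (b * cnj b)"
   using A B C by (simp add: mult.commute)
  also have "\<dots> \<in> ?P"
   by (intro subspace_add subspace_of_int_mult subspace_ip ip_mem lat_mem1 lat_mem2)
  finally have "m \<in> ?P" .
  moreover have "m * \<gamma> \<in> ?P" unfolding ab[symmetric] by (intro ip_mem) auto
  ultimately show "lat m (m * \<gamma>) \<subseteq> ?P" by (intro lat_subset subspace_ip)
 qed
 have mg: "m * \<gamma> = m * of_int B - b * cnj a" using ba by simp
 have "m * (\<gamma> * a) = a * (m * \<gamma>)" by simp
 also have "\<dots> = a * (m * of_int B - b * cnj a)" unfolding mg ..
 also have "\<dots> = m * (of_int B * a - of_int A * b)" using A by (simp add: algebra_simps)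
 finally have 1: "\<gamma> * a = of_int B * a - of_int A * b" using m by simp
 have "m * (\<gamma> * b) = a * (b * cnj b)" using ab by simp
 also have "\<dots> = m * (of_int C * a)" using C by simp
 finally have 2: "\<gamma> * b = of_int C * a" using m by simp
 have "lat a b \<subseteq> {v. \<gamma> * v \<in> lat a b}"
  using latI[of B a "- A" b] latI[of C a 0 b]
  by (intro lat_subset subspace_preimage_mult subspace_lat) (simp_all add: 1 2)
 then show "a * cnj b / m * v \<in> lat a b" if "v \<in> lat a b" using that unfolding \<gamma>_def by blast
qed

lemma primitive_integer_multiple:
 fixes r1 r2 r3 :: rat
 assumes "r1 > 0"
 obtains m :: rat and A B C :: int where "m > 0" "gcd A (gcd B C) = 1" "r1 = m * of_int A" "r2 = m * of_int B" "r3 = m * of_int C"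
proof -
 obtain p1 q1 where 1: "quotient_of r1 = (p1, q1)" by fastforce
 obtain p2 q2 where 2: "quotient_of r2 = (p2, q2)" by fastforce
 obtain p3 q3 where 3: "quotient_of r3 = (p3, q3)" by fastforce
 have q: "q1 > 0" "q2 > 0" "q3 > 0" using 1 2 3 quotient_of_denom_pos by auto
 have r: "r1 = of_int p1 / of_int q1" "r2 = of_int p2 / of_int q2" "r3 = of_int p3 / of_int q3"
  using 1 2 3 quotient_of_div by auto
 define n where "n = q1 * q2 * q3"
 define P1 P2 P3 where "P1 = p1 * q2 * q3" and "P2 = p2 * q1 * q3" and "P3 = p3 * q1 * q2"
 have n: "n > 0" using q by (simp add: n_def)
 have rr: "r1 = of_int P1 / of_int n" "r2 = of_int P2 / of_int n" "r3 = of_int P3 / of_int n"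
  using q by (simp_all add: r n_def P1_def P2_def P3_def)
 define g where "g = gcd P1 (gcd P2 P3)"
 have "P1 \<noteq> 0" using assms rr(1) by auto
 then have g: "g > 0" by (simp add: g_def)
 have dvd: "g dvd P1" "g dvd P2" "g dvd P3" unfolding g_def by (auto intro: dvd_trans)
 then obtain A B C where abc: "P1 = g * A" "P2 = g * B" "P3 = g * C" by blast
 have "g = g * gcd A (gcd B C)" using g unfolding abc g_def[unfolded abc, symmetric]
  by (metis abc g_def gcd_mult_distrib_int abs_of_pos)
 then have "gcd A (gcd B C) = 1" using g by simp
 moreover have "of_int g / of_int n > (0::rat)" using g n by simp
 ultimately show thesis using that[of "of_int g / of_int n" A B C] rr abc by simp
qed

context quad
begin

abbreviation "proper L \<equiv> proper_ideal d0 f L"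

lemma proper_smult: "proper L ==> z \<in> O' ==> v \<in> L ==> z * v \<in> L"
 unfolding proper_ideal_def coefficient_ring_def by blast

lemma proper_fractional: "proper L ==> fractional_ideal d0 L"
 by (simp add: proper_ideal_def)

lemmas proper_lat = fractional_ideal_lat[OF proper_fractional]

lemma proper_subspace: assumes "proper L" shows "int_complex.subspace L"
 using proper_lat[OF assms] by fastforce

lemma proper_K: assumes "proper L" "v \<in> L" shows "v \<in> K"
 using proper_lat[OF assms(1)] assms(2) lat_in_K by metis

text \<open>Makes \<open>nrm\<close> well defined: the ratio of the two scalars and its inverse are
  real elements of the order, hence integers.\<close>

lemma O_sc_eqD:
 assumes "sc (of_real m) O' = sc (of_real m') O'" "m > 0" "m' > 0" shows "m = m'"
proof -
 have *: "\<exists>k. of_real (a / b) = (of_int k :: complex)" if "sc (of_real a) O' \<subseteq> sc (of_real b) O'" "a > 0" "b > 0" for a b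
 proof -
  have "of_real a \<in> sc (of_real a) O'" by fastforce
  then have "of_real a \<in> sc (of_real b) O'" using that by blast
  then have "of_real (a / b) \<in> O'" using that by fastforce
  then show ?thesis using O_real[of "of_real (a / b)"] by (metis Im_complex_of_real)
 qed
 obtain k where k: "of_real (m / m') = (of_int k :: complex)" using *[of m m'] assms by auto
 obtain j where j: "of_real (m' / m) = (of_int j :: complex)" using *[of m' m] assms by auto
 have k': "m / m' = of_int k" using k by (metis of_real_eq_iff of_real_of_int_eq)
 have j': "m' / m = of_int j" using j by (metis of_real_eq_iff of_real_of_int_eq)
 have "of_int (k * j) = (1::real)" using k' j' assms by (simp flip: k' j')
 then have "k * j = 1" by blast
 moreover have "k > 0" using k' assms by (metis divide_pos_pos of_int_0_less_iff)
 ultimately have "k = 1" by (simp add: zmult_eq_1_iff)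
 then show ?thesis using k' assms by simp
qed

lemma norm_form:
 assumes a: "a \<in> K" and b: "b \<in> K" and nz: "Im (a * cnj b) \<noteq> 0"
 obtains m :: real and A B C :: int where "m > 0" "gcd A (gcd B C) = 1"
  "a * cnj a = of_real m * of_int A" "a * cnj b + cnj a * b = of_real m * of_int B"
  "b * cnj b = of_real m * of_int C" "of_real m \<in> K"
proof -
 obtain r1 where r1: "a * cnj a = of_rat r1" using K_real[of "a * cnj a"] a by auto
 have "Im (a * cnj b + cnj a * b) = 0" by simp
 moreover have "a * cnj b + cnj a * b \<in> K" using a b by blast
 ultimately obtain r2 where r2: "a * cnj b + cnj a * b = of_rat r2" using K_real by blast
 obtain r3 where r3: "b * cnj b = of_rat r3" using K_real[of "b * cnj b"] b by auto
 have "a \<noteq> 0" using nz by auto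
 have "complex_of_real ((cmod a)\<^sup>2) = of_real (of_rat r1)" using r1 complex_norm_square of_real_of_rat by simp
 then have "of_rat r1 = (cmod a)\<^sup>2" using of_real_eq_iff by metis
 then have "(0::real) < of_rat r1" using \<open>a \<noteq> 0\<close> by simp
 then have "r1 > 0" by simp
 then obtain m A B C where m: "m > 0" "gcd A (gcd B C) = 1" "r1 = m * of_int A" "r2 = m * of_int B" "r3 = m * of_int C"
  by (rule primitive_integer_multiple)
 show thesis
  by (rule that[of "of_rat m" A B C]) (use m r1 r2 r3 in \<open>simp_all add: of_rat_mult of_real_of_rat\<close>)
qed

lemma form_disc:
 fixes m :: complex
 assumes "a * cnj a = m * of_int A" "a * cnj b + cnj a * b = m * of_int B" "b * cnj b = m * of_int C"
 shows "(a * cnj b - cnj a * b)\<^sup>2 = m\<^sup>2 * of_int (B * B - 4 * A * C)"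
proof -
 have "(a * cnj b - cnj a * b)\<^sup>2 = (a * cnj b + cnj a * b)\<^sup>2 - 4 * (a * cnj a) * (b * cnj b)"
  by (simp add: square_simps)
 also have "\<dots> = m\<^sup>2 * of_int (B * B - 4 * A * C)" unfolding assms by (simp add: square_simps)
 finally show ?thesis .
qed

text \<open>The number \<open>\<gamma> = a * cnj b / m\<close> stabilises the lattice, so it lies in
  the order, which is the whole coefficient ring. Conversely the order maps \<open>m\<close> into
  the product, which gives the reverse inclusion. Comparing \<open>\<gamma>\<close> with
  \<open>\<theta>\<close> then yields the discriminant \<open>D\<close>.\<close>

lemma proper_form:
 assumes L: "proper (lat a b)" and ab: "a \<in> K" "b \<in> K" "Im (a * cnj b) \<noteq> 0"
 obtains m :: real and A B C :: int where "m > 0" "gcd A (gcd B C) = 1" "of_real m \<in> K"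
  "a * cnj a = of_real m * of_int A" "a * cnj b + cnj a * b = of_real m * of_int B"
  "b * cnj b = of_real m * of_int C" "B * B - 4 * A * C = D" "\<bar>Im (a * cnj b)\<bar> = m * (Im rD / 2)"
  "lat a b \<odot> cnj ` lat a b = sc (of_real m) O'"
proof -
 obtain m A B C where m: "m > 0" "gcd A (gcd B C) = 1"
  and f: "a * cnj a = of_real m * of_int A" "a * cnj b + cnj a * b = of_real m * of_int B"
  "b * cnj b = of_real m * of_int C" and mK: "of_real m \<in> K" by (rule norm_form[OF ab])
 define \<gamma> where "\<gamma> = a * cnj b / of_real m"
 have m0: "complex_of_real m \<noteq> 0" using m by simp
 note fp = form_product[OF m0 m(2) f, folded \<gamma>_def]
 have "\<gamma> \<in> K" using ab mK by (auto simp: \<gamma>_def)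
 then have "\<gamma> \<in> O'" using L fp(2) unfolding proper_ideal_def coefficient_ring_def by blast
 then have 1: "lat 1 \<gamma> \<subseteq> O'" by (intro lat_subset) auto
 have 2: "O' \<subseteq> lat 1 \<gamma>"
 proof
  fix z assume z: "z \<in> O'"
  have "lat a b \<odot> cnj ` lat a b \<subseteq> {v. z * v \<in> lat a b \<odot> cnj ` lat a b}"
  proof (intro ip_subset subspace_preimage_mult subspace_ip)
   fix x y assume "x \<in> lat a b" "y \<in> cnj ` lat a b"
   then show "x * y \<in> {v. z * v \<in> lat a b \<odot> cnj ` lat a b}"
    using proper_smult[OF L z] ip_mem[of "z * x" "lat a b" y] by (simp add: mult.assoc)
  qed
  moreover have "of_real m \<in> lat a b \<odot> cnj ` lat a b" unfolding fp(1) by fastforce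
  ultimately have "z * of_real m \<in> sc (of_real m) (lat 1 \<gamma>)" unfolding fp(1) by blast
  then show "z \<in> lat 1 \<gamma>" using m0 by fastforce
 qed
 have O: "lat 1 \<gamma> = O'" using 1 2 by simp
 have "\<gamma> \<in> lat 1 \<theta>" using O O_eq_lat lat_mem2 by metis
 then obtain x y where g: "\<gamma> = of_int x * 1 + of_int y * \<theta>" by (rule latE)
 have "\<theta> \<in> lat 1 \<gamma>" using O O_theta by simp
 then obtain x' y' where t: "\<theta> = of_int x' * 1 + of_int y' * \<gamma>" by (rule latE)
 have Ig: "Im \<gamma> = of_int y * Im \<theta>" unfolding g by simp
 have It: "Im \<theta> = of_int y' * Im \<gamma>" using t by simp
 have tp: "Im \<theta> > 0" using Im_rD_pos by (simp add: Im_theta)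
 have "Im \<theta> = of_int y' * (of_int y * Im \<theta>)" using It unfolding Ig .
 then have "Im \<theta> = of_int (y' * y) * Im \<theta>" by simp
 then have "of_int (y' * y) = (1::real)" using tp by simp
 then have "y' * y = 1" by blast
 then have "\<bar>y\<bar> = 1" by (auto simp: zmult_eq_1_iff)
 then have Iabs: "\<bar>Im \<gamma>\<bar> = Im \<theta>" using Ig tp by (simp add: abs_mult flip: of_int_abs)
 have ab': "a * cnj b = of_real m * \<gamma>" using m0 by (simp add: \<gamma>_def)
 have Iab: "\<bar>Im (a * cnj b)\<bar> = m * (Im rD / 2)" unfolding ab' using Iabs m(1) by (simp add: abs_mult Im_theta)
 have "a * cnj b - cnj a * b = of_real (2 * Im (a * cnj b)) * \<i>" by (simp add: complex_eq_iff)
 then have "(a * cnj b - cnj a * b)\<^sup>2 = (of_real (2 * Im (a * cnj b)) * \<i>)\<^sup>2" by simp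
 also have "\<dots> = - of_real (4 * \<bar>Im (a * cnj b)\<bar>\<^sup>2)"
 proof -
  have "(of_real (2 * t) * \<i>)\<^sup>2 = (- of_real (4 * \<bar>t\<bar>\<^sup>2) :: complex)" for t :: real
   by (simp add: power_mult_distrib)
  then show ?thesis .
 qed
 also have "\<dots> = - of_real (m\<^sup>2 * (Im rD)\<^sup>2)" unfolding Iab by (simp add: power_mult_distrib power_divide)
 also have "(Im rD)\<^sup>2 = - of_int D" using D_neg by (simp add: Im_rD)
 finally have "(of_real m)\<^sup>2 * of_int (B * B - 4 * A * C) = (of_real m)\<^sup>2 * (of_int D :: complex)"
  unfolding form_disc[OF f] by simp
 then have "of_int (B * B - 4 * A * C) = (of_int D :: complex)" using m0 by simp
 then have "B * B - 4 * A * C = D" by (simp only: of_int_eq_iff)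
 then show thesis using that[OF m mK f _ Iab fp(1)[unfolded O]] by simp
qed

text \<open>A multiplier of \<open>L\<close> is also a multiplier of \<open>L \<odot> M\<close>, a
  scaled copy of the order, and applying it to \<open>m\<close> shows that it lies in the order.
  Invertible modules thus have no larger coefficient ring.\<close>

lemma proper_crit:
 assumes fr: "fractional_ideal d0 L" and st: "\<And>v. v \<in> L ==> \<theta> * v \<in> L" and inv: "L \<odot> M = sc m O'" "m \<noteq> 0"
 shows "proper L"
proof -
 obtain a b where ab: "a \<in> K" "b \<in> K" "Im (a * cnj b) \<noteq> 0" "L = lat a b" using fractional_ideal_lat[OF fr] .
 have ss: "int_complex.subspace L" by (simp add: ab)
 have "coefficient_ring d0 L = O'"
 proof
  show "O' \<subseteq> coefficient_ring d0 L"
  proof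
   fix z assume z: "z \<in> O'"
   then obtain x y where xy: "z = of_int x * 1 + of_int y * \<theta>" unfolding O_eq_lat by (rule latE)
   have "z * v \<in> L" if "v \<in> L" for v
   proof -
    have "z * v = of_int x * v + of_int y * (\<theta> * v)" by (simp add: xy algebra_simps)
    then show ?thesis using that st subspace_add[OF ss] subspace_of_int_mult[OF ss] by simp
   qed
   then show "z \<in> coefficient_ring d0 L" using O_K[OF z] by (auto simp: coefficient_ring_def)
  qed
  show "coefficient_ring d0 L \<subseteq> O'"
  proof
   fix z assume z: "z \<in> coefficient_ring d0 L"
   have "L \<odot> M \<subseteq> {v. z * v \<in> L \<odot> M}"
   proof (intro ip_subset subspace_preimage_mult subspace_ip)
    fix x y assume "x \<in> L" "y \<in> M"
    moreover have "z * x \<in> L" using z \<open>x \<in> L\<close> by (auto simp: coefficient_ring_def)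
    ultimately show "x * y \<in> {v. z * v \<in> L \<odot> M}" using ip_mem[of "z * x" L y M] by (simp add: mult.assoc)
   qed
   moreover have "m \<in> L \<odot> M" unfolding inv(1) by fastforce
   ultimately have "z * m \<in> sc m O'" unfolding inv(1) by blast
   then show "z \<in> O'" using inv(2) by fastforce
  qed
 qed
 then show ?thesis using fr by (simp add: proper_ideal_def)
qed

text \<open>Converse of \<open>proper_form\<close>: discriminant \<open>D\<close> forces
  \<open>a * cnj b / m\<close> to be \<open>(B + rD) / 2\<close> or \<open>(B - rD) / 2\<close>.
  Together with 1 this spans the order, since \<open>B\<close> and \<open>D\<close> have the same
  parity.\<close>

lemma proper_from_form:
 fixes m :: real
 assumes ab: "a \<in> K" "b \<in> K" "Im (a * cnj b) \<noteq> 0" and m: "m > 0" and gcd: "gcd A (gcd B C) = 1"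
  and f: "a * cnj a = of_real m * of_int A" "a * cnj b + cnj a * b = of_real m * of_int B"
  "b * cnj b = of_real m * of_int C" and disc: "B * B - 4 * A * C = D"
 shows "proper (lat a b)" "lat a b \<odot> cnj ` lat a b = sc (of_real m) O'"
proof -
 define \<gamma> where "\<gamma> = a * cnj b / of_real m"
 have m0: "complex_of_real m \<noteq> 0" using m by simp
 note fp = form_product[OF m0 gcd f, folded \<gamma>_def]
 have "(a * cnj b - cnj a * b)\<^sup>2 = (of_real m * rD)\<^sup>2"
  unfolding form_disc[OF f] disc power_mult_distrib by (simp add: power2_eq_square rD_sq)
 then have "a * cnj b - cnj a * b = of_real m * rD \<or> a * cnj b - cnj a * b = - (of_real m * rD)"
  by (simp add: power2_eq_iff)
 then obtain s :: int where s: "s = 1 \<or> s = -1" "a * cnj b - cnj a * b = of_int s * (of_real m * rD)"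
  by fastforce
 have "2 * (a * cnj b) = (a * cnj b + cnj a * b) + (a * cnj b - cnj a * b)" by simp
 also have "\<dots> = of_real m * (of_int B + of_int s * rD)" unfolding f s(2) by (simp add: algebra_simps)
 finally have g: "\<gamma> = (of_int B + of_int s * rD) / 2" using m0 by (simp add: \<gamma>_def field_simps)
 have "even (B * B - D)" using disc by (metis add_diff_cancel_left' diff_diff_eq2 dvd_mult2 dvd_triv_left even_numeral mult.assoc add.commute diff_add_cancel)
 then have "even B = even D" by simp
 then have "even (B - s * D)" using s(1) by auto
 then obtain k where k: "B - s * D = 2 * k" by blast
 then have B: "B = 2 * k + s * D" by simp
 have gt: "\<gamma> = of_int k * 1 + of_int s * \<theta>" unfolding g B by (simp add: \<theta>_def field_simps)
 have tg: "\<theta> = of_int (- s * k) * 1 + of_int s * \<gamma>" unfolding gt using s(1) by fastforce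
 have O: "lat 1 \<gamma> = O'" unfolding O_eq_lat
  using latI[of k 1 s \<theta>, folded gt] latI[of "- s * k" 1 s \<gamma>, folded tg]
  by (intro equalityI lat_subset subspace_lat) simp_all
 show p: "lat a b \<odot> cnj ` lat a b = sc (of_real m) O'" using fp(1) unfolding O .
 have "\<theta> * v \<in> lat a b" if "v \<in> lat a b" for v
 proof -
  have "\<theta> * v = of_int (- s * k) * v + of_int s * (\<gamma> * v)" by (subst tg) (simp add: algebra_simps)
  also have "\<dots> \<in> lat a b" using that fp(2) by (intro subspace_add subspace_of_int_mult subspace_lat)
  finally show ?thesis .
 qed
 then show "proper (lat a b)"
  by (rule proper_crit[OF lat_fractional_ideal[OF ab] _ p]) (use m0 in auto)
qed

text \<open>Taking the ideal norm from the product with the conjugate ideal makes it multiplicative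
  at once; that it also measures covolume and index is the content of \<open>covol\<close> and
  \<open>index_proper\<close>.\<close>

definition nrm :: "complex set => real" where
 "nrm L = (THE m. m > 0 \<and> L \<odot> cnj ` L = sc (of_real m) O')"

lemma nrm_eq: "m > 0 ==> L \<odot> cnj ` L = sc (of_real m) O' ==> nrm L = m"
 unfolding nrm_def by (rule the_equality) (auto dest: O_sc_eqD)

lemma nrm_props:
 assumes "proper L"
 shows "nrm L > 0" "L \<odot> cnj ` L = sc (of_real (nrm L)) O'" "of_real (nrm L) \<in> K"
proof -
 obtain a b where ab: "a \<in> K" "b \<in> K" "Im (a * cnj b) \<noteq> 0" "L = lat a b"
  using proper_lat[OF assms] .
 obtain m where m: "m > 0" "of_real m \<in> K" "lat a b \<odot> cnj ` lat a b = sc (of_real m) O'"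
  by (rule proper_form[OF assms[unfolded ab(4)] ab(1-3)]) blast
 then have "nrm L = m" using nrm_eq ab(4) by simp
 with m ab(4) show "nrm L > 0" "L \<odot> cnj ` L = sc (of_real (nrm L)) O'" "of_real (nrm L) \<in> K" by auto
qed

lemma O_ip: assumes "proper L" shows "O' \<odot> L = L"
proof
 show "O' \<odot> L \<subseteq> L" using proper_smult[OF assms] by (intro ip_subset proper_subspace[OF assms])
 show "L \<subseteq> O' \<odot> L" using ip_mem[OF O_1] by fastforce
qed

lemma O_ip_O: "O' \<odot> O' = O'"
proof
 show "O' \<odot> O' \<subseteq> O'" using O_mult by (intro ip_subset O_subspace)
 show "O' \<subseteq> O' \<odot> O'" using ip_mem[OF O_1, of _ O'] by fastforce
qed

lemma cnj_O: "cnj ` O' = O'"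
 using O_cnj by (force intro: image_eqI[where x = "cnj _"])

lemma fractional_ip:
 assumes "fractional_ideal d0 I" "fractional_ideal d0 J" shows "fractional_ideal d0 (I \<odot> J)"
proof -
 obtain a b where ab: "a \<in> K" "b \<in> K" "Im (a * cnj b) \<noteq> 0" "I = lat a b" using fractional_ideal_lat[OF assms(1)] .
 obtain c d where cd: "c \<in> K" "d \<in> K" "Im (c * cnj d) \<noteq> 0" "J = lat c d" using fractional_ideal_lat[OF assms(2)] .
 let ?X = "{a * c, a * d, b * c, b * d}"
 have eq: "I \<odot> J = int_complex.span ?X"
 proof
  show "I \<odot> J \<subseteq> int_complex.span ?X" unfolding ab cd
   by (intro ip_lat_lat int_complex.subspace_span) (auto intro: int_complex.span_base)
  show "int_complex.span ?X \<subseteq> I \<odot> J" unfolding ab cd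
   by (intro int_complex.span_minimal subspace_ip) (auto intro!: ip_mem)
 qed
 have X: "finite ?X" "?X \<subseteq> K" using ab cd by auto
 have c0: "c \<noteq> 0" using cd by auto
 have "a * c \<in> int_complex.span ?X" "b * c \<in> int_complex.span ?X" by (auto intro: int_complex.span_base)
 moreover have "Im ((a * c) * cnj (b * c)) \<noteq> 0"
 proof -
  have "(a * c) * cnj (b * c) = (c * cnj c) * (a * cnj b)" by simp
  also have "\<dots> = of_real ((cmod c)\<^sup>2) * (a * cnj b)" by (simp only: complex_norm_square)
  finally have "Im ((a * c) * cnj (b * c)) = (cmod c)\<^sup>2 * Im (a * cnj b)" by (simp only: Im_complex_of_real Re_complex_of_real times_complex.sel)
  then show ?thesis using ab(3) c0 by simp
 qed
 ultimately obtain x y where "x \<in> K" "y \<in> K" "Im (x * cnj y) \<noteq> 0" "int_complex.span ?X = lat x y"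
  using finite_span_is_lat[OF X] by blast
 then show ?thesis using eq lat_fractional_ideal by simp
qed

lemma proper_ip:
 assumes I: "proper I" and J: "proper J"
 shows "proper (I \<odot> J)" "nrm (I \<odot> J) = nrm I * nrm J"
proof -
 have "(I \<odot> J) \<odot> cnj ` (I \<odot> J) = (I \<odot> cnj ` I) \<odot> (J \<odot> cnj ` J)"
  unfolding cnj_ip by (metis ip_assoc ip_left_comm)
 also have "\<dots> = sc (of_real (nrm I * nrm J)) O'"
  unfolding nrm_props(2)[OF I] nrm_props(2)[OF J] ip_sc ip_sc_right sc_sc O_ip_O by fastforce
 finally have *: "(I \<odot> J) \<odot> cnj ` (I \<odot> J) = sc (of_real (nrm I * nrm J)) O'" .
 have pos: "nrm I * nrm J > 0" using nrm_props(1) I J by simp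
 show "proper (I \<odot> J)"
 proof (rule proper_crit[OF fractional_ip[OF proper_fractional[OF I] proper_fractional[OF J]] _ *])
  fix v assume v: "v \<in> I \<odot> J"
  have "I \<odot> J \<subseteq> {v. \<theta> * v \<in> I \<odot> J}"
  proof (intro ip_subset subspace_preimage_mult subspace_ip)
   fix x y assume "x \<in> I" "y \<in> J"
   then show "x * y \<in> {v. \<theta> * v \<in> I \<odot> J}"
    using ip_mem[of "\<theta> * x" I y J] proper_smult[OF I O_theta] by (simp add: mult.assoc)
  qed
  then show "\<theta> * v \<in> I \<odot> J" using v by blast
 qed (use I J pos in \<open>auto simp: proper_fractional\<close>)
 show "nrm (I \<odot> J) = nrm I * nrm J" by (rule nrm_eq[OF pos *])
qed

lemma proper_O: "proper O'" "nrm O' = 1"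
proof -
 have fr: "fractional_ideal d0 O'" unfolding O_eq_lat
  using Im_rD_pos by (intro lat_fractional_ideal) (auto simp: Im_theta)
 show "proper O'"
  by (rule proper_crit[OF fr, of O' 1]) (auto simp: O_mult O_ip_O)
 show "nrm O' = 1" by (rule nrm_eq) (auto simp: cnj_O O_ip_O)
qed

lemma proper_sc:
 assumes I: "proper I" and c: "c \<in> K" "c \<noteq> 0"
 shows "proper (sc c I)" "nrm (sc c I) = (cmod c)\<^sup>2 * nrm I"
proof -
 obtain a b where ab: "a \<in> K" "b \<in> K" "Im (a * cnj b) \<noteq> 0" "I = lat a b"
  using proper_lat[OF I] .
 have "(c * a) * cnj (c * b) = of_real ((cmod c)\<^sup>2) * (a * cnj b)" by (simp only: complex_norm_square) simp
 then have "Im ((c * a) * cnj (c * b)) = (cmod c)\<^sup>2 * Im (a * cnj b)" by (simp only: Im_complex_of_real Re_complex_of_real times_complex.sel)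
 then have fr: "fractional_ideal d0 (sc c I)" unfolding ab image_mult_lat
  using ab c by (intro lat_fractional_ideal) auto
 have "sc c I \<odot> cnj ` sc c I = sc (c * cnj c) (I \<odot> cnj ` I)"
  unfolding cnj_sc ip_sc ip_sc_right sc_sc by fastforce
 also have "\<dots> = sc (of_real ((cmod c)\<^sup>2 * nrm I)) O'"
  unfolding nrm_props(2)[OF I] sc_sc of_real_mult complex_norm_square by simp
 finally have *: "sc c I \<odot> cnj ` sc c I = sc (of_real ((cmod c)\<^sup>2 * nrm I)) O'" .
 have pos: "(cmod c)\<^sup>2 * nrm I > 0" using nrm_props(1)[OF I] c by simp
 show "proper (sc c I)"
  by (rule proper_crit[OF fr _ *])
   (use pos proper_smult[OF I O_theta] in \<open>auto simp: mult.left_commute intro!: imageI\<close>)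
 show "nrm (sc c I) = (cmod c)\<^sup>2 * nrm I" by (rule nrm_eq[OF pos *])
qed

lemma proper_cnj:
 assumes I: "proper I" shows "proper (cnj ` I)" "nrm (cnj ` I) = nrm I"
proof -
 obtain a b where ab: "a \<in> K" "b \<in> K" "Im (a * cnj b) \<noteq> 0" "I = lat a b"
  using proper_lat[OF I] .
 have fr: "fractional_ideal d0 (cnj ` I)" unfolding ab cnj_lat
  using ab by (intro lat_fractional_ideal) auto
 have *: "cnj ` I \<odot> cnj ` cnj ` I = sc (of_real (nrm I)) O'" using nrm_props(2)[OF I] by (simp add: ip_comm)
 show "proper (cnj ` I)"
 proof (rule proper_crit[OF fr _ *])
  fix v assume "v \<in> cnj ` I"
  then obtain u where u: "u \<in> I" "v = cnj u" by auto
  have "cnj \<theta> * u \<in> I" using u O_cnj[OF O_theta] proper_smult[OF I] by simp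
  then have "cnj (cnj \<theta> * u) \<in> cnj ` I" by blast
  then show "\<theta> * v \<in> cnj ` I" by (simp add: u)
 qed (use nrm_props(1)[OF I] in auto)
 show "nrm (cnj ` I) = nrm I" by (rule nrm_eq[OF nrm_props(1)[OF I] *])
qed

text \<open>Multiplication by the conjugate of \<open>I\<close> turns \<open>I\<close> into the
  scalar \<open>nrm I\<close>.\<close>

lemma ip_cancel:
 assumes "proper I" "proper J" "proper J'" "I \<odot> J \<subseteq> I \<odot> J'" shows "J \<subseteq> J'"
proof -
 have e: "cnj ` I \<odot> (I \<odot> M) = sc (of_real (nrm I)) M" if "proper M" for M
 proof -
  have "cnj ` I \<odot> (I \<odot> M) = (I \<odot> cnj ` I) \<odot> M" by (metis ip_assoc ip_comm)
  then show ?thesis unfolding nrm_props(2)[OF assms(1)] ip_sc O_ip[OF that] .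
 qed
 have "sc (of_real (nrm I)) J \<subseteq> sc (of_real (nrm I)) J'"
  using ip_mono[OF order_refl assms(4), of "cnj ` I"] e assms by simp
 moreover have "of_real (nrm I) \<noteq> (0::complex)" using nrm_props(1)[OF assms(1)] by simp
 ultimately show ?thesis by fastforce
qed

end

text \<open>Representatives are \<open>i a + j b\<close> with \<open>0 \<le> i < e\<close> and
  \<open>0 \<le> j < g\<close>. The second coordinate has to be reduced first, because the second
  generator also changes the first coordinate.\<close>

lemma lattice_index_hermite:
 fixes e g x :: int
 assumes ab: "Im (a * cnj b) \<noteq> 0" and eg: "e > 0" "g > 0"
 shows "lattice_index (lat a b) (lat (of_int e * a) (of_int x * a + of_int g * b)) = nat (e * g)"
proof -
 let ?L = "lat a b" and ?M = "lat (of_int e * a) (of_int x * a + of_int g * b)"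
 define R where "R = {(u, v). u \<in> ?L \<and> v \<in> ?L \<and> u - v \<in> ?M}"
 define F where "F = (\<lambda>(i, j). R `` {of_int i * a + of_int j * b})"
 have eqR: "R `` {u} = R `` {v}" if "u \<in> ?L" "v \<in> ?L" "u - v \<in> ?M" for u v
 proof -
  have "u - z \<in> ?M \<longleftrightarrow> v - z \<in> ?M" for z
  proof -
   have "u - z = (u - v) + (v - z)" "v - z = (u - z) - (u - v)" by simp_all
   then show ?thesis using that(3) subspace_add[OF subspace_lat] subspace_diff[OF subspace_lat] by metis
  qed
  then show ?thesis using that by (auto simp: R_def)
 qed
 have "?L // R = F ` ({0..<e} \<times> {0..<g})"
 proof
  show "?L // R \<subseteq> F ` ({0..<e} \<times> {0..<g})"
  proof
   fix Z assume "Z \<in> ?L // R"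
   then obtain z where z: "z \<in> ?L" "Z = R `` {z}" by (auto simp: quotient_def)
   obtain p q where pq: "z = of_int p * a + of_int q * b" using z(1) by (rule latE)
   define k j where "k = q div g" and "j = q mod g"
   define h i where "h = (p - k * x) div e" and "i = (p - k * x) mod e"
   have "q = g * k + j" "p - k * x = e * h + i" by (simp_all add: k_def j_def h_def i_def)
   then have qp: "q = g * k + j" "p = e * h + i + k * x" by simp_all
   have "z - (of_int i * a + of_int j * b) = of_int h * (of_int e * a) + of_int k * (of_int x * a + of_int g * b)"
    unfolding pq qp by (simp add: algebra_simps)
   then have "z - (of_int i * a + of_int j * b) \<in> ?M" using latI by simp
   then have "Z = F (i, j)" unfolding z(2) F_def prod.case by (intro eqR z(1) latI)
   moreover have "(i, j) \<in> {0..<e} \<times> {0..<g}" using eg by (simp add: i_def j_def)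
   ultimately show "Z \<in> F ` ({0..<e} \<times> {0..<g})" by simp
  qed
  show "F ` ({0..<e} \<times> {0..<g}) \<subseteq> ?L // R" by (auto simp: F_def intro!: quotientI latI)
 qed
 moreover have "inj_on F ({0..<e} \<times> {0..<g})"
 proof (rule inj_onI)
  fix P Q assume PQ: "P \<in> {0..<e} \<times> {0..<g}" "Q \<in> {0..<e} \<times> {0..<g}" and F: "F P = F Q"
  obtain i j i' j' where ij: "P = (i, j)" "Q = (i', j')" by fastforce
  let ?u = "of_int i * a + of_int j * b" and ?v = "of_int i' * a + of_int j' * b"
  have "?v \<in> R `` {?v}" using subspace_zero[OF subspace_lat] by (auto simp: R_def latI)
  then have "?v \<in> R `` {?u}" using F by (simp add: F_def ij)
  then have "?u - ?v \<in> ?M" by (simp add: R_def)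
  then obtain h k where "?u - ?v = of_int h * (of_int e * a) + of_int k * (of_int x * a + of_int g * b)" by (rule latE)
  then have "of_int (i - i') * a + of_int (j - j') * b = of_int (h * e + k * x) * a + of_int (k * g) * b"
   by (simp add: algebra_simps)
  from lat_coord_unique[OF ab this] have hk: "i - i' = h * e + k * x" "j - j' = k * g" by auto
  have small: "z = 0" if "\<bar>z * m\<bar> < m" for z m :: int
  proof (rule ccontr)
   assume "z \<noteq> 0"
   then have "1 * \<bar>m\<bar> \<le> \<bar>z\<bar> * \<bar>m\<bar>" by (intro mult_right_mono) auto
   then show False using that unfolding abs_mult by simp
  qed
  have "\<bar>j - j'\<bar> < g" "\<bar>i - i'\<bar> < e" using PQ unfolding ij by auto
  then have "k = 0" unfolding hk(2) by (intro small)
  moreover from this have "i - i' = h * e" using hk(1) by simp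
  then have "h = 0" using \<open>\<bar>i - i'\<bar> < e\<close> small by simp
  ultimately show "P = Q" using hk by (simp add: ij)
 qed
 ultimately have "card (?L // R) = card ({0..<e} \<times> {0..<g})" by (simp add: card_image)
 also have "\<dots> = nat (e * g)" using eg by (simp add: card_cartesian_product nat_mult_distrib)
 finally show ?thesis by (simp add: lattice_index_def R_def)
qed

context quad
begin

abbreviation G where "G \<equiv> class_group d0 f"
abbreviation cl where "cl L \<equiv> similarity d0 f `` {L}"
abbreviation class_mult (infixl "\<cdot>" 70) where "X \<cdot> Y \<equiv> X \<otimes>\<^bsub>G\<^esub> Y"
abbreviation class_one ("1\<^sub>G") where "1\<^sub>G \<equiv> \<one>\<^bsub>G\<^esub>"

lemma sim_iff: "(I, J) \<in> similarity d0 f \<longleftrightarrow> proper I \<and> proper J \<and> (\<exists>c. c \<in> K \<and> c \<noteq> 0 \<and> J = sc c I)"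
 by (auto simp: similarity_def)

lemma equiv_sim: "equiv {L. proper L} (similarity d0 f)"
proof (rule equivI)
 show "similarity d0 f \<subseteq> {L. proper L} \<times> {L. proper L}" by (auto simp: sim_iff)
 show "refl_on {L. proper L} (similarity d0 f)"
  by (rule refl_onI) (auto simp: sim_iff intro: exI[of _ 1])
 show "sym (similarity d0 f)"
 proof (rule symI)
  fix I J assume "(I, J) \<in> similarity d0 f"
  then obtain c where c: "proper I" "proper J" "c \<in> K" "c \<noteq> 0" "J = sc c I" by (auto simp: sim_iff)
  then have "I = sc (inverse c) J" by (simp add: sc_sc)
  then show "(J, I) \<in> similarity d0 f" using c K_inverse by (auto simp: sim_iff intro!: exI[of _ "inverse c"])
 qed
 show "trans (similarity d0 f)"
 proof (rule transI)
  fix I J M assume "(I, J) \<in> similarity d0 f" "(J, M) \<in> similarity d0 f"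
  then obtain c d where c: "proper I" "proper M" "c \<in> K" "c \<noteq> 0" "J = sc c I" "d \<in> K" "d \<noteq> 0" "M = sc d J"
   by (auto simp: sim_iff)
  then have "M = sc (d * c) I" by fastforce
  then show "(I, M) \<in> similarity d0 f" using c by (auto simp: sim_iff intro!: exI[of _ "d * c"])
 qed
qed

lemma cl_eq_iff: "proper I ==> proper J ==> cl I = cl J \<longleftrightarrow> (\<exists>c. c \<in> K \<and> c \<noteq> 0 \<and> J = sc c I)"
 using eq_equiv_class_iff[OF equiv_sim, of I J] by (auto simp: sim_iff)

lemma cl_sc: "proper I ==> c \<in> K ==> c \<noteq> 0 ==> cl (sc c I) = cl I"
 using cl_eq_iff[of I "sc c I"] proper_sc by blast

lemma mem_cl: "J \<in> cl I \<longleftrightarrow> proper I \<and> proper J \<and> cl J = cl I"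
proof
 assume "J \<in> cl I"
 then have s: "(I, J) \<in> similarity d0 f" by simp
 then have p: "proper I" "proper J" by (auto simp: sim_iff)
 have "cl I = cl J" using equiv_class_eq[OF equiv_sim s] .
 with p show "proper I \<and> proper J \<and> cl J = cl I" by simp
next
 assume "proper I \<and> proper J \<and> cl J = cl I"
 then show "J \<in> cl I" using eq_equiv_class[OF _ equiv_sim, of I J] by auto
qed

lemma carrier_G: "X \<in> carrier G \<longleftrightarrow> (\<exists>L. proper L \<and> X = cl L)"
 by (auto simp: class_group_def quotient_def)

lemma cl_carrier [simp]: "proper L ==> cl L \<in> carrier G"
 by (auto simp: carrier_G)

lemma carrier_memD: "X \<in> carrier G ==> L \<in> X ==> proper L \<and> X = cl L"
 unfolding carrier_G using mem_cl by metis

lemma carrier_nonempty: "X \<in> carrier G ==> \<exists>L. L \<in> X"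
 unfolding carrier_G using mem_cl by metis

text \<open>The union over representatives in the definition of the group operation collapses, since
  all products of representatives are similar.\<close>

lemma cl_mult: assumes "proper I" "proper J" shows "cl I \<cdot> cl J = cl (I \<odot> J)"
proof -
 have eq: "cl (I' \<odot> J') = cl (I \<odot> J)" if "I' \<in> cl I" "J' \<in> cl J" for I' J'
 proof -
  have "(I, I') \<in> similarity d0 f" "(J, J') \<in> similarity d0 f" using that by auto
  then obtain c d where cd: "c \<in> K" "c \<noteq> 0" "I' = sc c I" "d \<in> K" "d \<noteq> 0" "J' = sc d J"
   unfolding sim_iff by blast
  then have "I' \<odot> J' = sc (c * d) (I \<odot> J)" by (simp only: ip_sc ip_sc_right sc_sc mult.commute[of d c])
  then show ?thesis using cl_sc[of "I \<odot> J" "c * d"] proper_ip(1)[OF assms] cd by auto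
 qed
 have "I \<in> cl I" "J \<in> cl J" using assms mem_cl by auto
 then have "(\<Union>I'\<in>cl I. \<Union>J'\<in>cl J. cl (I' \<odot> J')) = cl (I \<odot> J)"
 proof (intro equalityI subsetI)
  fix z assume "z \<in> (\<Union>I'\<in>cl I. \<Union>J'\<in>cl J. cl (I' \<odot> J'))"
  then obtain I' J' where "I' \<in> cl I" "J' \<in> cl J" "z \<in> cl (I' \<odot> J')" by blast
  then show "z \<in> cl (I \<odot> J)" using eq by simp
 next
  fix z assume "z \<in> cl (I \<odot> J)"
  then show "z \<in> (\<Union>I'\<in>cl I. \<Union>J'\<in>cl J. cl (I' \<odot> J'))"
   using \<open>I \<in> cl I\<close> \<open>J \<in> cl J\<close> by blast
 qed
 then show ?thesis by (simp add: class_group_def)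
qed

lemma one_G: "1\<^sub>G = cl O'" by (simp add: class_group_def)

lemma cl_cnj_mult: assumes "proper I" shows "cl I \<cdot> cl (cnj ` I) = cl O'"
 using cl_mult[OF assms proper_cnj(1)[OF assms]] nrm_props[OF assms] cl_sc[OF proper_O(1)] by simp

lemma comm_group_G: "comm_group G"
proof (rule comm_groupI)
 fix X Y assume "X \<in> carrier G" "Y \<in> carrier G"
 then obtain I J where IJ: "proper I" "X = cl I" "proper J" "Y = cl J" by (auto simp: carrier_G)
 then show "X \<cdot> Y \<in> carrier G" by (simp add: cl_mult proper_ip)
 show "X \<cdot> Y = Y \<cdot> X" using IJ by (simp add: cl_mult ip_comm)
 fix Z assume "Z \<in> carrier G"
 then obtain M where "proper M" "Z = cl M" by (auto simp: carrier_G)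
 then show "X \<cdot> Y \<cdot> Z = X \<cdot> (Y \<cdot> Z)" using IJ by (simp add: cl_mult proper_ip ip_assoc)
next
 show "1\<^sub>G \<in> carrier G" by (simp add: one_G proper_O)
next
 fix X assume "X \<in> carrier G"
 then obtain I where I: "proper I" "X = cl I" by (auto simp: carrier_G)
 then show "1\<^sub>G \<cdot> X = X" by (simp add: one_G cl_mult proper_O O_ip)
 have "cl (cnj ` I) \<cdot> X = 1\<^sub>G"
  using cl_cnj_mult[OF I(1)] I proper_cnj by (simp add: cl_mult one_G ip_comm)
 then show "\<exists>Y\<in>carrier G. Y \<cdot> X = 1\<^sub>G" using I proper_cnj by auto
qed

sublocale G: comm_group "class_group d0 f" by (rule comm_group_G)

lemma inv_cl: assumes "proper I" shows "inv\<^bsub>G\<^esub> (cl I) = cl (cnj ` I)"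
 using G.inv_equality[of "cl (cnj ` I)" "cl I"] assms proper_cnj cl_cnj_mult G.m_comm[of "cl I" "cl (cnj ` I)"]
 by (simp add: one_G)

text \<open>Links the algebraic norm with geometry: \<open>Im rD / 2\<close> is the covolume of the
  order itself.\<close>

lemma covol:
 assumes "proper (lat a b)" "a \<in> K" "b \<in> K" "Im (a * cnj b) \<noteq> 0"
 shows "\<bar>Im (a * cnj b)\<bar> = nrm (lat a b) * (Im rD / 2)"
proof -
 obtain m where "m > 0" "\<bar>Im (a * cnj b)\<bar> = m * (Im rD / 2)" "lat a b \<odot> cnj ` lat a b = sc (of_real m) O'"
  by (rule proper_form[OF assms])
 then show ?thesis using nrm_eq by simp
qed

lemma proper_sub_hermite:
 assumes I: "proper I" "I = lat a b" "a \<in> K" "b \<in> K" "Im (a * cnj b) \<noteq> 0" and J: "proper J" "J \<subseteq> I"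
 obtains e g x :: int where "e > 0" "g > 0" "J = lat (of_int e * a) (of_int x * a + of_int g * b)"
  "nrm J = of_int (e * g) * nrm I" "lattice_index I J = nat (e * g)"
proof -
 obtain c d where cd: "c \<in> K" "d \<in> K" "Im (c * cnj d) \<noteq> 0" "J = lat c d" using proper_lat[OF J(1)] .
 obtain e g x where eg: "e > 0" "g > 0" and Jeq: "J = lat (of_int e * a) (of_int x * a + of_int g * b)"
  by (rule sublattice_hermite[OF I(5) proper_subspace[OF J(1)] J(2)[unfolded I(2)], of c d]) (use cd in auto)
 let ?a = "of_int e * a" and ?b = "of_int x * a + of_int g * b"
 have Im: "Im (?a * cnj ?b) = of_int (e * g) * Im (a * cnj b)"
  using Im_mult_cnj_comb[of e a 0 b x g] by simp
 have "\<bar>Im (?a * cnj ?b)\<bar> = nrm J * (Im rD / 2)" unfolding Jeq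
 proof (rule covol)
  show "proper (lat ?a ?b)" using J(1) Jeq by simp
  show "Im (?a * cnj ?b) \<noteq> 0" unfolding Im using eg I(5) by simp
 qed (use I in \<open>auto intro!: K_add K_mult\<close>)
 moreover have "\<bar>Im (?a * cnj ?b)\<bar> = of_int (e * g) * (nrm I * (Im rD / 2))"
  unfolding Im abs_mult using covol[of a b] I eg by simp
 ultimately have "nrm J = of_int (e * g) * nrm I" using Im_rD_pos by simp
 then show thesis using that[OF eg Jeq] lattice_index_hermite[OF I(5) eg] I(2) Jeq by simp
qed

lemma index_proper:
 assumes "proper I" "proper J" "J \<subseteq> I"
 shows "nrm J = real (lattice_index I J) * nrm I" "lattice_index I J > 0"
  "lattice_index I J = 1 ==> J = I"
proof -
 obtain a b where ab: "a \<in> K" "b \<in> K" "Im (a * cnj b) \<noteq> 0" "I = lat a b" using proper_lat[OF assms(1)] .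
 obtain e g x where h: "e > 0" "g > 0" "J = lat (of_int e * a) (of_int x * a + of_int g * b)"
  "nrm J = of_int (e * g) * nrm I" "lattice_index I J = nat (e * g)"
  by (rule proper_sub_hermite[OF assms(1) ab(4,1-3) assms(2,3)])
 show "nrm J = real (lattice_index I J) * nrm I" using h by simp
 show "lattice_index I J > 0" using h by simp
 show "J = I" if "lattice_index I J = 1"
 proof -
  have "e * g = 1" using that h by simp
  then have "e = 1" "g = 1" using h(1,2) by (auto simp: zmult_eq_1_iff)
  then have J: "J = lat a (of_int x * a + b)" using h(3) by simp
  have "b = of_int (- x) * a + of_int 1 * (of_int x * a + b)" by simp
  then have "b \<in> J" unfolding J using latI by metis
  then have "I \<subseteq> J" unfolding ab J by (intro lat_subset subspace_lat) auto
  then show ?thesis using assms(3) by simp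
 qed
qed

definition integral :: "complex set => bool" where "integral I \<longleftrightarrow> proper I \<and> I \<subseteq> O'"

text \<open>The norm as a natural number, meant for integral ideals. There \<open>nrm\<close> is the
  index in the order, so the floor loses nothing.\<close>

definition nn :: "complex set => nat" where "nn I = nat \<lfloor>nrm I\<rfloor>"

lemma integral_nn:
 assumes "integral I"
 shows "nrm I = real (nn I)" "nn I > 0" "lattice_index O' I = nn I" "nn I = 1 ==> I = O'"
proof -
 have I: "proper I" "I \<subseteq> O'" using assms by (auto simp: integral_def)
 have n: "nrm I = real (lattice_index O' I)" using index_proper(1)[OF proper_O(1) I] by (simp add: proper_O)
 then have nn: "nn I = lattice_index O' I" by (simp add: nn_def)
 show "nrm I = real (nn I)" "nn I > 0" "lattice_index O' I = nn I" "nn I = 1 ==> I = O'"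
  using n nn index_proper(2,3)[OF proper_O(1) I] by auto
qed

lemma integral_proper [simp]: "integral I ==> proper I" by (simp add: integral_def)

lemma integral_O: "integral O'" "nn O' = 1"
 by (auto simp: integral_def proper_O nn_def)

lemma integral_ip:
 assumes "integral I" "integral J" shows "integral (I \<odot> J)" "nn (I \<odot> J) = nn I * nn J"
proof -
 have "I \<odot> J \<subseteq> O' \<odot> O'" using assms by (intro ip_mono) (auto simp: integral_def)
 then show *: "integral (I \<odot> J)" using assms by (simp add: integral_def proper_ip O_ip_O)
 have "real (nn (I \<odot> J)) = real (nn I * nn J)"
  using integral_nn(1)[OF *] integral_nn(1)[OF assms(1)] integral_nn(1)[OF assms(2)] assms by (simp add: proper_ip)
 then show "nn (I \<odot> J) = nn I * nn J" by (simp only: of_nat_eq_iff)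
qed

lemma integral_cnj: "integral I ==> integral (cnj ` I)" "integral I ==> nn (cnj ` I) = nn I"
 using proper_cnj O_cnj by (auto simp: integral_def nn_def)

lemma integral_sc:
 assumes "integral I" "c \<in> O'" "c \<noteq> 0"
 shows "integral (sc c I)" "real (nn (sc c I)) = (cmod c)\<^sup>2 * real (nn I)"
proof -
 have 1: "proper (sc c I)" "nrm (sc c I) = (cmod c)\<^sup>2 * nrm I" using proper_sc[of I c] assms O_K by auto
 moreover have "sc c I \<subseteq> O'" using assms O_mult by (auto simp: integral_def)
 ultimately show 2: "integral (sc c I)" by (simp add: integral_def)
 show "real (nn (sc c I)) = (cmod c)\<^sup>2 * real (nn I)"
  using 1(2) integral_nn(1)[OF 2] integral_nn(1)[OF assms(1)] by simp
qed

lemma ip_subset_right: assumes "integral I" "proper J" shows "I \<odot> J \<subseteq> J"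
 using ip_mono[of I O' J J] O_ip assms by (auto simp: integral_def)

lemma ip_subset_left: assumes "integral I" "proper J" shows "J \<odot> I \<subseteq> J"
 using ip_subset_right[OF assms] by (simp add: ip_comm)

lemma cnj_ip_nn: assumes "integral I" shows "I \<odot> cnj ` I = sc (of_nat (nn I)) O'"
 using nrm_props(2)[of I] integral_nn(1)[OF assms] assms by simp

lemma nn_mem: assumes "integral I" shows "of_nat (nn I) \<in> I"
proof -
 have "of_nat (nn I) \<in> sc (of_nat (nn I)) O'" by fastforce
 then have "of_nat (nn I) \<in> I \<odot> cnj ` I" using cnj_ip_nn[OF assms] by simp
 then show ?thesis using ip_subset_left[OF integral_cnj(1)[OF assms], of I] assms by auto
qed

text \<open>To contain is to divide: the quotient is the conjugate of \<open>P\<close> times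
  \<open>I\<close>, divided by \<open>nrm P\<close>. It is integral because
  \<open>I \<subseteq> P\<close> and the product of \<open>P\<close> with its conjugate is
  \<open>nrm P\<close> times the order.\<close>

lemma integral_divide:
 assumes I: "proper I" and P: "proper P" and "I \<subseteq> P"
 obtains J where "integral J" "I = P \<odot> J"
proof -
 define c where "c = inverse (complex_of_real (nrm P))"
 have nP: "nrm P > 0" using nrm_props P by simp
 have c: "c \<in> K" "c \<noteq> 0" using nrm_props[OF P] K_inverse by (auto simp: c_def)
 have cP: "sc c (P \<odot> cnj ` P) = O'" unfolding nrm_props(2)[OF P] sc_sc c_def using nP by simp
 define J where "J = sc c (cnj ` P \<odot> I)"
 have pJ: "proper J" unfolding J_def using I P c by (intro proper_sc proper_ip proper_cnj)
 have "J \<subseteq> sc c (cnj ` P \<odot> P)" unfolding J_def using assms(3) by (intro image_mono ip_mono) auto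
 then have "J \<subseteq> O'" using cP by (simp only: ip_comm)
 moreover have "P \<odot> J = sc c (P \<odot> cnj ` P) \<odot> I" unfolding J_def ip_sc ip_sc_right ip_assoc ..
 then have "P \<odot> J = I" unfolding cP using O_ip[OF I] by simp
 ultimately show thesis using that[of J] pJ by (simp add: integral_def)
qed

lemma integral_hermite:
 assumes "integral I"
 obtains e g x :: int where "e > 0" "g > 0" "I = lat (of_int e) (of_int x + of_int g * \<theta>)" "int (nn I) = e * g"
proof -
 have O: "Im (1 * cnj \<theta>) \<noteq> 0" using Im_rD_pos by (simp add: Im_theta)
 obtain e g x where h: "e > 0" "g > 0" "I = lat (of_int e * 1) (of_int x * 1 + of_int g * \<theta>)"
  "nrm I = of_int (e * g) * nrm O'"
  by (rule proper_sub_hermite[OF proper_O(1) O_eq_lat _ _ O, of I]) (use assms in \<open>auto simp: integral_def\<close>)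
 have "real_of_int (int (nn I)) = of_int (e * g)" using h(4) integral_nn(1)[OF assms] by (simp add: proper_O)
 then have "int (nn I) = e * g" by (simp only: of_int_eq_iff)
 with h show thesis using that[of e g x] by simp
qed

text \<open>One factor of the prime \<open>e * g\<close> is 1. As \<open>e = 1\<close> would put 1
  into \<open>I\<close>, it is \<open>g\<close>.\<close>

lemma prime_norm_hermite:
 assumes I: "integral I" and p: "prime (nn I)"
 obtains n x :: int where "n = int (nn I)" "I = lat (of_int n) (of_int x + \<theta>)"
proof -
 obtain e g x where h: "e > 0" "g > 0" "I = lat (of_int e) (of_int x + of_int g * \<theta>)" "int (nn I) = e * g"
  using integral_hermite[OF I] .
 have "nn I = nat e * nat g" using h by (simp flip: nat_mult_distrib)
 then have "nat e = 1 \<or> nat g = 1" using p prime_product by simp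
 then have "e = 1 \<or> g = 1" by linarith
 moreover have False if "e = 1"
 proof -
  have "1 \<in> I" using h(3) that lat_mem1[of 1] by simp
  then have "I = O'" using I proper_smult[of I _ 1] by (auto simp: integral_def)
  then show False using p integral_O by simp
 qed
 ultimately have "g = 1" by blast
 then show thesis using that[of e x] h by simp
qed

lemma prime_norm_int_repr:
 assumes I: "integral I" and p: "prime (nn I)" and z: "z \<in> O'"
 obtains k :: int where "z - of_int k \<in> I"
proof -
 obtain n x where n: "n = int (nn I)" and x: "I = lat (of_int n) (of_int x + \<theta>)" using prime_norm_hermite[OF I p] .
 obtain u v where "z = of_int u * 1 + of_int v * \<theta>" using z unfolding O_eq_lat by (rule latE)
 then have "z - of_int (u - v * x) = of_int 0 * of_int n + of_int v * (of_int x + \<theta>)"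
  by (simp add: algebra_simps)
 then have "z - of_int (u - v * x) \<in> I" unfolding x using latI by metis
 then show thesis by (rule that)
qed

lemma prime_norm_int_mem:
 assumes I: "integral I" and p: "prime (nn I)"
 shows "of_int k \<in> I \<longleftrightarrow> int (nn I) dvd k"
proof
 obtain n x where n: "n = int (nn I)" and x: "I = lat (of_int n) (of_int x + \<theta>)" using prime_norm_hermite[OF I p] .
 assume "of_int k \<in> I"
 then obtain u v where "of_int k = of_int u * of_int n + of_int v * (of_int x + \<theta>)" unfolding x by (rule latE)
 then have "of_int k * 1 + of_int 0 * \<theta> = of_int (u * n + v * x) * 1 + of_int v * \<theta>"
  by (simp add: algebra_simps)
 from lat_coord_unique[OF _ this] have "k = u * n + v * x" "0 = v"
  using Im_rD_pos by (auto simp: Im_theta)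
 then show "int (nn I) dvd k" by (simp flip: n)
next
 assume "int (nn I) dvd k"
 then obtain j where "k = int (nn I) * j" by blast
 then have "of_int k = (of_int j * of_nat (nn I) :: complex)" by simp
 then show "of_int k \<in> I"
  using subspace_of_int_mult[OF proper_subspace[of I] nn_mem[OF I]] I by simp
qed

text \<open>Modulo \<open>I\<close> every element of the order is congruent to a rational integer,
  and the integers in \<open>I\<close> are the multiples of the prime \<open>nn I\<close>; so the
  question is reduced to divisibility of integers.\<close>

lemma prime_norm_prime:
 assumes I: "integral I" and p: "prime (nn I)" and ab: "a \<in> O'" "b \<in> O'" "a * b \<in> I"
 shows "a \<in> I \<or> b \<in> I"
proof -
 have s: "int_complex.subspace I" using I proper_subspace by simp
 obtain k where k: "a - of_int k \<in> I" using prime_norm_int_repr[OF I p ab(1)] .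
 obtain j where j: "b - of_int j \<in> I" using prime_norm_int_repr[OF I p ab(2)] .
 have "b * (a - of_int k) \<in> I" "of_int k * (b - of_int j) \<in> I"
  using proper_smult[of I] I ab k j by auto
 moreover have "of_int (k * j) = a * b - b * (a - of_int k) - of_int k * (b - of_int j)" by (simp add: algebra_simps)
 ultimately have "of_int (k * j) \<in> I" using ab(3) subspace_diff[OF s] by simp
 then have "int (nn I) dvd k * j" using prime_norm_int_mem[OF I p] by blast
 then have "int (nn I) dvd k \<or> int (nn I) dvd j" using p by (metis prime_dvd_mult_iff prime_nat_int_transfer)
 then have "of_int k \<in> I \<or> of_int j \<in> I" using prime_norm_int_mem[OF I p] by simp
 moreover have "a = (a - of_int k) + of_int k" "b = (b - of_int j) + of_int j" by simp_all
 ultimately show ?thesis using k j subspace_add[OF s] by metis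
qed

lemma cring_order: "cring (order_ring d0 f)"
proof (rule cringI)
 show "abelian_group (order_ring d0 f)"
 proof (rule abelian_groupI)
  fix x assume "x \<in> carrier (order_ring d0 f)"
  then show "\<exists>y\<in>carrier (order_ring d0 f). y \<oplus>\<^bsub>order_ring d0 f\<^esub> x = \<zero>\<^bsub>order_ring d0 f\<^esub>"
   using subspace_uminus[OF O_subspace] by (auto simp: order_ring_def intro!: bexI[of _ "- x"])
 qed (auto simp: order_ring_def O_add subspace_zero)
 show "Group.comm_monoid (order_ring d0 f)"
  by (rule comm_monoidI) (auto simp: order_ring_def O_mult mult.assoc mult.commute)
qed (auto simp: order_ring_def algebra_simps)

lemma primeideal_prime_norm:
 assumes I: "integral I" and p: "prime (nn I)"
 shows "primeideal I (order_ring d0 f)"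
proof -
 interpret cring "order_ring d0 f" by (rule cring_order)
 have s: "int_complex.subspace I" using I proper_subspace by simp
 have c: "carrier (order_ring d0 f) = O'" by (simp add: order_ring_def)
 have id: "ideal I (order_ring d0 f)"
 proof (rule idealI)
  show "subgroup I (add_monoid (order_ring d0 f))"
  proof (rule add.subgroupI)
   show "I \<subseteq> carrier (order_ring d0 f)" using I by (simp add: c integral_def)
   show "I \<noteq> {}" using subspace_zero[OF s] by blast
   fix x assume x: "x \<in> I"
   then have xO: "x \<in> carrier (order_ring d0 f)" using I by (auto simp: c integral_def)
   have "\<ominus>\<^bsub>order_ring d0 f\<^esub> x = - x"
    using subspace_uminus[OF O_subspace] xO by (intro minus_equality) (simp_all add: order_ring_def)
   then show "\<ominus>\<^bsub>order_ring d0 f\<^esub> x \<in> I" using subspace_uminus[OF s x] by simp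
   fix y assume "y \<in> I"
   then show "x \<oplus>\<^bsub>order_ring d0 f\<^esub> y \<in> I" using subspace_add[OF s x] by (simp add: order_ring_def)
  qed
 next
  fix a x assume "a \<in> I" "x \<in> carrier (order_ring d0 f)"
  then show "x \<otimes>\<^bsub>order_ring d0 f\<^esub> a \<in> I" "a \<otimes>\<^bsub>order_ring d0 f\<^esub> x \<in> I"
   using proper_smult[of I x a] I by (auto simp: order_ring_def mult.commute)
 qed (rule ring_axioms)
 show ?thesis
 proof (rule primeidealI[OF id cring_order])
  show "carrier (order_ring d0 f) \<noteq> I"
  proof
   assume "carrier (order_ring d0 f) = I"
   then have "nn I = 1" using integral_O by (simp add: c)
   then show False using p by simp
  qed
  fix a b assume "a \<in> carrier (order_ring d0 f)" "b \<in> carrier (order_ring d0 f)" "a \<otimes>\<^bsub>order_ring d0 f\<^esub> b \<in> I"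
  then show "a \<in> I \<or> b \<in> I" using prime_norm_prime[OF I p] by (simp add: order_ring_def)
 qed
qed

text \<open>An ideal of prime index is automatically a prime ideal, so the condition on
  \<open>l\<close> becomes one on norm and class only.\<close>

lemma prime_ideal_in_class_iff:
 assumes "prime l"
 shows "prime_ideal_in_class d0 f X l \<longleftrightarrow> (\<exists>P. integral P \<and> nn P = l \<and> P \<in> X)"
proof
 assume "prime_ideal_in_class d0 f X l"
 then obtain P where P: "primeideal P (order_ring d0 f)" "proper P" "lattice_index O' P = l" "P \<in> X"
  by (auto simp: prime_ideal_in_class_def)
 have "ideal P (order_ring d0 f)" using P(1) primeideal.axioms(1) by blast
 then have "P \<subseteq> carrier (order_ring d0 f)"
  using additive_subgroup.a_subset ideal.axioms(1) by blast
 then have "integral P" using P(2) by (simp add: integral_def order_ring_def)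
 then show "\<exists>P. integral P \<and> nn P = l \<and> P \<in> X" using P integral_nn(3) by metis
next
 assume "\<exists>P. integral P \<and> nn P = l \<and> P \<in> X"
 then show "prime_ideal_in_class d0 f X l"
  using primeideal_prime_norm integral_nn(3) assms unfolding prime_ideal_in_class_def
  by (metis integral_proper)
qed

end

section \<open>Characters of finite abelian groups\<close>

definition is_char_on :: "('a, 'b) monoid_scheme => 'a set => ('a => complex) => bool" where
 "is_char_on G H \<xi> \<longleftrightarrow> \<xi> \<one>\<^bsub>G\<^esub> = 1 \<and> (\<forall>x\<in>H. \<forall>y\<in>H. \<xi> (x \<otimes>\<^bsub>G\<^esub> y) = \<xi> x * \<xi> y)"

text \<open>Vanishing off the carrier makes a character, as a function, determined by its values on
  the group; thus \<open>chars G\<close> is a finite set over which one can sum.\<close>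

definition chars :: "('a, 'b) monoid_scheme => ('a => complex) set" where
 "chars G = {\<xi>. is_char_on G (carrier G) \<xi> \<and> (\<forall>x. x \<notin> carrier G --> \<xi> x = 0)}"

lemma complex_root_exists: assumes "m > (0::nat)" obtains z :: complex where "z ^ m = c"
proof (cases "c = 0")
 case True
 then show thesis using that[of 0] assms by simp
next
 case False
 have "exp (Ln c / of_nat m) ^ m = exp (of_nat m * (Ln c / of_nat m))" by (rule exp_of_nat_mult[symmetric])
 also have "\<dots> = c" using assms False by simp
 finally show thesis by (rule that)
qed

context comm_group
begin

lemma subgroup_pow_closed: "subgroup H G ==> x \<in> H ==> x [^] (n::nat) \<in> H"
 by (induction n) (auto intro: subgroup.one_closed subgroup.m_closed)

lemma is_char_on_pow:
 assumes "is_char_on G H \<xi>" "subgroup H G" "x \<in> H" shows "\<xi> (x [^] (n::nat)) = \<xi> x ^ n"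
proof (induction n)
 case 0
 then show ?case using assms by (simp add: is_char_on_def)
next
 case (Suc n)
 have "x [^] n \<in> H" using assms(2,3) by (rule subgroup_pow_closed)
 then show ?case using assms Suc by (simp add: is_char_on_def)
qed

lemma finite_subgroupI:
 assumes "finite (carrier G)" "H \<subseteq> carrier G" "H \<noteq> {}" and m: "\<And>x y. x \<in> H ==> y \<in> H ==> x \<otimes> y \<in> H"
 shows "subgroup H G"
proof (rule subgroupI[OF assms(2,3) _ m])
 fix a assume a: "a \<in> H"
 have aG: "a \<in> carrier G" using a assms(2) by blast
 have pw: "a [^] Suc n \<in> H" for n :: nat by (induction n) (use a aG m in auto)
 have n: "Coset.order G > 0" using assms(1) order_gt_0_iff_finite by simp
 have "a \<otimes> a [^] (Coset.order G - 1) = a [^] Coset.order G"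
  using nat_pow_mult[OF aG, of 1 "Coset.order G - 1"] n aG by simp
 then have "inv a = a [^] (Coset.order G - 1)"
  using pow_order_eq_1[OF aG] aG by (metis inv_unique' m_comm nat_pow_closed)
 moreover have "a [^] (Coset.order G - 1) \<in> H"
 proof (cases "Coset.order G - 1")
  case 0
  then have "a [^] (1::nat) = \<one>" using pow_order_eq_1[OF aG] n by (metis Suc_diff_1 One_nat_def)
  then show ?thesis using 0 a aG by simp
 next
  case (Suc k)
  then show ?thesis using pw[of k] by simp
 qed
 ultimately show "inv a \<in> H" by simp
qed

text \<open>Adjoining \<open>a\<close> to \<open>H\<close>: the extension sends
  \<open>h \<otimes> a [^] k\<close> to \<open>\<xi> h * \<zeta> ^ k\<close>. It is well defined
  because \<open>a [^] k\<close> lies in \<open>H\<close> only if \<open>m\<close> divides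
  \<open>k\<close>, and on these powers the choice of \<open>\<zeta>\<close> as an
  \<open>m\<close>-th root agrees with \<open>\<xi>\<close>.\<close>

lemma char_extend:
 assumes fin: "finite (carrier G)" and H: "subgroup H G" and \<xi>: "is_char_on G H \<xi>"
  and a: "a \<in> carrier G" and m: "m > 0" "a [^] (m::nat) \<in> H" and least: "\<And>j. 0 < j ==> j < m ==> a [^] (j::nat) \<notin> H"
  and \<zeta>: "\<zeta> ^ m = \<xi> (a [^] m)"
 obtains H' \<xi>' where "subgroup H' G" "H \<subseteq> H'" "a \<in> H'" "is_char_on G H' \<xi>'" "\<And>h. h \<in> H ==> \<xi>' h = \<xi> h" "\<xi>' a = \<zeta>"
proof -
 have HG: "h \<in> H ==> h \<in> carrier G" for h using H subgroup.mem_carrier by metis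
 have dvd: "m dvd j" if "a [^] j \<in> H" for j :: nat
 proof (rule ccontr)
  assume "\<not> m dvd j"
  then have r: "0 < j mod m" "j mod m < m" using m(1) by (auto simp: mod_greater_zero_iff_not_dvd)
  have "a [^] j = a [^] (m * (j div m)) \<otimes> a [^] (j mod m)" using a by (simp add: nat_pow_mult)
  also have "a [^] (m * (j div m)) = (a [^] m) [^] (j div m)" using a by (simp add: nat_pow_pow)
  finally have j: "a [^] j = (a [^] m) [^] (j div m) \<otimes> a [^] (j mod m)" .
  have p: "(a [^] m) [^] (j div m) \<in> H" using H m(2) by (rule subgroup_pow_closed)
  have "inv ((a [^] m) [^] (j div m)) \<otimes> a [^] j \<in> H"
   using p that H by (simp add: subgroup.m_closed subgroup.m_inv_closed)
  then have "a [^] (j mod m) \<in> H" unfolding j using a HG[OF p] by (simp add: m_assoc[symmetric])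
  then show False using least r by simp
 qed
 have wd1: "\<xi> h * \<zeta> ^ k = \<xi> h' * \<zeta> ^ k'"
  if "h \<in> H" "h' \<in> H" "h \<otimes> a [^] k = h' \<otimes> a [^] k'" "k \<le> k'" for h h' and k k' :: nat
 proof -
  have "h \<otimes> a [^] k = (h' \<otimes> a [^] (k' - k)) \<otimes> a [^] k"
   using that a HG by (simp add: m_assoc nat_pow_mult)
  then have h: "h = h' \<otimes> a [^] (k' - k)" using that a HG by simp
  then have "inv h' \<otimes> h = a [^] (k' - k)" using that a HG by (simp add: m_assoc[symmetric])
  moreover have "inv h' \<otimes> h \<in> H" using that H by (simp add: subgroup.m_closed subgroup.m_inv_closed)
  ultimately have "m dvd k' - k" using dvd by simp
  then obtain q where q: "k' - k = m * q" by blast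
  have "a [^] (k' - k) = (a [^] m) [^] q" using a by (simp add: q nat_pow_pow)
  then have "\<xi> h = \<xi> h' * \<xi> ((a [^] m) [^] q)"
   unfolding h using that(2) \<xi> subgroup_pow_closed[OF H m(2), of q] by (simp add: is_char_on_def)
  also have "\<xi> ((a [^] m) [^] q) = \<zeta> ^ (k' - k)"
   unfolding q power_mult \<zeta> by (rule is_char_on_pow[OF \<xi> H m(2)])
  finally show ?thesis using that(4) by (simp add: power_add[symmetric])
 qed
 have wd: "\<xi> h * \<zeta> ^ k = \<xi> h' * \<zeta> ^ k'"
  if "h \<in> H" "h' \<in> H" "h \<otimes> a [^] k = h' \<otimes> a [^] k'" for h h' and k k' :: nat
  using wd1[of h h' k k'] wd1[of h' h k' k] that by (cases "k \<le> k'") auto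
 define H' where "H' = {h \<otimes> a [^] k | h (k::nat). h \<in> H}"
 \<comment> \<open>The choice picks one of many representations of \<open>x\<close>; by
   \<open>wd\<close> the value does not depend on it.\<close>
 define \<xi>' where "\<xi>' = (\<lambda>x. let (h, k) = (SOME (h, k::nat). h \<in> H \<and> x = h \<otimes> a [^] k) in \<xi> h * \<zeta> ^ k)"
 have val: "\<xi>' (h \<otimes> a [^] k) = \<xi> h * \<zeta> ^ k" if "h \<in> H" for h and k :: nat
 proof -
  define P where "P = (\<lambda>p::'a \<times> nat. case p of (h', k') => h' \<in> H \<and> h \<otimes> a [^] k = h' \<otimes> a [^] k')"
  obtain h' k' where s: "(SOME p. P p) = (h', k')" by fastforce
  have "P (h, k)" using that by (simp add: P_def)
  then have "P (SOME p. P p)" by (rule someI)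
  then have "h' \<in> H" "h \<otimes> a [^] k = h' \<otimes> a [^] k'" unfolding s by (simp_all add: P_def)
  then have "\<xi> h * \<zeta> ^ k = \<xi> h' * \<zeta> ^ k'" using wd that by blast
  moreover have "\<xi>' (h \<otimes> a [^] k) = \<xi> h' * \<zeta> ^ k'" using s unfolding \<xi>'_def P_def by simp
  ultimately show ?thesis by simp
 qed
 have one: "\<one> \<in> H" using H by (rule subgroup.one_closed)
 have HH': "H \<subseteq> H'"
 proof
  fix h assume "h \<in> H"
  moreover from this have "h = h \<otimes> a [^] (0::nat)" using HG by simp
  ultimately show "h \<in> H'" unfolding H'_def by blast
 qed
 have aH': "a \<in> H'"
 proof -
  have "a = \<one> \<otimes> a [^] (1::nat)" using a by simp
  then show ?thesis unfolding H'_def using one by blast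
 qed
 have mult: "(h \<otimes> a [^] k) \<otimes> (h' \<otimes> a [^] k') = (h \<otimes> h') \<otimes> a [^] (k + k')"
  if "h \<in> H" "h' \<in> H" for h h' and k k' :: nat
  using that HG a by (simp add: nat_pow_mult[symmetric] m_ac)
 have sub: "subgroup H' G"
 proof (rule finite_subgroupI[OF fin])
  show "H' \<subseteq> carrier G" "H' \<noteq> {}" using HG a aH' by (auto simp: H'_def)
  fix x y assume "x \<in> H'" "y \<in> H'"
  then obtain h k h' k' where "h \<in> H" "h' \<in> H" "x = h \<otimes> a [^] (k::nat)" "y = h' \<otimes> a [^] (k'::nat)" by (auto simp: H'_def)
  then show "x \<otimes> y \<in> H'" using mult[of h h' k k'] H subgroup.m_closed unfolding H'_def by fastforce
 qed
 have ext: "\<xi>' h = \<xi> h" if "h \<in> H" for h using val[OF that, of 0] that HG by simp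
 have ch: "is_char_on G H' \<xi>'" unfolding is_char_on_def
 proof (intro conjI ballI)
  show "\<xi>' \<one> = 1" using ext[OF one] \<xi> by (simp add: is_char_on_def)
  fix x y assume "x \<in> H'" "y \<in> H'"
  then obtain h k h' k' where hk: "h \<in> H" "h' \<in> H" "x = h \<otimes> a [^] (k::nat)" "y = h' \<otimes> a [^] (k'::nat)" by (auto simp: H'_def)
  then have "\<xi>' (x \<otimes> y) = \<xi> (h \<otimes> h') * \<zeta> ^ (k + k')" using mult val[OF subgroup.m_closed[OF H]] by simp
  also have "\<dots> = \<xi>' x * \<xi>' y" using hk val \<xi> by (simp add: is_char_on_def power_add)
  finally show "\<xi>' (x \<otimes> y) = \<xi>' x * \<xi>' y" .
 qed
 have "\<xi>' a = \<zeta>" using val[OF one, of 1] a \<xi> by (simp add: is_char_on_def)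
 then show thesis using that[OF sub HH' aH' ch ext] by simp
qed

lemma least_pow_in_subgroup:
 assumes "finite (carrier G)" "subgroup H G" "a \<in> carrier G"
 obtains m :: nat where "m > 0" "a [^] m \<in> H" "\<And>j. 0 < j ==> j < m ==> a [^] (j::nat) \<notin> H"
proof -
 define P where "P = (\<lambda>m::nat. m > 0 \<and> a [^] m \<in> H)"
 have "P (Coset.order G)"
  using assms pow_order_eq_1[of a] order_gt_0_iff_finite subgroup.one_closed[OF assms(2)] by (simp add: P_def)
 then have "P (LEAST m. P m)" by (rule LeastI)
 moreover have "j < (LEAST m. P m) ==> \<not> P j" for j by (rule not_less_Least)
 ultimately show thesis using that[of "LEAST m. P m"] by (auto simp: P_def)
qed

text \<open>A root of unity of order \<open>m \<ge> 2\<close> gives a character that is nontrivial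
  at \<open>g\<close> on some subgroup containing \<open>g\<close>. Among the subgroups that carry
  such a character one of maximal size is the whole group, since otherwise
  \<open>char_extend\<close> enlarges it.\<close>

lemma char_separates:
 assumes fin: "finite (carrier G)" and g: "g \<in> carrier G" "g \<noteq> \<one>"
 obtains \<xi> where "\<xi> \<in> chars G" "\<xi> g \<noteq> 1"
proof -
 define T where "T = {H. subgroup H G \<and> (\<exists>\<xi>. is_char_on G H \<xi> \<and> g \<in> H \<and> \<xi> g \<noteq> 1)}"
 have triv: "subgroup {\<one>} G" by (rule triv_subgroup)
 obtain m where m: "m > 0" "g [^] m \<in> {\<one>}" "\<And>j. 0 < j ==> j < m ==> g [^] (j::nat) \<notin> {\<one>}"
  using least_pow_in_subgroup[OF fin triv g(1)] by blast
 have "m \<noteq> 1" using m(2) g by auto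
 then have m2: "m \<ge> 2" using m(1) by simp
 define \<zeta> where "\<zeta> = cis (2 * pi / real m)"
 have \<zeta>: "\<zeta> ^ m = 1" using m(1) Complex.DeMoivre[of "2 * pi / real m" m] unfolding \<zeta>_def by simp
 have "\<zeta> \<noteq> 1"
 proof
  assume "\<zeta> = 1"
  then have "cos (2 * pi / real m) = 1" by (simp add: \<zeta>_def complex_eq_iff)
  moreover have "cos (2 * pi / real m) < cos 0"
  proof (rule cos_monotone_0_pi)
   have "2 * pi / real m \<le> 2 * pi / 2" using m2 by (intro divide_left_mono) auto
   then show "2 * pi / real m \<le> pi" by simp
  qed (use m(1) in auto)
  ultimately show False by simp
 qed
 define \<epsilon> :: "'a => complex" where "\<epsilon> = (\<lambda>_. 1)"
 have c1: "is_char_on G {\<one>} \<epsilon>" by (simp add: is_char_on_def \<epsilon>_def)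
 have \<zeta>\<epsilon>: "\<zeta> ^ m = \<epsilon> (g [^] m)" using \<zeta> by (simp add: \<epsilon>_def)
 have "\<exists>H0 \<xi>0. subgroup H0 G \<and> g \<in> H0 \<and> is_char_on G H0 \<xi>0 \<and> \<xi>0 g = \<zeta>"
 proof (rule char_extend[OF fin triv c1 g(1) m \<zeta>\<epsilon>])
  fix H' \<xi>' assume 1: "subgroup H' G" and 2: "g \<in> H'" and 3: "is_char_on G H' \<xi>'" and 4: "\<xi>' g = \<zeta>"
  show "\<exists>H0 \<xi>0. subgroup H0 G \<and> g \<in> H0 \<and> is_char_on G H0 \<xi>0 \<and> \<xi>0 g = \<zeta>"
   by (intro exI[of _ H'] exI[of _ \<xi>'] conjI 1 2 3 4)
 qed
 then obtain H0 \<xi>0 where "subgroup H0 G" "g \<in> H0" "is_char_on G H0 \<xi>0" "\<xi>0 g = \<zeta>" by blast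
 then have H0: "H0 \<in> T" using \<open>\<zeta> \<noteq> 1\<close> by (auto simp: T_def)
 have "T \<subseteq> Pow (carrier G)" by (auto simp: T_def subgroup.mem_carrier)
 then have "finite T" using fin by (simp add: finite_subset)
 then have "Max (card ` T) \<in> card ` T" using H0 by (intro Max_in) auto
 then obtain H where H: "H \<in> T" "card H = Max (card ` T)" by auto
 then have Hmax: "card H' \<le> card H" if "H' \<in> T" for H'
  using \<open>finite T\<close> that by simp
 obtain \<xi> where \<xi>: "subgroup H G" "is_char_on G H \<xi>" "g \<in> H" "\<xi> g \<noteq> 1" using H(1) by (auto simp: T_def)
 have "H = carrier G"
 proof (rule ccontr)
  assume "H \<noteq> carrier G"
  then obtain a where a: "a \<in> carrier G" "a \<notin> H" using \<xi>(1) subgroup.subset by blast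
  obtain m where m: "m > 0" "a [^] m \<in> H" "\<And>j. 0 < j ==> j < m ==> a [^] (j::nat) \<notin> H"
   using least_pow_in_subgroup[OF fin \<xi>(1) a(1)] by blast
  obtain z where z: "z ^ m = \<xi> (a [^] m)" using complex_root_exists[OF m(1)] .
  have "\<exists>H' \<xi>'. subgroup H' G \<and> H \<subseteq> H' \<and> a \<in> H' \<and> is_char_on G H' \<xi>' \<and> (\<forall>h\<in>H. \<xi>' h = \<xi> h)"
  proof (rule char_extend[OF fin \<xi>(1,2) a(1) m z])
   fix H' \<xi>' assume 1: "subgroup H' G" and 2: "H \<subseteq> H'" and 3: "a \<in> H'" and 4: "is_char_on G H' \<xi>'"
    and 5: "\<And>h. h \<in> H ==> \<xi>' h = \<xi> h"
   show "\<exists>H' \<xi>'. subgroup H' G \<and> H \<subseteq> H' \<and> a \<in> H' \<and> is_char_on G H' \<xi>' \<and> (\<forall>h\<in>H. \<xi>' h = \<xi> h)"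
    by (intro exI[of _ H'] exI[of _ \<xi>'] conjI ballI 1 2 3 4 5)
  qed
  then obtain H' \<xi>' where H': "subgroup H' G" "H \<subseteq> H'" "a \<in> H'" "is_char_on G H' \<xi>'" "\<And>h. h \<in> H ==> \<xi>' h = \<xi> h"
   by blast
  then have "H' \<in> T" using \<xi> by (auto simp: T_def intro!: exI[of _ \<xi>'])
  then have "card H' \<le> card H" by (rule Hmax)
  moreover have "finite H'" using H'(1) fin subgroup.subset finite_subset by metis
  then have "card H < card H'" using H'(2,3) a(2) by (intro psubset_card_mono) auto
  ultimately show False by simp
 qed
 define \<xi>' where "\<xi>' = (\<lambda>x. if x \<in> carrier G then \<xi> x else 0)"
 have "\<xi>' \<in> chars G" using \<xi>(2) \<open>H = carrier G\<close> by (simp add: chars_def is_char_on_def \<xi>'_def)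
 then show thesis using that[of \<xi>'] \<xi>(4) g by (simp add: \<xi>'_def)
qed

lemma chars_mult: "\<xi> \<in> chars G ==> x \<in> carrier G ==> y \<in> carrier G ==> \<xi> (x \<otimes> y) = \<xi> x * \<xi> y"
 and chars_one: "\<xi> \<in> chars G ==> \<xi> \<one> = 1"
 by (auto simp: chars_def is_char_on_def)

lemma chars_pow: "\<xi> \<in> chars G ==> x \<in> carrier G ==> \<xi> (x [^] (n::nat)) = \<xi> x ^ n"
 by (rule is_char_on_pow[OF _ subgroup_self]) (auto simp: chars_def)

lemma chars_root:
 assumes "finite (carrier G)" "\<xi> \<in> chars G" "x \<in> carrier G" shows "\<xi> x ^ card (carrier G) = 1"
 using chars_pow[OF assms(2,3), of "card (carrier G)"] pow_order_eq_1[OF assms(3)] chars_one[OF assms(2)]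
 by (simp add: Coset.order_def)

lemma norm_chars:
 assumes "finite (carrier G)" "\<xi> \<in> chars G" "x \<in> carrier G" shows "cmod (\<xi> x) = 1"
proof -
 have "card (carrier G) \<noteq> 0" using assms by auto
 moreover have "cmod (\<xi> x) = 1 \<or> card (carrier G) = 0" using power_eq_1_iff[OF chars_root[OF assms]] .
 ultimately show ?thesis by simp
qed

lemma finite_chars: assumes "finite (carrier G)" shows "finite (chars G)"
proof (rule finite_subset)
 have n: "card (carrier G) > 0" using assms by (auto simp: card_gt_0_iff)
 have "finite {z::complex. z ^ card (carrier G) = 1}" using n by (intro finite_roots_unity) auto
 then show "finite {\<xi>. \<forall>x. (x \<in> carrier G --> \<xi> x \<in> {z::complex. z ^ card (carrier G) = 1}) \<and> (x \<notin> carrier G --> \<xi> x = 0)}"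
  by (intro finite_set_of_finite_funs assms)
 show "chars G \<subseteq> {\<xi>. \<forall>x. (x \<in> carrier G --> \<xi> x \<in> {z::complex. z ^ card (carrier G) = 1}) \<and> (x \<notin> carrier G --> \<xi> x = 0)}"
  using chars_root[OF assms] by (auto simp: chars_def)
qed

definition triv_char :: "'a => complex" where "triv_char = (\<lambda>x. if x \<in> carrier G then 1 else 0)"

lemma triv_char: "triv_char \<in> chars G"
 by (simp add: triv_char_def chars_def is_char_on_def)

text \<open>Multiplication by a character \<open>\<psi>\<close> with
  \<open>\<psi> g \<noteq> 1\<close> permutes the characters, so it multiplies the sum by
  \<open>\<psi> g\<close> without changing it.\<close>

lemma sum_chars:
 assumes fin: "finite (carrier G)" and g: "g \<in> carrier G"
 shows "(\<Sum>\<xi>\<in>chars G. \<xi> g) = (if g = \<one> then of_nat (card (chars G)) else 0)"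
proof (cases "g = \<one>")
 case True
 have "(\<Sum>\<xi>\<in>chars G. \<xi> g) = (\<Sum>\<xi>\<in>chars G. 1)" by (intro sum.cong) (auto simp: True chars_one)
 then show ?thesis using True by simp
next
 case False
 obtain \<psi> where \<psi>: "\<psi> \<in> chars G" "\<psi> g \<noteq> 1" using char_separates[OF fin g False] .
 have nz: "\<psi> x \<noteq> 0" if "x \<in> carrier G" for x using norm_chars[OF fin \<psi>(1) that] by auto
 have "(\<Sum>\<xi>\<in>chars G. \<xi> g) = (\<Sum>\<xi>\<in>chars G. \<psi> g * \<xi> g)"
 proof (rule sum.reindex_bij_witness[of _ "\<lambda>\<xi> x. \<psi> x * \<xi> x" "\<lambda>\<xi> x. inverse (\<psi> x) * \<xi> x"])
  fix \<xi> assume \<xi>: "\<xi> \<in> chars G"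
  show "(\<lambda>x. \<psi> x * (inverse (\<psi> x) * \<xi> x)) = \<xi>" "(\<lambda>x. inverse (\<psi> x) * (\<psi> x * \<xi> x)) = \<xi>"
   using nz \<xi> unfolding chars_def fun_eq_iff by (auto simp: field_simps)
  show "(\<lambda>x. inverse (\<psi> x) * \<xi> x) \<in> chars G" "(\<lambda>x. \<psi> x * \<xi> x) \<in> chars G"
   using \<psi> \<xi> by (auto simp: chars_def is_char_on_def)
  show "\<psi> g * (inverse (\<psi> g) * \<xi> g) = \<xi> g" using nz[OF g] by simp
 qed
 also have "\<dots> = \<psi> g * (\<Sum>\<xi>\<in>chars G. \<xi> g)" by (rule sum_distrib_left[symmetric])
 finally have "(1 - \<psi> g) * (\<Sum>\<xi>\<in>chars G. \<xi> g) = 0" by fastforce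
 then show ?thesis using \<psi>(2) False by simp
qed

lemma sum_char:
 assumes fin: "finite (carrier G)" and \<xi>: "\<xi> \<in> chars G" "\<xi> \<noteq> triv_char"
 shows "(\<Sum>x\<in>carrier G. \<xi> x) = 0"
proof -
 have "\<exists>g\<in>carrier G. \<xi> g \<noteq> 1"
 proof (rule ccontr)
  assume "\<not> ?thesis"
  then have "\<xi> = triv_char" using \<xi>(1) by (auto simp: triv_char_def chars_def)
  then show False using \<xi>(2) by simp
 qed
 then obtain g where g: "g \<in> carrier G" "\<xi> g \<noteq> 1" by blast
 have "(\<Sum>x\<in>carrier G. \<xi> x) = (\<Sum>x\<in>carrier G. \<xi> (g \<otimes> x))"
  by (rule sum.reindex_bij_witness[of _ "\<lambda>x. g \<otimes> x" "\<lambda>x. inv g \<otimes> x"]) (use g in \<open>auto simp: m_assoc[symmetric]\<close>)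
 also have "\<dots> = \<xi> g * (\<Sum>x\<in>carrier G. \<xi> x)" using chars_mult[OF \<xi>(1) g(1)] by (simp add: sum_distrib_left)
 finally have "(1 - \<xi> g) * (\<Sum>x\<in>carrier G. \<xi> x) = 0" by fastforce
 then show ?thesis using g(2) by simp
qed

end

section \<open>Euler products and Landau's theorem\<close>

text \<open>The intermediate sets \<open>T\<close> may be infinite. The Euler product needs this,
  because even finitely many primes have infinitely many products.\<close>

lemma infsum_exhaust:
 fixes f :: "'a => complex"
 assumes f: "f summable_on A" and e: "e > 0"
 obtains Y where "finite Y" "Y \<subseteq> A" "\<And>T. Y \<subseteq> T ==> T \<subseteq> A ==> norm (infsum f A - infsum f T) \<le> e"
proof -
 have n: "(\<lambda>x. norm (f x)) summable_on A" using f by (simp only: summable_on_iff_abs_summable_on_complex)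
 then have "((\<lambda>x. norm (f x)) has_sum infsum (\<lambda>x. norm (f x)) A) A" by simp
 from has_sum_finite_approximation[OF this e]
 obtain Y where Y: "finite Y" "Y \<subseteq> A" "dist (sum (\<lambda>x. norm (f x)) Y) (infsum (\<lambda>x. norm (f x)) A) \<le> e"
  by blast
 show thesis
 proof (rule that[OF Y(1,2)])
  fix T assume T: "Y \<subseteq> T" "T \<subseteq> A"
  have s: "f summable_on T" "f summable_on A - T" "(\<lambda>x. norm (f x)) summable_on A - T" "(\<lambda>x. norm (f x)) summable_on A - Y"
   "(\<lambda>x. norm (f x)) summable_on Y"
   using f n T Y summable_on_subset_banach by blast+
  have "infsum f A = infsum f T + infsum f (A - T)"
   using infsum_Un_disjoint[OF s(1,2)] T by (simp add: Un_absorb1 Un_Diff_cancel)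
  then have "norm (infsum f A - infsum f T) = norm (infsum f (A - T))" by simp
  also have "\<dots> \<le> infsum (\<lambda>x. norm (f x)) (A - T)" by (rule norm_infsum_bound[OF s(3)])
  also have "\<dots> \<le> infsum (\<lambda>x. norm (f x)) (A - Y)" using T by (intro infsum_mono2 s) auto
  also have "\<dots> = infsum (\<lambda>x. norm (f x)) A - sum (\<lambda>x. norm (f x)) Y"
  proof -
   have "infsum (\<lambda>x. norm (f x)) A = infsum (\<lambda>x. norm (f x)) Y + infsum (\<lambda>x. norm (f x)) (A - Y)"
    using infsum_Un_disjoint[OF s(5,4)] Y by (simp add: Un_absorb1 Un_Diff_cancel)
   then show ?thesis using Y(1) by simp
  qed
  also have "\<dots> \<le> e" using Y(3) by (simp add: dist_real_def)
  finally show "norm (infsum f A - infsum f T) \<le> e" .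
 qed
qed

text \<open>Multisets of primes stand for ideals; \<open>mw c\<close> is the completely
  multiplicative function with the values \<open>c\<close> at primes.\<close>

definition mw :: "('p => complex) => 'p multiset => complex" where
 "mw c M = prod_mset (image_mset c M)"

definition ms :: "'p set => 'p multiset set" where
 "ms P = {M. set_mset M \<subseteq> P}"

lemma mw_add [simp]: "mw c (add_mset p M) = c p * mw c M" and mw_empty [simp]: "mw c {#} = 1"
 by (simp_all add: mw_def)

text \<open>A multiset over \<open>insert p F\<close> either avoids \<open>p\<close> or is
  \<open>add_mset p\<close> of another one. For the two sums this gives the equation
  \<open>new = old + c p * new\<close>.\<close>

lemma euler_finite:
 fixes c :: "'p => complex"
 assumes "finite F" "F \<subseteq> P" and s: "mw c summable_on ms P" and c: "\<And>p. p \<in> P ==> c p \<noteq> 1"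
 shows "infsum (mw c) (ms F) = (\<Prod>p\<in>F. 1 / (1 - c p))"
 using assms(1,2)
proof (induction F rule: finite_induct)
 case empty
 have "ms ({} :: 'p set) = {{#}}" by (auto simp: ms_def)
 then show ?case by simp
next
 case (insert p F)
 have sub: "ms X \<subseteq> ms P" if "X \<subseteq> P" for X using that by (auto simp: ms_def)
 have s1: "mw c summable_on ms F" and s2: "mw c summable_on ms (insert p F)"
  using s sub insert.prems summable_on_subset_banach by (metis insert_subset)+
 have eq: "ms (insert p F) = ms F \<union> add_mset p ` ms (insert p F)"
 proof (intro equalityI subsetI)
  fix M assume M: "M \<in> ms (insert p F)"
  show "M \<in> ms F \<union> add_mset p ` ms (insert p F)"
  proof (cases "p \<in># M")
   case True
   then obtain M' where "M = add_mset p M'" by (metis insert_DiffM)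
   then show ?thesis using M by (auto simp: ms_def)
  next
   case False
   then show ?thesis using M by (auto simp: ms_def)
  qed
 qed (auto simp: ms_def)
 have disj: "ms F \<inter> add_mset p ` ms (insert p F) = {}" using insert.hyps by (auto simp: ms_def)
 have inj: "inj_on (add_mset p) (ms (insert p F))" by (rule inj_onI) simp
 have comp: "mw c \<circ> add_mset p = (\<lambda>M. c p * mw c M)" by auto
 have s3: "mw c summable_on (add_mset p ` ms (insert p F))"
  unfolding summable_on_reindex[OF inj] comp by (intro summable_on_cmult_right s2)
 have "infsum (mw c) (ms (insert p F)) = infsum (mw c) (ms F) + infsum (mw c) (add_mset p ` ms (insert p F))"
  by (subst eq) (rule infsum_Un_disjoint[OF s1 s3 disj])
 also have "infsum (mw c) (add_mset p ` ms (insert p F)) = c p * infsum (mw c) (ms (insert p F))"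
  unfolding infsum_reindex[OF inj] comp by (rule infsum_cmult_right) (use s2 in simp)
 finally have "infsum (mw c) (ms (insert p F)) - c p * infsum (mw c) (ms (insert p F)) = infsum (mw c) (ms F)"
  by (metis add_diff_cancel_right')
 then have "infsum (mw c) (ms (insert p F)) * (1 - c p) = infsum (mw c) (ms F)"
  by (simp only: right_diff_distrib mult_1_right mult.commute[of "c p"])
 moreover have "1 - c p \<noteq> 0" using c insert.prems by simp
 ultimately have "infsum (mw c) (ms (insert p F)) = infsum (mw c) (ms F) / (1 - c p)" by (simp add: eq_divide_eq)
 then show ?case using insert by simp
qed

lemma norm_neg_Ln_le: "cmod z < 1/2 ==> cmod (- Ln (1 - z)) \<le> 2 * cmod z"
 using norm_Ln_le[of "- z"] by simp

lemma euler_summable: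
 fixes c :: "'p => complex"
 assumes s: "mw c summable_on ms P" and c: "\<And>p. p \<in> P ==> cmod (c p) < 1/2"
 shows "(\<lambda>p. cmod (c p)) summable_on P" "(\<lambda>p. - Ln (1 - c p)) summable_on P"
proof -
 have inj: "inj_on (\<lambda>p. {#p#}) P" by (rule inj_onI) simp
 have "mw c summable_on (\<lambda>p. {#p#}) ` P" by (rule summable_on_subset_banach[OF s]) (auto simp: ms_def)
 then have "(mw c \<circ> (\<lambda>p. {#p#})) summable_on P" unfolding summable_on_reindex[OF inj] .
 moreover have "mw c \<circ> (\<lambda>p. {#p#}) = c" by fastforce
 ultimately have "c summable_on P" by simp
 then show n: "(\<lambda>p. cmod (c p)) summable_on P" using summable_on_iff_abs_summable_on_complex by blast
 have "(\<lambda>p. norm (- Ln (1 - c p))) summable_on P"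
  by (rule Infinite_Sum.abs_summable_on_comparison_test'[OF summable_on_cmult_right[OF n, of 2]]) (use norm_neg_Ln_le c in auto)
 then show "(\<lambda>p. - Ln (1 - c p)) summable_on P" by (rule Infinite_Sum.abs_summable_summable)
qed

text \<open>An exponential of a sum of \<open>- Ln (1 - c p)\<close> takes the place of an infinite
  product. The logarithm of the L-series is then one definite convergent sum, which can be expanded
  into prime powers.\<close>

lemma euler_product:
 fixes c :: "'p => complex"
 assumes s: "mw c summable_on ms P" and c: "\<And>p. p \<in> P ==> cmod (c p) < 1/2"
 shows "infsum (mw c) (ms P) = exp (\<Sum>\<^sub>\<infinity>p\<in>P. - Ln (1 - c p))"
proof -
 have c1: "c p \<noteq> 1" if "p \<in> P" for p using c[OF that] by auto
 have "((\<lambda>F. \<Sum>p\<in>F. - Ln (1 - c p)) \<longlongrightarrow> (\<Sum>\<^sub>\<infinity>p\<in>P. - Ln (1 - c p))) (finite_subsets_at_top P)"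
  using euler_summable(2)[OF s c] infsum_tendsto by blast
 then have lim1: "((\<lambda>F. exp (\<Sum>p\<in>F. - Ln (1 - c p))) \<longlongrightarrow> exp (\<Sum>\<^sub>\<infinity>p\<in>P. - Ln (1 - c p))) (finite_subsets_at_top P)"
  by (rule tendsto_exp)
 have lim2: "((\<lambda>F. exp (\<Sum>p\<in>F. - Ln (1 - c p))) \<longlongrightarrow> infsum (mw c) (ms P)) (finite_subsets_at_top P)"
 proof (rule tendstoI)
  fix e :: real assume e: "e > 0"
  obtain Y where Y: "finite Y" "Y \<subseteq> ms P" "\<And>T. Y \<subseteq> T ==> T \<subseteq> ms P ==> norm (infsum (mw c) (ms P) - infsum (mw c) T) \<le> e / 2"
   using infsum_exhaust[OF s, of "e / 2"] e by auto
  \<comment> \<open>All primes that occur in the finite set \<open>Y\<close> of multisets; as soon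
    as \<open>F\<close> contains them, the finite product accounts for the whole of
    \<open>Y\<close>.\<close>
  define F0 where "F0 = (\<Union>M\<in>Y. set_mset M)"
  have F0: "finite F0" "F0 \<subseteq> P" using Y by (auto simp: F0_def ms_def)
  have "dist (exp (\<Sum>p\<in>F. - Ln (1 - c p))) (infsum (mw c) (ms P)) < e" if F: "finite F" "F0 \<subseteq> F" "F \<subseteq> P" for F
  proof -
   have "exp (\<Sum>p\<in>F. - Ln (1 - c p)) = (\<Prod>p\<in>F. 1 / (1 - c p))"
    using F c1 by (auto simp: exp_sum exp_minus inverse_eq_divide intro!: prod.cong)
   also have "\<dots> = infsum (mw c) (ms F)" by (rule euler_finite[OF F(1,3) s c1, symmetric])
   finally have e1: "exp (\<Sum>p\<in>F. - Ln (1 - c p)) = infsum (mw c) (ms F)" .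
   have "Y \<subseteq> ms F" using F(2) by (auto simp: ms_def F0_def)
   moreover have "ms F \<subseteq> ms P" using F by (auto simp: ms_def)
   ultimately have "norm (infsum (mw c) (ms P) - infsum (mw c) (ms F)) \<le> e / 2" by (rule Y(3))
   then show ?thesis unfolding e1 dist_norm using e by (simp add: norm_minus_commute)
  qed
  then show "\<forall>\<^sub>F F in finite_subsets_at_top P. dist (exp (\<Sum>p\<in>F. - Ln (1 - c p))) (infsum (mw c) (ms P)) < e"
   using F0 by (auto simp: eventually_finite_subsets_at_top intro!: exI[of _ F0])
 qed
 show ?thesis by (rule tendsto_unique[OF _ lim2 lim1]) simp
qed

lemma has_sum_neg_Ln:
 assumes "cmod z < 1"
 shows "((\<lambda>k. z ^ k / of_nat k) has_sum (- Ln (1 - z))) {1..}"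
proof -
 have "(\<lambda>n. - ((- (- z)) ^ n) / of_nat n) sums ln (1 + (- z))" using assms by (intro Ln_series') simp
 then have "(\<lambda>n. - (- (z ^ n) / of_nat n)) sums (- Ln (1 - z))" by (intro sums_minus) simp
 then have s: "(\<lambda>n. z ^ n / of_nat n) sums (- Ln (1 - z))" by simp
 have "summable (\<lambda>n. norm (z ^ n / of_nat n))"
 proof (rule summable_comparison_test'[of "\<lambda>n. norm z ^ n" 1])
  show "summable (\<lambda>n. cmod z ^ n)" using assms by simp
  fix n :: nat assume "1 \<le> n"
  then have "norm z ^ n / real n \<le> norm z ^ n / 1" by (intro divide_left_mono) auto
  then show "norm (norm (z ^ n / of_nat n)) \<le> cmod z ^ n" by (simp add: norm_divide norm_power)
 qed
 then have "((\<lambda>k. z ^ k / of_nat k) has_sum (- Ln (1 - z))) UNIV" using s by (rule norm_summable_imp_has_sum)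
 \<comment> \<open>The term at \<open>k = 0\<close> vanishes because division by zero gives
   zero.\<close>
 then show ?thesis by (rule has_sum_cong_neutral[THEN iffD1, rotated -1]) (auto simp: not_le)
qed

lemma has_sum_double_Ln:
 fixes c :: "'p => complex"
 assumes s: "(\<lambda>p. cmod (c p)) summable_on P" and c: "\<And>p. p \<in> P ==> cmod (c p) < 1/2"
 shows "((\<lambda>(p, k). c p ^ k / of_nat k) has_sum (\<Sum>\<^sub>\<infinity>p\<in>P. - Ln (1 - c p))) (P \<times> {1..})"
proof (rule has_sum_SigmaI)
 show "((\<lambda>k. case (p, k) of (p, k) => c p ^ k / of_nat k) has_sum (- Ln (1 - c p))) {1..}" if "p \<in> P" for p
  using has_sum_neg_Ln[of "c p"] c[OF that] by simp
 have "(\<lambda>p. norm (- Ln (1 - c p))) summable_on P"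
  by (rule Infinite_Sum.abs_summable_on_comparison_test'[OF summable_on_cmult_right[OF s, of 2]]) (use norm_neg_Ln_le c in auto)
 then have "(\<lambda>p. - Ln (1 - c p)) summable_on P" by (rule Infinite_Sum.abs_summable_summable)
 then show "((\<lambda>p. - Ln (1 - c p)) has_sum (\<Sum>\<^sub>\<infinity>p\<in>P. - Ln (1 - c p))) P" by simp
 have "(\<lambda>x. norm (case x of (p, k) => c p ^ k / of_nat k)) summable_on (P \<times> {1::nat..})"
 proof (rule Infinite_Sum.abs_summable_on_comparison_test'[of "\<lambda>(p, k). cmod (c p) ^ k"])
  show "(\<lambda>(p, k). cmod (c p) ^ k) summable_on (P \<times> {1::nat..})"
  proof (rule summable_on_SigmaI[where g = "\<lambda>p. cmod (c p) / (1 - cmod (c p))"])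
   show "((\<lambda>y. case (p, y) of (p, k) => cmod (c p) ^ k) has_sum cmod (c p) / (1 - cmod (c p))) {1..}" if "p \<in> P" for p
    using has_sum_geometric_from_1[of "cmod (c p)"] c[OF that] by simp
   show "(\<lambda>p. cmod (c p) / (1 - cmod (c p))) summable_on P"
   proof (rule summable_on_comparison_test[OF summable_on_cmult_right[OF s, of 2]])
    fix p assume "p \<in> P"
    then have "cmod (c p) < 1/2" by (rule c)
    then show "0 \<le> cmod (c p) / (1 - cmod (c p))" by simp
    have "cmod (c p) / (1 - cmod (c p)) \<le> cmod (c p) / (1/2)" using \<open>cmod (c p) < 1/2\<close> by (intro divide_left_mono) auto
    then show "cmod (c p) / (1 - cmod (c p)) \<le> 2 * cmod (c p)" by simp
   qed
  qed auto
  fix x assume "x \<in> P \<times> {1::nat..}"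
  then obtain p k where x: "x = (p, k)" "k \<ge> 1" by auto
  have "cmod (c p) ^ k / real k \<le> cmod (c p) ^ k / 1" using x by (intro divide_left_mono) auto
  then show "norm (case x of (p, k) => c p ^ k / of_nat k) \<le> (case x of (p, k) => cmod (c p) ^ k)"
   using x by (simp add: norm_divide norm_power)
 qed
 then show "(\<lambda>(p, k). c p ^ k / of_nat k) summable_on P \<times> {1..}" by (rule Infinite_Sum.abs_summable_summable)
qed

lemma has_sum_exp:
 fixes z x :: "'a::{real_normed_field, banach}"
 shows "((\<lambda>k. z ^ k * (x ^ k / fact k)) has_sum exp (z * x)) UNIV"
proof (rule norm_summable_imp_has_sum)
 have e: "z ^ k * (x ^ k / fact k) = (z * x) ^ k /\<^sub>R fact k" for k
  by (simp add: power_mult_distrib scaleR_conv_of_real divide_inverse mult_ac)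
 show "summable (\<lambda>k. norm (z ^ k * (x ^ k / fact k)))" unfolding e by (rule summable_norm_exp)
 show "(\<lambda>k. z ^ k * (x ^ k / fact k)) sums exp (z * x)" unfolding e by (rule exp_converges)
qed

text \<open>
 Landau's theorem for a generalised Dirichlet series with nonnegative coefficients whose exponential
 continues analytically: all Taylor coefficients at 2 have the expected sign, and those of the
 exponential dominate those of the series.
\<close>

lemma landau_exp:
 fixes c \<mu> :: "'i => real" and F :: "complex => complex"
 assumes c: "\<And>i. i \<in> I ==> c i \<ge> 0" and l: "\<And>i. i \<in> I ==> \<mu> i \<ge> 0"
  and sum: "\<And>s. 1 < s ==> s < 3 ==> (\<lambda>i. c i * exp (- s * \<mu> i)) summable_on I"
  and F: "F holomorphic_on ball 2 2"
  and eq: "\<And>s. s \<in> ball 2 1 ==> F s = exp (\<Sum>\<^sub>\<infinity>i\<in>I. of_real (c i) * exp (- s * of_real (\<mu> i)))"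
  and \<sigma>: "0 < \<sigma>" "\<sigma> < 2"
 shows "(\<lambda>i. c i * exp (- \<sigma> * \<mu> i)) summable_on I"
proof -
 \<comment> \<open>In the variable \<open>z = 2 - s\<close> the series becomes a power series with
   coefficients \<open>Gk\<close>, which are sums of nonnegative \<open>T\<close>; it converges
   absolutely for \<open>cmod z < 1\<close>.\<close>
 define T where "T = (\<lambda>(i, k::nat). c i * exp (- 2 * \<mu> i) * (\<mu> i ^ k / fact k))"
 define g where "g = (\<lambda>z. \<Sum>\<^sub>\<infinity>i\<in>I. of_real (c i) * exp (- (2 - z) * of_real (\<mu> i)) :: complex)"
 define Gk where "Gk = (\<lambda>k. \<Sum>\<^sub>\<infinity>i\<in>I. T (i, k))"
 have T0: "T (i, k) \<ge> 0" if "i \<in> I" for i k using c[OF that] l[OF that] by (simp add: T_def)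
 have hT: "((\<lambda>k. r ^ k * T (i, k)) has_sum c i * exp (- (2 - r) * \<mu> i)) UNIV" for r i
 proof -
  have "((\<lambda>k. (c i * exp (- 2 * \<mu> i)) * (r ^ k * (\<mu> i ^ k / fact k))) has_sum (c i * exp (- 2 * \<mu> i)) * exp (r * \<mu> i)) UNIV"
   by (intro has_sum_cmult_right has_sum_exp)
  moreover have "(c i * exp (- 2 * \<mu> i)) * exp (r * \<mu> i) = c i * exp (- (2 - r) * \<mu> i)"
   by (simp add: algebra_simps flip: exp_add)
  moreover have "(\<lambda>k. (c i * exp (- 2 * \<mu> i)) * (r ^ k * (\<mu> i ^ k / fact k))) = (\<lambda>k. r ^ k * T (i, k))"
   by (simp add: T_def mult_ac)
  ultimately show ?thesis by (simp only:)
 qed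
 have dsum: "(\<lambda>(i, k). r ^ k * T (i, k)) summable_on (I \<times> UNIV)" if r: "0 \<le> r" "r < 1" for r
 proof (rule summable_on_SigmaI[where g = "\<lambda>i. c i * exp (- (2 - r) * \<mu> i)"])
  fix i assume i: "i \<in> I"
  show "((\<lambda>k. case (i, k) of (i, k) => r ^ k * T (i, k)) has_sum c i * exp (- (2 - r) * \<mu> i)) UNIV" using hT by simp
  show "0 \<le> (case (i, k) of (i, k) => r ^ k * T (i, k))" for k using T0[OF i] r by simp
 next
  show "(\<lambda>i. c i * exp (- (2 - r) * \<mu> i)) summable_on I" using sum[of "2 - r"] r by simp
 qed
 have cdsum: "(\<lambda>(i, k). z ^ k * of_real (T (i, k))) summable_on (I \<times> UNIV)" if z: "cmod z < 1" for z
 proof -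
  have "(\<lambda>x. norm (case x of (i, k) => z ^ k * of_real (T (i, k)))) summable_on (I \<times> UNIV)"
   by (rule Infinite_Sum.abs_summable_on_comparison_test'[OF dsum[of "cmod z"]])
    (use z T0 in \<open>auto simp: norm_mult norm_power\<close>)
  then show ?thesis by (rule Infinite_Sum.abs_summable_summable)
 qed
 have inner: "((\<lambda>k. z ^ k * of_real (T (i, k))) has_sum of_real (c i) * exp (- (2 - z) * of_real (\<mu> i))) UNIV" for i and z :: complex
 proof -
  have "((\<lambda>k. of_real (c i * exp (- 2 * \<mu> i)) * (z ^ k * (of_real (\<mu> i) ^ k / fact k))) has_sum of_real (c i * exp (- 2 * \<mu> i)) * exp (z * of_real (\<mu> i))) UNIV"
   by (intro has_sum_cmult_right has_sum_exp)
  moreover have "of_real (c i * exp (- 2 * \<mu> i)) * exp (z * of_real (\<mu> i)) = of_real (c i) * exp (- (2 - z) * of_real (\<mu> i))"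
   by (simp add: algebra_simps exp_of_real[symmetric] flip: exp_add)
  moreover have "(\<lambda>k. of_real (c i * exp (- 2 * \<mu> i)) * (z ^ k * (of_real (\<mu> i) ^ k / fact k))) = (\<lambda>k. z ^ k * of_real (T (i, k)))"
   by (simp add: T_def mult_ac)
  ultimately show ?thesis by (simp only:)
 qed
 have gsum: "((\<lambda>i. of_real (c i) * exp (- (2 - z) * of_real (\<mu> i))) has_sum g z) I" if z: "cmod z < 1" for z
 proof -
  have "(\<lambda>i. \<Sum>\<^sub>\<infinity>k. z ^ k * of_real (T (i, k))) summable_on I"
   using summable_on_Sigma_banach[of "\<lambda>i k. z ^ k * of_real (T (i, k))" I "\<lambda>_. UNIV"] cdsum[OF z] by simp
  moreover have "(\<Sum>\<^sub>\<infinity>k. z ^ k * of_real (T (i, k))) = of_real (c i) * exp (- (2 - z) * of_real (\<mu> i))" for i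
   using inner by (rule infsumI)
  ultimately show ?thesis by (simp add: g_def)
 qed
 have total: "((\<lambda>(i, k). z ^ k * of_real (T (i, k))) has_sum g z) (I \<times> UNIV)" if z: "cmod z < 1" for z
  by (rule has_sum_SigmaI[OF _ gsum[OF z] cdsum[OF z]]) (use inner in simp)
 have Tsum: "(\<lambda>i. T (i, k)) summable_on I" for k
 proof -
  have "(\<lambda>(k, i). (1/2) ^ k * T (i, k)) summable_on (UNIV \<times> I)"
   using dsum[of "1/2"] summable_on_swap[of "\<lambda>(i, k). (1/2) ^ k * T (i, k)" I UNIV] by simp
  then have "(\<lambda>i. (1/2) ^ k * T (i, k)) summable_on I" by (rule summable_on_SigmaD1[of "\<lambda>k i. (1/2) ^ k * T (i, k)"]) auto
  then have "(\<lambda>i. 2 ^ k * ((1/2) ^ k * T (i, k))) summable_on I" by (rule summable_on_cmult_right)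
  moreover have "2 ^ k * ((1/2) ^ k * x) = x" for x :: real by (simp add: power_one_over)
  ultimately show ?thesis by simp
 qed
 have gseries: "(\<lambda>k. of_real (Gk k) * z ^ k) sums g z" if z: "cmod z < 1" for z :: complex
 proof -
  have sw: "((\<lambda>(k, i). z ^ k * of_real (T (i, k))) has_sum g z) (UNIV \<times> I)"
   using total[OF z] has_sum_swap[of "\<lambda>(i, k). z ^ k * complex_of_real (T (i, k))" I UNIV "g z"] by simp
  have "((\<lambda>k. z ^ k * of_real (Gk k)) has_sum g z) UNIV"
  proof (rule has_sum_Sigma'[OF sw])
   fix k :: nat
   have "((\<lambda>i. of_real (T (i, k))) has_sum complex_of_real (Gk k)) I"
    using Tsum by (simp add: Gk_def has_sum_of_real_iff)
   then show "((\<lambda>i. case (k, i) of (k, i) => z ^ k * of_real (T (i, k))) has_sum z ^ k * of_real (Gk k)) I"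
    using has_sum_cmult_right by fastforce
  qed
  then show ?thesis using has_sum_imp_sums by (simp add: mult.commute)
 qed
 have G0: "Gk k \<ge> 0" for k unfolding Gk_def by (intro infsum_nonneg T0)
 define f where "f = (\<lambda>z. F (2 - z))"
 have fhol: "f holomorphic_on ball 0 2"
  unfolding f_def by (rule holomorphic_on_compose_gen[OF _ F, unfolded o_def])
   (auto intro!: holomorphic_intros simp: dist_norm)
 define A where "A = (\<lambda>n. (deriv ^^ n) f 0 / fact n)"
 have fseries: "(\<lambda>n. A n * z ^ n) sums f z" if "cmod z < 2" for z
  using holomorphic_power_series[OF fhol, of z] that by (simp add: A_def)
 have fg: "f z = exp (g z)" if "cmod z < 1" for z
  using eq[of "2 - z"] that by (simp add: f_def g_def dist_norm)
 have near: "\<forall>\<^sub>F z in nhds (0::complex). cmod z < 1"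
  using eventually_nhds_in_open[of "ball 0 1" "0::complex"] by simp
 have gexp: "g has_fps_expansion Abs_fps (\<lambda>k. of_real (Gk k))"
  by (rule has_fps_expansionI) (use gseries near in \<open>auto elim: eventually_mono\<close>)
 have fexp: "f has_fps_expansion Abs_fps A"
  by (rule has_fps_expansionI) (use fseries near in \<open>auto elim!: eventually_mono\<close>)
 have gdiff: "\<forall>\<^sub>F z in nhds 0. g field_differentiable at z"
 proof -
  have "g analytic_on {0}" using gexp by (rule has_fps_expansion_imp_analytic_0)
  then obtain S where "open S" "0 \<in> S" "g holomorphic_on S" by (auto simp: analytic_at)
  then show ?thesis using eventually_nhds_in_open[of S 0] by (auto elim!: eventually_mono dest: holomorphic_on_imp_differentiable_at)
 qed
 have ev: "\<forall>\<^sub>F z in nhds 0. deriv f z = deriv g z * f z"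
  using gdiff near
 proof eventually_elim
  fix z assume gd: "g field_differentiable at z" and z': "cmod z < 1"
  then have z: "z \<in> ball 0 1" by simp
  have "((\<lambda>z. exp (g z)) has_field_derivative exp (g z) * deriv g z) (at z)"
   using gd by (auto intro!: derivative_eq_intros simp: field_differentiable_derivI)
  moreover have "\<forall>\<^sub>F x in nhds z. f x = exp (g x)"
   using eventually_nhds_in_open[of "ball 0 1" z] z fg by (auto elim!: eventually_mono simp: dist_norm)
  ultimately have "(f has_field_derivative exp (g z) * deriv g z) (at z)"
   by (subst DERIV_cong_ev[OF refl _ refl]) auto
  then show "deriv f z = deriv g z * f z" using fg[OF z'] by (simp add: DERIV_imp_deriv)
 qed
 have "(\<lambda>z. deriv g z * f z) has_fps_expansion fps_deriv (Abs_fps A)"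
  by (rule has_fps_expansion_cong[OF ev refl, THEN iffD1, OF has_fps_expansion_deriv[OF fexp]])
 moreover have "(\<lambda>z. deriv g z * f z) has_fps_expansion fps_deriv (Abs_fps (\<lambda>k. of_real (Gk k))) * Abs_fps A"
  by (intro has_fps_expansion_mult has_fps_expansion_deriv gexp fexp)
 ultimately have fps: "fps_deriv (Abs_fps A) = fps_deriv (Abs_fps (\<lambda>k. of_real (Gk k))) * Abs_fps A"
  by (rule fps_expansion_unique_complex)
 \<comment> \<open>Comparison of coefficients in \<open>f' = g' f\<close>, where
   \<open>f = exp g\<close> near 0.\<close>
 have rec: "of_nat (n + 1) * A (n + 1) = (\<Sum>j=0..n. of_nat (j + 1) * of_real (Gk (j + 1)) * A (n - j))" for n
  using arg_cong[OF fps, of "\<lambda>u. fps_nth u n"] by (simp add: fps_mult_nth)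
 have A0: "A 0 = of_real (exp (Gk 0))"
 proof -
  have "g 0 = of_real (Gk 0)" using gexp has_fps_expansion_imp_0_eq_fps_nth_0 by fastforce
  then show ?thesis using fg[of 0] by (simp add: A_def exp_of_real)
 qed
 \<comment> \<open>By the recursion all \<open>A n\<close> are nonnegative. Its summand with
   \<open>A 0 = exp (Gk 0) \<ge> 1\<close> alone already gives \<open>A n \<ge> Gk n\<close>, so the
   power series of \<open>g\<close> converges wherever that of \<open>f\<close> does on the positive
   axis.\<close>
 have Apos: "\<exists>a\<ge>0. A n = of_real a \<and> (n > 0 --> a \<ge> Gk n)" for n
 proof (induction n rule: less_induct)
  case (less n)
  show ?case
  proof (cases n)
   case 0
   then show ?thesis using A0 by simp
  next
   case (Suc m)
   define b where "b = (\<lambda>n. Re (A n))"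
   have b: "A j = of_real (b j)" "b j \<ge> 0" if "j \<le> m" for j using less[of j] that Suc by (auto simp: b_def)
   have b0: "b 0 \<ge> 1" using A0 G0[of 0] by (simp add: b_def)
   define t where "t = (\<Sum>j=0..m. real (j + 1) * Gk (j + 1) * b (m - j))"
   have "of_nat (m + 1) * A (m + 1) = (\<Sum>j=0..m. of_nat (j + 1) * of_real (Gk (j + 1)) * of_real (b (m - j)))"
    unfolding rec using b by (intro sum.cong) auto
   also have "\<dots> = of_real t" by (simp add: t_def)
   finally have "of_nat n * A n = of_real t" using Suc by simp
   then have "A n = of_real t / of_nat n" using Suc by (metis nonzero_mult_div_cancel_left of_nat_eq_0_iff nat.distinct(1))
   then have An: "A n = of_real (t / real n)" by simp
   have t0: "t \<ge> real n * Gk n"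
   proof -
    have "real (m + 1) * Gk (m + 1) * b (m - m) \<le> t" unfolding t_def
     by (rule member_le_sum[of m "{0..m}" "\<lambda>j. real (j + 1) * Gk (j + 1) * b (m - j)"]) (use b G0 in auto)
    moreover have "real (m + 1) * Gk (m + 1) * 1 \<le> real (m + 1) * Gk (m + 1) * b (m - m)"
     using b0 G0 by (intro mult_left_mono) auto
    moreover have "real n * Gk n = real (m + 1) * Gk (m + 1) * 1" using Suc by simp
    ultimately show ?thesis by linarith
   qed
   then have "t / real n \<ge> Gk n" using Suc by (simp add: field_simps)
   moreover from this have "t / real n \<ge> 0" using G0 order_trans by blast
   ultimately show ?thesis using An by blast
  qed
 qed
 then obtain a where a: "\<And>n. a n \<ge> (0::real)" "\<And>n. A n = of_real (a n)" "\<And>n. n > 0 ==> a n \<ge> Gk n" by metis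
 define r where "r = 2 - \<sigma>"
 have r: "0 < r" "r < 2" using \<sigma> by (auto simp: r_def)
 have "summable (\<lambda>n. A n * of_real r ^ n)" using fseries[of "of_real r"] r sums_summable by force
 then have "summable (\<lambda>n. complex_of_real (a n * r ^ n))" by (simp add: a(2))
 then have "summable (\<lambda>n. a n * r ^ n)" using summable_of_real_iff by blast
 then have gs: "summable (\<lambda>n. Gk n * r ^ n)"
  by (rule summable_comparison_test'[of _ 1]) (use a(3) G0 r in \<open>auto simp: mult_right_mono\<close>)
 show ?thesis
 proof (rule nonneg_bounded_partial_sums_imp_summable_on)
  show "0 \<le> c i * exp (- \<sigma> * \<mu> i)" if "i \<in> I" for i using c[OF that] by simp
  \<comment> \<open>Nonnegativity permits a termwise comparison of the finite partial sums with the
    power series at \<open>r = 2 - \<sigma>\<close>.\<close>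
  have "sum (\<lambda>i. c i * exp (- \<sigma> * \<mu> i)) J \<le> (\<Sum>n. Gk n * r ^ n)" if J: "finite J" "J \<subseteq> I" for J
  proof -
   have e: "(\<lambda>k. r ^ k * T (i, k)) sums (c i * exp (- \<sigma> * \<mu> i))" for i
    using has_sum_imp_sums[OF hT[of r i]] by (simp add: r_def)
   have ss: "(\<lambda>k. \<Sum>i\<in>J. r ^ k * T (i, k)) sums (\<Sum>i\<in>J. c i * exp (- \<sigma> * \<mu> i))" by (intro sums_sum e)
   have le: "(\<Sum>i\<in>J. r ^ k * T (i, k)) \<le> Gk k * r ^ k" for k
   proof -
    have "(\<Sum>i\<in>J. T (i, k)) \<le> Gk k" unfolding Gk_def using J T0 Tsum by (intro finite_sum_le_infsum) auto
    then have "r ^ k * (\<Sum>i\<in>J. T (i, k)) \<le> r ^ k * Gk k" using r by (intro mult_left_mono) auto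
    then show ?thesis by (simp add: sum_distrib_left mult.commute)
   qed
   show ?thesis by (rule sums_le[OF le ss summable_sums[OF gs]])
  qed
  then show "\<forall>\<^sub>F X in finite_subsets_at_top I. sum (\<lambda>i. c i * exp (- \<sigma> * \<mu> i)) X \<le> (\<Sum>n. Gk n * r ^ n)"
   by fastforce
 qed
qed

lemma has_sum_sum_fin:
 fixes f :: "'a => 'b => complex"
 assumes "finite A" "\<And>a. a \<in> A ==> (f a has_sum s a) B"
 shows "((\<lambda>x. \<Sum>a\<in>A. f a x) has_sum (\<Sum>a\<in>A. s a)) B"
 using assms by (induction A rule: finite_induct) (auto intro!: has_sum_add)

definition lnN :: "('p => real) => 'p multiset => real" where
 "lnN N M = (\<Sum>p\<in>#M. ln (N p))"

text \<open>Collects what the analytic argument uses of the class group: multisets of primes play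
  the ideals, \<open>W A s / (s - 1)\<close> is the zeta function of the class \<open>A\<close>, and
  the residue \<open>\<kappa>\<close> is common to all classes, so that the poles cancel in the
  L-series of a nontrivial character. The disc is the one of \<open>landau_exp\<close>.\<close>

locale prime_system = comm_group G for G (structure) +
 fixes P :: "'p set" and N :: "'p => real" and cl :: "'p multiset => 'a" and W :: "'a => complex => complex" and \<kappa> :: complex
 assumes fin: "finite (carrier G)"
  and N2: "\<And>p. p \<in> P ==> N p \<ge> 2"
  and cl0: "cl {#} = \<one>" and clc: "\<And>M. M \<in> ms P ==> cl M \<in> carrier G"
  and clm: "\<And>p M. p \<in> P ==> M \<in> ms P ==> cl (add_mset p M) = cl {#p#} \<otimes> cl M"
  and Whol: "\<And>A. A \<in> carrier G ==> W A holomorphic_on ball 2 2"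
  and W1: "\<And>A. A \<in> carrier G ==> W A 1 = \<kappa>" and k0: "\<kappa> \<noteq> 0"
  and Wsum: "\<And>A s. A \<in> carrier G ==> s \<in> ball 2 2 ==> Re s > 1 ==>
   ((\<lambda>M. exp (- s * of_real (lnN N M))) has_sum (W A s / (s - 1))) {M \<in> ms P. cl M = A}"
begin

definition c :: "complex => ('a => complex) => 'p => complex" where
 "c s \<xi> p = \<xi> (cl {#p#}) * exp (- s * of_real (ln (N p)))"

lemma cl1: "p \<in> P ==> cl {#p#} \<in> carrier G"
 by (rule clc) (simp add: ms_def)

lemma mw_c:
 assumes "\<xi> \<in> chars G" "M \<in> ms P"
 shows "mw (c s \<xi>) M = \<xi> (cl M) * exp (- s * of_real (lnN N M))"
 using assms(2)
proof (induction M)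
 case empty
 then show ?case using assms(1) by (simp add: cl0 chars_one lnN_def)
next
 case (add p M)
 have p: "p \<in> P" "M \<in> ms P" using add.prems by (auto simp: ms_def)
 have "\<xi> (cl (add_mset p M)) = \<xi> (cl {#p#}) * \<xi> (cl M)"
  unfolding clm[OF p] using chars_mult[OF assms(1)] cl1 clc p by simp
 moreover have "exp (- s * of_real (lnN N (add_mset p M))) = exp (- s * of_real (ln (N p))) * exp (- s * of_real (lnN N M))"
  by (simp add: lnN_def distrib_left flip: exp_add)
 ultimately show ?case using add.IH p by (simp add: c_def)
qed

lemma norm_c_le:
 assumes "\<xi> \<in> chars G" "p \<in> P"
 shows "cmod (c s \<xi> p) = exp (- Re s * ln (N p))"
 using norm_chars[OF fin assms(1) cl1[OF assms(2)]] by (simp add: c_def norm_mult)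

lemma norm_c_lt:
 assumes "\<xi> \<in> chars G" "p \<in> P" "Re s > 1"
 shows "cmod (c s \<xi> p) < 1 / 2"
proof -
 have l: "ln (N p) \<ge> ln 2" "ln (N p) > 0" using N2[OF assms(2)] by auto
 then have "1 * ln (N p) < Re s * ln (N p)" using assms(3) by (intro mult_strict_right_mono) auto
 then have "- Re s * ln (N p) < - ln 2" using l(1) by simp
 then have "exp (- Re s * ln (N p)) < exp (- ln 2)" by simp
 also have "exp (- ln 2) = (1 / 2 :: real)" by (simp add: exp_minus inverse_eq_divide)
 finally show ?thesis using norm_c_le[OF assms(1,2)] by simp
qed

definition Wx :: "('a => complex) => complex => complex" where
 "Wx \<xi> s = (\<Sum>A\<in>carrier G. \<xi> A * W A s)"

lemma Wx_holomorphic: "Wx \<xi> holomorphic_on ball 2 2"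
 unfolding Wx_def[abs_def] by (intro holomorphic_intros Whol)

lemma L_has_sum:
 assumes \<xi>: "\<xi> \<in> chars G" and s: "s \<in> ball 2 2" "Re s > 1"
 shows "(mw (c s \<xi>) has_sum (Wx \<xi> s / (s - 1))) (ms P)"
proof -
 have "(mw (c s \<xi>) has_sum (\<Sum>A\<in>carrier G. \<xi> A * (W A s / (s - 1)))) (\<Union>A\<in>carrier G. {M \<in> ms P. cl M = A})"
 proof (rule sum_has_sum[OF fin])
  fix A assume A: "A \<in> carrier G"
  have "((\<lambda>M. \<xi> A * exp (- s * of_real (lnN N M))) has_sum \<xi> A * (W A s / (s - 1))) {M \<in> ms P. cl M = A}"
   by (intro has_sum_cmult_right Wsum A s)
  then show "(mw (c s \<xi>) has_sum \<xi> A * (W A s / (s - 1))) {M \<in> ms P. cl M = A}"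
   by (rule has_sum_cong[THEN iffD1, rotated]) (auto simp: mw_c[OF \<xi>])
 qed auto
 moreover have "(\<Union>A\<in>carrier G. {M \<in> ms P. cl M = A}) = ms P" using clc by auto
 moreover have "(\<Sum>A\<in>carrier G. \<xi> A * (W A s / (s - 1))) = Wx \<xi> s / (s - 1)"
  by (simp add: Wx_def sum_divide_distrib)
 ultimately show ?thesis by simp
qed

definition \<Lambda> :: "complex => ('a => complex) => complex" where
 "\<Lambda> s \<xi> = (\<Sum>\<^sub>\<infinity>p\<in>P. - Ln (1 - c s \<xi> p))"

lemma c_summable:
 assumes \<xi>: "\<xi> \<in> chars G" and s: "s \<in> ball 2 2" "Re s > 1"
 shows "(\<lambda>p. cmod (c s \<xi> p)) summable_on P"
 by (rule euler_summable(1)[OF has_sum_imp_summable[OF L_has_sum[OF assms]] norm_c_lt[OF \<xi> _ s(2)]])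

lemma L_exp:
 assumes \<xi>: "\<xi> \<in> chars G" and s: "s \<in> ball 2 2" "Re s > 1"
 shows "Wx \<xi> s / (s - 1) = exp (\<Lambda> s \<xi>)"
 using euler_product[OF has_sum_imp_summable[OF L_has_sum[OF assms]] norm_c_lt[OF \<xi> _ s(2)]]
  infsumI[OF L_has_sum[OF assms]] by (simp add: \<Lambda>_def)

definition h :: nat where "h = card (chars G)"

lemma h_pos: "h > 0"
 unfolding h_def using triv_char finite_chars[OF fin] by (auto simp: card_gt_0_iff)

definition wt :: "'a => real => 'p \<times> nat => real" where
 "wt Y s = (\<lambda>(p, k). if Y \<otimes> cl {#p#} [^] k = \<one> then real h / real k * exp (- s * (real k * ln (N p))) else 0)"

text \<open>Orthogonality: weighting the logarithms of the L-series by \<open>\<xi> Y\<close>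
  retains just the prime powers whose class is inverse to \<open>Y\<close>.\<close>

lemma Lambda_sum:
 assumes Y: "Y \<in> carrier G" and s: "s \<in> ball 2 2" "Re s > 1"
 shows "((\<lambda>(p, k). if Y \<otimes> cl {#p#} [^] k = \<one> then of_real (real h / real k) * exp (- s * of_real (real k * ln (N p))) else 0)
  has_sum (\<Sum>\<xi>\<in>chars G. \<xi> Y * \<Lambda> s \<xi>)) (P \<times> {1..})"
proof -
 have "((\<lambda>x. \<Sum>\<xi>\<in>chars G. \<xi> Y * (case x of (p, k) => c s \<xi> p ^ k / of_nat k)) has_sum (\<Sum>\<xi>\<in>chars G. \<xi> Y * \<Lambda> s \<xi>)) (P \<times> {1..})"
  unfolding \<Lambda>_def
  by (intro has_sum_sum_fin finite_chars fin has_sum_cmult_right has_sum_double_Ln c_summable norm_c_lt s)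
 then show ?thesis
 proof (rule has_sum_cong[THEN iffD1, rotated])
  fix x assume "x \<in> P \<times> {1::nat..}"
  then obtain p k where x: "x = (p, k)" "p \<in> P" "k \<ge> 1" by auto
  have g: "cl {#p#} \<in> carrier G" using cl1 x by simp
  have t: "\<xi> Y * (c s \<xi> p ^ k / of_nat k) = \<xi> (Y \<otimes> cl {#p#} [^] k) * (exp (- s * of_real (real k * ln (N p))) / of_nat k)"
   if "\<xi> \<in> chars G" for \<xi>
  proof -
   have "\<xi> (Y \<otimes> cl {#p#} [^] k) = \<xi> Y * \<xi> (cl {#p#}) ^ k"
    using chars_mult[OF that Y, of "cl {#p#} [^] k"] chars_pow[OF that g, of k] g by simp
   moreover have "exp (- s * of_real (ln (N p))) ^ k = exp (- s * of_real (real k * ln (N p)))"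
    by (simp add: mult_ac flip: exp_of_nat_mult)
   ultimately show ?thesis by (simp add: c_def power_mult_distrib)
  qed
  have "(\<Sum>\<xi>\<in>chars G. \<xi> Y * (c s \<xi> p ^ k / of_nat k)) =
   (\<Sum>\<xi>\<in>chars G. \<xi> (Y \<otimes> cl {#p#} [^] k)) * (exp (- s * of_real (real k * ln (N p))) / of_nat k)"
   unfolding sum_distrib_right by (rule sum.cong[OF refl]) (rule t)
  also have "(\<Sum>\<xi>\<in>chars G. \<xi> (Y \<otimes> cl {#p#} [^] k)) = (if Y \<otimes> cl {#p#} [^] k = \<one> then of_nat h else 0)"
   unfolding h_def using Y g by (intro sum_chars fin) auto
  finally show "(\<Sum>\<xi>\<in>chars G. \<xi> Y * (case x of (p, k) => c s \<xi> p ^ k / of_nat k)) =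
   (case x of (p, k) => if Y \<otimes> cl {#p#} [^] k = \<one> then of_real (real h / real k) * exp (- s * of_real (real k * ln (N p))) else 0)"
   by (simp add: x)
 qed
qed

lemma Lambda_sum_real:
 assumes Y: "Y \<in> carrier G" and s: "1 < s" "s < 3"
 shows "(wt Y s has_sum Re (\<Sum>\<xi>\<in>chars G. \<xi> Y * \<Lambda> (of_real s) \<xi>)) (P \<times> {1..})"
proof -
 have sb: "complex_of_real s \<in> ball 2 2" "Re (complex_of_real s) > 1"
 proof -
  have "norm (2 - complex_of_real s) = \<bar>2 - s\<bar>" by (metis norm_of_real of_real_diff of_real_numeral)
  then show "complex_of_real s \<in> ball 2 2" using s by (simp add: dist_norm)
 qed (use s in simp)
 show ?thesis
 proof (rule has_sum_cong[THEN iffD1, rotated, OF has_sum_Re[OF Lambda_sum[OF Y sb]]])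
  fix x :: "'p \<times> nat"
  obtain p k where x: "x = (p, k)" by fastforce
  have "exp (- complex_of_real s * of_real (real k * ln (N p))) = of_real (exp (- s * (real k * ln (N p))))"
   by (simp flip: exp_of_real)
  then show "Re (case x of (p, k) => if Y \<otimes> cl {#p#} [^] k = \<one> then of_real (real h / real k) * exp (- of_real s * of_real (real k * ln (N p))) else 0) = wt Y s x"
   unfolding x wt_def by (simp only: prod.case if_distrib[of Re] flip: of_real_mult) simp
 qed
qed

lemma real_in_ball: "1 < s ==> s < 3 ==> complex_of_real s \<in> ball 2 2"
proof -
 assume s: "1 < s" "s < 3"
 have "norm (2 - complex_of_real s) = \<bar>2 - s\<bar>" by (metis norm_of_real of_real_diff of_real_numeral)
 then show ?thesis using s by (simp add: dist_norm)
qed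

lemma one_in_ball: "(1::complex) \<in> ball 2 2"
 by (simp add: dist_norm)

lemma Wx_triv: "Wx triv_char 1 \<noteq> 0"
proof -
 have "Wx triv_char 1 = of_nat (card (carrier G)) * \<kappa>" unfolding Wx_def by (simp add: W1 triv_char_def)
 moreover have "card (carrier G) > 0" using fin by (auto simp: card_gt_0_iff)
 ultimately show ?thesis using k0 by simp
qed

lemma tendsto_holomorphic_right:
 assumes "F holomorphic_on ball 2 2"
 shows "((\<lambda>s. F (complex_of_real s)) \<longlongrightarrow> F 1) (at_right 1)"
proof -
 have "isCont F 1" using assms one_in_ball holomorphic_on_imp_continuous_on continuous_on_eq_continuous_at open_ball by blast
 moreover have "((\<lambda>s::real. complex_of_real s) \<longlongrightarrow> of_real 1) (at_right 1)" by (intro tendsto_intros)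
 then have "((\<lambda>s::real. complex_of_real s) \<longlongrightarrow> 1) (at_right 1)" by simp
 ultimately show ?thesis by (rule isCont_tendsto_compose)
qed

text \<open>If the sum converged, the logarithm of the zeta function would be bounded as
  \<open>s\<close> tends to 1 from the right, and \<open>Wx triv_char\<close> would vanish at
  1.\<close>

lemma not_summable_all: "\<not> (\<lambda>p. 1 / N p) summable_on P"
proof
 assume S: "(\<lambda>p. 1 / N p) summable_on P"
 define B where "B = (\<Sum>\<^sub>\<infinity>p\<in>P. 2 * (1 / N p))"
 have bd: "cmod (Wx triv_char (of_real s)) \<le> exp B * (s - 1)" if s: "1 < s" "s < 3" for s
 proof -
  have sb: "complex_of_real s \<in> ball 2 2" "Re (complex_of_real s) > 1" using real_in_ball s by auto
  have cN: "cmod (- Ln (1 - c (of_real s) triv_char p)) \<le> 2 * (1 / N p)" if p: "p \<in> P" for p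
  proof -
   have "cmod (- Ln (1 - c (of_real s) triv_char p)) \<le> 2 * cmod (c (of_real s) triv_char p)"
    by (rule norm_neg_Ln_le[OF norm_c_lt[OF triv_char p sb(2)]])
   also have "cmod (c (of_real s) triv_char p) = exp (- s * ln (N p))" using norm_c_le[OF triv_char p] by simp
   also have "exp (- s * ln (N p)) \<le> exp (- ln (N p))" using s N2[OF p] by simp
   also have "exp (- ln (N p)) = 1 / N p" using N2[OF p] by (simp add: exp_minus inverse_eq_divide)
   finally show ?thesis by simp
  qed
  have n: "(\<lambda>p. norm (- Ln (1 - c (of_real s) triv_char p))) summable_on P"
   by (rule Infinite_Sum.abs_summable_on_comparison_test'[OF summable_on_cmult_right[OF S, of 2] cN])
  have "cmod (\<Lambda> (of_real s) triv_char) \<le> (\<Sum>\<^sub>\<infinity>p\<in>P. norm (- Ln (1 - c (of_real s) triv_char p)))"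
   unfolding \<Lambda>_def by (rule norm_infsum_bound[OF n])
  also have "\<dots> \<le> B" unfolding B_def by (rule infsum_mono[OF n summable_on_cmult_right[OF S, of 2] cN])
  finally have "Re (\<Lambda> (of_real s) triv_char) \<le> B" using complex_Re_le_cmod order_trans by blast
  moreover have "cmod (Wx triv_char (of_real s) / (of_real s - 1)) = exp (Re (\<Lambda> (of_real s) triv_char))"
   unfolding L_exp[OF triv_char sb] by simp
  ultimately have "cmod (Wx triv_char (of_real s)) / cmod (of_real s - 1) \<le> exp B" by (simp add: norm_divide)
  moreover have "cmod (of_real s - 1) = s - 1" using s by (metis abs_of_pos diff_gt_0_iff_gt norm_of_real of_real_1 of_real_diff)
  ultimately show ?thesis using s by (simp add: pos_divide_le_eq)
 qed
 have l1: "((\<lambda>s. cmod (Wx triv_char (of_real s))) \<longlongrightarrow> cmod (Wx triv_char 1)) (at_right 1)"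
  by (intro tendsto_norm tendsto_holomorphic_right Wx_holomorphic)
 have "((\<lambda>s::real. exp B * (s - 1)) \<longlongrightarrow> exp B * (1 - 1)) (at_right 1)"
  by (intro tendsto_intros)
 then have l2: "((\<lambda>s::real. exp B * (s - 1)) \<longlongrightarrow> 0) (at_right 1)" by simp
 have "\<forall>\<^sub>F s in at_right 1. cmod (Wx triv_char (of_real s)) \<le> exp B * (s - 1)"
  using eventually_at_right[of 1 "3::real"] bd by (auto intro!: exI[of _ 3])
 then have "cmod (Wx triv_char 1) \<le> 0" by (rule tendsto_le[OF _ l2 l1, rotated]) simp
 then show False using Wx_triv by simp
qed

text \<open>For nontrivial \<open>\<xi>\<close> this is the L-series continued over 1: as
  \<open>Wx \<xi> 1 = 0\<close>, the quotient by \<open>s - 1\<close> has a removable singularity.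
  The case distinction has the shape of \<open>pole_lemma_open\<close>.\<close>

definition V :: "('a => complex) => complex => complex" where
 "V \<xi> = (\<lambda>z. if z = 1 then deriv (Wx \<xi>) 1 else (Wx \<xi> z - Wx \<xi> 1) / (z - 1))"

lemma V_holomorphic: "V \<xi> holomorphic_on ball 2 2"
 unfolding V_def by (rule pole_lemma_open[OF Wx_holomorphic open_ball])

lemma V_eq:
 assumes "\<xi> \<in> chars G" "\<xi> \<noteq> triv_char" "s \<noteq> 1" shows "V \<xi> s = Wx \<xi> s / (s - 1)"
proof -
 have "Wx \<xi> 1 = (\<Sum>A\<in>carrier G. \<xi> A) * \<kappa>" by (simp add: Wx_def W1 sum_distrib_right)
 then have "Wx \<xi> 1 = 0" using sum_char[OF fin assms(1,2)] by simp
 then show ?thesis using assms(3) by (simp add: V_def)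
qed

text \<open>If some \<open>L(1, \<xi>)\<close> vanished, the product of all \<open>L(s, \<xi>)\<close> would have no pole at 1; Landau's theorem
 then bounds its logarithm up to 0, although it dominates \<open>\<Sum> N p powr (- n s)\<close>, where \<open>n\<close> is the group order.\<close>

lemma V_nonzero:
 assumes \<xi>0: "\<xi>0 \<in> chars G" "\<xi>0 \<noteq> triv_char" shows "V \<xi>0 1 \<noteq> 0"
proof
 assume V0: "V \<xi>0 1 = 0"
 \<comment> \<open>The assumed zero of \<open>V \<xi>0\<close> is divided out. In the product of all
   L-series the resulting factor \<open>s - 1\<close> cancels the simple pole of the trivial
   character.\<close>
 define U where "U = (\<lambda>z. if z = 1 then deriv (V \<xi>0) 1 else (V \<xi>0 z - V \<xi>0 1) / (z - 1))"
 have Uh: "U holomorphic_on ball 2 2" unfolding U_def by (rule pole_lemma_open[OF V_holomorphic open_ball])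
 define R where "R = chars G - {triv_char, \<xi>0}"
 define F where "F = (\<lambda>s. Wx triv_char s * U s * (\<Prod>\<xi>\<in>R. V \<xi> s))"
 have Fh: "F holomorphic_on ball 2 2"
  unfolding F_def by (intro holomorphic_intros Wx_holomorphic Uh V_holomorphic)
 define I where "I = {(p, k). p \<in> P \<and> k \<ge> 1 \<and> cl {#p#} [^] (k::nat) = \<one>}"
 define ci where "ci = (\<lambda>(p::'p, k::nat). real h / real k)"
 define mi where "mi = (\<lambda>(p, k::nat). real k * ln (N p))"
 have n: "card (carrier G) > 0" using fin by (auto simp: card_gt_0_iff)
 \<comment> \<open>At \<open>\<sigma> = 1 / n\<close>, with \<open>n\<close> the group order, the
   terms with \<open>k = n\<close> are a fixed multiple of \<open>1 / N p\<close>. By Lagrange these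
   pairs belong to \<open>I\<close> for all primes, so summability contradicts
   \<open>not_summable_all\<close>.\<close>
 have "(\<lambda>i. ci i * exp (- (1 / real (card (carrier G))) * mi i)) summable_on I"
 proof (rule landau_exp[OF _ _ _ Fh])
  show "0 \<le> ci i" if "i \<in> I" for i by (auto simp: ci_def split: prod.split)
  show "0 \<le> mi i" if "i \<in> I" for i
  proof -
   obtain p k where i: "i = (p, k)" "p \<in> P" using \<open>i \<in> I\<close> by (auto simp: I_def)
   then have "ln (N p) \<ge> 0" using N2[of p] by simp
   then show ?thesis by (simp add: mi_def i)
  qed
  show "(\<lambda>i. ci i * exp (- s * mi i)) summable_on I" if "1 < s" "s < 3" for s
  proof -
   have "wt \<one> s summable_on I"
    by (rule summable_on_subset_banach[OF has_sum_imp_summable[OF Lambda_sum_real[OF one_closed that]]]) (auto simp: I_def)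
   then show ?thesis
    by (rule summable_on_cong[THEN iffD1, rotated]) (auto simp: I_def wt_def ci_def mi_def cl1)
  qed
  show "0 < 1 / real (card (carrier G))" using n by simp
  show "1 / real (card (carrier G)) < 2" using n by (simp add: divide_less_eq)
  fix s :: complex assume s: "s \<in> ball 2 1"
  have sb: "s \<in> ball 2 2" using s by simp
  have "\<bar>Re (2 - s)\<bar> < 1" using s abs_Re_le_cmod[of "2 - s"] by (simp add: dist_norm)
  then have sr: "Re s > 1" by simp
  then have s1: "s \<noteq> 1" by auto
  have fc: "finite (chars G)" by (rule finite_chars[OF fin])
  have split: "(\<Prod>\<xi>\<in>chars G. Wx \<xi> s / (s - 1)) = Wx triv_char s / (s - 1) * (Wx \<xi>0 s / (s - 1) * (\<Prod>\<xi>\<in>R. Wx \<xi> s / (s - 1)))"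
  proof -
   have "R = chars G - {triv_char} - {\<xi>0}" by (auto simp: R_def)
   then show ?thesis
    using prod.remove[OF fc triv_char, of "\<lambda>\<xi>. Wx \<xi> s / (s - 1)"]
     prod.remove[of "chars G - {triv_char}" \<xi>0 "\<lambda>\<xi>. Wx \<xi> s / (s - 1)"] fc \<xi>0 by simp
  qed
  have "F s = (\<Prod>\<xi>\<in>chars G. Wx \<xi> s / (s - 1))"
  proof -
   have "(\<Prod>\<xi>\<in>R. Wx \<xi> s / (s - 1)) = (\<Prod>\<xi>\<in>R. V \<xi> s)"
    using V_eq s1 by (intro prod.cong) (auto simp: R_def)
   moreover have "Wx \<xi>0 s / (s - 1) = (s - 1) * U s"
    using V_eq[OF \<xi>0 s1] V0 s1 by (simp add: U_def)
   ultimately show ?thesis unfolding split F_def using s1 by simp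
  qed
  also have "\<dots> = exp (\<Sum>\<xi>\<in>chars G. \<Lambda> s \<xi>)"
   using L_exp[OF _ sb sr] fc by (simp add: exp_sum)
  also have "(\<Sum>\<xi>\<in>chars G. \<Lambda> s \<xi>) = (\<Sum>\<xi>\<in>chars G. \<xi> \<one> * \<Lambda> s \<xi>)" by (intro sum.cong) (auto simp: chars_one)
  also have "\<dots> = (\<Sum>\<^sub>\<infinity>i\<in>I. of_real (ci i) * exp (- s * of_real (mi i)))"
  proof (rule infsumI[symmetric])
   show "((\<lambda>i. of_real (ci i) * exp (- s * of_real (mi i))) has_sum (\<Sum>\<xi>\<in>chars G. \<xi> \<one> * \<Lambda> s \<xi>)) I"
    by (rule has_sum_cong_neutral[THEN iffD1, OF _ _ _ Lambda_sum[OF one_closed sb sr]])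
     (auto simp: I_def ci_def mi_def cl1 split: if_splits)
  qed
  finally show "F s = exp (\<Sum>\<^sub>\<infinity>i\<in>I. of_real (ci i) * exp (- s * of_real (mi i)))" .
 qed
 then have sI: "(\<lambda>i. ci i * exp (- (1 / real (card (carrier G))) * mi i)) summable_on ((\<lambda>p. (p, card (carrier G))) ` P)"
 proof (rule summable_on_subset_banach)
  show "(\<lambda>p. (p, card (carrier G))) ` P \<subseteq> I"
   using n pow_order_eq_1[OF cl1] by (auto simp: I_def Coset.order_def)
 qed
 have inj: "inj_on (\<lambda>p. (p, card (carrier G))) P" by (rule inj_onI) simp
 have "(\<lambda>p. real h / real (card (carrier G)) * (1 / N p)) summable_on P"
 proof (rule summable_on_cong[THEN iffD1, OF _ sI[unfolded summable_on_reindex[OF inj]]])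
  fix p assume p: "p \<in> P"
  have "exp (- ln (N p)) = 1 / N p" using N2[OF p] by (simp add: exp_minus inverse_eq_divide)
  then show "((\<lambda>i. ci i * exp (- (1 / real (card (carrier G))) * mi i)) \<circ> (\<lambda>p. (p, card (carrier G)))) p =
   real h / real (card (carrier G)) * (1 / N p)"
   using n by (simp add: ci_def mi_def)
 qed
 then have "(\<lambda>p. real (card (carrier G)) / real h * (real h / real (card (carrier G)) * (1 / N p))) summable_on P"
  by (rule summable_on_cmult_right)
 then have "(\<lambda>p. 1 / N p) summable_on P" using n h_pos by simp
 then show False using not_summable_all by simp
qed

lemma char_square_one:
 assumes "\<xi> \<in> chars G" "X \<in> carrier G" "X \<otimes> X = \<one>" shows "Im (\<xi> X) = 0"
proof -
 have "\<xi> X * \<xi> X = 1" using chars_mult[OF assms(1,2,2)] assms(3) chars_one[OF assms(1)] by simp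
 then have "\<xi> X = 1 \<or> \<xi> X = -1" by (metis square_eq_1_iff)
 then show ?thesis by auto
qed

text \<open>Since \<open>X\<close> is its own inverse, every \<open>\<xi> X\<close> is 1 or -1.
  Hence the real part of the weighted sum of logarithms involves only absolute values of L-series.
  Near 1 these stay away from 0 and infinity, except for the pole of the trivial character.\<close>

theorem not_summable_class:
 assumes X: "X \<in> carrier G" "X \<otimes> X = \<one>"
 shows "\<not> (\<lambda>p. 1 / N p) summable_on {p \<in> P. cl {#p#} = X}"
proof
 assume S: "(\<lambda>p. 1 / N p) summable_on {p \<in> P. cl {#p#} = X}"
 \<comment> \<open>A majorant independent of \<open>s > 1\<close>: the terms with
   \<open>k = 1\<close> keep only primes in the class \<open>X\<close>, and the terms with
   \<open>k \<ge> 2\<close> of all primes converge by comparison with the squares of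
   \<open>1 / N p\<close>.\<close>
 define u where "u = (\<lambda>(p, k::nat). (if k = 1 then (if cl {#p#} = X then real h * (1 / N p) else 0) else real h * (1 / N p) ^ k))"
 have S2: "(\<lambda>p. (1 / N p) ^ 2) summable_on P"
 proof (rule summable_on_cong[THEN iffD1, OF _ c_summable[OF triv_char, of 2]])
  fix p assume p: "p \<in> P"
  have "exp (- 2 * ln (N p)) = exp (2 * (- ln (N p)))" by simp
  also have "\<dots> = exp (- ln (N p)) ^ 2" by (rule exp_double)
  also have "exp (- ln (N p)) = 1 / N p" using N2[OF p] by (simp add: exp_minus inverse_eq_divide)
  finally show "cmod (c 2 triv_char p) = (1 / N p) ^ 2" using norm_c_le[OF triv_char p, of 2] by simp
 qed simp_all
 have us: "u summable_on (P \<times> {1..})"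
 proof (rule summable_on_SigmaI[where g = "\<lambda>p. (if cl {#p#} = X then real h * (1 / N p) else 0) + real h * (1 / N p) * ((1 / N p) / (1 - 1 / N p))"])
  fix p assume p: "p \<in> P"
  have q: "0 < 1 / N p" "1 / N p \<le> 1 / 2" using N2[OF p] by (auto simp: divide_simps)
  have "((\<lambda>k. (1 / N p) ^ k) has_sum (1 / N p) / (1 - 1 / N p)) {1..}"
   using has_sum_geometric_from_1[of "1 / N p"] q by simp
  then have "((\<lambda>k. real h * (1 / N p) * (1 / N p) ^ k) has_sum real h * (1 / N p) * ((1 / N p) / (1 - 1 / N p))) {1..}"
   by (rule has_sum_cmult_right)
  moreover have "Suc ` {1..} = {2..}"
  proof (intro equalityI subsetI)
   fix x :: nat assume "x \<in> {2..}"
   then have "x = Suc (x - 1)" "x - 1 \<in> {1..}" by auto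
   then show "x \<in> Suc ` {1..}" by blast
  qed auto
  ultimately have "((\<lambda>k. real h * (1 / N p) ^ k) has_sum real h * (1 / N p) * ((1 / N p) / (1 - 1 / N p))) {2..}"
   using has_sum_reindex[of Suc "{1..}" "\<lambda>k. real h * (1 / N p) ^ k" "real h * (1 / N p) * ((1 / N p) / (1 - 1 / N p))"]
   by (simp add: o_def mult.assoc)
  then have h2: "((\<lambda>k. u (p, k)) has_sum real h * (1 / N p) * ((1 / N p) / (1 - 1 / N p))) {2..}"
   by (rule has_sum_cong[THEN iffD1, rotated]) (auto simp: u_def)
  have h1: "((\<lambda>k. u (p, k)) has_sum (if cl {#p#} = X then real h * (1 / N p) else 0)) {1}"
   by (rule has_sum_finiteI) (auto simp: u_def)
  have "{1..} = {1} \<union> {2::nat..}" by auto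
  then show "((\<lambda>k. u (p, k)) has_sum (if cl {#p#} = X then real h * (1 / N p) else 0) + real h * (1 / N p) * ((1 / N p) / (1 - 1 / N p))) {1..}"
   using has_sum_Un_disjoint[OF h1 h2] by simp
  show "0 \<le> u (p, k)" for k using q by (simp add: u_def)
 next
  have "(\<lambda>p. real h * (1 / N p)) summable_on {p \<in> P. cl {#p#} = X}" by (intro summable_on_cmult_right S)
  then have "(\<lambda>p. if cl {#p#} = X then real h * (1 / N p) else 0) summable_on P"
   by (rule summable_on_cong_neutral[THEN iffD1, rotated -1]) auto
  moreover have "(\<lambda>p. real h * (1 / N p) * ((1 / N p) / (1 - 1 / N p))) summable_on P"
  proof (rule summable_on_comparison_test[OF summable_on_cmult_right[OF S2, of "2 * real h"]])
   fix p assume p: "p \<in> P"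
   have q: "0 < 1 / N p" "1 / N p \<le> 1 / 2" using N2[OF p] by (auto simp: divide_simps)
   then show "0 \<le> real h * (1 / N p) * ((1 / N p) / (1 - 1 / N p))" by simp
   have "(1 / N p) / (1 - 1 / N p) \<le> (1 / N p) / (1 / 2)" using q by (intro divide_left_mono) auto
   then have "real h * (1 / N p) * ((1 / N p) / (1 - 1 / N p)) \<le> real h * (1 / N p) * ((1 / N p) / (1 / 2))"
    using q by (intro mult_left_mono) auto
   moreover have "real h * (1 / N p) * ((1 / N p) / (1 / 2)) = 2 * real h * (1 / N p) ^ 2" by (simp add: power2_eq_square)
   ultimately show "real h * (1 / N p) * ((1 / N p) / (1 - 1 / N p)) \<le> 2 * real h * (1 / N p) ^ 2" by simp
  qed
  ultimately show "(\<lambda>p. (if cl {#p#} = X then real h * (1 / N p) else 0) + real h * (1 / N p) * ((1 / N p) / (1 - 1 / N p))) summable_on P"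
   by (rule summable_on_add)
 qed
 define B where "B = infsum u (P \<times> {1..})"
 have bd: "Re (\<Sum>\<xi>\<in>chars G. \<xi> X * \<Lambda> (of_real s) \<xi>) \<le> B" if s: "1 < s" "s < 3" for s
 proof -
  note hs = Lambda_sum_real[OF X(1) s]
  have "infsum (wt X s) (P \<times> {1..}) \<le> B" unfolding B_def
  proof (rule infsum_mono[OF has_sum_imp_summable[OF hs] us])
   fix x assume "x \<in> P \<times> {1::nat..}"
   then obtain p k where x: "x = (p, k)" "p \<in> P" "k \<ge> 1" by auto
   have l: "ln (N p) \<ge> 0" "N p > 0" using N2[OF x(2)] by auto
   have e: "exp (- (real k * ln (N p))) = (1 / N p) ^ k"
    using l by (simp add: exp_minus inverse_eq_divide power_one_over exp_of_nat_mult)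
   have "exp (- s * (real k * ln (N p))) \<le> exp (- (real k * ln (N p)))"
    using s l mult_right_mono[of 1 s "real k * ln (N p)"] by simp
   then have b: "real h / real k * exp (- s * (real k * ln (N p))) \<le> real h * (1 / N p) ^ k"
   proof -
    have "real h / real k \<le> real h / 1" using x by (intro divide_left_mono) auto
    then show ?thesis
     using \<open>exp (- s * (real k * ln (N p))) \<le> exp (- (real k * ln (N p)))\<close> unfolding e
     by (intro mult_mono) auto
   qed
   have g: "cl {#p#} \<in> carrier G" using cl1 x by simp
   have "cl {#p#} = X" if "X \<otimes> cl {#p#} = \<one>"
   proof -
    show ?thesis using inv_unique[OF X(2) that X(1) X(1) g] by simp
   qed
   then show "wt X s x \<le> u x" using b x l g by (auto simp: wt_def u_def)
  qed
  then show ?thesis using infsumI[OF hs] by simp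
 qed
 \<comment> \<open>The part of the sum of logarithms that has a limit at 1. What is split off is
   \<open>- ln (s - 1)\<close>, from the trivial character, which tends to infinity.\<close>
 define H where "H = (\<lambda>s. (\<Sum>\<xi>\<in>chars G - {triv_char}. Re (\<xi> X) * ln (cmod (V \<xi> (of_real s)))) + ln (cmod (Wx triv_char (of_real s))))"
 define H1 where "H1 = (\<Sum>\<xi>\<in>chars G - {triv_char}. Re (\<xi> X) * ln (cmod (V \<xi> 1))) + ln (cmod (Wx triv_char 1))"
 have "(H \<longlongrightarrow> H1) (at_right 1)" unfolding H_def H1_def
  using V_nonzero Wx_triv
  by (intro tendsto_add tendsto_sum tendsto_mult tendsto_const tendsto_ln tendsto_norm tendsto_holomorphic_right V_holomorphic Wx_holomorphic) auto
 then have ev1: "\<forall>\<^sub>F s in at_right 1. H s > H1 - 1" by (rule order_tendstoD) simp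
 have "filterlim (\<lambda>s::real. s - 1) (at_right 0) (at_right 1)"
 proof (unfold filterlim_at, intro conjI)
  show "((\<lambda>s::real. s - 1) \<longlongrightarrow> 0) (at_right 1)" by (auto intro!: tendsto_eq_intros)
  show "\<forall>\<^sub>F s in at_right 1. s - 1 \<in> {0<..} \<and> s - 1 \<noteq> (0::real)"
   using eventually_at_right_less[of "1::real"] by (rule eventually_mono) auto
 qed
 then have "filterlim (\<lambda>s::real. ln (s - 1)) at_bot (at_right 1)" by (rule filterlim_compose[OF ln_at_0])
 then have ev2: "\<forall>\<^sub>F s in at_right (1::real). ln (s - 1) < H1 - 1 - B" by (simp add: filterlim_at_bot_dense)
 have ev3: "\<forall>\<^sub>F s in at_right (1::real). 1 < s \<and> s < 3" by (auto simp: eventually_at_right[of 1 3] intro!: exI[of _ 3])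
 obtain s :: real where s: "H s > H1 - 1" "ln (s - 1) < H1 - 1 - B" "1 < s" "s < 3"
  using eventually_happens'[OF _ eventually_conj[OF ev1 eventually_conj[OF ev2 ev3]]] by auto
 have sb: "complex_of_real s \<in> ball 2 2" "Re (complex_of_real s) > 1" "complex_of_real s \<noteq> 1" using real_in_ball s by auto
 have ReL: "Re (\<Lambda> (of_real s) \<xi>) = ln (cmod (Wx \<xi> (of_real s) / (of_real s - 1)))" if "\<xi> \<in> chars G" for \<xi>
  unfolding L_exp[OF that sb(1,2)] by simp
 have Wnz: "Wx triv_char (of_real s) \<noteq> 0"
  using L_exp[OF triv_char sb(1,2)] by fastforce
 have "cmod (of_real s - 1) = s - 1" using s by (metis abs_of_pos diff_gt_0_iff_gt norm_of_real of_real_1 of_real_diff)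
 then have triv: "Re (\<Lambda> (of_real s) triv_char) = ln (cmod (Wx triv_char (of_real s))) - ln (s - 1)"
  unfolding ReL[OF triv_char] using Wnz s by (simp add: norm_divide ln_div)
 have "Re (\<Sum>\<xi>\<in>chars G. \<xi> X * \<Lambda> (of_real s) \<xi>) = (\<Sum>\<xi>\<in>chars G. Re (\<xi> X) * Re (\<Lambda> (of_real s) \<xi>))"
  using char_square_one[OF _ X] by simp
 also have "\<dots> = Re (triv_char X) * Re (\<Lambda> (of_real s) triv_char) + (\<Sum>\<xi>\<in>chars G - {triv_char}. Re (\<xi> X) * Re (\<Lambda> (of_real s) \<xi>))"
  by (rule sum.remove[OF finite_chars[OF fin] triv_char])
 also have "(\<Sum>\<xi>\<in>chars G - {triv_char}. Re (\<xi> X) * Re (\<Lambda> (of_real s) \<xi>)) = (\<Sum>\<xi>\<in>chars G - {triv_char}. Re (\<xi> X) * ln (cmod (V \<xi> (of_real s))))"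
  using ReL V_eq sb(3) by (intro sum.cong) auto
 also have "Re (triv_char X) = 1" using X by (simp add: triv_char_def)
 finally have "Re (\<Sum>\<xi>\<in>chars G. \<xi> X * \<Lambda> (of_real s) \<xi>) = H s - ln (s - 1)" unfolding triv H_def by simp
 then show False using bd[OF s(3,4)] s(1,2) by simp
qed

end

section \<open>Sums over translates of a lattice\<close>

definition phi :: "complex => complex => complex" where
 "phi s v = of_real (norm v) powr (- 2 * s)"

text \<open>As the origin contributes nothing, sums over whole lattices need no exception for
  it.\<close>

lemma phi_0 [simp]: "phi s 0 = 0"
 by (simp add: phi_def)

lemma phi_exp: "v \<noteq> 0 ==> phi s v = exp (- 2 * s * of_real (ln (norm v)))"
 by (simp add: phi_def powr_def Ln_of_real)

lemma norm_phi: "v \<noteq> 0 ==> norm (phi s v) = norm v powr (- 2 * Re s)"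
 by (simp add: phi_exp powr_def)

lemma phi_mult: "c \<noteq> 0 ==> phi s (c * v) = phi s c * phi s v"
 by (cases "v = 0") (simp_all add: phi_exp norm_mult ln_mult ring_distribs flip: exp_add)

lemma phi_holomorphic: "(\<lambda>s. phi s v) holomorphic_on A"
proof (cases "v = 0")
 case False
 then have "(\<lambda>s. phi s v) = (\<lambda>s. exp (- 2 * s * of_real (ln (norm v))))" by (simp add: phi_exp)
 then show ?thesis by (simp only:) (intro holomorphic_intros)
qed simp

text \<open>A coordinate is recovered from an area: \<open>\<bar>x\<bar>\<close> times the area of
  the basis is \<open>\<bar>Im (z * cnj b)\<bar>\<close>, hence at most
  \<open>norm z * norm b\<close>.\<close>

lemma lat_lower:
 assumes "Im (a * cnj b) \<noteq> 0"
 obtains c where "c > 0" "\<And>x y :: int. c * max \<bar>real_of_int x\<bar> \<bar>real_of_int y\<bar> \<le> norm (of_int x * a + of_int y * b)"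
proof -
 define I where "I = \<bar>Im (a * cnj b)\<bar>"
 have ab: "a \<noteq> 0" "b \<noteq> 0" using assms by auto
 have I: "I > 0" using assms by (simp add: I_def)
 have n: "norm a + norm b > 0" using ab by (simp add: add_pos_pos)
 show thesis
 proof (rule that[of "I / (norm a + norm b)"])
  show "I / (norm a + norm b) > 0" using I n by simp
  fix x y :: int
  let ?z = "of_int x * a + of_int y * b"
  have "Im (?z * cnj b) = of_int x * Im (a * cnj b)" using Im_mult_cnj_comb[of x a y b 0 1] by simp
  then have "\<bar>real_of_int x\<bar> * I = \<bar>Im (?z * cnj b)\<bar>" by (simp only: I_def abs_mult)
  also have "\<dots> \<le> norm (?z * cnj b)" by (rule abs_Im_le_cmod)
  also have "\<dots> = norm ?z * norm b" by (simp only: norm_mult complex_mod_cnj)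
  also have "\<dots> \<le> norm ?z * (norm a + norm b)" by (intro mult_left_mono) auto
  finally have 1: "I * \<bar>real_of_int x\<bar> \<le> norm ?z * (norm a + norm b)" by (simp only: mult.commute)
  have "Im (a * cnj ?z) = of_int y * Im (a * cnj b)" using Im_mult_cnj_comb[of 1 a 0 b x y] by simp
  then have "\<bar>real_of_int y\<bar> * I = \<bar>Im (a * cnj ?z)\<bar>" by (simp only: I_def abs_mult)
  also have "\<dots> \<le> norm (a * cnj ?z)" by (rule abs_Im_le_cmod)
  also have "\<dots> = norm ?z * norm a" by (simp only: norm_mult complex_mod_cnj mult.commute)
  also have "\<dots> \<le> norm ?z * (norm a + norm b)" by (intro mult_left_mono) auto
  finally have 2: "I * \<bar>real_of_int y\<bar> \<le> norm ?z * (norm a + norm b)" by (simp only: mult.commute)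
  have "I * max \<bar>real_of_int x\<bar> \<bar>real_of_int y\<bar> \<le> norm ?z * (norm a + norm b)"
   using 1 2 by (simp only: max_def split: if_split) simp
  then show "I / (norm a + norm b) * max \<bar>real_of_int x\<bar> \<bar>real_of_int y\<bar> \<le> norm ?z"
   using n by (simp add: pos_divide_le_eq)
 qed
qed

definition mx :: "int \<times> int => real" where "mx = (\<lambda>(x, y). max \<bar>real_of_int x\<bar> \<bar>real_of_int y\<bar>)"

lemma mx_nonneg: "mx p \<ge> 0" by (cases p) (simp add: mx_def)

lemma finite_mx_le: "finite {p. mx p \<le> R}"
proof (rule finite_subset)
 show "{p. mx p \<le> R} \<subseteq> {- \<lceil>R\<rceil>..\<lceil>R\<rceil>} \<times> {- \<lceil>R\<rceil>..\<lceil>R\<rceil>}"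
 proof
  fix p assume "p \<in> {p. mx p \<le> R}"
  moreover obtain x y where p: "p = (x, y)" by fastforce
  ultimately have "\<bar>real_of_int x\<bar> \<le> R" "\<bar>real_of_int y\<bar> \<le> R" by (auto simp: mx_def)
  then have "real_of_int \<bar>x\<bar> \<le> of_int \<lceil>R\<rceil>" "real_of_int \<bar>y\<bar> \<le> of_int \<lceil>R\<rceil>"
   using le_of_int_ceiling[of R] by linarith+
  then have "\<bar>x\<bar> \<le> \<lceil>R\<rceil>" "\<bar>y\<bar> \<le> \<lceil>R\<rceil>" by (simp_all only: of_int_le_iff)
  then show "p \<in> {- \<lceil>R\<rceil>..\<lceil>R\<rceil>} \<times> {- \<lceil>R\<rceil>..\<lceil>R\<rceil>}" by (simp add: p abs_le_iff)
 qed
qed simp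

lemma summable_int_powr:
 assumes "q > 1" shows "(\<lambda>x::int. (1 + \<bar>real_of_int x\<bar>) powr (- q)) summable_on UNIV"
proof -
 have "summable (\<lambda>n. real n powr (- q))" using assms by (simp add: summable_real_powr_iff)
 then have "summable (\<lambda>n. real (Suc n) powr (- q))" by (subst summable_Suc_iff)
 then have n: "(\<lambda>n. real (Suc n) powr (- q)) summable_on (UNIV :: nat set)"
  by (intro summable_nonneg_imp_summable_on) auto
 have 1: "(\<lambda>x::int. (1 + \<bar>real_of_int x\<bar>) powr (- q)) summable_on (int ` UNIV)"
  by (subst summable_on_reindex) (use n in \<open>auto simp: o_def add.commute\<close>)
 have 2: "(\<lambda>x::int. (1 + \<bar>real_of_int x\<bar>) powr (- q)) summable_on ((\<lambda>n. - int n) ` UNIV)"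
  by (subst summable_on_reindex) (use n in \<open>auto simp: o_def add.commute inj_on_def\<close>)
 have "x \<in> range int \<union> range (\<lambda>n. - int n)" for x :: int by (cases x rule: int_cases2) auto
 then have "range int \<union> range (\<lambda>n. - int n) = UNIV" by blast
 then show ?thesis using summable_on_union[OF 1 2] by simp
qed

text \<open>Comparison with a product of two one-dimensional series of exponent
  \<open>p / 2 > 1\<close>.\<close>

lemma summable_mx:
 assumes p: "p > 2" shows "(\<lambda>v. (1 + mx v) powr (- p)) summable_on UNIV"
proof -
 define q where "q = p / 2"
 have q: "q > 1" using p by (simp add: q_def)
 define t where "t = (\<lambda>x::int. (1 + \<bar>real_of_int x\<bar>) powr (- q))"
 have t: "(t has_sum infsum t UNIV) UNIV" using summable_int_powr[OF q] by (simp add: t_def)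
 have "(\<lambda>(x, y). t x * t y) summable_on (UNIV \<times> UNIV)"
 proof (rule summable_on_SigmaI)
  show "((\<lambda>y. case (x, y) of (x, y) => t x * t y) has_sum t x * infsum t UNIV) UNIV" for x
   using has_sum_cmult_right[OF t, of "t x"] by simp
  show "(\<lambda>x. t x * infsum t UNIV) summable_on UNIV"
   using has_sum_imp_summable[OF t] by (rule summable_on_cmult_left)
 qed (auto simp: t_def)
 then have "(\<lambda>(x, y). t x * t y) summable_on UNIV" by simp
 then show ?thesis
 proof (rule summable_on_comparison_test)
  fix v :: "int \<times> int"
  obtain x y where v: "v = (x, y)" by fastforce
  have m: "(1 + \<bar>real_of_int x\<bar>) * (1 + \<bar>real_of_int y\<bar>) \<le> (1 + mx v) * (1 + mx v)"
   by (intro mult_mono) (auto simp: v mx_def)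
  have "(1 + mx v) powr (- p) = ((1 + mx v) powr 2) powr (- q)" unfolding powr_powr q_def by simp
  also have "(1 + mx v) powr 2 = (1 + mx v) * (1 + mx v)" using mx_nonneg[of v] by (simp add: power2_eq_square)
  also have "((1 + mx v) * (1 + mx v)) powr (- q) \<le> ((1 + \<bar>real_of_int x\<bar>) * (1 + \<bar>real_of_int y\<bar>)) powr (- q)"
   using m q by (intro powr_mono2') (auto intro!: mult_pos_pos)
  also have "\<dots> = t x * t y" by (simp add: t_def powr_mult)
  finally show "(1 + mx v) powr (- p) \<le> (case v of (x, y) => t x * t y)" by (simp add: v)
 qed simp
qed

definition pt :: "complex => complex => complex => int \<times> int => complex" where
 "pt a b z = (\<lambda>(x, y). z + (of_int x * a + of_int y * b))"

definition coset :: "complex => complex set => complex set" where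
 "coset z L = (\<lambda>v. z + v) ` L"

lemma coset_pt: "coset z (lat a b) = range (pt a b z)"
proof -
 have "lat a b = range (\<lambda>(x, y). of_int x * a + of_int y * b)" by (auto simp: lat_def)
 then show ?thesis by (simp add: coset_def pt_def image_image case_prod_unfold)
qed

lemma inj_pt: assumes "Im (a * cnj b) \<noteq> 0" shows "inj (pt a b z)"
proof (rule injI)
 fix p q assume eq: "pt a b z p = pt a b z q"
 obtain x y x' y' where "p = (x, y)" "q = (x', y')" by fastforce
 moreover from this eq have "of_int x * a + of_int y * b = of_int x' * a + of_int y' * b" by (simp add: pt_def)
 ultimately show "p = q" using lat_coord_unique[OF assms] by simp
qed

text \<open>The constant \<open>c\<close> depends on the lattice only; the shift \<open>z\<close>
  and the radius \<open>R\<close> affect merely the finite set of exceptions.\<close>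

lemma pt_lower:
 assumes ab: "Im (a * cnj b) \<noteq> 0"
 obtains c where "c > 0" "\<And>R z. finite {p. \<not> (c * (1 + mx p) \<le> norm (pt a b z p) \<and> R \<le> norm (pt a b z p))}"
proof -
 obtain c where c: "c > 0" "\<And>x y :: int. c * max \<bar>real_of_int x\<bar> \<bar>real_of_int y\<bar> \<le> norm (of_int x * a + of_int y * b)"
  using lat_lower[OF ab] by blast
 show thesis
 proof (rule that[of "c / 2"])
  fix R and z :: complex
  define T where "T = 2 * (norm z + c / 2 + \<bar>R\<bar>) / c"
  have "{p. \<not> (c / 2 * (1 + mx p) \<le> norm (pt a b z p) \<and> R \<le> norm (pt a b z p))} \<subseteq> {p. mx p \<le> T}"
  proof (rule subsetI, rule ccontr)
   fix p assume p: "p \<in> {p. \<not> (c / 2 * (1 + mx p) \<le> norm (pt a b z p) \<and> R \<le> norm (pt a b z p))}" and "p \<notin> {p. mx p \<le> T}"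
   then have T: "mx p > T" by simp
   obtain x y where xy: "p = (x, y)" by fastforce
   have "c * mx p \<le> norm (of_int x * a + of_int y * b)" using c(2) by (simp add: xy mx_def)
   also have "\<dots> = norm (pt a b z p - z)" by (simp add: pt_def xy)
   also have "\<dots> \<le> norm (pt a b z p) + norm z" by (rule norm_triangle_ineq4)
   finally have 1: "c * mx p - norm z \<le> norm (pt a b z p)" by simp
   have "c * T < c * mx p" using c(1) T by simp
   then have "2 * (norm z + c / 2 + \<bar>R\<bar>) < c * mx p" using c(1) by (simp add: T_def)
   then have big: "2 * norm z + c + 2 * \<bar>R\<bar> < c * mx p" by simp
   have e: "c / 2 * (1 + mx p) = c / 2 + c * mx p / 2" by (simp add: algebra_simps)
   have "c / 2 * (1 + mx p) \<le> norm (pt a b z p)" unfolding e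
    using big 1 c(1) norm_ge_zero[of z] abs_ge_zero[of R] by simp
   moreover have "R \<le> norm (pt a b z p)"
    using big 1 c(1) norm_ge_zero[of z] abs_ge_self[of R] abs_ge_zero[of R] by linarith
   ultimately have "c / 2 * (1 + mx p) \<le> norm (pt a b z p) \<and> R \<le> norm (pt a b z p)" ..
   then show False using p by simp
  qed
  then show "finite {p. \<not> (c / 2 * (1 + mx p) \<le> norm (pt a b z p) \<and> R \<le> norm (pt a b z p))}"
   using finite_mx_le finite_subset by blast
 qed (use c in simp)
qed

lemma summable_cofinite:
 fixes f :: "'a => complex"
 assumes "finite X" "f summable_on (UNIV - X)" shows "f summable_on UNIV"
proof -
 have "f summable_on (UNIV - X) \<union> X" using assms by (intro summable_on_Un_disjoint) auto
 then show ?thesis by simp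
qed

lemma phi_summable_pt:
 assumes ab: "Im (a * cnj b) \<noteq> 0" and s: "Re s > 1"
 shows "(\<lambda>p. phi s (pt a b z p)) summable_on UNIV"
proof -
 obtain c where c: "c > 0" "\<And>R z. finite {p. \<not> (c * (1 + mx p) \<le> norm (pt a b z p) \<and> R \<le> norm (pt a b z p))}"
  using pt_lower[OF ab] by blast
 define X where "X = {p. \<not> (c * (1 + mx p) \<le> norm (pt a b z p) \<and> 1 \<le> norm (pt a b z p))}"
 have "(\<lambda>p. norm (phi s (pt a b z p))) summable_on (UNIV - X)"
 proof (rule Infinite_Sum.abs_summable_on_comparison_test')
  show "(\<lambda>p. c powr (- 2 * Re s) * (1 + mx p) powr (- (2 * Re s))) summable_on (UNIV - X)"
   using summable_on_subset_banach[OF summable_mx[of "2 * Re s"]] s by (intro summable_on_cmult_right) auto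
  fix p assume "p \<in> UNIV - X"
  then have p: "c * (1 + mx p) \<le> norm (pt a b z p)" "1 \<le> norm (pt a b z p)" by (auto simp: X_def)
  have "norm (phi s (pt a b z p)) = norm (pt a b z p) powr (- 2 * Re s)" using p(2) by (intro norm_phi) auto
  also have "\<dots> \<le> (c * (1 + mx p)) powr (- 2 * Re s)"
   using p(1) s c(1) mx_nonneg[of p] by (intro powr_mono2') (auto intro!: mult_pos_pos)
  also have "\<dots> = c powr (- 2 * Re s) * (1 + mx p) powr (- (2 * Re s))" using c(1) mx_nonneg[of p] by (simp add: powr_mult)
  finally show "norm (phi s (pt a b z p)) \<le> c powr (- 2 * Re s) * (1 + mx p) powr (- (2 * Re s))" .
 qed
 then have "(\<lambda>p. phi s (pt a b z p)) summable_on (UNIV - X)" by (rule Infinite_Sum.abs_summable_summable)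
 then show ?thesis using c(2)[of z 1] by (intro summable_cofinite[of X]) (simp_all add: X_def)
qed

definition E :: "complex set => complex => complex" where "E X s = infsum (phi s) X"

lemma E_coset:
 assumes ab: "Im (a * cnj b) \<noteq> 0" and s: "Re s > 1"
 shows "phi s summable_on coset z (lat a b)" "E (coset z (lat a b)) s = (\<Sum>\<^sub>\<infinity>p. phi s (pt a b z p))"
 using phi_summable_pt[OF assms, of z] unfolding E_def coset_pt summable_on_reindex[OF inj_pt[OF ab]] infsum_reindex[OF inj_pt[OF ab]]
 by (simp_all add: o_def)

text \<open>For real \<open>t\<close> the polynomial
  \<open>q t = (v + t * h) * (cnj v + t * cnj h)\<close> is the squared distance
  \<open>\<bar>v + t h\<bar>\<^sup>2\<close>. So \<open>phi s (v + t h)\<close> is a complex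
  differentiable expression in \<open>t\<close> along the segment from -1 to 1, and Taylor's theorem
  applies. The linear terms cancel in the second difference, and the remainder gains a factor of
  order \<open>\<bar>v\<bar>\<close> to the power -2.\<close>

lemma second_difference_bound:
 assumes v: "norm v \<ge> 2 * norm h" "norm v \<ge> 2" and s: "Re s \<ge> \<sigma>" "\<sigma> > 0" "norm s \<le> R"
 shows "norm (phi s (v + h) + phi s (v - h) - 2 * phi s v) \<le>
  2 * ((4 * R * (R + 1) + 2 * R) * (norm h)\<^sup>2 * (norm v / 2) powr (- 2 * \<sigma> - 2))"
proof -
 define S where "S = closed_segment (-1) (1 :: complex)"
 have R0: "R \<ge> 0" using s(3) norm_ge_zero order_trans by blast
 have Sreal: "\<exists>r. t = of_real r \<and> \<bar>r\<bar> \<le> 1" if "t \<in> S" for t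
 proof -
  have "\<exists>u::real. 0 \<le> u \<and> u \<le> 1 \<and> t = (1 - u) *\<^sub>R (-1) + u *\<^sub>R (1 :: complex)"
   using that unfolding S_def in_segment .
  then obtain u :: real where uu: "0 \<le> u \<and> u \<le> 1 \<and> t = (1 - u) *\<^sub>R (-1) + u *\<^sub>R (1 :: complex)" by blast
  note u = uu[THEN conjunct1] uu[THEN conjunct2, THEN conjunct1] uu[THEN conjunct2, THEN conjunct2]
  have "t = of_real (2 * u - 1)" unfolding u(3) by (simp add: complex_eq_iff)
  moreover have "\<bar>2 * u - 1\<bar> \<le> 1" using u(1,2) by simp
  ultimately show ?thesis by blast
 qed
 define q where "q = (\<lambda>t. (v + t * h) * (cnj v + t * cnj h))"
 define q1 where "q1 = (\<lambda>t. h * (cnj v + t * cnj h) + (v + t * h) * cnj h)"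
 define g where "g = (\<lambda>t. exp (- s * Ln (q t)))"
 define g1 where "g1 = (\<lambda>t. - s * (q1 t / q t) * g t)"
 define g2 where "g2 = (\<lambda>t. (s * (s + 1) * (q1 t / q t)\<^sup>2 - s * (2 * h * cnj h / q t)) * g t)"
 have low: "norm (v + t * h) \<ge> norm v / 2" and qt: "q t = of_real ((norm (v + t * h))\<^sup>2)" and
  gt: "g t = phi s (v + t * h)" and nz: "v + t * h \<noteq> 0" if t: "t \<in> S" for t
 proof -
  obtain r where r: "t = of_real r" "\<bar>r\<bar> \<le> 1" using Sreal[OF t] by blast
  have "norm (t * h) \<le> 1 * norm h" unfolding r norm_mult norm_of_real using r(2) by (intro mult_right_mono) auto
  then show l: "norm (v + t * h) \<ge> norm v / 2"
   using v(1) norm_triangle_ineq4[of "v + t * h" "t * h"] by simp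
  have "norm (v + t * h) > 0" using l v(2) by linarith
  then show "v + t * h \<noteq> 0" by auto
  have "q t = (v + t * h) * cnj (v + t * h)" by (simp add: q_def r)
  then show qq: "q t = of_real ((norm (v + t * h))\<^sup>2)" by (simp only: complex_norm_square)
  have "Ln (q t) = of_real (ln ((norm (v + t * h))\<^sup>2))"
   unfolding qq using \<open>norm (v + t * h) > 0\<close> by (intro Ln_of_real) simp
  also have "ln ((norm (v + t * h))\<^sup>2) = 2 * ln (norm (v + t * h))" using \<open>norm (v + t * h) > 0\<close> by (simp add: ln_realpow)
  finally show "g t = phi s (v + t * h)" using \<open>v + t * h \<noteq> 0\<close> by (simp add: g_def phi_exp mult_ac)
 qed
 have qnz: "q t \<noteq> 0" and qslit: "q t \<notin> \<real>\<^sub>\<le>\<^sub>0" if "t \<in> S" for t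
  unfolding qt[OF that] nonpos_Reals_of_real_iff of_real_eq_0_iff using nz[OF that] by (simp_all add: not_le)
 have dq: "(q has_field_derivative q1 t) (at t within S)" for t
  unfolding q_def q1_def by (auto intro!: derivative_eq_intros)
 have dq1: "(q1 has_field_derivative 2 * h * cnj h) (at t within S)" for t
  unfolding q1_def by (auto intro!: derivative_eq_intros)
 have dLn: "((\<lambda>t. Ln (q t)) has_field_derivative (q1 t / q t)) (at t within S)" if "t \<in> S" for t
  using DERIV_chain2[OF has_field_derivative_Ln[OF qslit[OF that]] dq] by (simp add: divide_inverse mult.commute)
 have dg: "(g has_field_derivative g1 t) (at t within S)" if "t \<in> S" for t
  using DERIV_chain2[OF DERIV_exp DERIV_cmult[OF dLn[OF that], of "- s"]]
  unfolding g_def g1_def by (simp add: mult.commute)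
 have dg1: "(g1 has_field_derivative g2 t) (at t within S)" if t: "t \<in> S" for t
 proof -
  have "((\<lambda>t. q1 t / q t) has_field_derivative ((2 * h * cnj h) * q t - q1 t * q1 t) / (q t * q t)) (at t within S)"
   by (rule DERIV_divide[OF dq1 dq qnz[OF t]])
  then have "((\<lambda>t. - s * (q1 t / q t)) has_field_derivative - s * (((2 * h * cnj h) * q t - q1 t * q1 t) / (q t * q t))) (at t within S)"
   by (rule DERIV_cmult)
  from DERIV_mult[OF this dg[OF t]]
  have "(g1 has_field_derivative - s * (((2 * h * cnj h) * q t - q1 t * q1 t) / (q t * q t)) * g t + g1 t * (- s * (q1 t / q t))) (at t within S)"
   unfolding g1_def .
  moreover have "- s * (((2 * h * cnj h) * q t - q1 t * q1 t) / (q t * q t)) * g t + g1 t * (- s * (q1 t / q t)) = g2 t"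
   using qnz[OF t] by (simp add: g1_def g2_def power2_eq_square divide_simps) (simp add: algebra_simps)
  ultimately show ?thesis by simp
 qed
 \<comment> \<open>With \<open>n = \<bar>v + t h\<bar>\<close>, the two summands of the constant
   come from \<open>\<bar>q'/q\<bar> \<le> 2 \<bar>h\<bar> / n\<close>, which enters squared with
   the factor \<open>s (s + 1)\<close>, and from
   \<open>\<bar>q''/q\<bar> = 2 \<bar>h\<bar>\<^sup>2 / n\<^sup>2\<close> with the factor
   \<open>s\<close>.\<close>
 define B where "B = (4 * R * (R + 1) + 2 * R) * (norm h)\<^sup>2 * (norm v / 2) powr (- 2 * \<sigma> - 2)"
 have g2B: "norm (g2 t) \<le> B" if t: "t \<in> S" for t
 proof -
  define n where "n = norm (v + t * h)"
  have n: "n \<ge> norm v / 2" "n \<ge> 1" "n > 0" using low[OF t] v(2) by (auto simp: n_def)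
  obtain r where r: "t = of_real r" using Sreal[OF t] by blast
  have nq: "norm (q t) = n\<^sup>2" unfolding qt[OF t] n_def by (simp only: norm_of_real abs_power2)
  have "norm (cnj v + t * cnj h) = norm (cnj (v + t * h))" by (simp add: r)
  then have "norm (cnj v + t * cnj h) = n" by (simp only: complex_mod_cnj n_def)
  then have "norm (q1 t) \<le> norm h * n + n * norm h"
   unfolding q1_def by (intro norm_triangle_le) (simp add: norm_mult n_def)
  then have "norm (q1 t / q t) \<le> (2 * norm h * n) / n\<^sup>2" unfolding norm_divide nq by (intro divide_right_mono) (auto simp: mult_ac)
  also have "\<dots> = 2 * norm h / n" using n(3) by (simp add: power2_eq_square)
  finally have "(norm (q1 t / q t))\<^sup>2 \<le> (2 * norm h / n)\<^sup>2" by (intro power_mono) auto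
  also have "\<dots> = 4 * (norm h)\<^sup>2 / n\<^sup>2" by (simp add: power_divide power_mult_distrib)
  finally have 1: "norm ((q1 t / q t)\<^sup>2) \<le> 4 * (norm h)\<^sup>2 / n\<^sup>2" by (simp only: norm_power)
  have 2: "norm (2 * h * cnj h / q t) = 2 * (norm h)\<^sup>2 / n\<^sup>2" by (simp add: norm_divide nq norm_mult power2_eq_square)
  have ss: "norm (s * (s + 1)) \<le> R * (R + 1)"
   unfolding norm_mult using s(3) R0 norm_triangle_ineq[of s 1] by (intro mult_mono) auto
  have "norm (s * (s + 1) * (q1 t / q t)\<^sup>2 - s * (2 * h * cnj h / q t)) \<le> norm (s * (s + 1)) * norm ((q1 t / q t)\<^sup>2) + norm s * norm (2 * h * cnj h / q t)"
   using norm_triangle_ineq4[of "s * (s + 1) * (q1 t / q t)\<^sup>2" "s * (2 * h * cnj h / q t)"] by (simp only: norm_mult)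
  also have "\<dots> \<le> R * (R + 1) * (4 * (norm h)\<^sup>2 / n\<^sup>2) + R * (2 * (norm h)\<^sup>2 / n\<^sup>2)"
   unfolding 2 using ss 1 s(3) R0 by (intro add_mono mult_mono) auto
  also have "\<dots> = (4 * R * (R + 1) + 2 * R) * (norm h)\<^sup>2 / n\<^sup>2" by (simp add: add_divide_distrib algebra_simps)
  finally have A: "norm (s * (s + 1) * (q1 t / q t)\<^sup>2 - s * (2 * h * cnj h / q t)) \<le> (4 * R * (R + 1) + 2 * R) * (norm h)\<^sup>2 / n\<^sup>2" .
  have ng: "norm (g t) = n powr (- 2 * Re s)" unfolding gt[OF t] n_def by (rule norm_phi[OF nz[OF t]])
  also have "\<dots> \<le> n powr (- 2 * \<sigma>)" using n s(1) by (intro powr_mono) auto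
  finally have "norm (g2 t) \<le> ((4 * R * (R + 1) + 2 * R) * (norm h)\<^sup>2 / n\<^sup>2) * n powr (- 2 * \<sigma>)"
   unfolding g2_def norm_mult using A R0 by (intro mult_mono) auto
  also have "\<dots> = (4 * R * (R + 1) + 2 * R) * (norm h)\<^sup>2 * (n powr (- 2 * \<sigma>) / n\<^sup>2)"
   by simp
  also have "n powr (- 2 * \<sigma>) / n\<^sup>2 = n powr (- 2 * \<sigma> - 2)"
   unfolding powr_diff using powr_numeral[of n "num.Bit0 num.One"] n(3) by simp
  also have "(4 * R * (R + 1) + 2 * R) * (norm h)\<^sup>2 * n powr (- 2 * \<sigma> - 2) \<le> B" unfolding B_def
  proof (rule mult_left_mono)
   show "n powr (- 2 * \<sigma> - 2) \<le> (norm v / 2) powr (- 2 * \<sigma> - 2)" using n(1) v(2) s(2) by (intro powr_mono2') auto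
  qed (use R0 in auto)
  finally show ?thesis .
 qed
 have conv: "convex S" by (simp add: S_def)
 have in_S: "0 \<in> S" "1 \<in> S" "-1 \<in> S"
 proof -
  have "(0::complex) = (1 - 1/2) *\<^sub>R (-1) + (1/2) *\<^sub>R 1" by simp
  then show "0 \<in> S" unfolding S_def in_segment by (intro exI[of _ "1/2"] conjI) auto
 qed (auto simp: S_def)
 define f where "f = (\<lambda>i::nat. if i = 0 then g else if i = 1 then g1 else g2)"
 have taylor: "norm (g z - (g 0 + g1 0 * z)) \<le> B * norm z ^ 2" if "z \<in> S" for z
 proof -
  have "norm (f 0 z - (\<Sum>i\<le>1. f i 0 * (z - 0) ^ i / fact i)) \<le> B * norm (z - 0) ^ Suc 1 / fact 1"
  proof (rule complex_Taylor[OF conv _ _ in_S(1) that])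
   show "(f i has_field_derivative f (Suc i) x) (at x within S)" if "x \<in> S" "i \<le> 1" for i x
    using that dg dg1 by (cases i) (auto simp: f_def)
   show "norm (f (Suc 1) x) \<le> B" if "x \<in> S" for x using g2B[OF that] by (simp add: f_def)
  qed
  then show ?thesis by (simp add: f_def power2_eq_square)
 qed
 have "norm (g 1 - (g 0 + g1 0 * 1)) \<le> B" "norm (g (-1) - (g 0 + g1 0 * (-1))) \<le> B"
  using taylor[OF in_S(2)] taylor[OF in_S(3)] by simp_all
 then have "norm ((g 1 - (g 0 + g1 0 * 1)) + (g (-1) - (g 0 + g1 0 * (-1)))) \<le> B + B" by (rule norm_triangle_mono)
 moreover have "(g 1 - (g 0 + g1 0 * 1)) + (g (-1) - (g 0 + g1 0 * (-1))) = phi s (v + h) + phi s (v - h) - 2 * phi s v"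
  using gt[OF in_S(1)] gt[OF in_S(2)] gt[OF in_S(3)] by simp
 ultimately show ?thesis by (simp add: B_def mult_ac)
qed

section \<open>The pole of the zeta function of a lattice\<close>

text \<open>The majorant is demanded only off a finite set, because the estimates for lattice sums
  fail near the origin; the finitely many remaining terms are holomorphic by themselves.\<close>

lemma holomorphic_infsum_cofinite:
 fixes f :: "'a => complex => complex"
 assumes hol: "\<And>p. f p holomorphic_on {s. Re s > 0}" and X: "finite X"
  and bd: "\<And>\<sigma> R. \<sigma> > 0 ==> \<exists>M. M summable_on (UNIV - X) \<and> (\<forall>p\<in>UNIV - X. \<forall>s. Re s \<ge> \<sigma> \<and> norm s \<le> R --> norm (f p s) \<le> (M p :: real))"
 shows "(\<lambda>s. infsum (\<lambda>p. f p s) UNIV) holomorphic_on {s. Re s > 0}"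
  and "\<And>s. Re s > 0 ==> (\<lambda>p. f p s) summable_on UNIV"
proof -
 have op: "open {s. Re s > 0}" using open_halfspace_Re_gt[of 0] by simp
 have sm: "(\<lambda>p. f p s) summable_on (UNIV - X)" if s: "Re s > 0" for s
 proof -
  obtain M where M: "M summable_on (UNIV - X)" "\<forall>p\<in>UNIV - X. \<forall>t. Re t \<ge> Re s \<and> norm t \<le> norm s --> norm (f p t) \<le> (M p :: real)"
   using bd[OF s] by blast
  have "(\<lambda>p. norm (f p s)) summable_on (UNIV - X)"
   by (rule Infinite_Sum.abs_summable_on_comparison_test'[OF M(1)]) (use M(2) in auto)
  then show ?thesis by (rule Infinite_Sum.abs_summable_summable)
 qed
 then show sU: "(\<lambda>p. f p s) summable_on UNIV" if "Re s > 0" for s using summable_cofinite[OF X] that by simp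
 have h: "(\<lambda>s. infsum (\<lambda>p. f p s) (UNIV - X)) holomorphic_on {s. Re s > 0}"
 proof (rule holomorphic_on_open[THEN iffD2, OF op], intro ballI)
  fix z :: complex assume "z \<in> {s. Re s > 0}"
  then have z: "Re z > 0" by simp
  define r where "r = Re z / 2"
  have r: "r > 0" using z by (simp add: r_def)
  have cb: "Re s \<ge> r \<and> norm s \<le> norm z + r" if "s \<in> cball z r" for s
  proof -
   have d: "norm (z - s) \<le> r" using that by (simp add: dist_norm)
   have "Re z - Re s \<le> r" using d abs_Re_le_cmod[of "z - s"] by simp
   moreover have "norm s \<le> norm z + norm (z - s)" using norm_triangle_ineq4[of z "z - s"] by simp
   ultimately show ?thesis using d by (auto simp: r_def)
  qed
  obtain M where M: "M summable_on (UNIV - X)" "\<forall>p\<in>UNIV - X. \<forall>t. Re t \<ge> r \<and> norm t \<le> norm z + r --> norm (f p t) \<le> (M p :: real)"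
   using bd[OF r] by blast
  have ul: "uniform_limit (cball z r) (\<lambda>F s. \<Sum>p\<in>F. f p s) (\<lambda>s. infsum (\<lambda>p. f p s) (UNIV - X)) (finite_subsets_at_top (UNIV - X))"
   by (rule Weierstrass_m_test_general[OF _ M(1)]) (use M(2) cb in blast)
  have sub: "cball z r \<subseteq> {s. Re s > 0}" using cb r by force
  have "\<forall>\<^sub>F F in finite_subsets_at_top (UNIV - X). continuous_on (cball z r) (\<lambda>s. \<Sum>p\<in>F. f p s) \<and> (\<lambda>s. \<Sum>p\<in>F. f p s) holomorphic_on ball z r"
  proof (intro always_eventually allI conjI)
   fix F
   have hF: "(\<lambda>s. \<Sum>p\<in>F. f p s) holomorphic_on {s. Re s > 0}" by (intro holomorphic_on_sum hol)
   then show "continuous_on (cball z r) (\<lambda>s. \<Sum>p\<in>F. f p s)" using sub holomorphic_on_imp_continuous_on continuous_on_subset by blast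
   show "(\<lambda>s. \<Sum>p\<in>F. f p s) holomorphic_on ball z r" using hF sub ball_subset_cball holomorphic_on_subset by blast
  qed
  from holomorphic_uniform_limit[OF this ul]
  have "(\<lambda>s. infsum (\<lambda>p. f p s) (UNIV - X)) holomorphic_on ball z r" by auto
  then have "(\<lambda>s. infsum (\<lambda>p. f p s) (UNIV - X)) field_differentiable (at z)"
   using r holomorphic_on_imp_differentiable_at by simp
  then show "\<exists>f'. ((\<lambda>s. infsum (\<lambda>p. f p s) (UNIV - X)) has_field_derivative f') (at z)"
   by (auto simp: field_differentiable_def)
 qed
 have "(\<lambda>s. infsum (\<lambda>p. f p s) (UNIV - X) + (\<Sum>p\<in>X. f p s)) holomorphic_on {s. Re s > 0}"
  by (intro holomorphic_on_add h holomorphic_on_sum hol)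
 then show "(\<lambda>s. infsum (\<lambda>p. f p s) UNIV) holomorphic_on {s. Re s > 0}"
 proof (rule holomorphic_transform)
  fix s :: complex assume "s \<in> {s. Re s > 0}"
  then have "(\<lambda>p. f p s) summable_on (UNIV - X)" using sm by simp
  then have "infsum (\<lambda>p. f p s) ((UNIV - X) \<union> X) = infsum (\<lambda>p. f p s) (UNIV - X) + infsum (\<lambda>p. f p s) X"
   using X by (intro infsum_Un_disjoint) auto
  then show "infsum (\<lambda>p. f p s) (UNIV - X) + (\<Sum>p\<in>X. f p s) = infsum (\<lambda>p. f p s) UNIV" using X by simp
 qed
qed

text \<open>The exponent \<open>2 \<sigma> + 2 > 2\<close> makes the sum of the second differences
  converge for every \<open>\<sigma> > 0\<close>, although the three series are used separately only
  for \<open>Re s > 1\<close>.\<close>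

lemma second_difference_holomorphic:
 assumes ab: "Im (a * cnj b) \<noteq> 0"
 obtains H where "H holomorphic_on {s. Re s > 0}"
  "\<And>s. Re s > 1 ==> E (coset (z + h) (lat a b)) s + E (coset (z - h) (lat a b)) s - 2 * E (coset z (lat a b)) s = H s"
proof -
 obtain c where c: "c > 0" "\<And>R z. finite {p. \<not> (c * (1 + mx p) \<le> norm (pt a b z p) \<and> R \<le> norm (pt a b z p))}"
  using pt_lower[OF ab] by blast
 define X where "X = {p. \<not> (c * (1 + mx p) \<le> norm (pt a b z p) \<and> 2 + 2 * norm h \<le> norm (pt a b z p))}"
 define f where "f = (\<lambda>p s. phi s (pt a b z p + h) + phi s (pt a b z p - h) - 2 * phi s (pt a b z p))"
 have hol: "f p holomorphic_on {s. Re s > 0}" for p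
  unfolding f_def by (intro holomorphic_intros phi_holomorphic)
 have X: "finite X" unfolding X_def by (rule c(2))
 have bd: "\<exists>M. M summable_on (UNIV - X) \<and> (\<forall>p\<in>UNIV - X. \<forall>s. Re s \<ge> \<sigma> \<and> norm s \<le> R --> norm (f p s) \<le> (M p :: real))"
  if \<sigma>: "\<sigma> > 0" for \<sigma> R
 proof (intro exI conjI ballI allI impI)
  define C where "C = 2 * ((4 * R * (R + 1) + 2 * R) * (norm h)\<^sup>2)"
  show "(\<lambda>p. C * ((c / 2) powr (- 2 * \<sigma> - 2) * (1 + mx p) powr (- (2 * \<sigma> + 2)))) summable_on (UNIV - X)"
   using summable_on_subset_banach[OF summable_mx[of "2 * \<sigma> + 2"]] \<sigma> by (intro summable_on_cmult_right) auto
  fix p s assume p: "p \<in> UNIV - X" and s: "\<sigma> \<le> Re s \<and> norm s \<le> R"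
  have pl: "c * (1 + mx p) \<le> norm (pt a b z p)" "2 + 2 * norm h \<le> norm (pt a b z p)" using p by (auto simp: X_def)
  have R0: "R \<ge> 0" using s norm_ge_zero order_trans by blast
  have "norm (f p s) \<le> 2 * ((4 * R * (R + 1) + 2 * R) * (norm h)\<^sup>2 * (norm (pt a b z p) / 2) powr (- 2 * \<sigma> - 2))"
   unfolding f_def
  proof (rule second_difference_bound)
   show "2 * norm h \<le> norm (pt a b z p)" using pl(2) by simp
   show "2 \<le> norm (pt a b z p)" using pl(2) norm_ge_zero[of h] by linarith
  qed (use s \<sigma> in auto)
  also have "\<dots> = C * (norm (pt a b z p) / 2) powr (- 2 * \<sigma> - 2)" by (simp add: C_def)
  also have "\<dots> \<le> C * (c / 2 * (1 + mx p)) powr (- 2 * \<sigma> - 2)"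
  proof (intro mult_left_mono powr_mono2')
   show "0 < c / 2 * (1 + mx p)" using c(1) mx_nonneg[of p] by (intro mult_pos_pos) auto
   show "c / 2 * (1 + mx p) \<le> norm (pt a b z p) / 2" using pl(1) by simp
   show "0 \<le> C" using R0 by (simp add: C_def)
  qed (use \<sigma> in simp)
  also have "(c / 2 * (1 + mx p)) powr (- 2 * \<sigma> - 2) = (c / 2) powr (- 2 * \<sigma> - 2) * (1 + mx p) powr (- (2 * \<sigma> + 2))"
  proof -
   have e: "- (2 * \<sigma> + 2) = - 2 * \<sigma> - 2" by simp
   show ?thesis unfolding e by (rule powr_mult)
  qed
  finally show "norm (f p s) \<le> C * ((c / 2) powr (- 2 * \<sigma> - 2) * (1 + mx p) powr (- (2 * \<sigma> + 2)))" .
 qed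
 show thesis
 proof (rule that)
  show "(\<lambda>s. infsum (\<lambda>p. f p s) UNIV) holomorphic_on {s. Re s > 0}" by (rule holomorphic_infsum_cofinite(1)[OF hol X bd])
  fix s :: complex assume s: "Re s > 1"
  have sh: "pt a b (z + h) p = pt a b z p + h" "pt a b (z - h) p = pt a b z p - h" for p
   by (simp_all add: pt_def split: prod.split)
  have hs: "((\<lambda>p. phi s (pt a b y p)) has_sum E (coset y (lat a b)) s) UNIV" for y
   unfolding E_coset(2)[OF ab s] using phi_summable_pt[OF ab s] by simp
  have "((\<lambda>p. phi s (pt a b (z + h) p) + phi s (pt a b (z - h) p) + (- 2) * phi s (pt a b z p)) has_sum
   (E (coset (z + h) (lat a b)) s + E (coset (z - h) (lat a b)) s + (- 2) * E (coset z (lat a b)) s)) UNIV"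
   by (intro has_sum_add has_sum_cmult_right hs)
  moreover have "(\<lambda>p. phi s (pt a b (z + h) p) + phi s (pt a b (z - h) p) + (- 2) * phi s (pt a b z p)) = (\<lambda>p. f p s)"
   by (simp add: f_def sh)
  ultimately have "((\<lambda>p. f p s) has_sum (E (coset (z + h) (lat a b)) s + E (coset (z - h) (lat a b)) s + (- 2) * E (coset z (lat a b)) s)) UNIV"
   by simp
  then show "E (coset (z + h) (lat a b)) s + E (coset (z - h) (lat a b)) s - 2 * E (coset z (lat a b)) s = infsum (\<lambda>p. f p s) UNIV"
   using infsumI by fastforce
 qed
qed

lemma coset_shift: "v \<in> lat a b ==> coset (z + v) (lat a b) = coset z (lat a b)"
proof -
 have sub: "coset (z + v) (lat a b) \<subseteq> coset z (lat a b)" if "v \<in> lat a b" for z v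
  using that subspace_add[OF subspace_lat] by (auto simp: coset_def add.assoc)
 assume v: "v \<in> lat a b"
 then have "coset ((z + v) + (- v)) (lat a b) \<subseteq> coset (z + v) (lat a b)" by (intro sub subspace_uminus subspace_lat)
 then show ?thesis using sub[OF v, of z] by simp
qed

text \<open>The second differences of the function E along the multiples of a torsion point are holomorphic;
 as the first differences sum to zero over a period, they are holomorphic as well.\<close>

lemma torsion_difference_holomorphic:
 assumes ab: "Im (a * cnj b) \<noteq> 0" and N: "N > 0" "of_nat N * h \<in> lat a b"
 obtains H where "H holomorphic_on {s. Re s > 0}"
  "\<And>s. Re s > 1 ==> E (coset (z + h) (lat a b)) s = E (coset z (lat a b)) s + H s"
proof -
 define e where "e = (\<lambda>j::nat. E (coset (z + of_nat j * h) (lat a b)))"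
 have "\<exists>H. H holomorphic_on {s. Re s > 0} \<and> (\<forall>s. Re s > 1 --> e (Suc (Suc j)) s + e j s - 2 * e (Suc j) s = H s)" for j
 proof -
  obtain H where H: "H holomorphic_on {s. Re s > 0}"
   "\<And>s. Re s > 1 ==> E (coset ((z + of_nat (Suc j) * h) + h) (lat a b)) s + E (coset ((z + of_nat (Suc j) * h) - h) (lat a b)) s - 2 * E (coset (z + of_nat (Suc j) * h) (lat a b)) s = H s"
   using second_difference_holomorphic[OF ab] by blast
  have "z + of_nat (Suc j) * h + h = z + of_nat (Suc (Suc j)) * h" "z + of_nat (Suc j) * h - h = z + of_nat j * h"
   by (simp_all add: algebra_simps)
  then show ?thesis using H unfolding e_def by metis
 qed
 then obtain \<delta> where \<delta>: "\<And>j. \<delta> j holomorphic_on {s. Re s > 0}"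
  "\<And>j s. Re s > 1 ==> e (Suc (Suc j)) s + e j s - 2 * e (Suc j) s = \<delta> j s" by metis
 have d: "e (Suc j) s - e j s = (e 1 s - e 0 s) + (\<Sum>i<j. \<delta> i s)" if s: "Re s > 1" for j s
 proof (induction j)
  case (Suc j)
  have "e (Suc (Suc j)) s - e (Suc j) s = (e (Suc j) s - e j s) + \<delta> j s" using \<delta>(2)[OF s, of j] by (simp add: algebra_simps)
  then show ?case using Suc by simp
 qed simp
 have per: "e N = e 0" unfolding e_def using coset_shift[OF N(2), of z] by simp
 define H where "H = (\<lambda>s. - (\<Sum>j<N. \<Sum>i<j. \<delta> i s) / of_nat N)"
 show thesis
 proof (rule that)
  show "H holomorphic_on {s. Re s > 0}" unfolding H_def using N(1) by (intro holomorphic_intros \<delta>) auto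
  fix s :: complex assume s: "Re s > 1"
  have "(\<Sum>j<N. e (Suc j) s - e j s) = e N s - e 0 s" by (rule sum_lessThan_telescope)
  then have "0 = of_nat N * (e 1 s - e 0 s) + (\<Sum>j<N. \<Sum>i<j. \<delta> i s)"
   unfolding d[OF s] by (simp add: per sum.distrib)
  then have "of_nat N * (e 1 s - e 0 s) = - (\<Sum>j<N. \<Sum>i<j. \<delta> i s)" by (metis add.commute add_eq_0_iff)
  then have "e 1 s - e 0 s = H s" using N(1) by (simp add: H_def field_simps)
  then show "E (coset (z + h) (lat a b)) s = E (coset z (lat a b)) s + H s" by (simp add: e_def algebra_simps)
 qed
qed

text \<open>At most a simple pole at 1, with residue \<open>\<kappa>\<close>, for the sum of
  \<open>phi s\<close> over \<open>X\<close>, continued to the disc that \<open>landau_exp\<close>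
  asks for. The value \<open>\<kappa> = 0\<close> is allowed and means regularity at 1.\<close>

definition pole :: "complex set => complex => bool" where
 "pole X \<kappa> \<longleftrightarrow> (\<exists>W. W holomorphic_on ball 2 2 \<and> W 1 = \<kappa> \<and>
   (\<forall>s\<in>ball 2 2. Re s > 1 --> (phi s has_sum (W s / (s - 1))) X))"

lemma ball22_Re: "s \<in> ball (2::complex) 2 ==> Re s > 0"
 using abs_Re_le_cmod[of "2 - s"] by (simp add: dist_norm)

lemma ball22_sub: "ball (2::complex) 2 \<subseteq> {s. Re s > 0}"
 using ball22_Re by blast

lemma pole_torsion:
 assumes ab: "Im (a * cnj b) \<noteq> 0" and N: "N > 0" "of_nat N * z \<in> lat a b" and p: "pole (lat a b) \<kappa>"
 shows "pole (coset z (lat a b)) \<kappa>"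
proof -
 obtain W where W: "W holomorphic_on ball 2 2" "W 1 = \<kappa>" "\<And>s. s \<in> ball 2 2 ==> Re s > 1 ==> (phi s has_sum (W s / (s - 1))) (lat a b)"
  using p unfolding pole_def by blast
 obtain H where H: "H holomorphic_on {s. Re s > 0}" "\<And>s. Re s > 1 ==> E (coset (0 + z) (lat a b)) s = E (coset 0 (lat a b)) s + H s"
  using torsion_difference_holomorphic[OF ab N] by blast
 show ?thesis unfolding pole_def
 proof (intro exI conjI ballI impI)
  show "(\<lambda>s. W s + (s - 1) * H s) holomorphic_on ball 2 2"
   by (intro holomorphic_intros W holomorphic_on_subset[OF H(1) ball22_sub])
  show "W 1 + (1 - 1) * H 1 = \<kappa>" using W by simp
  fix s :: complex assume s: "s \<in> ball 2 2" "Re s > 1"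
  have "coset 0 (lat a b) = lat a b" by (simp add: coset_def)
  then have "E (coset z (lat a b)) s = W s / (s - 1) + H s"
   using H(2)[OF s(2)] infsumI[OF W(3)[OF s]] by (simp add: E_def)
  also have "\<dots> = (W s + (s - 1) * H s) / (s - 1)"
  proof -
   have "s - 1 \<noteq> 0" using s(2) by auto
   then show ?thesis by (simp add: add_divide_distrib)
  qed
  finally show "(phi s has_sum ((W s + (s - 1) * H s) / (s - 1))) (coset z (lat a b))"
   using E_coset(1)[OF ab s(2), of z] by (simp add: E_def has_sum_iff)
 qed
qed

lemma pole_scale:
 assumes "pole X \<kappa>" "c \<noteq> 0" shows "pole (sc c X) (\<kappa> / of_real ((norm c)\<^sup>2))"
proof -
 obtain W where W: "W holomorphic_on ball 2 2" "W 1 = \<kappa>" "\<And>s. s \<in> ball 2 2 ==> Re s > 1 ==> (phi s has_sum (W s / (s - 1))) X"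
  using assms(1) unfolding pole_def by blast
 show ?thesis unfolding pole_def
 proof (intro exI conjI ballI impI)
  show "(\<lambda>s. phi s c * W s) holomorphic_on ball 2 2" by (intro holomorphic_intros phi_holomorphic W)
  have "phi 1 c = of_real (norm c powr (- 2))" unfolding phi_def using powr_of_real[of "norm c" "- 2"] by simp
  also have "norm c powr (- 2) = 1 / (norm c)\<^sup>2" using assms(2) by (simp add: powr_minus_divide)
  finally show "phi 1 c * W 1 = \<kappa> / of_real ((norm c)\<^sup>2)" using W(2) by simp
  fix s :: complex assume s: "s \<in> ball 2 2" "Re s > 1"
  have inj: "inj_on (\<lambda>v. c * v) X" using assms(2) by (auto intro: inj_onI)
  have "((\<lambda>v. phi s c * phi s v) has_sum phi s c * (W s / (s - 1))) X" by (intro has_sum_cmult_right W s)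
  moreover have "phi s \<circ> (\<lambda>v. c * v) = (\<lambda>v. phi s c * phi s v)" using assms(2) by (auto simp: phi_mult)
  ultimately show "(phi s has_sum (phi s c * W s / (s - 1))) (sc c X)"
   unfolding has_sum_reindex[OF inj] by simp
 qed
qed

lemma pole_UN:
 assumes "finite I" "\<And>i. i \<in> I ==> pole (X i) (\<kappa> i)" "\<And>i j. i \<in> I ==> j \<in> I ==> i \<noteq> j ==> X i \<inter> X j = {}"
 shows "pole (\<Union>i\<in>I. X i) (\<Sum>i\<in>I. \<kappa> i)"
proof -
 have "\<forall>i\<in>I. \<exists>W. W holomorphic_on ball 2 2 \<and> W 1 = \<kappa> i \<and> (\<forall>s\<in>ball 2 2. Re s > 1 --> (phi s has_sum (W s / (s - 1))) (X i))"
  using assms(2) unfolding pole_def by simp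
 then obtain W where W: "\<And>i. i \<in> I ==> W i holomorphic_on ball 2 2" "\<And>i. i \<in> I ==> W i 1 = \<kappa> i"
  "\<And>i s. i \<in> I ==> s \<in> ball 2 2 ==> Re s > 1 ==> (phi s has_sum (W i s / (s - 1))) (X i)" by metis
 show ?thesis unfolding pole_def
 proof (intro exI conjI ballI impI)
  show "(\<lambda>s. \<Sum>i\<in>I. W i s) holomorphic_on ball 2 2" by (intro holomorphic_intros W)
  show "(\<Sum>i\<in>I. W i 1) = (\<Sum>i\<in>I. \<kappa> i)" using W by simp
  fix s :: complex assume s: "s \<in> ball 2 2" "Re s > 1"
  have "(phi s has_sum (\<Sum>i\<in>I. W i s / (s - 1))) (\<Union>i\<in>I. X i)"
   by (rule sum_has_sum[OF assms(1) W(3)[OF _ s] assms(3)])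
  then show "(phi s has_sum ((\<Sum>i\<in>I. W i s) / (s - 1))) (\<Union>i\<in>I. X i)" by (simp add: sum_divide_distrib)
 qed
qed

lemma pole_unique:
 assumes "pole X \<kappa>" "pole X \<kappa>'" shows "\<kappa> = \<kappa>'"
proof -
 obtain W where W: "W holomorphic_on ball 2 2" "W 1 = \<kappa>" "\<And>s. s \<in> ball 2 2 ==> Re s > 1 ==> (phi s has_sum (W s / (s - 1))) X"
  using assms(1) unfolding pole_def by blast
 obtain W' where W': "W' holomorphic_on ball 2 2" "W' 1 = \<kappa>'" "\<And>s. s \<in> ball 2 2 ==> Re s > 1 ==> (phi s has_sum (W' s / (s - 1))) X"
  using assms(2) unfolding pole_def by blast
 have "W s = W' s" if s: "s \<in> ball 2 2" "Re s > 1" for s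
 proof -
  have "W s / (s - 1) = W' s / (s - 1)" using W(3)[OF s] W'(3)[OF s] has_sum_unique by blast
  moreover have "s - 1 \<noteq> 0" using s(2) by auto
  ultimately show ?thesis by simp
 qed
 moreover have "open (ball (2::complex) 2 \<inter> {s. Re s > 1})" using open_halfspace_Re_gt[of 1] by (intro open_Int) auto
 moreover have "(2::complex) \<in> ball 2 2 \<inter> {s. Re s > 1}" by simp
 moreover have "(1::complex) \<in> ball 2 2" by (simp add: dist_norm)
 ultimately have "W 1 = W' 1"
  by (intro analytic_continuation_open[of "ball 2 2 \<inter> {s. Re s > 1}" "ball 2 2" W W' 1] W(1) W'(1)) blast+
 then show ?thesis using W(2) W'(2) by simp
qed

text \<open>Without a pole the function has a finite limit as real \<open>s\<close> decreases to 1.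
  By nonnegativity that limit bounds all finite partial sums at \<open>s = 1\<close>.\<close>

lemma pole_mono_divergent:
 assumes p: "pole X 0" shows "\<exists>C. \<forall>F. finite F \<and> F \<subseteq> X \<and> 0 \<notin> F --> (\<Sum>v\<in>F. 1 / (norm v)\<^sup>2) \<le> C"
proof -
 obtain W where W: "W holomorphic_on ball 2 2" "W 1 = 0" "\<And>s. s \<in> ball 2 2 ==> Re s > 1 ==> (phi s has_sum (W s / (s - 1))) X"
  using p unfolding pole_def by blast
 define V where "V = (\<lambda>z. if z = 1 then deriv W 1 else (W z - W 1) / (z - 1))"
 have V: "V holomorphic_on ball 2 2" unfolding V_def by (rule pole_lemma_open[OF W(1) open_ball])
 have "(1::complex) \<in> ball 2 2" by (simp add: dist_norm)
 then have "isCont V 1" using V holomorphic_on_imp_continuous_on continuous_on_eq_continuous_at open_ball by blast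
 moreover have "((\<lambda>s::real. complex_of_real s) \<longlongrightarrow> of_real 1) (at_right 1)" by (intro tendsto_intros)
 then have "((\<lambda>s::real. complex_of_real s) \<longlongrightarrow> 1) (at_right 1)" by simp
 ultimately have lim: "((\<lambda>s::real. V (complex_of_real s)) \<longlongrightarrow> V 1) (at_right 1)" by (rule isCont_tendsto_compose)
 have "(\<Sum>v\<in>F. 1 / (norm v)\<^sup>2) \<le> Re (V 1)" if F: "finite F" "F \<subseteq> X" "0 \<notin> F" for F
 proof (rule tendsto_le[OF _ tendsto_Re[OF lim]])
  have "((\<lambda>s::real. \<Sum>v\<in>F. norm v powr (- 2 * s)) \<longlongrightarrow> (\<Sum>v\<in>F. norm v powr (- 2 * 1))) (at_right 1)"
   using F by (intro tendsto_intros) auto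
  moreover have "(\<Sum>v\<in>F. norm v powr (- 2 * 1)) = (\<Sum>v\<in>F. 1 / (norm v)\<^sup>2)"
   using F by (intro sum.cong) (auto simp: powr_minus_divide)
  ultimately show "((\<lambda>s::real. \<Sum>v\<in>F. norm v powr (- 2 * s)) \<longlongrightarrow> (\<Sum>v\<in>F. 1 / (norm v)\<^sup>2)) (at_right 1)" by simp
  have "(\<Sum>v\<in>F. norm v powr (- 2 * s)) \<le> Re (V (complex_of_real s))" if s: "1 < s" "s < 3" for s
  proof -
   have "norm (2 - complex_of_real s) = \<bar>2 - s\<bar>" by (metis norm_of_real of_real_diff of_real_numeral)
   then have sb: "complex_of_real s \<in> ball 2 2" "Re (complex_of_real s) > 1" using s by (auto simp: dist_norm)
   have "W (of_real s) / (of_real s - 1) = V (of_real s)" using s W(2) by (auto simp: V_def)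
   then have "(phi (of_real s) has_sum V (of_real s)) X" using W(3)[OF sb] by simp
   then have h: "((\<lambda>v. Re (phi (of_real s) v)) has_sum Re (V (of_real s))) X" by (rule has_sum_Re)
   have re: "Re (phi (of_real s) v) = norm v powr (- 2 * s)" for v
   proof -
    have "phi (of_real s) v = of_real (norm v powr (- 2 * s))" unfolding phi_def
     using powr_of_real[of "norm v" "- 2 * s"] by simp
    then show ?thesis by simp
   qed
   show ?thesis using finite_sum_le_has_sum[OF h F(1,2)] by (simp add: re)
  qed
  then show "\<forall>\<^sub>F s in at_right 1. (\<Sum>v\<in>F. norm v powr (- 2 * s)) \<le> Re (V (complex_of_real s))"
   by (auto simp: eventually_at_right[of 1 3] intro!: exI[of _ 3])
 qed simp
 then show ?thesis by blast
qed

text \<open>The lattice is the union of four cosets of its double, whose sums agree up to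
  holomorphic functions because the shifts are torsion points. The double itself contributes
  \<open>4 powr (- s)\<close> times the sum \<open>E\<close> of the lattice. Hence
  \<open>(1 - 4 powr (1 - s)) * E\<close> is holomorphic.\<close>

lemma pole_lat_exists:
 assumes ab: "Im (a * cnj b) \<noteq> 0"
 obtains \<kappa> where "pole (lat a b) \<kappa>"
proof -
 let ?L = "lat a b" and ?L2 = "lat (2 * a) (2 * b)"
 have ab2: "Im ((2 * a) * cnj (2 * b)) \<noteq> 0" using ab by simp
 define Z where "Z = {0, 1::int} \<times> {0, 1::int}"
 define z where "z = (\<lambda>(i, j). of_int i * a + of_int j * b)"
 have "\<exists>H. H holomorphic_on {s. Re s > 0} \<and> (\<forall>s. Re s > 1 --> E (coset (z p) ?L2) s = E ?L2 s + H s)" for p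
 proof -
  have "of_nat 2 * z p \<in> ?L2" using latI[of "fst p" "2 * a" "snd p" "2 * b"] by (simp add: z_def case_prod_unfold algebra_simps)
  from torsion_difference_holomorphic[OF ab2 _ this, of 0] show ?thesis by (auto simp: coset_def)
 qed
 then obtain H where H: "\<And>p. H p holomorphic_on {s. Re s > 0}"
  "\<And>p s. Re s > 1 ==> E (coset (z p) ?L2) s = E ?L2 s + H p s" by metis
 have cov: "(\<Union>p\<in>Z. coset (z p) ?L2) = ?L"
 proof (intro equalityI subsetI)
  fix v assume "v \<in> (\<Union>p\<in>Z. coset (z p) ?L2)"
  then obtain i j u where u: "u \<in> ?L2" "v = (of_int i * a + of_int j * b) + u" by (auto simp: coset_def z_def)
  obtain x y where "u = of_int x * (2 * a) + of_int y * (2 * b)" using u(1) by (rule latE)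
  then have "v = of_int (i + 2 * x) * a + of_int (j + 2 * y) * b" by (simp add: u(2) algebra_simps)
  then show "v \<in> ?L" using latI by metis
 next
  fix v assume "v \<in> ?L"
  then obtain x y where v: "v = of_int x * a + of_int y * b" by (rule latE)
  have e: "of_int x = 2 * of_int (x div 2) + (of_int (x mod 2) :: complex)" for x
   by (metis mult_div_mod_eq of_int_add of_int_mult of_int_numeral)
  have "v = z (x mod 2, y mod 2) + (of_int (x div 2) * (2 * a) + of_int (y div 2) * (2 * b))"
   unfolding v z_def using e[of x] e[of y] by (simp add: algebra_simps)
  moreover have "(x mod 2, y mod 2) \<in> Z" by (auto simp: Z_def)
  ultimately show "v \<in> (\<Union>p\<in>Z. coset (z p) ?L2)" unfolding coset_def using latI by blast
 qed
 have disj: "coset (z p) ?L2 \<inter> coset (z p') ?L2 = {}" if Z12: "p \<in> Z" "p' \<in> Z" "p \<noteq> p'" for p p'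
 proof (rule ccontr)
  assume "coset (z p) ?L2 \<inter> coset (z p') ?L2 \<noteq> {}"
  then obtain u u' where u: "u \<in> ?L2" "u' \<in> ?L2" "z p + u = z p' + u'" by (auto simp: coset_def)
  obtain x y where 1: "u = of_int x * (2 * a) + of_int y * (2 * b)" using u(1) by (rule latE)
  obtain x' y' where 2: "u' = of_int x' * (2 * a) + of_int y' * (2 * b)" using u(2) by (rule latE)
  obtain i j i' j' where p: "p = (i, j)" "p' = (i', j')" by fastforce
  have "of_int (i + 2 * x) * a + of_int (j + 2 * y) * b = of_int (i' + 2 * x') * a + of_int (j' + 2 * y') * b"
   using u(3) unfolding 1 2 p z_def by (simp add: algebra_simps)
  from lat_coord_unique[OF ab this] have "i + 2 * x = i' + 2 * x'" "j + 2 * y = j' + 2 * y'" by auto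
  then show False using Z12 unfolding p Z_def by (auto; presburger)
 qed
 define Hs where "Hs = (\<lambda>s. \<Sum>p\<in>Z. H p s)"
 have eq: "E ?L s = 4 * E ?L2 s + Hs s" if s: "Re s > 1" for s
 proof -
  have "(phi s has_sum (\<Sum>p\<in>Z. E (coset (z p) ?L2) s)) (\<Union>p\<in>Z. coset (z p) ?L2)"
   by (rule sum_has_sum[OF _ _ disj]) (use E_coset(1)[OF ab2 s] in \<open>auto simp: Z_def E_def\<close>)
  then have "E ?L s = (\<Sum>p\<in>Z. E (coset (z p) ?L2) s)" unfolding cov E_def by (rule infsumI)
  also have "\<dots> = of_nat (card Z) * E ?L2 s + Hs s" using H(2) s by (simp add: sum.distrib Hs_def)
  also have "card Z = 4" by (simp add: Z_def)
  finally show ?thesis by simp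
 qed
 have E2: "E ?L2 s = exp (- 2 * s * of_real (ln 2)) * E ?L s" if s: "Re s > 1" for s
 proof -
  have L2: "?L2 = sc 2 ?L" by (simp add: image_mult_lat)
  have inj: "inj_on (\<lambda>v. 2 * v) ?L" by (auto intro: inj_onI)
  have c0: "coset 0 ?L = ?L" by (simp add: coset_def)
  have "E ?L2 s = (\<Sum>\<^sub>\<infinity>v\<in>?L. phi s 2 * phi s v)" unfolding E_def L2 infsum_reindex[OF inj] by (simp add: o_def phi_mult)
  also have "\<dots> = phi s 2 * E ?L s" unfolding E_def
   by (intro infsum_cmult_right) (use E_coset(1)[OF ab s, of 0] c0 in simp)
  finally show ?thesis by (simp add: phi_exp)
 qed
 \<comment> \<open>This is \<open>1 - 4 powr (1 - s)\<close>; the next function \<open>q\<close> is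
   its quotient by \<open>s - 1\<close>, extended over the zero at 1.\<close>
 define m where "m = (\<lambda>s::complex. 1 - exp ((1 - s) * of_real (2 * ln 2)))"
 define q where "q = (\<lambda>s. if s = 1 then deriv m 1 else (m s - m 1) / (s - 1))"
 have mh: "m holomorphic_on ball 2 2" unfolding m_def by (intro holomorphic_intros)
 have qh: "q holomorphic_on ball 2 2" unfolding q_def by (rule pole_lemma_open[OF mh open_ball])
 have m1: "m 1 = 0" by (simp add: m_def)
 have dm: "(m has_field_derivative of_real (2 * ln 2)) (at 1)" unfolding m_def
  by (auto intro!: derivative_eq_intros)
 \<comment> \<open>All zeros of \<open>m\<close> lie on the line \<open>Re s = 1\<close>, and those
   other than 1 have as imaginary part a nonzero multiple of \<open>pi / ln 2 > 3\<close>. In the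
   disc \<open>\<bar>Im s\<bar> < 2\<close>.\<close>
 have qnz: "q s \<noteq> 0" if s: "s \<in> ball 2 2" for s
 proof (cases "s = 1")
  case True
  then show ?thesis using DERIV_imp_deriv[OF dm] by (simp add: q_def)
 next
  case False
  have "m s \<noteq> 0"
  proof
   assume "m s = 0"
   then have e: "exp ((1 - s) * of_real (2 * ln 2)) = 1" by (simp add: m_def)
   define l :: real where "l = 2 * ln 2"
   have "Re ((1 - s) * of_real l) = 0 \<and> (\<exists>n::int. Im ((1 - s) * of_real l) = of_int (2 * n) * pi)"
    using e unfolding l_def[symmetric] by (simp only: exp_eq_1)
   moreover have "l \<noteq> 0" by (simp add: l_def)
   ultimately obtain n :: int where n: "Re s = 1" "- Im s * (2 * ln 2) = of_int (2 * n) * pi"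
    unfolding l_def[symmetric] by auto
   have "\<bar>Im (2 - s)\<bar> < 2" using s abs_Im_le_cmod[of "2 - s"] by (simp add: dist_norm)
   then have I: "\<bar>Im s\<bar> < 2" by simp
   have "ln 2 < (1::real)" by (rule ln_2_less_1)
   then have "\<bar>- Im s * (2 * ln 2)\<bar> \<le> 2 * (2 * 1)" unfolding abs_mult using I by (intro mult_mono) auto
   then have "2 * \<bar>real_of_int n\<bar> * pi \<le> 4" unfolding n(2) by (simp add: abs_mult)
   moreover have "2 * 1 * 3 \<le> 2 * \<bar>real_of_int n\<bar> * pi" if "n \<noteq> 0"
    using that pi_gt3 by (intro mult_mono) auto
   ultimately have "n = 0" by fastforce
   then have "Im s = 0" using n(2) by simp
   then have "s = 1" using n(1) by (simp add: complex_eq_iff)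
   then show False using False by simp
  qed
  then show ?thesis using False by (simp add: q_def m1)
 qed
 show thesis
 proof (rule that, unfold pole_def, intro exI conjI ballI impI)
  show "(\<lambda>s. Hs s / q s) holomorphic_on ball 2 2"
  proof (intro holomorphic_on_divide qh qnz)
   have "Hs holomorphic_on {s. Re s > 0}" unfolding Hs_def by (intro holomorphic_intros H(1))
   then show "Hs holomorphic_on ball 2 2" by (rule holomorphic_on_subset[OF _ ball22_sub])
  qed
  show "Hs 1 / q 1 = Hs 1 / q 1" ..
  fix s :: complex assume s: "s \<in> ball 2 2" "Re s > 1"
  have s1: "s \<noteq> 1" using s(2) by auto
  have "E ?L s = 4 * (exp (- 2 * s * of_real (ln 2)) * E ?L s) + Hs s" using eq[OF s(2)] E2[OF s(2)] by simp
  also have "4 * (exp (- 2 * s * of_real (ln 2)) * E ?L s) = exp ((1 - s) * of_real (2 * ln 2)) * E ?L s"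
  proof -
   have "exp (complex_of_real (2 * ln 2)) = of_real (exp (2 * ln 2))" by (rule exp_of_real)
   also have "exp (2 * ln 2) = (4::real)" by (simp add: exp_double)
   finally have "exp (complex_of_real (2 * ln 2)) = 4" by simp
   moreover have "exp ((1 - s) * of_real (2 * ln 2)) = exp (complex_of_real (2 * ln 2)) * exp (- 2 * s * of_real (ln 2))"
    by (simp add: algebra_simps flip: exp_add)
   ultimately show ?thesis by simp
  qed
  finally have "m s * E ?L s = Hs s" by (simp add: m_def algebra_simps)
  moreover have "m s = q s * (s - 1)" using s1 by (simp add: q_def m1)
  ultimately have "E ?L s = Hs s / q s / (s - 1)" using qnz[OF s(1)] s1 by (simp add: field_simps)
  moreover have "phi s summable_on ?L" using E_coset(1)[OF ab s(2), of 0] by (simp add: coset_def)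
  ultimately show "(phi s has_sum (Hs s / q s / (s - 1))) ?L" by (simp add: E_def has_sum_iff)
 qed
qed

text \<open>The \<open>k\<close> points \<open>k a + j b\<close> with
  \<open>1 \<le> j \<le> k\<close> together contribute at least a constant times
  \<open>1 / k\<close>, so a residue 0 would bound the harmonic series.\<close>

lemma pole_lat_nonzero:
 assumes ab: "Im (a * cnj b) \<noteq> 0" shows "\<not> pole (lat a b) 0"
proof
 assume "pole (lat a b) 0"
 then obtain C where C: "\<And>F. finite F ==> F \<subseteq> lat a b ==> 0 \<notin> F ==> (\<Sum>v\<in>F. 1 / (norm v)\<^sup>2) \<le> C"
  using pole_mono_divergent by meson
 define M where "M = (norm a + norm b)\<^sup>2"
 have "norm a > 0" using ab by auto
 then have M: "M > 0" unfolding M_def by (intro zero_less_power add_pos_nonneg) auto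
 have bound: "(\<Sum>k=1..n. 1 / real k) \<le> C * M" for n
 proof -
  define S where "S = (SIGMA k:{1..n}. {1..k})"
  define g where "g = (\<lambda>(k::nat, j::nat). of_int (int k) * a + of_int (int j) * b)"
  have gl: "g p \<in> lat a b" for p unfolding g_def by (cases p) (simp only: prod.case latI)
  have inj: "inj_on g S"
  proof (rule inj_onI)
   fix p p' assume eq: "g p = g p'"
   obtain k j k' j' where p: "p = (k, j)" "p' = (k', j')" by fastforce
   have "of_int (int k) * a + of_int (int j) * b = of_int (int k') * a + of_int (int j') * b" using eq by (simp only: g_def p prod.case)
   from lat_coord_unique[OF ab this] show "p = p'" by (simp add: p)
  qed
  have "0 \<notin> g ` S"
  proof
   assume "0 \<in> g ` S"
   then obtain p where p: "p \<in> S" "g p = 0" by fastforce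
   moreover obtain k j where "p = (k, j)" by fastforce
   ultimately have k: "k \<ge> 1" "g (k, j) = 0" by (auto simp: S_def)
   then have "of_int (int k) * a + of_int (int j) * b = of_int 0 * a + of_int 0 * b" by (simp only: g_def prod.case) simp
   from lat_coord_unique(1)[OF ab this] show False using k by simp
  qed
  then have "(\<Sum>v\<in>g ` S. 1 / (norm v)\<^sup>2) \<le> C" using gl by (intro C) (auto simp: S_def)
  then have 1: "(\<Sum>p\<in>S. 1 / (norm (g p))\<^sup>2) \<le> C" by (simp add: sum.reindex[OF inj] o_def)
  have "(\<Sum>k=1..n. 1 / real k) = (\<Sum>k=1..n. \<Sum>j=1..k. 1 / (real k)\<^sup>2)"
   by (intro sum.cong) (auto simp: power2_eq_square)
  also have "\<dots> = (\<Sum>p\<in>S. 1 / (real (fst p))\<^sup>2)" unfolding S_def by (subst sum.Sigma) (auto simp: case_prod_unfold)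
  also have "\<dots> \<le> (\<Sum>p\<in>S. M * (1 / (norm (g p))\<^sup>2))"
  proof (rule sum_mono)
   fix p assume "p \<in> S"
   then obtain k j where p: "p = (k, j)" "1 \<le> k" "j \<le> k" by (auto simp: S_def)
   have "norm (g p) \<le> norm (of_int (int k) * a) + norm (of_int (int j) * b)" unfolding g_def p prod.case by (rule norm_triangle_ineq)
   also have "\<dots> = real k * norm a + real j * norm b" by (simp add: norm_mult)
   also have "\<dots> \<le> real k * norm a + real k * norm b" using p by (intro add_left_mono mult_right_mono) auto
   finally have "norm (g p) \<le> real k * (norm a + norm b)" by (simp add: distrib_left)
   then have "(norm (g p))\<^sup>2 \<le> (real k)\<^sup>2 * M" unfolding M_def power_mult_distrib[symmetric] by (intro power_mono) auto
   moreover have "g p \<noteq> 0" using \<open>0 \<notin> g ` S\<close> \<open>p \<in> S\<close> by fastforce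
   ultimately show "1 / (real (fst p))\<^sup>2 \<le> M * (1 / (norm (g p))\<^sup>2)"
    using p(2) by (simp add: p(1) divide_simps mult.commute)
  qed
  also have "\<dots> = M * (\<Sum>p\<in>S. 1 / (norm (g p))\<^sup>2)" by (simp add: sum_distrib_left)
  also have "\<dots> \<le> M * C" using 1 M by (intro mult_left_mono) auto
  finally show ?thesis by (simp add: mult.commute)
 qed
 have "\<not> summable (\<lambda>n. 1 / real (Suc n))"
  unfolding summable_Suc_iff[of "\<lambda>n. 1 / real n"]
  using not_summable_harmonic[where 'a = real] by (simp only: inverse_eq_divide not_False_eq_True)
 moreover have "summable (\<lambda>n. 1 / real (Suc n))"
 proof (rule summableI_nonneg_bounded)
  show "(\<Sum>k<n. 1 / real (Suc k)) \<le> C * M" for n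
   using bound[of n] by (simp add: sum.shift_bounds_Suc_ivl sum.atLeast1_atMost_eq)
 qed simp
 ultimately show False by simp
qed

context quad
begin

text \<open>Prime factors of the conductor would spoil unique factorisation, and those of
  \<open>d0\<close> ramify; excluding both leaves only split and inert primes.\<close>

definition cop :: "complex set => bool" where
 "cop I \<longleftrightarrow> integral I \<and> coprime (int (nn I)) D"

text \<open>Stability under \<open>\<theta>\<close> makes the content of the ideal visible in its
  Hermite basis: \<open>I\<close> is \<open>g\<close> times a lattice
  \<open>lat e' (x' + \<theta>)\<close>.\<close>

lemma integral_stable_divides:
 assumes I: "integral I" and h: "e > 0" "g > 0" "I = lat (of_int e) (of_int x + of_int g * \<theta>)"
 obtains e' x' where "e = g * e'" "x = g * x'"
proof -
 have coord: "g dvd v" if z: "of_int u + of_int v * \<theta> \<in> I" for u v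
 proof -
  obtain i j where "of_int u + of_int v * \<theta> = of_int i * of_int e + of_int j * (of_int x + of_int g * \<theta>)"
   using z unfolding h(3) by (rule latE)
  then have "of_int u * 1 + of_int v * \<theta> = of_int (i * e + j * x) * 1 + of_int (j * g) * \<theta>" by (simp add: algebra_simps)
  from lat_coord_unique(2)[OF _ this] have "v = j * g" using Im_rD_pos by (auto simp: Im_theta)
  then show ?thesis by auto
 qed
 obtain q where q: "\<theta> * \<theta> = of_int D * \<theta> - of_int q" by (rule theta_quadratic)
 have "of_int e \<in> I" "of_int x + of_int g * \<theta> \<in> I" using h(3) by auto
 then have 1: "\<theta> * of_int e \<in> I" "\<theta> * (of_int x + of_int g * \<theta>) \<in> I" using proper_smult[of I \<theta>] I by auto
 have "g dvd e" using coord[of 0 e] 1(1) by (simp add: mult.commute)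
 moreover have "\<theta> * (of_int x + of_int g * \<theta>) = of_int (- (g * q)) + of_int (x + g * D) * \<theta>"
 proof -
  have "\<theta> * (of_int x + of_int g * \<theta>) = of_int x * \<theta> + of_int g * (\<theta> * \<theta>)" by (simp add: algebra_simps)
  also have "\<dots> = - of_int (g * q) + of_int (x + g * D) * \<theta>" unfolding q by (simp add: algebra_simps)
  finally show ?thesis by simp
 qed
 then have "g dvd x + g * D" using coord[of "- (g * q)" "x + g * D"] 1(2) by simp
 then have "g dvd x" by (simp add: dvd_add_left_iff)
 ultimately show thesis using that by blast
qed

lemma theta_norm: obtains q where "D * D - D = 4 * q"
 "(of_int x + \<theta>) * cnj (of_int x + \<theta>) = of_int (x * x + x * D + q)" "\<theta> * \<theta> = of_int D * \<theta> - of_int q"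
proof -
 obtain q where q: "D * D - D = 4 * q" "\<theta> * \<theta> = of_int D * \<theta> - of_int q" "\<theta> * cnj \<theta> = of_int q" by (rule theta_quadratic)
 have "(of_int x + \<theta>) * cnj (of_int x + \<theta>) = of_int x * of_int x + of_int x * (\<theta> + cnj \<theta>) + \<theta> * cnj \<theta>"
  by (simp add: algebra_simps)
 also have "\<theta> + cnj \<theta> = of_int D" by (simp add: cnj_theta)
 finally show thesis using that q by simp
qed

text \<open>The norm form of the lattice is \<open>(p, 2 x + D, c)\<close>, of discriminant
  \<open>D\<close>. It is primitive, since a \<open>p\<close> dividing \<open>2 x + D\<close> would
  divide \<open>D\<close>; so \<open>proper_from_form\<close> applies.\<close>

lemma prime_lattice_ideal:
 fixes p x :: int
 assumes p: "prime p" "\<not> p dvd D" and q: "D * D - D = 4 * q" and dv: "p dvd x * x + x * D + q"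
 shows "integral (lat (of_int p) (of_int x + \<theta>))" "nn (lat (of_int p) (of_int x + \<theta>)) = nat p"
proof -
 obtain q' where q': "D * D - D = 4 * q'" "(of_int x + \<theta>) * cnj (of_int x + \<theta>) = of_int (x * x + x * D + q')"
  by (rule theta_norm)
 have "q' = q" using q q'(1) by simp
 note N = q'(2)[unfolded this]
 obtain c where c: "x * x + x * D + q = p * c" using dv by blast
 have p0: "p > 0" using p(1) by (simp add: prime_gt_0_int)
 have g: "gcd p (gcd (2 * x + D) c) = 1"
 proof -
  have disc: "(2 * x + D) * (2 * x + D) - 4 * p * c = D" using c q by (simp add: algebra_simps)
  have "\<not> p dvd 2 * x + D"
  proof
   assume "p dvd 2 * x + D"
   then have "p dvd (2 * x + D) * (2 * x + D)" by simp
   moreover have "p dvd 4 * p * c" by simp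
   ultimately have "p dvd (2 * x + D) * (2 * x + D) - 4 * p * c" by simp
   then show False using disc p(2) by simp
  qed
  then have "\<not> p dvd gcd (2 * x + D) c" using gcd_dvd1 dvd_trans by simp
  then have "coprime p (gcd (2 * x + D) c)" by (rule prime_imp_coprime[OF p(1)])
  then show ?thesis by simp
 qed
 have K: "of_int p \<in> K" "of_int x + \<theta> \<in> K" by auto
 have Im: "Im (of_int p * cnj (of_int x + \<theta>)) \<noteq> 0" using p0 Im_rD_pos by (simp add: Im_theta)
 have f: "of_int p * cnj (of_int p) = of_real (of_int p) * (of_int p :: complex)"
  "of_int p * cnj (of_int x + \<theta>) + cnj (of_int p) * (of_int x + \<theta>) = of_real (of_int p) * of_int (2 * x + D)"
  "(of_int x + \<theta>) * cnj (of_int x + \<theta>) = of_real (of_int p) * of_int c"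
 proof -
  show "(of_int x + \<theta>) * cnj (of_int x + \<theta>) = of_real (of_int p) * of_int c" unfolding N c by simp
 qed (simp_all add: cnj_theta algebra_simps)
 have disc: "(2 * x + D) * (2 * x + D) - 4 * p * c = D" using c q by (simp add: algebra_simps)
 have pr: "proper (lat (of_int p) (of_int x + \<theta>))"
  and pp: "lat (of_int p) (of_int x + \<theta>) \<odot> cnj ` lat (of_int p) (of_int x + \<theta>) = sc (of_real (of_int p)) O'"
  using proper_from_form[OF K Im _ g f disc] p0 by auto
 have sub: "lat (of_int p) (of_int x + \<theta>) \<subseteq> O'" by (intro lat_subset) (auto intro: O_add)
 then show "integral (lat (of_int p) (of_int x + \<theta>))" using pr by (simp add: integral_def)
 have "nrm (lat (of_int p) (of_int x + \<theta>)) = of_int p" using p0 pp by (intro nrm_eq) auto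
 then show "nn (lat (of_int p) (of_int x + \<theta>)) = nat p" by (simp add: nn_def)
qed

section \<open>Factorisation of ideals coprime to the discriminant\<close>

text \<open>With \<open>I = g * lat e' (x' + \<theta>)\<close> the norm is
  \<open>g\<^sup>2 e'\<close>. If \<open>p\<close> divides \<open>g\<close>, then \<open>I\<close>
  lies in \<open>p\<close> times the order. If it divides \<open>e'\<close>, it divides the norm of
  \<open>x' + \<theta>\<close>, and the ideal with basis \<open>p\<close>,
  \<open>x' + \<theta>\<close> contains \<open>I\<close>.\<close>

lemma prime_divides_ideal:
 assumes I: "integral I" and p: "prime p" "p dvd nn I" "\<not> int p dvd D"
 shows "I \<subseteq> sc (of_nat p) O' \<or> (\<exists>P. integral P \<and> nn P = p \<and> I \<subseteq> P)"
proof -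
 obtain e g x where h: "e > 0" "g > 0" "I = lat (of_int e) (of_int x + of_int g * \<theta>)" "int (nn I) = e * g"
  by (rule integral_hermite[OF I])
 obtain e' x' where ex: "e = g * e'" "x = g * x'" by (rule integral_stable_divides[OF I h(1-3)])
 have e': "e' > 0" using h(1,2) ex(1) by (simp add: zero_less_mult_iff)
 have pI: "prime (int p)" using p(1) by simp
 have Ieq: "I = sc (of_int g) (lat (of_int e') (of_int x' + \<theta>))"
  unfolding h(3) image_mult_lat ex by (simp add: algebra_simps)
 have "int p dvd g * g * e'" using p(2) h(4) ex(1) by (metis int_dvd_int_iff mult.commute mult.assoc)
 then consider "int p dvd g" | "int p dvd e'" using pI by (auto simp: prime_dvd_mult_iff)
 then show ?thesis
 proof cases
  case 1
  then obtain k where k: "g = int p * k" by blast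
  have "lat (of_int e') (of_int x' + \<theta>) \<subseteq> O'" by (intro lat_subset) (auto intro: O_add)
  then have "sc (of_int k) (lat (of_int e') (of_int x' + \<theta>)) \<subseteq> O'" using subspace_of_int_mult[OF O_subspace] by auto
  then have "sc (of_nat p) (sc (of_int k) (lat (of_int e') (of_int x' + \<theta>))) \<subseteq> sc (of_nat p) O'" by blast
  moreover have "sc (of_nat p) (sc (of_int k) (lat (of_int e') (of_int x' + \<theta>))) = I" unfolding Ieq sc_sc k by simp
  ultimately show ?thesis by simp
 next
  case 2
  obtain q where q: "D * D - D = 4 * q" "(of_int x' + \<theta>) * cnj (of_int x' + \<theta>) = of_int (x' * x' + x' * D + q)"
   by (rule theta_norm)
  have "of_int g * (of_int x' + \<theta>) \<in> I" unfolding Ieq by auto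
  moreover have "cnj (of_int x' + \<theta>) \<in> O'" by (intro O_cnj O_add) auto
  ultimately have "cnj (of_int x' + \<theta>) * (of_int g * (of_int x' + \<theta>)) \<in> I"
   using proper_smult[of I] I by simp
  moreover have "cnj (of_int x' + \<theta>) * (of_int g * (of_int x' + \<theta>)) = of_int g * of_int (x' * x' + x' * D + q)"
   using q(2) by (simp add: mult_ac)
  ultimately have "of_int g * of_int (x' * x' + x' * D + q) \<in> I" by (simp only:)
  then have "of_int g * of_int (x' * x' + x' * D + q) \<in> sc (of_int g) (lat (of_int e') (of_int x' + \<theta>))"
   unfolding Ieq .
  then have "of_int (x' * x' + x' * D + q) \<in> lat (of_int e') (of_int x' + \<theta>)" using h(2) by fastforce
  then obtain i j where "of_int (x' * x' + x' * D + q) = of_int i * of_int e' + of_int j * (of_int x' + \<theta>)" by (rule latE)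
  then have "of_int (x' * x' + x' * D + q) * 1 + of_int 0 * \<theta> = of_int (i * e' + j * x') * 1 + of_int j * \<theta>"
   by (simp add: algebra_simps)
  from lat_coord_unique[OF _ this] have "x' * x' + x' * D + q = i * e' + j * x'" "0 = j"
   using Im_rD_pos by (auto simp: Im_theta)
  then have "e' dvd x' * x' + x' * D + q" by simp
  then have dv: "int p dvd x' * x' + x' * D + q" using 2 by fastforce
  define P where "P = lat (of_int (int p)) (of_int x' + \<theta>)"
  have P: "integral P" "nn P = p" using prime_lattice_ideal[OF pI p(3) q(1) dv] by (simp_all add: P_def)
  obtain k where k: "e' = int p * k" using 2 by blast
  have "of_int e' = (of_int k * of_int (int p) :: complex)" by (simp add: k)
  then have "of_int e' \<in> P" unfolding P_def using subspace_of_int_mult[OF subspace_lat lat_mem1] by simp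
  moreover have "of_int x' + \<theta> \<in> P" by (simp add: P_def)
  ultimately have "lat (of_int e') (of_int x' + \<theta>) \<subseteq> P" unfolding P_def by (intro lat_subset subspace_lat)
  then have "I \<subseteq> P" unfolding Ieq using subspace_of_int_mult[OF proper_subspace[of P]] P(1) by auto
  then show ?thesis using P by blast
 qed
qed

lemma sc_nat_integral: assumes "n > 0" shows "integral (sc (of_nat n) O')" "nn (sc (of_nat n) O') = n * n"
proof -
 have n: "of_nat n \<in> O'" "of_nat n \<noteq> (0::complex)" using O_of_int[of "int n"] assms by auto
 show "integral (sc (of_nat n) O')" by (rule integral_sc(1)[OF integral_O(1) n])
 have "real (nn (sc (of_nat n) O')) = real (n * n)"
  using integral_sc(2)[OF integral_O(1) n] by (simp add: integral_O power2_eq_square)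
 then show "nn (sc (of_nat n) O') = n * n" by (simp only: of_nat_eq_iff)
qed

definition split_primes :: "complex set set" where
 "split_primes = {P. integral P \<and> prime (nn P) \<and> \<not> int (nn P) dvd D}"

text \<open>Inertness is expressed by the absence of an ideal of norm \<open>p\<close>, so that no
  residue symbol enters the factorisation.\<close>

definition inert_primes :: "complex set set" where
 "inert_primes = {sc (of_nat p) O' | p. prime p \<and> \<not> int p dvd D \<and> (\<nexists>P. integral P \<and> nn P = p)}"

definition PP :: "complex set set" where "PP = split_primes \<union> inert_primes"

lemma inertE:
 assumes "P \<in> inert_primes"
 obtains p where "P = sc (of_nat p) O'" "prime p" "\<not> int p dvd D" "\<nexists>Q. integral Q \<and> nn Q = p" "integral P" "nn P = p * p"
proof -
 obtain p where "P = sc (of_nat p) O'" "prime p" "\<not> int p dvd D" "\<nexists>Q. integral Q \<and> nn Q = p"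
  using assms unfolding inert_primes_def mem_Collect_eq by blast
 then show thesis using that[of p] sc_nat_integral[of p] prime_gt_0_nat[of p] by simp
qed

lemma PP_integral: "P \<in> PP ==> integral P"
 by (auto simp: PP_def split_primes_def elim: inertE)

lemma PP_cop: "P \<in> PP ==> cop P"
proof -
 assume P: "P \<in> PP"
 have pc: "coprime (int p) D" if "prime p" "\<not> int p dvd D" for p :: nat
  using that by (simp add: prime_imp_coprime)
 show "cop P" using P unfolding PP_def
  by (auto simp: cop_def split_primes_def intro: pc elim!: inertE)
qed

lemma PP_gt1: "P \<in> PP ==> nn P \<ge> 2"
proof -
 assume P: "P \<in> PP"
 then consider "prime (nn P)" | p where "prime p" "nn P = p * p" by (auto simp: PP_def split_primes_def elim: inertE)
 then show ?thesis
 proof cases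
  case 1 then show ?thesis by (rule prime_ge_2_nat)
 next
  case 2 then have "2 * 2 \<le> p * p" by (intro mult_le_mono prime_ge_2_nat)
  then show ?thesis using 2 by simp
 qed
qed

lemma ideal_sub_PP:
 assumes I: "cop I" "nn I \<noteq> 1" obtains P where "P \<in> PP" "I \<subseteq> P"
proof -
 have Ii: "integral I" using I by (simp add: cop_def)
 obtain p where p: "prime p" "p dvd nn I" using I(2) prime_factor_nat by blast
 have pD: "\<not> int p dvd D"
 proof
  assume "int p dvd D"
  moreover have "int p dvd int (nn I)" using p(2) by simp
  ultimately have "int p dvd 1" using I(1) unfolding cop_def by fastforce
  then show False using p(1) by simp
 qed
 show thesis
 proof (cases "\<exists>P. integral P \<and> nn P = p \<and> I \<subseteq> P")
  case True
  then show ?thesis using that p pD by (auto simp: PP_def split_primes_def)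
 next
  case False
  then have sub: "I \<subseteq> sc (of_nat p) O'" using prime_divides_ideal[OF Ii p pD] by blast
  show ?thesis
  proof (cases "\<exists>P. integral P \<and> nn P = p")
   case True
   then obtain P where P: "integral P" "nn P = p" by blast
   have "sc (of_nat p) O' = P \<odot> cnj ` P" using cnj_ip_nn[OF P(1)] P(2) by simp
   also have "\<dots> \<subseteq> P" using P integral_cnj by (intro ip_subset_left) auto
   finally have "I \<subseteq> P" using sub by simp
   then show ?thesis using P False by simp
  next
   case False
   then have "sc (of_nat p) O' \<in> PP" using p pD by (auto simp: PP_def inert_primes_def)
   then show ?thesis using that sub by simp
  qed
 qed
qed

text \<open>In the inert case a product contained in \<open>p\<close> times the order has norm
  divisible by \<open>p\<close>, hence so has one of the factors. As there are no ideals of norm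
  \<open>p\<close>, \<open>prime_divides_ideal\<close> leaves only the inclusion of that factor in
  \<open>P\<close>.\<close>

lemma PP_prime:
 assumes P: "P \<in> PP" and I: "integral I" "integral J" "I \<odot> J \<subseteq> P" shows "I \<subseteq> P \<or> J \<subseteq> P"
proof (cases "P \<in> split_primes")
 case True
 then have P': "integral P" "prime (nn P)" by (auto simp: split_primes_def)
 show ?thesis
 proof (rule ccontr)
  assume "\<not> ?thesis"
  then obtain a b where ab: "a \<in> I" "a \<notin> P" "b \<in> J" "b \<notin> P" by blast
  then have "a * b \<in> P" using ip_mem I(3) by blast
  then show False using prime_norm_prime[OF P', of a b] ab I by (auto simp: integral_def)
 qed
next
 case False
 then have "P \<in> inert_primes" using P by (simp add: PP_def)
 then obtain p where p: "P = sc (of_nat p) O'" "prime p" "\<not> int p dvd D" "\<nexists>Q. integral Q \<and> nn Q = p" "integral P" "nn P = p * p"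
  by (rule inertE)
 obtain M where M: "integral M" "I \<odot> J = P \<odot> M"
  using integral_divide[of "I \<odot> J" P] integral_ip[OF I(1,2)] p(5) I(3) by auto
 have "nn I * nn J = p * p * nn M" using integral_ip(2)[OF I(1,2)] integral_ip(2)[OF p(5) M(1)] M(2) p(6) by simp
 then have "p dvd nn I * nn J" by simp
 then have "p dvd nn I \<or> p dvd nn J" using p(2) by (simp add: prime_dvd_mult_iff)
 then show ?thesis using prime_divides_ideal[OF I(1) p(2) _ p(3)] prime_divides_ideal[OF I(2) p(2) _ p(3)] p(1,4) by blast
qed

lemma PP_sub_eq:
 assumes "P \<in> PP" "Q \<in> PP" "P \<subseteq> Q" shows "P = Q"
proof -
 have i: "integral P" "integral Q" using assms PP_integral by auto
 obtain M where M: "integral M" "P = Q \<odot> M" by (rule integral_divide[of P Q]) (use i assms in auto)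
 have n: "nn P = nn Q * nn M" using integral_ip[OF i(2) M(1)] M(2) by simp
 have "nn P = nn Q"
 proof (cases "P \<in> split_primes")
  case True
  then have "prime (nn Q * nn M)" using n by (simp add: split_primes_def)
  then have "nn Q = 1 \<or> nn M = 1" by (rule prime_product)
  then show ?thesis using n PP_gt1[OF assms(2)] by auto
 next
  case False
  then have "P \<in> inert_primes" using assms by (simp add: PP_def)
  then obtain p where p: "prime p" "\<nexists>Q. integral Q \<and> nn Q = p" "nn P = p * p" by (rule inertE)
  show ?thesis
  proof (cases "Q \<in> split_primes")
   case True
   then have "prime (nn Q)" by (simp add: split_primes_def)
   moreover have "nn Q dvd p * p" using n p(3) by simp
   ultimately have "nn Q = p" using p(1) by (metis prime_dvd_mult_iff primes_dvd_imp_eq)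
   then show ?thesis using p(2) i(2) by simp
  next
   case False
   then have "Q \<in> inert_primes" using assms by (simp add: PP_def)
   then obtain q where q: "prime q" "nn Q = q * q" by (rule inertE)
   have "q dvd p * p" using n p(3) q(2) by simp
   then have "q = p" using q(1) p(1) by (metis prime_dvd_mult_iff primes_dvd_imp_eq)
   then show ?thesis using p q by simp
  qed
 qed
 then have "nn M = 1" using n PP_gt1[OF assms(2)] by simp
 then have "M = O'" using integral_nn(4)[OF M(1)] by simp
 then show ?thesis using M(2) O_ip[of Q] i(2) by (simp add: ip_comm)
qed

interpretation ipf: comp_fun_commute "(\<odot>)"
 by standard (auto simp: fun_eq_iff ip_left_comm)

definition mprod :: "complex set multiset => complex set" where
 "mprod M = fold_mset (\<odot>) O' M"

lemma mprod_empty [simp]: "mprod {#} = O'" and mprod_add [simp]: "mprod (add_mset P M) = P \<odot> mprod M"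
 by (simp_all add: mprod_def)

lemma mprod_cop:
 assumes "set_mset M \<subseteq> PP" shows "cop (mprod M)" "nn (mprod M) = (\<Prod>P\<in>#M. nn P)"
proof -
 have "cop (mprod M) \<and> nn (mprod M) = (\<Prod>P\<in>#M. nn P)"
  using assms
 proof (induction M)
  case empty
  then show ?case by (simp add: cop_def integral_O)
 next
  case (add P M)
  then have "cop P" "cop (mprod M)" "nn (mprod M) = (\<Prod>P\<in>#M. nn P)" using PP_cop by auto
  then show ?case by (auto simp: cop_def integral_ip)
 qed
 then show "cop (mprod M)" "nn (mprod M) = (\<Prod>P\<in>#M. nn P)" by auto
qed

lemma mprod_exists:
 assumes "cop I" obtains M where "set_mset M \<subseteq> PP" "mprod M = I"
proof -
 have "\<exists>M. set_mset M \<subseteq> PP \<and> mprod M = I" using assms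
 proof (induction "nn I" arbitrary: I rule: less_induct)
  case less
  show ?case
  proof (cases "nn I = 1")
   case True
   then show ?thesis using less.prems integral_nn(4) by (intro exI[of _ "{#}"]) (auto simp: cop_def)
  next
   case False
   obtain P where P: "P \<in> PP" "I \<subseteq> P" by (rule ideal_sub_PP[OF less.prems False])
   have i: "integral I" "integral P" using less.prems P PP_integral by (auto simp: cop_def)
   obtain J where J: "integral J" "I = P \<odot> J" by (rule integral_divide[of I P]) (use i P in auto)
   have n: "nn I = nn P * nn J" using integral_ip(2)[OF i(2) J(1)] J(2) by simp
   have "cop J" using less.prems J(1) unfolding cop_def n by simp
   moreover have "nn J < nn I" using n PP_gt1[OF P(1)] integral_nn(2)[OF J(1)] by simp
   ultimately obtain M where "set_mset M \<subseteq> PP" "mprod M = J" using less.hyps by blast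
   then show ?thesis using P J by (intro exI[of _ "add_mset P M"]) auto
  qed
 qed
 then show thesis using that by blast
qed

lemma mprod_sub_mem:
 assumes "set_mset M \<subseteq> PP" "P \<in> PP" "mprod M \<subseteq> P" shows "P \<in># M"
 using assms
proof (induction M)
 case empty
 have i: "integral P" using empty PP_integral by simp
 then have "P = O'" using empty by (auto simp: integral_def)
 then show ?case using PP_gt1[OF empty(2)] integral_O by simp
next
 case (add Q M)
 have "Q \<subseteq> P \<or> mprod M \<subseteq> P"
  using PP_prime[OF add.prems(2), of Q "mprod M"] add.prems PP_integral mprod_cop(1)[of M] by (auto simp: cop_def)
 then show ?case using add PP_sub_eq[of Q P] by auto
qed

text \<open>Uniqueness as for integers: a prime containing the product occurs among the factors by
  \<open>mprod_sub_mem\<close>, and invertibility allows it to be cancelled.\<close>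

lemma mprod_inj:
 assumes "set_mset M \<subseteq> PP" "set_mset M' \<subseteq> PP" "mprod M = mprod M'" shows "M = M'"
 using assms
proof (induction M arbitrary: M')
 case empty
 show ?case
 proof (cases M')
  case (add P N)
  have "mprod M' \<subseteq> P" using empty add ip_subset_left[of "mprod N" P] mprod_cop(1)[of N] PP_integral by (auto simp: cop_def)
  then have "P \<in># {#}" using mprod_sub_mem[of "{#}" P] empty add by simp
  then show ?thesis by simp
 qed simp
next
 case (add P M)
 have i: "integral P" "integral (mprod M)" using add.prems PP_integral mprod_cop(1)[of M] by (auto simp: cop_def)
 have "mprod (add_mset P M) \<subseteq> P" using ip_subset_left[OF i(2), of P] i by simp
 then have "P \<in># M'" using mprod_sub_mem[of M' P] add.prems by simp
 then obtain N where N: "M' = add_mset P N" by (metis insert_DiffM)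
 have i2: "integral (mprod N)" using add.prems N mprod_cop(1)[of N] by (auto simp: cop_def)
 have eq: "P \<odot> mprod M = P \<odot> mprod N" using add.prems N by simp
 then have "mprod M = mprod N"
  using ip_cancel[of P "mprod M" "mprod N"] ip_cancel[of P "mprod N" "mprod M"] i i2 by auto
 then show ?case using add.IH[of N] add.prems N by simp
qed

end

section \<open>Zeta functions of ideal classes\<close>

text \<open>With \<open>x\<close> and \<open>y\<close> chosen as products of prime factors of
  \<open>D\<close>, modulo each prime dividing \<open>D\<close> exactly one of the three terms
  survives: the first if \<open>A\<close> is a unit there, else the last if \<open>C\<close> is one,
  else the middle one, by primitivity.\<close>

lemma coprime_form_value:
 fixes A B C D :: int
 assumes g: "gcd A (gcd B C) = 1" and D: "D \<noteq> 0"
 obtains x y :: int where "coprime (A * x * x + B * x * y + C * y * y) D"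
proof -
 define P where "P = prime_factors D"
 have P: "p \<in> P \<longleftrightarrow> prime p \<and> p dvd D" for p using D by (auto simp: P_def prime_factors_dvd)
 have fP: "finite P" by (simp add: P_def)
 define x where "x = \<Prod>{p \<in> P. p dvd A \<and> \<not> p dvd C}"
 define y where "y = \<Prod>{p \<in> P. \<not> p dvd A}"
 have dv: "p dvd \<Prod>{q \<in> P. Q q} \<longleftrightarrow> Q p" if p: "p \<in> P" for p Q
 proof
  assume "p dvd \<Prod>{q \<in> P. Q q}"
  moreover have "p dvd \<Prod>{q \<in> P. Q q} \<longleftrightarrow> (\<exists>q\<in>{q \<in> P. Q q}. p dvd q)"
  proof (rule prime_dvd_prod_iff)
   show "finite {q \<in> P. Q q}" using fP by (rule rev_finite_subset) blast
   show "prime p" using p P by simp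
  qed
  ultimately have "\<exists>q\<in>{q \<in> P. Q q}. p dvd q" by simp
  then obtain q where q: "q \<in> P" "Q q" "p dvd q" by blast
  then have "p = q" using p P by (metis primes_dvd_imp_eq)
  then show "Q p" using q by simp
 next
  assume "Q p" then show "p dvd \<Prod>{q \<in> P. Q q}" using p fP dvd_prod_eqI[of "{q \<in> P. Q q}" p "\<Prod>{q \<in> P. Q q}" "\<lambda>q. q"]
   by fastforce
 qed
 have "coprime (A * x * x + B * x * y + C * y * y) D"
 proof (rule ccontr)
  assume "\<not> coprime (A * x * x + B * x * y + C * y * y) D"
  then obtain a where a: "a dvd A * x * x + B * x * y + C * y * y" "a dvd D" "\<not> is_unit a" by fastforce
  have "a \<noteq> 0" using a(2) D by auto
  then obtain p where p: "prime p" "p dvd a" using a(3) prime_divisor_exists by blast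
  have pP: "p \<in> P" using p a(2) P by (blast intro: dvd_trans)
  have pv: "p dvd A * x * x + B * x * y + C * y * y" using p(2) a(1) by fastforce
  have px: "p dvd x \<longleftrightarrow> p dvd A \<and> \<not> p dvd C" and py: "p dvd y \<longleftrightarrow> \<not> p dvd A"
   unfolding x_def y_def by (rule dv[OF pP])+
  show False
  proof (cases "p dvd A")
   case False
   then have "p dvd y" "\<not> p dvd x" using px py by auto
   then have "p dvd A * x * x" using pv by (metis dvd_add_left_iff dvd_mult dvd_add)
   then show False using False \<open>\<not> p dvd x\<close> p(1) by (simp add: prime_dvd_mult_iff)
  next
   case True
   show False
   proof (cases "p dvd C")
    case False
    then have "p dvd x" "\<not> p dvd y" using px py True by auto
    then have "p dvd A * x * x + B * x * y" by simp
    then have "p dvd C * y * y" using pv by (metis dvd_add_right_iff)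
    then show False using False \<open>\<not> p dvd y\<close> p(1) by (simp add: prime_dvd_mult_iff)
   next
    case pC: True
    then have "\<not> p dvd x" "\<not> p dvd y" using px py True by auto
    moreover have "p dvd A * x * x" "p dvd C * y * y" using True pC by simp_all
    then have "p dvd B * x * y" using pv by (metis dvd_add_left_iff dvd_add_right_iff)
    ultimately have "p dvd B" using p(1) by (simp add: prime_dvd_mult_iff)
    then have "p dvd gcd A (gcd B C)" using True pC by simp
    then show False using g p(1) by fastforce
   qed
  qed
 qed
 then show thesis by (rule that)
qed

context quad
begin

text \<open>For \<open>L\<close> in the inverse class the squared length of
  \<open>\<alpha> \<in> L\<close> is \<open>nrm L\<close> times a value of the primitive form of
  \<open>L\<close>. If that value is coprime to \<open>D\<close>, the cofactor of \<open>L\<close>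
  in the principal ideal of \<open>\<alpha>\<close> is as required.\<close>

lemma cop_exists:
 assumes X: "X \<in> carrier G" obtains I where "cop I" "cl I = X"
proof -
 have "inv\<^bsub>G\<^esub> X \<in> carrier G" using X by simp
 then obtain L where L: "proper L" "inv\<^bsub>G\<^esub> X = cl L" by (auto simp: carrier_G)
 obtain a b where ab: "a \<in> K" "b \<in> K" "Im (a * cnj b) \<noteq> 0" "L = lat a b"
  by (rule proper_lat[OF L(1)])
 obtain m A B C where f: "m > 0" "gcd A (gcd B C) = 1" "of_real m \<in> K"
  "a * cnj a = of_real m * of_int A" "a * cnj b + cnj a * b = of_real m * of_int B"
  "b * cnj b = of_real m * of_int C" "B * B - 4 * A * C = D" "\<bar>Im (a * cnj b)\<bar> = m * (Im rD / 2)"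
  "lat a b \<odot> cnj ` lat a b = sc (of_real m) O'"
  using proper_form[OF L(1)[unfolded ab(4)] ab(1-3)] by metis
 have nL: "nrm L = m" using nrm_eq[OF f(1)] f(9) ab(4) by simp
 obtain x y where xy: "coprime (A * x * x + B * x * y + C * y * y) D" using coprime_form_value[OF f(2)] D_neg by (metis less_irrefl)
 define v where "v = A * x * x + B * x * y + C * y * y"
 define \<alpha> where "\<alpha> = of_int x * a + of_int y * b"
 have \<alpha>L: "\<alpha> \<in> L" unfolding \<alpha>_def ab(4) by (rule latI)
 have \<alpha>K: "\<alpha> \<in> K" using proper_K[OF L(1) \<alpha>L] .
 have "\<alpha> * cnj \<alpha> = of_int (x * x) * (a * cnj a) + of_int (x * y) * (a * cnj b + cnj a * b) + of_int (y * y) * (b * cnj b)"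
  by (simp add: \<alpha>_def algebra_simps)
 also have "\<dots> = of_real (m * of_int v)" unfolding f(4-6) v_def by (simp add: algebra_simps)
 finally have "of_real ((cmod \<alpha>)\<^sup>2) = (of_real (m * of_int v) :: complex)" by (simp only: complex_norm_square)
 then have n\<alpha>: "(cmod \<alpha>)\<^sup>2 = m * of_int v" by (simp only: of_real_eq_iff)
 have "v \<noteq> 0" using xy D_neg D_mod4 unfolding v_def[symmetric] by auto
 then have "\<alpha> \<noteq> 0" using n\<alpha> f(1) by auto
 have pa: "proper (sc \<alpha> O')" "nrm (sc \<alpha> O') = m * of_int v" using proper_sc[OF proper_O(1) \<alpha>K \<open>\<alpha> \<noteq> 0\<close>] n\<alpha> proper_O(2) by simp_all
 have "sc \<alpha> O' \<subseteq> L" using proper_smult[OF L(1) _ \<alpha>L] by (auto simp: mult.commute)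
 from integral_divide[OF pa(1) L(1) this] obtain J where J: "integral J" "sc \<alpha> O' = L \<odot> J" .
 have "m * nrm J = m * of_int v" using proper_ip(2)[OF L(1) integral_proper[OF J(1)]] J(2) pa(2) nL by simp
 then have "real (nn J) = of_int v" using integral_nn(1)[OF J(1)] f(1) by simp
 then have "int (nn J) = v" by simp
 then have cJ: "cop J" using J(1) xy by (simp add: cop_def v_def)
 have "cl L \<cdot> cl J = cl (sc \<alpha> O')" unfolding cl_mult[OF L(1) integral_proper[OF J(1)]] J(2) ..
 also have "\<dots> = 1\<^sub>G" unfolding one_G by (rule cl_sc[OF proper_O(1) \<alpha>K \<open>\<alpha> \<noteq> 0\<close>])
 finally have "cl J = inv\<^bsub>G\<^esub> (cl L)" using L(1) J(1) by (metis G.inv_equality G.m_comm cl_carrier integral_proper G.inv_inv)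
 then have "cl J = X" using L(2) X by (metis G.inv_inv)
 then show thesis using that cJ by simp
qed

definition coset_rel :: "complex set => complex set => (complex \<times> complex) set" where
 "coset_rel L M = {(x, y). x \<in> L \<and> y \<in> L \<and> x - y \<in> M}"

lemma equiv_coset_rel:
 assumes "int_complex.subspace M" shows "equiv L (coset_rel L M)"
proof (rule equivI)
 show "coset_rel L M \<subseteq> L \<times> L" by (auto simp: coset_rel_def)
 show "refl_on L (coset_rel L M)" by (auto simp: refl_on_def coset_rel_def subspace_zero[OF assms])
 show "sym (coset_rel L M)"
 proof (rule symI)
  fix x y assume "(x, y) \<in> coset_rel L M"
  then show "(y, x) \<in> coset_rel L M" using subspace_uminus[OF assms, of "x - y"] by (simp add: coset_rel_def)
 qed
 show "trans (coset_rel L M)"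
 proof (rule transI)
  fix x y z assume "(x, y) \<in> coset_rel L M" "(y, z) \<in> coset_rel L M"
  then show "(x, z) \<in> coset_rel L M" using subspace_add[OF assms, of "x - y" "y - z"] by (simp add: coset_rel_def)
 qed
qed

lemma coset_rel_Image:
 assumes M: "int_complex.subspace M" "M \<subseteq> L" and L: "int_complex.subspace L" "z \<in> L"
 shows "coset_rel L M `` {z} = coset z M"
proof (intro equalityI subsetI)
 fix v assume "v \<in> coset_rel L M `` {z}"
 then have "z - v \<in> M" by (simp add: coset_rel_def)
 then have "v - z \<in> M" using subspace_uminus[OF M(1), of "z - v"] by simp
 then show "v \<in> coset z M" unfolding coset_def by (intro image_eqI[of _ _ "v - z"]) simp_all
next
 fix v assume "v \<in> coset z M"
 then obtain u where u: "v = z + u" "u \<in> M" by (auto simp: coset_def)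
 then show "v \<in> coset_rel L M `` {z}"
  using subspace_uminus[OF M(1) u(2)] subspace_add[OF L(1) L(2)] M(2) L(2) by (auto simp: coset_rel_def)
qed

text \<open>The sublattice \<open>M\<close> has finite index in \<open>L\<close>, so
  \<open>z\<close> is a torsion point modulo \<open>M\<close>.\<close>

lemma pole_cosets:
 assumes M: "proper M" "proper L" "M \<subseteq> L" "pole M \<kappa>" "z \<in> L"
 shows "pole (coset z M) \<kappa>"
proof -
 obtain a b where ab: "a \<in> K" "b \<in> K" "Im (a * cnj b) \<noteq> 0" "M = lat a b"
  by (rule proper_lat[OF M(1)])
 define n where "n = lattice_index L M"
 obtain a' b' where ab': "a' \<in> K" "b' \<in> K" "Im (a' * cnj b') \<noteq> 0" "L = lat a' b'"
  by (rule proper_lat[OF M(2)])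
 obtain e g x where h: "e > 0" "g > 0" "M = lat (of_int e * a') (of_int x * a' + of_int g * b')"
  using proper_sub_hermite[OF M(2) ab'(4,1,2,3) M(1,3)] by metis
 have sM: "int_complex.subspace M" using M(1) by (rule proper_subspace)
 have "of_int e * a' \<in> M" "of_int x * a' + of_int g * b' \<in> M" unfolding h(3) by simp_all
 then have "of_int g * (of_int e * a') \<in> M" "of_int e * (of_int x * a' + of_int g * b') \<in> M"
  using subspace_of_int_mult[OF sM] by blast+
 moreover have "of_int (e * g) * a' = of_int g * (of_int e * a')" by simp
 moreover have "of_int (e * g) * b' = of_int e * (of_int x * a' + of_int g * b') - of_int x * (of_int e * a')"
  by (simp add: algebra_simps)
 ultimately have "of_int (e * g) * a' \<in> M" "of_int (e * g) * b' \<in> M"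
  using subspace_diff[OF sM] subspace_of_int_mult[OF sM] \<open>of_int e * a' \<in> M\<close> by metis+
 moreover obtain u v where "z = of_int u * a' + of_int v * b'" using M(5) unfolding ab'(4) by (rule latE)
 then have "of_int (e * g) * z = of_int u * (of_int (e * g) * a') + of_int v * (of_int (e * g) * b')" by (simp add: algebra_simps)
 ultimately have "of_int (e * g) * z \<in> M" using subspace_add[OF sM] subspace_of_int_mult[OF sM] by simp
 then have "of_nat (nat (e * g)) * z \<in> M" using h(1,2) by simp
 then show ?thesis using pole_torsion[OF ab(3), of "nat (e * g)" z \<kappa>] h(1,2) M(4) unfolding ab(4) by simp
qed

lemma pole_classes:
 assumes M: "proper M" "proper L" "M \<subseteq> L" "pole M \<kappa>" and Q: "Q \<subseteq> L // coset_rel L M"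
 shows "finite Q" "pole (\<Union>Q) (of_nat (card Q) * \<kappa>)"
proof -
 have sM: "int_complex.subspace M" and sL: "int_complex.subspace L" using M(1,2) by (auto intro: proper_subspace)
 have "card (L // coset_rel L M) > 0" using index_proper(2)[OF M(2,1,3)] by (simp add: lattice_index_def coset_rel_def)
 then show fin: "finite Q" using Q by (meson card_gt_0_iff finite_subset)
 have "pole (\<Union>X\<in>Q. X) (\<Sum>X\<in>Q. \<kappa>)"
 proof (rule pole_UN[OF fin])
  fix X assume "X \<in> Q"
  then obtain z where z: "z \<in> L" "X = coset_rel L M `` {z}" using Q by (auto elim: quotientE)
  then show "pole X \<kappa>" using pole_cosets[OF M z(1)] coset_rel_Image[OF sM M(3) sL z(1)] by simp
 next
  fix X Y assume "X \<in> Q" "Y \<in> Q" "X \<noteq> Y"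
  then show "X \<inter> Y = {}" using quotient_disj[OF equiv_coset_rel[OF sM]] Q by blast
 qed
 then show "pole (\<Union>Q) (of_nat (card Q) * \<kappa>)" by simp
qed

lemma pole_proper_exists: assumes "proper L" obtains \<kappa> where "pole L \<kappa>" "\<kappa> \<noteq> 0"
proof -
 obtain a b where ab: "a \<in> K" "b \<in> K" "Im (a * cnj b) \<noteq> 0" "L = lat a b"
  by (rule proper_lat[OF assms])
 obtain \<kappa> where "pole L \<kappa>" unfolding ab(4) by (rule pole_lat_exists[OF ab(3)])
 moreover have "\<not> pole L 0" unfolding ab(4) by (rule pole_lat_nonzero[OF ab(3)])
 ultimately show thesis using that by metis
qed

lemma pole_index:
 assumes M: "proper M" "proper L" "M \<subseteq> L" and p: "pole M \<kappa>" "pole L \<kappa>'"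
 shows "\<kappa>' = of_nat (lattice_index L M) * \<kappa>"
proof -
 have sM: "int_complex.subspace M" using M(1) by (rule proper_subspace)
 have "pole (\<Union>(L // coset_rel L M)) (of_nat (card (L // coset_rel L M)) * \<kappa>)"
  by (rule pole_classes(2)[OF M p(1)]) simp
 then have "pole L (of_nat (lattice_index L M) * \<kappa>)"
  unfolding Union_quotient[OF equiv_coset_rel[OF sM]] by (simp add: lattice_index_def coset_rel_def)
 then show ?thesis using pole_unique[OF p(2)] by simp
qed

definition coprime_elements :: "complex set" where
 "coprime_elements = {\<alpha> \<in> O'. \<exists>k::int. \<alpha> * cnj \<alpha> = of_int k \<and> coprime k D}"

text \<open>Coprimality of the norm depends only on the residue class modulo \<open>D\<close> times
  the order. These elements thus fill whole classes, and their sum inherits the pole of a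
  lattice.\<close>

lemma coprime_elements_shift:
 assumes "\<alpha> \<in> coprime_elements" "\<gamma> \<in> O'" shows "\<alpha> + of_int D * \<gamma> \<in> coprime_elements"
proof -
 obtain k :: int where k: "\<alpha> \<in> O'" "\<alpha> * cnj \<alpha> = of_int k" "coprime k D" using assms(1) by (auto simp: coprime_elements_def)
 define t where "t = \<alpha> * cnj \<gamma> + cnj \<alpha> * \<gamma> + of_int D * (\<gamma> * cnj \<gamma>)"
 have "t \<in> O'" unfolding t_def using k(1) assms(2) by (intro O_add O_mult O_cnj O_of_int)
 moreover have "Im t = 0" by (simp add: t_def algebra_simps)
 ultimately obtain j where j: "t = of_int j" by (rule O_real)
 have "(\<alpha> + of_int D * \<gamma>) * cnj (\<alpha> + of_int D * \<gamma>) = \<alpha> * cnj \<alpha> + of_int D * t" by (simp add: t_def algebra_simps)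
 also have "\<dots> = of_int (k + D * j)" by (simp add: k(2) j)
 finally have "(\<alpha> + of_int D * \<gamma>) * cnj (\<alpha> + of_int D * \<gamma>) = of_int (k + D * j)" .
 moreover have "coprime (k + D * j) D" using k(3) by (metis coprime_iff_gcd_eq_1 gcd.commute gcd_add_mult add.commute mult.commute)
 ultimately show ?thesis using O_add[OF k(1) O_mult[OF O_of_int assms(2)]] unfolding coprime_elements_def by blast
qed

lemma integral_divide_norm:
 assumes J: "integral J" and a: "\<alpha> \<in> J" "\<alpha> \<noteq> 0"
 obtains I where "integral I" "sc \<alpha> O' = I \<odot> J" "real (nn I) * real (nn J) = (cmod \<alpha>)\<^sup>2"
proof -
 have "\<alpha> \<in> O'" using J a(1) by (auto simp: integral_def)
 then have i: "integral (sc \<alpha> O')" "real (nn (sc \<alpha> O')) = (cmod \<alpha>)\<^sup>2" using integral_sc[OF integral_O(1) _ a(2)] integral_O(2) by simp_all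
 have "sc \<alpha> O' \<subseteq> J" using proper_smult[OF integral_proper[OF J] _ a(1)] by (auto simp: mult.commute)
 from integral_divide[OF integral_proper[OF i(1)] integral_proper[OF J] this] obtain I where I: "integral I" "sc \<alpha> O' = J \<odot> I" .
 have "nn (sc \<alpha> O') = nn J * nn I" unfolding I(2) using integral_ip(2)[OF J I(1)] .
 then show thesis using that[OF I(1)] I(2) i(2) by (simp add: ip_comm mult.commute)
qed

text \<open>As the norm of \<open>J\<close> is coprime to \<open>D\<close>, each class modulo
  \<open>D O'\<close> meets \<open>J\<close> in exactly one class modulo \<open>D J\<close>. So the
  number of classes involved does not depend on \<open>J\<close>, and \<open>J\<close> enters the
  residue only through its norm.\<close>

lemma pole_coprime_elements:
 assumes J: "cop J" and p: "pole O' \<kappa>"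
 shows "pole (J \<inter> coprime_elements) (of_nat (card {X \<in> O' // coset_rel O' (sc (of_int D) O'). X \<subseteq> coprime_elements}) * \<kappa> / (of_int D ^ 2 * of_nat (nn J)))"
proof -
 define M where "M = sc (of_int D) O'"
 define Q where "Q = {X \<in> O' // coset_rel O' M. X \<subseteq> coprime_elements}"
 have D0: "D \<noteq> 0" using D_neg by simp
 have iJ: "integral J" "coprime (int (nn J)) D" using J by (auto simp: cop_def)
 have pJ: "proper J" and JO: "J \<subseteq> O'" using iJ(1) by (auto simp: integral_def)
 have M: "proper M" "M \<subseteq> O'" unfolding M_def using integral_sc(1)[OF integral_O(1) O_of_int, of D] D0 by (auto simp: integral_def)
 have sO: "int_complex.subspace O'" by simp
 have sM: "int_complex.subspace M" using M(1) by (rule proper_subspace)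
 have sJ: "int_complex.subspace J" using pJ by (rule proper_subspace)
 define N where "N = sc (of_int D) J"
 have N: "proper N" "N \<subseteq> J" unfolding N_def using proper_sc(1)[OF pJ, of "of_int D"] D0 subspace_of_int_mult[OF sJ] by auto
 have sN: "int_complex.subspace N" using N(1) by (rule proper_subspace)
 obtain \<kappa>J where kJ: "pole J \<kappa>J" by (rule pole_proper_exists[OF pJ])
 have k1: "\<kappa> = of_nat (nn J) * \<kappa>J" using pole_index[OF pJ proper_O(1) JO kJ p] integral_nn(3)[OF iJ(1)] by simp
 have kN: "pole N (\<kappa>J / of_int D ^ 2)" unfolding N_def using pole_scale[OF kJ, of "of_int D"] D0 by simp
 obtain u v where uv: "u * int (nn J) + v * D = 1" using iJ(2) by (metis bezout_int coprime_imp_gcd_eq_1)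
 define h where "h = (\<lambda>X. X \<inter> J)"
 have NM: "M \<inter> J = N"
 proof (intro equalityI subsetI)
  fix z assume z: "z \<in> M \<inter> J"
  then obtain y where y: "y \<in> O'" "z = of_int D * y" by (auto simp: M_def)
  have "of_nat (nn J) * y \<in> J" using proper_smult[OF pJ y(1) nn_mem[OF iJ(1)]] by (simp add: mult.commute)
  then have "of_int u * (of_nat (nn J) * y) + of_int v * z \<in> J" using z sJ by (intro subspace_add subspace_of_int_mult) auto
  moreover have "of_int u * (of_nat (nn J) * y) + of_int v * z = of_int (u * int (nn J) + v * D) * y" by (simp add: y(2) algebra_simps)
  ultimately have "y \<in> J" using uv by simp
  then show "z \<in> N" unfolding N_def y(2) by blast
 next
  fix z assume "z \<in> N" then show "z \<in> M \<inter> J" using N(2) JO by (auto simp: N_def M_def)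
 qed
 have hX: "\<exists>z\<in>J. X = coset z M \<and> h X = coset z N" if X: "X \<in> O' // coset_rel O' M" for X
 proof -
  obtain y where y: "y \<in> O'" "X = coset y M" using X coset_rel_Image[OF sM M(2) sO] by (metis quotientE)
  \<comment> \<open>By Bezout the factor \<open>u * int (nn J)\<close> is 1 modulo \<open>D\<close>,
    and it moves \<open>y\<close> into \<open>J\<close>: this is the representative given by the
    Chinese remainder theorem.\<close>
  define z where "z = of_int (u * int (nn J)) * y"
  have "of_nat (nn J) * y \<in> J" using proper_smult[OF pJ y(1) nn_mem[OF iJ(1)]] by (simp add: mult.commute)
  then have zJ: "z \<in> J" unfolding z_def using subspace_of_int_mult[OF sJ, of _ u] by (simp add: mult.assoc)
  have e: "u * int (nn J) = 1 - v * D" using uv by simp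
  have "z = y + of_int D * (of_int (- v) * y)" unfolding z_def e by (simp add: algebra_simps)
  moreover have m: "of_int D * (of_int (- v) * y) \<in> M" unfolding M_def using O_mult[OF O_of_int y(1), of "- v"] by blast
  ultimately have zy: "z - y \<in> M" by simp
  have Xz: "X = coset z M"
  proof (unfold y(2) coset_def, intro equalityI subsetI)
   fix t assume "t \<in> (+) y ` M"
   then obtain s where "s \<in> M" "t = y + s" by auto
   then show "t \<in> (+) z ` M" using subspace_diff[OF sM _ zy] by (intro image_eqI[of _ _ "s - (z - y)"]) auto
  next
   fix t assume "t \<in> (+) z ` M"
   then obtain s where "s \<in> M" "t = z + s" by auto
   then show "t \<in> (+) y ` M" using subspace_add[OF sM _ zy] by (intro image_eqI[of _ _ "s + (z - y)"]) auto
  qed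
  have "h X = coset z N"
  proof (unfold Xz h_def coset_def NM[symmetric], intro equalityI subsetI)
   fix t assume "t \<in> (+) z ` M \<inter> J"
   then obtain s where s: "s \<in> M" "t = z + s" "t \<in> J" by auto
   then have "s \<in> J" using subspace_diff[OF sJ s(3) zJ] by simp
   then show "t \<in> (+) z ` (M \<inter> J)" using s by simp
  next
   fix t assume "t \<in> (+) z ` (M \<inter> J)" then show "t \<in> (+) z ` M \<inter> J" using subspace_add[OF sJ zJ] by auto
  qed
  then show ?thesis using zJ Xz by blast
 qed
 have z0: "0 \<in> M" using subspace_zero[OF sM] .
 have z0N: "0 \<in> N" using subspace_zero[OF sN] .
 have inj: "inj_on h Q"
 proof (rule inj_onI)
  fix X Y assume XY: "X \<in> Q" "Y \<in> Q" "h X = h Y"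
  obtain z where z: "z \<in> J" "X = coset z M" "h X = coset z N" using hX XY(1) unfolding Q_def by blast
  have "z \<in> h X" unfolding z(3) coset_def using z0N by simp
  then have "z \<in> X \<inter> Y" using XY(3) by (auto simp: h_def)
  then show "X = Y" using quotient_disj[OF equiv_coset_rel[OF sM]] XY(1,2) unfolding Q_def by blast
 qed
 have hQ: "h ` Q \<subseteq> J // coset_rel J N"
 proof
  fix Y assume "Y \<in> h ` Q"
  then obtain z where "z \<in> J" "Y = coset z N" using hX unfolding Q_def by blast
  then show "Y \<in> J // coset_rel J N" using coset_rel_Image[OF sN N(2) sJ] by (metis quotientI)
 qed
 have "\<Union>(h ` Q) = J \<inter> coprime_elements"
 proof (intro equalityI subsetI)
  fix t assume "t \<in> \<Union>(h ` Q)" then show "t \<in> J \<inter> coprime_elements" by (auto simp: h_def Q_def)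
 next
  fix t assume t: "t \<in> J \<inter> coprime_elements"
  then have tO: "t \<in> O'" using JO by blast
  have X: "coset_rel O' M `` {t} = coset t M" by (rule coset_rel_Image[OF sM M(2) sO tO])
  have "coset t M \<subseteq> coprime_elements" using t coprime_elements_shift[of t] by (auto simp: coset_def M_def)
  then have "coset t M \<in> Q" unfolding Q_def using quotientI[OF tO, of "coset_rel O' M"] X by simp
  moreover have "t \<in> h (coset t M)" unfolding h_def coset_def using z0 t by simp
  ultimately show "t \<in> \<Union>(h ` Q)" by blast
 qed
 then have "pole (J \<inter> coprime_elements) (of_nat (card (h ` Q)) * (\<kappa>J / of_int D ^ 2))"
  using pole_classes(2)[OF N(1) pJ N(2) kN hQ] by simp
 moreover have "card (h ` Q) = card Q" using inj by (rule card_image)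
 moreover have "nn J > 0" using integral_nn(2)[OF iJ(1)] .
 ultimately show ?thesis unfolding M_def[symmetric] Q_def[symmetric] k1 by simp
qed

text \<open>The units of the order. Their number is the multiplicity with which a principal ideal is
  counted by its generators.\<close>

definition unit_elements :: "complex set" where "unit_elements = {u \<in> O'. cmod u = 1}"

lemma finite_unit_elements: "finite unit_elements"
proof -
 have im: "Im (1 * cnj \<theta>) \<noteq> 0" using Im_theta Im_rD_pos by simp
 obtain c where c: "c > 0" "\<And>R z. finite {p. \<not> (c * (1 + mx p) \<le> norm (pt 1 \<theta> z p) \<and> R \<le> norm (pt 1 \<theta> z p))}"
  using pt_lower[OF im] by blast
 have "unit_elements \<subseteq> pt 1 \<theta> 0 ` {p. \<not> (c * (1 + mx p) \<le> norm (pt 1 \<theta> 0 p) \<and> 2 \<le> norm (pt 1 \<theta> 0 p))}"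
 proof
  fix u assume u: "u \<in> unit_elements"
  then have "u \<in> coset 0 (lat 1 \<theta>)" by (simp add: unit_elements_def O_eq_lat coset_def)
  then obtain p where p: "u = pt 1 \<theta> 0 p" by (auto simp: coset_pt)
  have "cmod u = 1" using u by (simp add: unit_elements_def)
  then show "u \<in> pt 1 \<theta> 0 ` {p. \<not> (c * (1 + mx p) \<le> norm (pt 1 \<theta> 0 p) \<and> 2 \<le> norm (pt 1 \<theta> 0 p))}"
   unfolding p by (intro imageI) simp
 qed
 then show ?thesis using c(2) by (meson finite_imageI finite_subset)
qed

lemma one_unit_element: "1 \<in> unit_elements" by (simp add: unit_elements_def O_1)

lemma sc_unit: assumes "u \<in> unit_elements" shows "sc u O' = O'"
proof -
 have u: "u \<in> O'" "u * cnj u = 1" using assms complex_norm_square[of u] by (auto simp: unit_elements_def)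
 show ?thesis
 proof (intro equalityI subsetI)
  fix z assume "z \<in> sc u O'" then show "z \<in> O'" using O_mult[OF u(1)] by auto
 next
  fix z assume "z \<in> O'"
  then have "cnj u * z \<in> O'" using O_mult[OF O_cnj[OF u(1)]] by simp
  moreover have "z = u * (cnj u * z)" using u(2) by simp
  ultimately show "z \<in> sc u O'" by blast
 qed
qed

text \<open>By the pigeonhole principle an ideal contains an element of norm at most a constant times its
 norm; hence every class contains an ideal of bounded norm.\<close>

lemma finite_G: "finite (carrier G)"
proof -
 define c where "c = 1 + cmod \<theta>"
 define N where "N = nat \<lceil>c\<^sup>2\<rceil>"
 have im: "Im (1 * cnj \<theta>) \<noteq> 0" using Im_theta Im_rD_pos by simp
 have "carrier G \<subseteq> (\<lambda>(e, g, x). cl (lat (of_int e) (of_int x + of_int g * \<theta>))) ` ({1..int N} \<times> {1..int N} \<times> {0..int N})"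
 proof
  fix X assume X: "X \<in> carrier G"
  obtain J where J: "cop J" "cl J = inv\<^bsub>G\<^esub> X" using cop_exists[OF G.inv_closed[OF X]] .
  have iJ: "integral J" "proper J" "J \<subseteq> O'" using J(1) by (auto simp: cop_def integral_def)
  \<comment> \<open>The box has \<open>(m + 1)\<^sup>2 > nn J\<close> points, more than there are
    residue classes modulo \<open>J\<close>, so two of them differ by an element of
    \<open>J\<close>.\<close>
  define m where "m = floor_sqrt (nn J)"
  have m: "m ^ 2 \<le> nn J" "nn J < (m + 1)\<^sup>2" using floor_sqrt_power2_le[of "nn J"] Suc_floor_sqrt_power2_gt[of "nn J"] by (simp_all add: m_def)
  define \<phi> where "\<phi> = (\<lambda>(x, y). coset_rel O' J `` {of_int x + of_int y * \<theta>})"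
  define B where "B = {0..int m} \<times> {0..int m}"
  have O: "of_int x + of_int y * \<theta> \<in> O'" for x y unfolding O_eq_lat using latI[of x 1 y \<theta>] by simp
  have "card (O' // coset_rel O' J) = nn J" using integral_nn(3)[OF iJ(1)] by (simp add: lattice_index_def coset_rel_def)
  moreover have "\<phi> ` B \<subseteq> O' // coset_rel O' J" using quotientI[OF O] by (auto simp: \<phi>_def)
  ultimately have "card (\<phi> ` B) \<le> nn J" using integral_nn(2)[OF iJ(1)] by (metis card_ge_0_finite card_mono)
  also have "nn J < card B" using m(2) by (simp add: B_def card_cartesian_product power2_eq_square nat_add_distrib)
  finally have "\<not> inj_on \<phi> B" by (rule pigeonhole)
  then obtain q q' where q: "q \<in> B" "q' \<in> B" "q \<noteq> q'" "\<phi> q = \<phi> q'" unfolding inj_on_def by blast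
  obtain x y x' y' where e: "q = (x, y)" "q' = (x', y')" by fastforce
  define \<alpha> where "\<alpha> = (of_int x + of_int y * \<theta>) - (of_int x' + of_int y' * \<theta>)"
  have \<alpha>J: "\<alpha> \<in> J"
   using eq_equiv_class_iff[OF equiv_coset_rel[OF proper_subspace[OF iJ(2)]] O O] q(4) by (simp add: e \<phi>_def \<alpha>_def coset_rel_def)
  have \<alpha>: "\<alpha> = of_int (x - x') * 1 + of_int (y - y') * \<theta>" by (simp add: \<alpha>_def algebra_simps)
  have \<alpha>0: "\<alpha> \<noteq> 0"
  proof
   assume "\<alpha> = 0"
   then have "of_int (x - x') * 1 + of_int (y - y') * \<theta> = of_int 0 * 1 + of_int 0 * \<theta>" using \<alpha> by simp
   from lat_coord_unique[OF im this] show False using q(3) e by simp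
  qed
  have "\<bar>x - x'\<bar> \<le> int m" "\<bar>y - y'\<bar> \<le> int m" using q(1,2) by (auto simp: e B_def)
  then have b: "\<bar>real_of_int (x - x')\<bar> \<le> real m" "\<bar>real_of_int (y - y')\<bar> \<le> real m" by linarith+
  have "cmod \<alpha> \<le> \<bar>real_of_int (x - x')\<bar> * 1 + \<bar>real_of_int (y - y')\<bar> * cmod \<theta>"
   unfolding \<alpha> using norm_triangle_ineq[of "of_int (x - x') * 1" "of_int (y - y') * \<theta>"] by (simp only: norm_mult norm_of_int norm_one)
  also have "\<dots> \<le> real m * 1 + real m * cmod \<theta>" using b by (intro add_mono mult_right_mono) auto
  finally have "cmod \<alpha> \<le> real m * c" by (simp add: c_def distrib_left)
  then have "(cmod \<alpha>)\<^sup>2 \<le> (real m)\<^sup>2 * c\<^sup>2" unfolding power_mult_distrib[symmetric] by (rule power_mono) simp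
  also have "\<dots> \<le> real (nn J) * c\<^sup>2" using m(1) by (intro mult_right_mono) (simp_all flip: of_nat_power)
  finally have n\<alpha>: "(cmod \<alpha>)\<^sup>2 \<le> real (nn J) * c\<^sup>2" .
  obtain I where I: "integral I" "sc \<alpha> O' = I \<odot> J" "real (nn I) * real (nn J) = (cmod \<alpha>)\<^sup>2"
   by (rule integral_divide_norm[OF iJ(1) \<alpha>J \<alpha>0])
  have "real (nn I) \<le> c\<^sup>2" using n\<alpha> integral_nn(2)[OF iJ(1)] unfolding I(3)[symmetric] by simp
  then have nI: "int (nn I) \<le> int N" unfolding N_def by linarith
  have "cl I \<cdot> cl J = 1\<^sub>G"
   unfolding cl_mult[OF integral_proper[OF I(1)] iJ(2)] I(2)[symmetric] one_G using \<alpha>J iJ(3) by (intro cl_sc[OF proper_O(1) O_K \<alpha>0]) auto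
  then have "cl I = inv\<^bsub>G\<^esub> (cl J)" using I(1) iJ(2) by (metis G.inv_equality cl_carrier G.inv_inv integral_proper)
  then have XI: "X = cl I" using J(2) X by simp
  \<comment> \<open>A Hermite basis with \<open>x\<close> reduced modulo \<open>e\<close> leaves
    finitely many candidates for ideals of norm at most \<open>N\<close>.\<close>
  obtain e g x where h: "e > 0" "g > 0" "I = lat (of_int e) (of_int x + of_int g * \<theta>)" "int (nn I) = e * g" by (rule integral_hermite[OF I(1)])
  have "of_int (x mod e) + of_int g * \<theta> = (of_int x + of_int g * \<theta>) + of_int (- (x div e)) * of_int e"
   by (simp add: minus_div_mult_eq_mod[symmetric] algebra_simps)
  then have sh: "of_int (x mod e) + of_int g * \<theta> = of_int (- (x div e)) * of_int e + of_int 1 * (of_int x + of_int g * \<theta>)"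
   "of_int x + of_int g * \<theta> = of_int (x div e) * of_int e + of_int 1 * (of_int (x mod e) + of_int g * \<theta>)" by simp_all
  have "I = lat (of_int e) (of_int (x mod e) + of_int g * \<theta>)"
   unfolding h(3) by (intro equalityI lat_subset subspace_lat lat_mem1; subst sh; rule latI)
  moreover have "e \<le> e * g" "g \<le> e * g" using h(1,2) by simp_all
  then have "e \<le> int N" "g \<le> int N" using h(4) nI by linarith+
  then have "e \<in> {1..int N}" "g \<in> {1..int N}" "x mod e \<in> {0..int N}"
   using h(1,2) pos_mod_bound[OF h(1), of x] pos_mod_sign[OF h(1), of x] by auto
  ultimately show "X \<in> (\<lambda>(e, g, x). cl (lat (of_int e) (of_int x + of_int g * \<theta>))) ` ({1..int N} \<times> {1..int N} \<times> {0..int N})"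
   unfolding XI by (intro image_eqI[of _ _ "(e, g, x mod e)"]) simp_all
 qed
 then show ?thesis by (rule finite_subset) simp
qed

abbreviation Nexp :: "complex => complex set => complex" where
 "Nexp s I \<equiv> exp (- s * of_real (ln (real (nn I))))"

text \<open>For \<open>J\<close> coprime to \<open>D\<close> in the class inverse to
  \<open>A\<close>, the ideals \<open>I\<close> to be counted correspond to the generators of the
  principal ideals \<open>I \<odot> J\<close>, that is, to the elements of \<open>J\<close> with
  norm coprime to \<open>D\<close>, up to units. This turns the sum over ideals into a lattice sum.
  In the residue the norm of \<open>J\<close> cancels, so it is the same for all classes.\<close>

lemma ideal_zeta:
 obtains \<kappa> where "\<kappa> \<noteq> 0" "\<forall>A\<in>carrier G. \<exists>W. W holomorphic_on ball 2 2 \<and> W 1 = \<kappa> \<and>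
  (\<forall>s. s \<in> ball 2 2 --> Re s > 1 --> ((\<lambda>I. Nexp s I) has_sum (W s / (s - 1))) {I. cop I \<and> cl I = A})"
proof -
 obtain \<rho> where \<rho>: "pole O' \<rho>" "\<rho> \<noteq> 0" by (rule pole_proper_exists[OF proper_O(1)])
 define Q where "Q = {X \<in> O' // coset_rel O' (sc (of_int D) O'). X \<subseteq> coprime_elements}"
 define w where "w = card unit_elements"
 have w0: "w > 0" unfolding w_def using finite_unit_elements one_unit_element by (auto simp: card_gt_0_iff)
 have D0: "D \<noteq> 0" using D_neg by simp
 have M: "proper (sc (of_int D) O')" "sc (of_int D) O' \<subseteq> O'"
  using integral_sc(1)[OF integral_O(1) O_of_int, of D] D0 by (auto simp: integral_def)
 have sM: "int_complex.subspace (sc (of_int D) O')" using M(1) by (rule proper_subspace)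
 have Q0: "card Q > 0"
 proof -
  obtain \<rho>' where "pole (sc (of_int D) O') \<rho>'" by (rule pole_proper_exists[OF M(1)])
  from pole_classes(1)[OF M(1) proper_O(1) M(2) this, of Q] have "finite Q" by (auto simp: Q_def)
  moreover have "coset_rel O' (sc (of_int D) O') `` {1} \<in> Q"
  proof -
   have "1 \<in> coprime_elements" unfolding coprime_elements_def by simp
   then have "coset 1 (sc (of_int D) O') \<subseteq> coprime_elements"
    using coprime_elements_shift[of 1] by (auto simp: coset_def)
   then show ?thesis unfolding Q_def using quotientI[OF O_1, of "coset_rel O' (sc (of_int D) O')"] coset_rel_Image[OF sM M(2) O_subspace O_1] by simp
  qed
  ultimately show ?thesis by (auto simp: card_gt_0_iff)
 qed
 define \<kappa> where "\<kappa> = of_nat (card Q) * \<rho> / (of_int D ^ 2 * of_nat w)"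
 have "\<kappa> \<noteq> 0" using Q0 \<rho>(2) D0 w0 by (simp add: \<kappa>_def)
 moreover have "\<exists>W. W holomorphic_on ball 2 2 \<and> W 1 = \<kappa> \<and>
  (\<forall>s. s \<in> ball 2 2 --> Re s > 1 --> ((\<lambda>I. Nexp s I) has_sum (W s / (s - 1))) {I. cop I \<and> cl I = A})"
  if A: "A \<in> carrier G" for A
 proof -
  have iA: "inv\<^bsub>G\<^esub> A \<in> carrier G" using A by simp
  obtain J where J: "cop J" "cl J = inv\<^bsub>G\<^esub> A" by (rule cop_exists[OF iA])
  have iJ: "integral J" "proper J" "coprime (int (nn J)) D" using J(1) by (auto simp: cop_def)
  have nJ: "nn J > 0" using integral_nn(2)[OF iJ(1)] .
  define R where "R = J \<inter> coprime_elements"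
  define II where "II = {I. cop I \<and> cl I = A}"
  have pR: "pole R (of_nat (card Q) * \<rho> / (of_int D ^ 2 * of_nat (nn J)))"
   unfolding R_def Q_def by (rule pole_coprime_elements[OF J(1) \<rho>(1)])
  then obtain V where V: "V holomorphic_on ball 2 2" "V 1 = of_nat (card Q) * \<rho> / (of_int D ^ 2 * of_nat (nn J))"
   "\<And>s. s \<in> ball 2 2 ==> Re s > 1 ==> (phi s has_sum (V s / (s - 1))) R" unfolding pole_def by blast
  have R0: "\<alpha> \<noteq> 0" if "\<alpha> \<in> R" for \<alpha>
  proof
   assume "\<alpha> = 0"
   moreover have "\<exists>k::int. \<alpha> * cnj \<alpha> = of_int k \<and> coprime k D" using that by (simp add: R_def coprime_elements_def)
   ultimately obtain k :: int where "of_int k = (0::complex)" "coprime k D" by simp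
   then have "coprime 0 D" by simp
   then have "is_unit D" by simp
   then show False using D_neg D_mod4 by auto
  qed
  have "\<exists>\<alpha>. \<alpha> \<in> R \<and> sc \<alpha> O' = I \<odot> J \<and> (cmod \<alpha>)\<^sup>2 = real (nn I) * real (nn J)" if I: "I \<in> II" for I
  proof -
   have i: "integral I" "proper I" "coprime (int (nn I)) D" "cl I = A" using I by (auto simp: II_def cop_def)
   have "cl (I \<odot> J) = 1\<^sub>G" using cl_mult[OF i(2) iJ(2)] i(4) J(2) A by simp
   then have "cl O' = cl (I \<odot> J)" by (simp add: one_G)
   then obtain \<alpha> where \<alpha>: "\<alpha> \<in> K" "\<alpha> \<noteq> 0" "I \<odot> J = sc \<alpha> O'"
    using cl_eq_iff[OF proper_O(1) proper_ip(1)[OF i(2) iJ(2)]] by blast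
   have n: "(cmod \<alpha>)\<^sup>2 = real (nn I) * real (nn J)"
    using proper_sc(2)[OF proper_O(1) \<alpha>(1,2)] proper_ip(2)[OF i(2) iJ(2)] integral_nn(1)[OF i(1)] integral_nn(1)[OF iJ(1)] proper_O(2) \<alpha>(3) by simp
   have "\<alpha> \<in> sc \<alpha> O'" using O_1 by (intro image_eqI[of _ _ 1]) auto
   then have \<alpha>J: "\<alpha> \<in> J" using \<alpha>(3) ip_subset_right[OF i(1) iJ(2)] by blast
   have "\<alpha> * cnj \<alpha> = of_real ((cmod \<alpha>)\<^sup>2)" by (simp only: complex_norm_square)
   also have "\<dots> = of_int (int (nn I) * int (nn J))" unfolding n by simp
   finally have "\<alpha> * cnj \<alpha> = of_int (int (nn I) * int (nn J))" .
   moreover have "coprime (int (nn I) * int (nn J)) D" using i(3) iJ(3) by simp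
   ultimately have "\<alpha> \<in> R" using \<alpha>J iJ(1) unfolding R_def coprime_elements_def integral_def by blast
   then show ?thesis using n \<alpha>(3) by blast
  qed
  then obtain g where g: "\<And>I. I \<in> II ==> g I \<in> R" "\<And>I. I \<in> II ==> sc (g I) O' = I \<odot> J"
   "\<And>I. I \<in> II ==> (cmod (g I))\<^sup>2 = real (nn I) * real (nn J)" by metis
  have bij: "bij_betw (\<lambda>(I, u). g I * u) (II \<times> unit_elements) R"
  proof (rule bij_betwI')
   fix x y assume xy: "x \<in> II \<times> unit_elements" "y \<in> II \<times> unit_elements"
   obtain I u I' u' where e: "x = (I, u)" "y = (I', u')" by fastforce
   have m: "I \<in> II" "I' \<in> II" "u \<in> unit_elements" "u' \<in> unit_elements" using xy e by auto
   show "((case x of (I, u) => g I * u) = (case y of (I, u) => g I * u)) = (x = y)"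
   proof
    assume "(case x of (I, u) => g I * u) = (case y of (I, u) => g I * u)"
    then have eq: "g I * u = g I' * u'" by (simp add: e)
    have "sc (g I) O' = sc (g I * u) O'" using sc_unit[OF m(3)] sc_sc[of "g I" u O'] by simp
    also have "\<dots> = sc (g I') O'" unfolding eq using sc_unit[OF m(4)] sc_sc[of "g I'" u' O'] by simp
    finally have "J \<odot> I = J \<odot> I'" using g(2) m by (simp add: ip_comm)
    moreover have "proper I" "proper I'" using m by (auto simp: II_def cop_def)
    ultimately have "I = I'" using ip_cancel[OF iJ(2)] by blast
    then show "x = y" using eq R0[OF g(1)[OF m(1)]] by (simp add: e)
   qed simp
  next
   fix x assume x: "x \<in> II \<times> unit_elements"
   then obtain I u where e: "x = (I, u)" "I \<in> II" "u \<in> unit_elements" by auto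
   have u: "u \<in> O'" "u * cnj u = 1" using e(3) complex_norm_square[of u] by (auto simp: unit_elements_def)
   obtain k :: int where k: "g I \<in> J" "g I \<in> O'" "g I * cnj (g I) = of_int k" "coprime k D"
    using g(1)[OF e(2)] by (auto simp: R_def coprime_elements_def)
   have "(g I * u) * cnj (g I * u) = (g I * cnj (g I)) * (u * cnj u)" by simp
   then have "(g I * u) * cnj (g I * u) = of_int k" by (simp only: k(3) u(2) mult_1_right)
   moreover have "g I * u \<in> J" using proper_smult[OF iJ(2) u(1) k(1)] by (simp add: mult.commute)
   ultimately show "(case x of (I, u) => g I * u) \<in> R"
    using k(4) O_mult[OF k(2) u(1)] unfolding e(1) R_def coprime_elements_def by auto
  next
   fix \<alpha> assume a: "\<alpha> \<in> R"
   then have aJ: "\<alpha> \<in> J" by (simp add: R_def)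
   obtain I where I: "integral I" "sc \<alpha> O' = I \<odot> J" "real (nn I) * real (nn J) = (cmod \<alpha>)\<^sup>2"
    by (rule integral_divide_norm[OF iJ(1) aJ R0[OF a]])
   have pI: "proper I" using I(1) by simp
   obtain k :: int where k: "\<alpha> \<in> O'" "\<alpha> * cnj \<alpha> = of_int k" "coprime k D" using a by (auto simp: R_def coprime_elements_def)
   have "(of_int k :: complex) = of_real ((cmod \<alpha>)\<^sup>2)" unfolding k(2)[symmetric] by (simp only: complex_norm_square)
   also have "\<dots> = of_int (int (nn I) * int (nn J))" unfolding I(3)[symmetric] by simp
   finally have "k = int (nn I) * int (nn J)" by (simp only: of_int_eq_iff)
   then have "cop I" using I(1) k(3) by (simp add: cop_def)
   moreover have "cl I = A"
   proof -
    have "cl I \<cdot> cl J = 1\<^sub>G"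
     unfolding cl_mult[OF pI iJ(2)] I(2)[symmetric] one_G by (rule cl_sc[OF proper_O(1) O_K[OF k(1)] R0[OF a]])
    then have "cl I = inv\<^bsub>G\<^esub> (cl J)" using pI iJ(2) by (metis G.inv_equality cl_carrier G.inv_inv)
    then show ?thesis using J(2) A by simp
   qed
   ultimately have II: "I \<in> II" by (simp add: II_def)
   have "\<alpha> \<in> sc \<alpha> O'" using O_1 by (intro image_eqI[of _ _ 1]) auto
   then have "\<alpha> \<in> sc (g I) O'" using g(2)[OF II] I(2) by simp
   then obtain u where u: "u \<in> O'" "\<alpha> = g I * u" by auto
   have "(cmod (g I))\<^sup>2 = (cmod \<alpha>)\<^sup>2" using g(3)[OF II] I(3) by simp
   then have "cmod (g I) = cmod \<alpha>" by simp
   then have "cmod u = 1" using u(2) R0[OF a] by (simp add: norm_mult)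
   then show "\<exists>x\<in>II \<times> unit_elements. \<alpha> = (case x of (I, u) => g I * u)"
    using u II by (intro bexI[of _ "(I, u)"]) (auto simp: unit_elements_def)
  qed
  \<comment> \<open>The exponential is \<open>nn J\<close> to the power \<open>s\<close> and
    compensates for the factor \<open>nn J\<close> in the squared length of a generator;
    \<open>w\<close> counts the generators of each ideal.\<close>
  define W where "W = (\<lambda>s. exp (s * of_real (ln (real (nn J)))) * V s / of_nat w)"
  have "((\<lambda>I. Nexp s I) has_sum (W s / (s - 1))) II" if s: "s \<in> ball 2 2" "Re s > 1" for s
  proof -
   have "((\<lambda>x. phi s (case x of (I, u) => g I * u)) has_sum (V s / (s - 1))) (II \<times> unit_elements)"
    using has_sum_reindex_bij_betw[OF bij] V(3)[OF s] by blast
   then have "((\<lambda>I. \<Sum>u\<in>unit_elements. phi s (g I * u)) has_sum (V s / (s - 1))) II"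
    by (rule has_sum_SigmaD) (use has_sum_finite[OF finite_unit_elements] in auto)
   then have "((\<lambda>I. of_nat w * exp (- s * of_real (ln (real (nn J)))) * Nexp s I) has_sum (V s / (s - 1))) II"
   proof (rule has_sum_cong[THEN iffD1, rotated])
    fix I assume I: "I \<in> II"
    have nI: "nn I > 0" using I integral_nn(2) by (auto simp: II_def cop_def)
    have g0: "g I \<noteq> 0" using R0 g(1)[OF I] by simp
    have "2 * ln (cmod (g I)) = ln ((cmod (g I))\<^sup>2)" using g0 by (simp add: ln_realpow)
    also have "\<dots> = ln (real (nn I)) + ln (real (nn J))" unfolding g(3)[OF I] using nI nJ by (simp add: ln_mult)
    finally have l: "2 * ln (cmod (g I)) = ln (real (nn I)) + ln (real (nn J))" .
    have "phi s (g I * u) = exp (- s * of_real (ln (real (nn J)))) * Nexp s I" if u: "u \<in> unit_elements" for u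
    proof -
     have "cmod u = 1" using u by (simp add: unit_elements_def)
     moreover from this have "u \<noteq> 0" by auto
     ultimately have "phi s (g I * u) = exp (- s * of_real (2 * ln (cmod (g I))))" using g0 by (simp add: phi_exp norm_mult) (simp add: mult_ac)
     also have "\<dots> = exp (- s * of_real (ln (real (nn J)))) * Nexp s I"
      unfolding l exp_add[symmetric] by (simp add: algebra_simps)
     finally show ?thesis .
    qed
    then show "(\<Sum>u\<in>unit_elements. phi s (g I * u)) = of_nat w * exp (- s * of_real (ln (real (nn J)))) * Nexp s I"
     by (simp add: w_def)
   qed
   then have "((\<lambda>I. (exp (s * of_real (ln (real (nn J)))) / of_nat w) * (of_nat w * exp (- s * of_real (ln (real (nn J)))) * Nexp s I))
    has_sum ((exp (s * of_real (ln (real (nn J)))) / of_nat w) * (V s / (s - 1)))) II" by (rule has_sum_cmult_right)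
   moreover have "(exp (s * of_real (ln (real (nn J)))) / of_nat w) * (of_nat w * exp (- s * of_real (ln (real (nn J)))) * X) = X" for X
    using w0 by (simp add: exp_minus)
   ultimately show ?thesis by (simp add: W_def)
  qed
  moreover have "W holomorphic_on ball 2 2" unfolding W_def by (intro holomorphic_intros V(1)) (use w0 in auto)
  moreover have "W 1 = \<kappa>"
  proof -
   have "exp (1 * of_real (ln (real (nn J)))) = (of_nat (nn J) :: complex)" using nJ by (simp add: exp_of_real)
   then show ?thesis using nJ by (simp add: W_def V(2) \<kappa>_def)
  qed
  ultimately show ?thesis unfolding II_def by blast
 qed
 ultimately show thesis using that by simp
qed

text \<open>The norms are distinct squares.\<close>

lemma inert_summable: "(\<lambda>P. 1 / real (nn P)) summable_on inert_primes"
proof -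
 have inj: "inj_on nn inert_primes"
 proof (rule inj_onI)
  fix P Q assume P: "P \<in> inert_primes" and Q: "Q \<in> inert_primes" and e: "nn P = nn Q"
  obtain p where p: "P = sc (of_nat p) O'" "nn P = p * p" using P by (rule inertE)
  obtain q where q: "Q = sc (of_nat q) O'" "nn Q = q * q" using Q by (rule inertE)
  have "p\<^sup>2 = q\<^sup>2" using e p(2) q(2) by (simp add: power2_eq_square)
  then have "p = q" by simp
  then show "P = Q" using p q by simp
 qed
 have "(\<lambda>n. 1 / real n) summable_on ((\<lambda>n. n * n) ` (UNIV :: nat set))"
 proof (subst summable_on_reindex)
  show "inj (\<lambda>n::nat. n * n)" by (rule injI) (metis power2_eq_iff_nonneg power2_eq_square zero_le)
  have "summable (\<lambda>n. 1 / real n ^ 2)" using inverse_power_summable[of 2, where 'a = real] by (simp add: inverse_eq_divide)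
  then have "(\<lambda>n. 1 / real n ^ 2) summable_on UNIV" by (rule summable_nonneg_imp_summable_on) simp
  then show "(\<lambda>n. 1 / real n) \<circ> (\<lambda>n. n * n) summable_on UNIV" by (simp add: o_def power2_eq_square)
 qed
 moreover have "nn ` inert_primes \<subseteq> (\<lambda>n. n * n) ` UNIV" by (auto elim!: inertE)
 ultimately have "(\<lambda>n. 1 / real n) summable_on (nn ` inert_primes)" by (rule summable_on_subset_banach)
 then show ?thesis by (simp add: summable_on_reindex[OF inj] o_def)
qed

text \<open>Unique factorisation identifies the multisets over \<open>PP\<close> with the ideals
  coprime to \<open>D\<close>, so \<open>prime_system\<close> applies. The inert primes are then
  dropped, because their sum converges.\<close>

theorem split_not_summable:
 assumes X: "X \<in> carrier G" "X \<cdot> X = 1\<^sub>G"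
 shows "\<not> (\<lambda>P. 1 / real (nn P)) summable_on {P \<in> split_primes. cl P = X}"
proof
 assume s: "(\<lambda>P. 1 / real (nn P)) summable_on {P \<in> split_primes. cl P = X}"
 obtain \<kappa> where \<kappa>: "\<kappa> \<noteq> 0" "\<forall>A\<in>carrier G. \<exists>W. W holomorphic_on ball 2 2 \<and> W 1 = \<kappa> \<and>
  (\<forall>s. s \<in> ball 2 2 --> Re s > 1 --> ((\<lambda>I. Nexp s I) has_sum (W s / (s - 1))) {I. cop I \<and> cl I = A})"
  by (rule ideal_zeta)
 from bchoice[OF \<kappa>(2)] obtain W where W: "\<And>A. A \<in> carrier G ==> W A holomorphic_on ball 2 2" "\<And>A. A \<in> carrier G ==> W A 1 = \<kappa>"
  "\<And>A s. A \<in> carrier G ==> s \<in> ball 2 2 ==> Re s > 1 ==>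
   ((\<lambda>I. Nexp s I) has_sum (W A s / (s - 1))) {I. cop I \<and> cl I = A}" by blast
 have cp: "cop (mprod M)" "proper (mprod M)" if "M \<in> ms PP" for M
  using mprod_cop(1)[of M] that by (auto simp: ms_def cop_def)
 have single: "P \<odot> O' = P" if "P \<in> PP" for P using O_ip[OF integral_proper[OF PP_integral[OF that]]] by (simp add: ip_comm)
 have lnN_eq: "lnN (\<lambda>P. real (nn P)) M = ln (real (nn (mprod M)))" if "M \<in> ms PP" for M
  using that
 proof (induction M)
  case empty then show ?case by (simp add: lnN_def integral_O(2))
 next
  case (add P M)
  then have M: "M \<in> ms PP" "P \<in> PP" by (auto simp: ms_def)
  have i: "integral P" "integral (mprod M)" using PP_integral[OF M(2)] cp[OF M(1)] by (auto simp: cop_def)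
  have "ln (real (nn (mprod (add_mset P M)))) = ln (real (nn P)) + ln (real (nn (mprod M)))"
   using integral_ip(2)[OF i] integral_nn(2)[OF i(1)] integral_nn(2)[OF i(2)] by (simp add: ln_mult)
  then show ?case using add.IH[OF M(1)] by (simp add: lnN_def)
 qed
 interpret ps: prime_system "class_group d0 f" PP "\<lambda>P. real (nn P)" "\<lambda>M. cl (mprod M)" W \<kappa>
 proof (unfold_locales, goal_cases)
  case 1 show ?case by (rule finite_G)
 next
  case (2 p) then show ?case using PP_gt1 by simp
 next
  case 3 show ?case by (simp add: one_G)
 next
  case (4 M) then show ?case using cp by simp
 next
  case (5 P M)
  then show ?case using cl_mult[OF integral_proper[OF PP_integral] cp(2)] by (simp add: single)
 next
  case (6 A) then show ?case by (rule W(1))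
 next
  case (7 A) then show ?case by (rule W(2))
 next
  case 8 show ?case by (rule \<kappa>(1))
 next
  case (9 A s)
  have "bij_betw mprod {M \<in> ms PP. cl (mprod M) = A} {I. cop I \<and> cl I = A}"
  proof (rule bij_betw_imageI)
   show "inj_on mprod {M \<in> ms PP. cl (mprod M) = A}" using mprod_inj by (auto simp: inj_on_def ms_def)
   show "mprod ` {M \<in> ms PP. cl (mprod M) = A} = {I. cop I \<and> cl I = A}"
   proof (intro equalityI subsetI)
    fix I assume I: "I \<in> {I. cop I \<and> cl I = A}"
    then obtain M where "set_mset M \<subseteq> PP" "mprod M = I" using mprod_exists by blast
    then show "I \<in> mprod ` {M \<in> ms PP. cl (mprod M) = A}" using I by (intro image_eqI[of _ _ M]) (auto simp: ms_def)
   qed (use cp in auto)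
  qed
  from has_sum_reindex_bij_betw[OF this, of "\<lambda>I. Nexp s I" "W A s / (s - 1)"] W(3)[OF 9]
  have "((\<lambda>M. exp (- s * of_real (ln (real (nn (mprod M)))))) has_sum (W A s / (s - 1))) {M \<in> ms PP. cl (mprod M) = A}" by simp
  moreover have "exp (- s * of_real (ln (real (nn (mprod M))))) = exp (- s * of_real (lnN (\<lambda>P. real (nn P)) M))"
   if "M \<in> {M \<in> ms PP. cl (mprod M) = A}" for M using that lnN_eq by simp
  ultimately show ?case using has_sum_cong by (metis (no_types, lifting))
 qed
 have "(\<lambda>P. 1 / real (nn P)) summable_on {P \<in> split_primes. cl P = X} \<union> inert_primes"
  by (intro summable_on_Un_disjoint s inert_summable) (auto simp: split_primes_def elim!: inertE dest!: prime_product)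
 then have "(\<lambda>P. 1 / real (nn P)) summable_on {P \<in> PP. cl (mprod {#P#}) = X}"
  by (rule summable_on_subset_banach) (auto simp: PP_def single)
 then show False using ps.not_summable_class[OF X] by simp
qed

end

section \<open>Legendre's theorem on ternary forms\<close>

text \<open>A Hensel step that multiplies the modulus by \<open>p\<close>. For odd \<open>p\<close>
  it is Newton's correction with an inverse of \<open>2 r\<close>; for \<open>p = 2\<close> the
  correction is \<open>(M / 2) j\<close>, which succeeds since \<open>8\<close> divides
  \<open>M\<close> and \<open>r\<close> is odd.\<close>

lemma sqrt_mod_step:
 fixes n r M p :: int
 assumes p: "prime p" "p dvd M" and two: "p = 2 ==> 8 dvd M" and c: "coprime n M" and r: "M dvd r\<^sup>2 - n"
 shows "\<exists>r'. M * p dvd r'\<^sup>2 - n"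
proof -
 obtain j where j: "r\<^sup>2 - n = M * j" using r by blast
 have pr: "\<not> p dvd r"
 proof
  assume "p dvd r"
  then have "p dvd r\<^sup>2" by (simp add: power2_eq_square)
  then have "p dvd r\<^sup>2 - (r\<^sup>2 - n)" using dvd_trans[OF p(2) r] by fastforce
  then have "p dvd n" by simp
  then show False using p c by (meson coprime_common_divisor not_prime_unit)
 qed
 show ?thesis
 proof (cases "p = 2")
  case True
  then have "8 dvd M" by (rule two)
  then obtain m where m: "M = 8 * m" by blast
  have "odd r" using pr True by simp
  have e: "(r + 4 * m * j)\<^sup>2 - n = 8 * m * (j * (1 + r) + 2 * m * j\<^sup>2)"
   using j unfolding m by (simp add: square_simps)
  have "2 dvd j * (1 + r) + 2 * m * j\<^sup>2" using \<open>odd r\<close> by simp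
  then have "M * p dvd (r + 4 * m * j)\<^sup>2 - n" unfolding e True m by (intro mult_dvd_mono) auto
  then show ?thesis by blast
 next
  case False
  have "\<not> p dvd 2" using False p(1) zdvd_imp_le[of p 2] prime_ge_2_int[of p] by force
  then have "\<not> p dvd 2 * r" using pr p(1) by (simp add: prime_dvd_mult_iff)
  then have "coprime p (2 * r)" by (rule prime_imp_coprime[OF p(1)])
  then have "coprime (2 * r) p" by (rule coprime_commute[THEN iffD1])
  then obtain u where u: "[2 * r * u = 1] (mod p)" by (meson cong_solve_coprime_int)
  then obtain v where v: "2 * r * u = 1 + p * v" by (metis cong_iff_lin mult.commute add.commute cong_sym)
  obtain m where m: "M = p * m" using p(2) by blast
  have "(r - M * (u * j))\<^sup>2 - n = M * p * (m * u\<^sup>2 * j\<^sup>2 - v * j)"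
  proof -
   have "(r - M * (u * j))\<^sup>2 - n = (r\<^sup>2 - n) - M * j * (2 * r * u) + M * M * u\<^sup>2 * j\<^sup>2"
    by (simp add: square_simps)
   also have "\<dots> = M * p * (m * u\<^sup>2 * j\<^sup>2 - v * j)" unfolding j v by (simp add: m algebra_simps)
   finally show ?thesis .
  qed
  then show ?thesis by (metis dvd_triv_left)
 qed
qed

text \<open>One Hensel step for each prime factor of \<open>t\<close>. All of these divide
  \<open>B\<close>, so \<open>n\<close> stays coprime to the growing modulus.\<close>

lemma sqrt_mod_lift:
 fixes n B :: int and t :: nat
 assumes B: "even B ==> 8 dvd B" "coprime n B" and r: "B dvd r\<^sup>2 - n"
 shows "t > 0 ==> (\<And>p. prime p ==> p dvd t ==> int p dvd B) ==> \<exists>r. B * int t dvd r\<^sup>2 - n"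
proof (induction t rule: less_induct)
 case (less t)
 show ?case
 proof (cases "t = 1")
  case True then show ?thesis using r by auto
 next
  case False
  then obtain p where p: "prime p" "p dvd t" using prime_factor_nat by blast
  then obtain t' where t': "t = p * t'" by blast
  have "t' < t" "t' > 0" using less.prems(1) t' prime_gt_1_nat[OF p(1)] by auto
  then obtain r' where r': "B * int t' dvd r'\<^sup>2 - n" using less.IH[of t'] less.prems(2) t' by auto
  have "coprime n (int q)" if "q dvd t'" for q
  proof (rule coprimeI)
   fix c assume c: "c dvd n" "c dvd int q"
   show "is_unit c"
   proof (rule ccontr)
    assume nu: "\<not> is_unit c"
    have "c \<noteq> 0" using c(2) that \<open>t' > 0\<close> by auto
    then obtain a where a: "prime a" "a dvd c" using nu prime_divisor_exists by blast
    then have "a dvd int t'" using c(2) that by (meson dvd_trans int_dvd_int_iff)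
    moreover obtain b where b: "a = int b" "prime b" using a(1) by (metis prime_int_nat_transfer prime_ge_0_int nat_0_le)
    ultimately have "int b dvd B" using less.prems(2) t' by auto
    then show False using a b c(1) B(2) by (meson coprime_common_divisor dvd_trans not_prime_unit)
   qed
  qed
  then have "coprime n (B * int t')" using B(2) by simp
  moreover have "int p dvd B * int t'" using less.prems(2) p by auto
  moreover have "8 dvd B * int t'" if "int p = 2" using B(1) less.prems(2)[OF p] that by simp
  ultimately obtain r'' where "B * int t' * int p dvd r''\<^sup>2 - n"
   using sqrt_mod_step[of "int p" "B * int t'" n r'] p(1) r' by auto
  then show ?thesis unfolding t' by (metis mult.assoc mult.commute of_nat_mult)
 qed
qed

lemma coprime_part:
 fixes D :: int
 shows "y > 0 ==> \<exists>a b. y = a * b \<and> coprime (int b) D \<and> (\<forall>p. prime p --> p dvd a --> int p dvd D)"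
proof (induction y rule: less_induct)
 case (less y)
 show ?case
 proof (cases "coprime (int y) D")
  case True then show ?thesis by (intro exI[of _ 1] exI[of _ y]) auto
 next
  case False
  then obtain c where c: "c dvd int y" "c dvd D" "\<not> is_unit c" by fastforce
  have "c \<noteq> 0" using c(1) less.prems by auto
  then obtain a where a: "prime a" "a dvd c" using c(3) prime_divisor_exists by blast
  obtain p where p: "a = int p" "prime p" using a(1) by (metis prime_int_nat_transfer prime_ge_0_int nat_0_le)
  have "int p dvd D" "int p dvd int y" using a(2) c(1,2) unfolding p(1) by (blast intro: dvd_trans)+
  then have pd: "int p dvd D" "p dvd y" by simp_all
  then obtain y' where y': "y = p * y'" by blast
  have "y' < y" "y' > 0" using less.prems y' prime_gt_1_nat[OF p(2)] by auto
  then obtain u v where uv: "y' = u * v" "coprime (int v) D" "\<forall>p. prime p --> p dvd u --> int p dvd D" using less.IH by blast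
  show ?thesis
  proof (rule exI[of _ "p * u"], rule exI[of _ v], intro conjI allI impI)
   show "y = p * u * v" using y' uv(1) by simp
   fix q assume q: "prime q" "q dvd p * u"
   then have "q dvd p \<or> q dvd u" by (simp add: prime_dvd_mult_iff)
   then show "int q dvd D" using q(1) uv(3) pd(1) p(2) by (metis primes_dvd_imp_eq)
  qed (rule uv(2))
 qed
qed

text \<open>A nonzero value in the second case is turned into a
 zero by the multiplicativity of the norm form.\<close>

lemma ternary_zero:
 fixes D n r s :: int
 assumes D: "D < -1" and n: "n > 0" and c: "coprime n D" and r: "[r\<^sup>2 = n] (mod D)" and s: "[s\<^sup>2 = D] (mod n)"
 obtains X Y Z where "Z\<^sup>2 - D * Y\<^sup>2 = n * X\<^sup>2" "\<not> (X = 0 \<and> Y = 0 \<and> Z = 0)"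
proof -
 define m where "m = - D"
 have m: "m > 1" using D by (simp add: m_def)
 \<comment> \<open>A box with sides about \<open>sqrt m\<close>, \<open>sqrt n\<close> and
   \<open>sqrt (m n)\<close>, rounded so that it has more than \<open>m n\<close> points; two of
   them agree in both linear forms modulo \<open>m\<close> and \<open>n\<close>.\<close>
 define a b c' where "a = floor_sqrt (nat m)" and "b = floor_sqrt (nat n)" and "c' = floor_sqrt (nat (m * n))"
 have sq: "int (floor_sqrt (nat k)) ^ 2 \<le> k \<and> k < (int (floor_sqrt (nat k)) + 1)\<^sup>2" if "k > 0" for k :: int
 proof -
  have "(floor_sqrt (nat k))\<^sup>2 \<le> nat k" "nat k < (Suc (floor_sqrt (nat k)))\<^sup>2" by (rule floor_sqrt_power2_le, rule Suc_floor_sqrt_power2_gt)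
  then have "int ((floor_sqrt (nat k))\<^sup>2) \<le> k" "k < int ((Suc (floor_sqrt (nat k)))\<^sup>2)" using that by linarith+
  then show ?thesis by (simp add: add.commute)
 qed
 have mn: "m * n > 0" using m n by simp
 note A = sq[of m, folded a_def] and B = sq[of n, folded b_def] and C = sq[of "m * n", folded c'_def]
 define Q where "Q = {0..int a} \<times> {0..int b} \<times> {0..int c'}"
 define \<phi> where "\<phi> = (\<lambda>(x, y, z). ((z - r * x) mod m, (z - s * y) mod n))"
 have "card Q = (a + 1) * ((b + 1) * (c' + 1))" by (simp add: Q_def card_cartesian_product nat_add_distrib)
 then have cQ: "int (card Q) = (int a + 1) * ((int b + 1) * (int c' + 1))" by (simp only: of_nat_mult of_nat_add of_nat_1)
 have "(m * n) * (m * n) < (int a + 1)\<^sup>2 * (int b + 1)\<^sup>2 * (int c' + 1)\<^sup>2"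
  using A B C m n mn by (intro mult_strict_mono) auto
 then have "(m * n)\<^sup>2 < (int (card Q))\<^sup>2" unfolding cQ power_mult_distrib by (simp only: power2_eq_square mult.assoc mult.left_commute)
 then have big: "m * n < int (card Q)" by (rule power_less_imp_less_base) simp
 have "card (\<phi> ` Q) \<le> card ({0..<m} \<times> {0..<n})" using m n by (intro card_mono) (auto simp: \<phi>_def)
 also have "\<dots> = nat (m * n)" using m n by (simp add: card_cartesian_product nat_mult_distrib)
 also have "\<dots> < card Q" using big mn by simp
 finally have "\<not> inj_on \<phi> Q" by (rule pigeonhole)
 then obtain q q' where q: "q \<in> Q" "q' \<in> Q" "q \<noteq> q'" "\<phi> q = \<phi> q'" unfolding inj_on_def by blast
 obtain x y z x' y' z' where qq: "q = (x, y, z)" "q' = (x', y', z')" by (metis prod_cases3)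
 define X Y Z where "X = x - x'" and "Y = y - y'" and "Z = z - z'"
 have bd: "\<bar>X\<bar> \<le> int a" "\<bar>Y\<bar> \<le> int b" "\<bar>Z\<bar> \<le> int c'" using q(1,2) by (auto simp: qq Q_def X_def Y_def Z_def)
 have nz: "\<not> (X = 0 \<and> Y = 0 \<and> Z = 0)" using q(3) by (auto simp: qq X_def Y_def Z_def)
 have "(z - r * x) mod m = (z' - r * x') mod m" "(z - s * y) mod n = (z' - s * y') mod n" using q(4) by (auto simp: qq \<phi>_def)
 then have "m dvd (z - r * x) - (z' - r * x')" "n dvd (z - s * y) - (z' - s * y')" by (simp_all only: mod_eq_dvd_iff)
 then have d: "m dvd Z - r * X" "n dvd Z - s * Y" by (simp_all add: X_def Y_def Z_def algebra_simps)
 have rm: "m dvd r\<^sup>2 - n" and sn: "n dvd s\<^sup>2 - D" using r s by (simp_all add: cong_iff_dvd_diff m_def)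
 define V where "V = Z\<^sup>2 - D * Y\<^sup>2 - n * X\<^sup>2"
 have "V = (Z - r * X) * (Z + r * X) + (r\<^sup>2 - n) * X\<^sup>2 + m * Y\<^sup>2" by (simp add: V_def m_def square_simps)
 then have "m dvd V" using d(1) rm by simp
 moreover have "V = (Z - s * Y) * (Z + s * Y) + (s\<^sup>2 - D) * Y\<^sup>2 - n * X\<^sup>2" by (simp add: V_def square_simps)
 then have "n dvd V" using d(2) sn by simp
 moreover have "coprime m n" using c by (simp add: m_def coprime_commute)
 ultimately have "m * n dvd V" by (rule divides_mult)
 then obtain k where k: "V = m * n * k" by blast
 have X2: "X\<^sup>2 \<le> m" and Y2: "Y\<^sup>2 \<le> n" and Z2: "Z\<^sup>2 \<le> m * n"
  using bd A B C m n mn abs_le_square_iff[of X "int a"] abs_le_square_iff[of Y "int b"] abs_le_square_iff[of Z "int c'"] by simp_all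
 have mY: "0 \<le> m * Y\<^sup>2" "m * Y\<^sup>2 \<le> m * n" and nX: "0 \<le> n * X\<^sup>2" "n * X\<^sup>2 \<le> m * n"
  using X2 Y2 m n by (simp_all add: mult.commute)
 have Veq: "V = Z\<^sup>2 + m * Y\<^sup>2 - n * X\<^sup>2" by (simp add: V_def m_def)
 \<comment> \<open>The value \<open>V\<close> is a multiple of \<open>m n\<close> between
   \<open>- m n\<close> and \<open>2 m n\<close>. Both extremes would make \<open>m\<close> a unit:
   the lower one through \<open>X\<^sup>2 = m\<close> dividing \<open>X\<close>, the upper one
   through \<open>m\<close> dividing \<open>n\<close>.\<close>
 have "m * n * k \<le> m * n * 2" "m * n * (-1) \<le> m * n * k"
  using mY nX Z2 zero_le_power2[of Z] unfolding k[symmetric] Veq by linarith+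
 then have k2: "k \<le> 2" "-1 \<le> k" using mn by (simp_all only: mult_le_cancel_left_pos)
 have "k \<noteq> -1"
 proof
  assume "k = -1"
  then have e: "Z\<^sup>2 + m * Y\<^sup>2 - n * X\<^sup>2 = - (m * n)" using k Veq by simp
  then have "n * X\<^sup>2 = m * n" "Z\<^sup>2 = 0" using mY nX zero_le_power2[of Z] by linarith+
  then have "n * X\<^sup>2 = n * m" "Z = 0" by (simp_all only: mult.commute power_eq_0_iff)
  then have XX: "X\<^sup>2 = m" "Z = 0" using n by simp_all
  then have "m dvd r * X" using d(1) by simp
  moreover have "coprime m r"
  proof -
   have "coprime m n" by fact
   then have "coprime m (r\<^sup>2)" using rm by (metis coprime_iff_gcd_eq_1 gcd_diff1 dvd_imp_mod_0 cong_imp_coprime cong_iff_dvd_diff cong_sym coprime_commute)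
   then show ?thesis by simp
  qed
  ultimately have "m dvd X" using coprime_dvd_mult_right_iff by blast
  then have "X\<^sup>2 dvd X" using XX(1) by simp
  then have "X dvd 1" using XX(1) m by (auto simp: power2_eq_square)
  then have "X\<^sup>2 = 1" by (auto simp: zdvd1_eq abs_square_eq_1)
  then show False using XX(1) m by simp
 qed
 moreover have "k \<noteq> 2"
 proof
  assume "k = 2"
  then have e: "Z\<^sup>2 + m * Y\<^sup>2 - n * X\<^sup>2 = 2 * (m * n)" using k Veq by simp
  then have ZZ: "Z\<^sup>2 = m * n" "n * X\<^sup>2 = 0" using mY nX Z2 by linarith+
  then have "X = 0" using n by simp
  then have "m dvd Z" using d(1) by simp
  then have "m * m dvd Z\<^sup>2" by (simp add: power2_eq_square mult_dvd_mono)
  then have "m dvd n" using ZZ(1) m by simp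
  then have "is_unit m" using \<open>coprime m n\<close> by fastforce
  then show False using m by simp
 qed
 ultimately consider "k = 0" | "k = 1" using k2 by linarith
 then show thesis
 proof cases
  case 1
  then have "Z\<^sup>2 - D * Y\<^sup>2 = n * X\<^sup>2" using k by (simp add: V_def)
  then show ?thesis using that nz by simp
 next
  case 2
  then have e: "Z\<^sup>2 - D * Y\<^sup>2 = n * (X\<^sup>2 - D)" using k by (simp add: V_def m_def algebra_simps)
  \<comment> \<open>Product of the norms of \<open>Z + Y sqrt D\<close> and
    \<open>X + sqrt D\<close>.\<close>
  have "(Z * X + D * Y)\<^sup>2 - D * (Z + X * Y)\<^sup>2 = (Z\<^sup>2 - D * Y\<^sup>2) * (X\<^sup>2 - D)" by (simp add: square_simps)
  also have "\<dots> = n * (X\<^sup>2 - D)\<^sup>2" unfolding e by (simp add: power2_eq_square)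
  finally have "(Z * X + D * Y)\<^sup>2 - D * (Z + X * Y)\<^sup>2 = n * (X\<^sup>2 - D)\<^sup>2" .
  moreover have "X\<^sup>2 - D > 0" using D zero_le_power2[of X] by linarith
  ultimately show ?thesis using that[of "Z * X + D * Y" "Z + X * Y" "X\<^sup>2 - D"] by auto
 qed
qed

lemma coprime_shift: "coprime (k + D * j) D \<longleftrightarrow> coprime k D" for k D j :: int
 by (metis coprime_iff_gcd_eq_1 gcd.commute gcd_add_mult add.commute mult.commute)

text \<open>Lifting at 2 has to start from a modulus divisible by 8. If \<open>D = 4 m\<close> with
  \<open>m\<close> odd, the congruence modulo 4 improves to one modulo 8, because \<open>n\<close>
  and the odd square \<open>r\<^sup>2\<close> are both 1 modulo 8.\<close>

lemma base_root:
 fixes D n r :: int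
 assumes D: "D \<noteq> 0" "D mod 4 = 0 \<or> D mod 4 = 1" and r: "[r\<^sup>2 = n] (mod D)" and e: "even D --> n mod 8 = 1"
 obtains B :: int where "B > 0" "D dvd B" "even B --> 8 dvd B \<and> even D" "B dvd r\<^sup>2 - n" "\<forall>p. prime p --> p dvd B --> p dvd D"
proof -
 have rD: "D dvd r\<^sup>2 - n" using r by (simp add: cong_iff_dvd_diff)
 show thesis
 proof (cases "odd D \<or> 8 dvd D")
  case True
  then show ?thesis using D rD by (intro that[of "\<bar>D\<bar>"]) auto
 next
  case False
  then have ev: "even D" "\<not> 8 dvd D" by auto
  then have "4 dvd D" using D(2) by presburger
  then obtain m where m: "D = 4 * m" by blast
  have om: "odd m" using ev(2) m by auto
  have "n mod 8 = 1" using e ev(1) by simp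
  have "odd r"
  proof
   assume "even r"
   then have "2 dvd r\<^sup>2" by simp
   moreover have "2 dvd r\<^sup>2 - n" using rD m by fastforce
   ultimately have "even n" by simp
   then show False using \<open>n mod 8 = 1\<close> by presburger
  qed
  then obtain k where k: "r = 2 * k + 1" by (elim oddE)
  have "r\<^sup>2 - 1 = 4 * (k * (k + 1))" by (simp add: k square_simps)
  moreover have "even (k * (k + 1))" by simp
  then have "4 * 2 dvd 4 * (k * (k + 1))" by fastforce
  ultimately have "8 dvd r\<^sup>2 - 1" by simp
  moreover have "8 dvd n - 1" using \<open>n mod 8 = 1\<close> by presburger
  ultimately have "8 dvd (r\<^sup>2 - 1) - (n - 1)" by fastforce
  then have "8 dvd r\<^sup>2 - n" by simp
  moreover have "m dvd r\<^sup>2 - n" using rD m by fastforce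
  moreover have "coprime (2 ^ 3) m" using om by (subst coprime_power_left_iff) simp
  then have "coprime 8 m" by simp
  ultimately have 8: "8 * m dvd r\<^sup>2 - n" by (intro divides_mult)
  show ?thesis
  proof (rule that[of "8 * \<bar>m\<bar>"])
   show "8 * \<bar>m\<bar> > 0" using D(1) m by simp
   show "D dvd 8 * \<bar>m\<bar>" unfolding m by (metis abs_mult abs_numeral dvd_abs_iff dvd_triv_right mult.assoc mult_2 numeral_Bit0 mult_dvd_mono dvd_refl dvdI mult.commute)
   show "8 * \<bar>m\<bar> dvd r\<^sup>2 - n" using 8 by fastforce
   show "\<forall>p. prime p --> p dvd 8 * \<bar>m\<bar> --> p dvd D"
   proof (intro allI impI)
   fix p :: int assume p: "prime p" "p dvd 8 * \<bar>m\<bar>"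
   then have "p dvd 2 ^ 3 \<or> p dvd m" by (simp add: prime_dvd_mult_iff)
   then have "p dvd 2 \<or> p dvd m" using p(1) prime_dvd_power by blast
   then show "p dvd D" unfolding m by (metis dvd_mult dvd_mult2 dvd_trans even_numeral)
   qed
  qed (use ev in auto)
 qed
qed

text \<open>A zero of the ternary form is moved, by a reflection in a vector that is a zero modulo a high power
 of the prime factors of the discriminant, to one whose last coordinate is coprime to the discriminant.\<close>

lemma ternary_zero_coprime:
 fixes D n r s :: int
 assumes D: "D < -1" "D mod 4 = 0 \<or> D mod 4 = 1" and n: "n > 0" "even D --> n mod 8 = 1" and c: "coprime n D"
  and r: "[r\<^sup>2 = n] (mod D)" and s: "[s\<^sup>2 = D] (mod n)"
 obtains x y z where "z\<^sup>2 - D * y\<^sup>2 = n * x\<^sup>2" "coprime x D"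
proof -
 obtain X Y Z where v: "Z\<^sup>2 - D * Y\<^sup>2 = n * X\<^sup>2" "\<not> (X = 0 \<and> Y = 0 \<and> Z = 0)" using ternary_zero[OF D(1) n(1) c r s] by blast
 show thesis
 proof (cases "Y = 0")
  case True
  then have e: "Z\<^sup>2 = n * X\<^sup>2" "X \<noteq> 0" using v by auto
  then have "X\<^sup>2 dvd Z\<^sup>2" by simp
  then have "X dvd Z" by simp
  then obtain m where "Z = X * m" by blast
  then have "X\<^sup>2 * m\<^sup>2 = X\<^sup>2 * n" using e(1) by (simp add: power_mult_distrib mult.commute)
  then have "m\<^sup>2 = n" using e(2) by simp
  then show ?thesis using that[of m 0 1] by simp
 next
  case False
  then have "nat (Y\<^sup>2) > 0" by simp
  \<comment> \<open>Only \<open>Y1\<close>, the part of \<open>Y\<^sup>2\<close> composed of primes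
    of \<open>D\<close>, has to be absorbed by the modulus to which the near zero is lifted.\<close>
  from coprime_part[OF this, of D] obtain Y1 Y2 where Y: "nat (Y\<^sup>2) = Y1 * Y2" "coprime (int Y2) D" "\<forall>p. prime p --> p dvd Y1 --> int p dvd D"
   by blast
  have Ysq: "Y\<^sup>2 = int Y1 * int Y2" using Y(1) by (metis int_nat_eq of_nat_mult zero_le_power2)
  have Y1: "Y1 > 0" using Ysq False by (intro Nat.gr0I) auto
  have D0: "D \<noteq> 0" using D(1) by simp
  obtain B where B: "B > 0" "D dvd B" "even B --> 8 dvd B \<and> even D" "B dvd r\<^sup>2 - n" "\<forall>p. prime p --> p dvd B --> p dvd D"
   by (rule base_root[OF D0 D(2) r n(2)])
  \<comment> \<open>The factor 4 in \<open>\<beta> * \<gamma>\<close> is absorbed by the lift if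
    \<open>D\<close> is even, and is a unit modulo \<open>D\<close> if \<open>D\<close> is odd;
    \<open>e\<close> and \<open>e'\<close> divide it up accordingly.\<close>
  define e :: nat where "e = (if even D then 4 else 1)"
  define e' :: int where "e' = (if even D then 1 else 4)"
  have ee: "e' * int e = 4" by (simp add: e_def e'_def)
  have nB: "coprime n B"
  proof (rule ccontr)
   assume "\<not> coprime n B"
   then obtain a where a: "a dvd n" "a dvd B" "\<not> is_unit a" by fastforce
   have "a \<noteq> 0" using a(1) n(1) by auto
   then obtain p where p: "prime p" "p dvd a" using a(3) prime_divisor_exists by blast
   then have "p dvd n" "p dvd D" using a B(5) by (blast intro: dvd_trans)+
   then show False using c p(1) by (meson coprime_common_divisor not_prime_unit)
  qed
  have pt: "int p dvd B" if p: "prime p" "p dvd e * Y1 * nat \<bar>D\<bar>" for p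
  proof -
   have "p dvd e \<or> p dvd Y1 \<or> p dvd nat \<bar>D\<bar>" using p by (simp add: prime_dvd_mult_iff)
   moreover have "int p dvd D" if "p dvd e"
   proof -
    have "even D" "p dvd 2 ^ 2" using that p(1) by (auto simp: e_def split: if_splits)
    then have "p dvd 2" using p(1) prime_dvd_power by blast
    then have "p = 2" using p(1) two_is_prime_nat primes_dvd_imp_eq by blast
    then show ?thesis using \<open>even D\<close> by simp
   qed
   moreover have "int p dvd D" if "p dvd nat \<bar>D\<bar>" using that by simp
   ultimately have "int p dvd D" using Y(3) p(1) by blast
   then show ?thesis using B(2) by fastforce
  qed
  have "\<exists>r. B * int (e * Y1 * nat \<bar>D\<bar>) dvd r\<^sup>2 - n"
   by (rule sqrt_mod_lift[OF _ nB B(4)]) (use B(3) pt Y1 D(1) in \<open>auto simp: e_def\<close>)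
  then obtain r' where "B * int (e * Y1 * nat \<bar>D\<bar>) dvd r'\<^sup>2 - n" by blast
  moreover have "D * (int e * int Y1 * D) dvd B * int (e * Y1 * nat \<bar>D\<bar>)" using B(2) by fastforce
  ultimately have "D * (int e * int Y1 * D) dvd r'\<^sup>2 - n" by fastforce
  then obtain t where t: "r'\<^sup>2 - n = D * (int e * int Y1 * D) * t" by blast
  \<comment> \<open>For the form \<open>z\<^sup>2 - D y\<^sup>2 - n x\<^sup>2\<close>,
    \<open>\<beta>\<close> is twice the inner product of the zero with the near zero
    \<open>z = r'\<close>, \<open>y = 0\<close>, \<open>x = 1\<close>. Multiplying by its companion
    \<open>\<gamma>\<close> gives \<open>4 D Y1\<close> times a number \<open>k0\<close> coprime to
    \<open>D\<close>.\<close>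
  define \<beta> \<gamma> where "\<beta> = 2 * (Z * r' - n * X)" and "\<gamma> = 2 * (Z * r' + n * X)"
  define k0 where "k0 = n * int Y2 + int e * D * t * Z\<^sup>2"
  define k1 where "k1 = e' * k0"
  have bg: "\<beta> * \<gamma> = 4 * D * int Y1 * k0"
  proof -
   have "\<beta> * \<gamma> = 4 * (Z\<^sup>2 * (r'\<^sup>2 - n) + n * (Z\<^sup>2 - n * X\<^sup>2))" by (simp add: \<beta>_def \<gamma>_def square_simps)
   also have "Z\<^sup>2 - n * X\<^sup>2 = D * (int Y1 * int Y2)" using v(1) Ysq by simp
   finally show ?thesis unfolding t k0_def by (simp add: algebra_simps power2_eq_square)
  qed
  have "coprime (n * int Y2) D" using c Y(2) by simp
  moreover have "k0 = n * int Y2 + D * (int e * t * Z\<^sup>2)" by (simp add: k0_def)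
  ultimately have "coprime k0 D" by (simp only: coprime_shift)
  moreover have "coprime e' D"
  proof (cases "even D")
   case False
   then have "coprime (2 ^ 2) D" by (subst coprime_power_left_iff) simp
   then show ?thesis using False by (simp add: e'_def)
  qed (simp add: e'_def)
  ultimately have k1: "coprime k1 D" by (simp add: k1_def)
  have key: "k1 * (r'\<^sup>2 - n) = D * t * \<gamma> * \<beta>"
  proof -
   have "k1 * (r'\<^sup>2 - n) = (e' * int e) * (D * t * D * int Y1 * k0)" unfolding t k1_def by simp
   also have "\<dots> = D * t * (4 * D * int Y1 * k0)" unfolding ee by simp
   finally show ?thesis unfolding bg[symmetric] by simp
  qed
  \<comment> \<open>The reflection of the zero in the near zero, scaled to integers, is
    \<open>q\<close> times the former minus \<open>k1\<close> times the latter. As \<open>D\<close>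
    divides \<open>q\<close>, its last coordinate is \<open>- k1\<close> modulo
    \<open>D\<close>.\<close>
  define q where "q = D * t * \<gamma>"
  have "(q * Z - k1 * r')\<^sup>2 - D * (q * Y)\<^sup>2 - n * (q * X - k1)\<^sup>2
   = q\<^sup>2 * (Z\<^sup>2 - D * Y\<^sup>2 - n * X\<^sup>2) + k1 * (k1 * (r'\<^sup>2 - n) - q * \<beta>)"
   by (simp add: \<beta>_def square_simps)
  also have "\<dots> = 0" using v(1) key by (simp add: q_def)
  finally have "(q * Z - k1 * r')\<^sup>2 - D * (q * Y)\<^sup>2 = n * (q * X - k1)\<^sup>2" by simp
  moreover have "coprime (q * X - k1) D"
  proof -
   have "q * X - k1 = - k1 + D * (t * \<gamma> * X)" by (simp add: q_def)
   then show ?thesis using k1 by (simp only: coprime_shift coprime_minus_left_iff)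
  qed
  ultimately show ?thesis by (rule that)
 qed
qed

section \<open>Minimal vectors and tempered forms\<close>

lemma real_coordinates:
 assumes "Im (a * cnj b) \<noteq> 0" shows "\<exists>x y. z = x *\<^sub>R a + y *\<^sub>R b"
proof (intro exI)
 have "Im (a * cnj b) *\<^sub>R z = Im (z * cnj b) *\<^sub>R a + Im (a * cnj z) *\<^sub>R b"
  by (simp add: complex_eq_iff algebra_simps)
 then have "z = (1 / Im (a * cnj b)) *\<^sub>R (Im (z * cnj b) *\<^sub>R a + Im (a * cnj z) *\<^sub>R b)"
  using assms by (metis divideR_right scaleR_one eq_vector_fraction_iff divide_inverse mult_1 inverse_eq_divide)
 then show "z = (Im (z * cnj b) / Im (a * cnj b)) *\<^sub>R a + (Im (a * cnj z) / Im (a * cnj b)) *\<^sub>R b"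
  by (simp add: scaleR_add_right)
qed

lemma form_expand:
 assumes "bilinear \<beta>" "\<forall>x y. \<beta> x y = \<beta> y x"
 shows "\<beta> (x *\<^sub>R a + y *\<^sub>R b) (x *\<^sub>R a + y *\<^sub>R b) = x\<^sup>2 * \<beta> a a + 2 * x * y * \<beta> a b + y\<^sup>2 * (\<beta> b b :: real)"
proof -
 have "\<beta> b a = \<beta> a b" using assms(2) by simp
 then show ?thesis
  by (simp add: bilinear_ladd[OF assms(1)] bilinear_radd[OF assms(1)] bilinear_lmul[OF assms(1)] bilinear_rmul[OF assms(1)] square_simps)
qed

lemma inner_expand:
 "(x *\<^sub>R a + y *\<^sub>R b) \<bullet> (x *\<^sub>R a + y *\<^sub>R b) = x\<^sup>2 * (a \<bullet> a) + 2 * x * y * (a \<bullet> b) + y\<^sup>2 * (b \<bullet> b)" for a b :: complex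
 by (simp add: inner_add_left inner_add_right inner_commute[of b a] square_simps)

lemma lat_scaleR: "of_int x * a + of_int y * b = of_int x *\<^sub>R a + of_int y *\<^sub>R (b :: complex)"
 by (simp add: scaleR_conv_of_real)

text \<open>Lagrange's identity: the squares of inner product and area add up to the product of the
  squared lengths.\<close>

lemma inner_lt:
 assumes "Im (a * cnj b) \<noteq> 0" "a \<bullet> a = u" "b \<bullet> b = u" shows "\<bar>a \<bullet> b\<bar> < u"
proof -
 have "(a \<bullet> b)\<^sup>2 + (Im (a * cnj b))\<^sup>2 = (a \<bullet> a) * (b \<bullet> b)" by (simp add: inner_complex_def square_simps)
 moreover have "(Im (a * cnj b))\<^sup>2 > 0" using assms(1) by simp
 ultimately have "(a \<bullet> b)\<^sup>2 < u\<^sup>2" using assms(2,3) by (simp add: power2_eq_square)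
 then have "\<bar>a \<bullet> b\<bar>\<^sup>2 < u\<^sup>2" by simp
 moreover have "u \<ge> 0" using assms(2) inner_ge_zero[of a] by simp
 ultimately show ?thesis by (rule power2_less_imp_less)
qed

text \<open>Rounding leaves a remainder with coordinates of absolute value at most 1/2. In dimension
  two its squared length is below \<open>u / 4 + u / 4 + u / 2\<close>, so it vanishes by
  minimality.\<close>

lemma minimal_generate:
 assumes H: "int_complex.subspace H" and v: "v1 \<in> H" "v2 \<in> H" "Im (v1 * cnj v2) \<noteq> 0" "v1 \<bullet> v1 = u" "v2 \<bullet> v2 = u"
  and min: "\<And>z. z \<in> H ==> z \<noteq> 0 ==> u \<le> z \<bullet> z"
 shows "H = lat v1 v2"
proof
 show "lat v1 v2 \<subseteq> H" by (rule lat_subset[OF H v(1,2)])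
 show "H \<subseteq> lat v1 v2"
 proof
  fix z assume z: "z \<in> H"
  obtain x y where xy: "z = x *\<^sub>R v1 + y *\<^sub>R v2" using real_coordinates[OF v(3)] by blast
  define x' y' where "x' = x - of_int (round x)" and "y' = y - of_int (round y)"
  have b: "\<bar>x'\<bar> \<le> 1 / 2" "\<bar>y'\<bar> \<le> 1 / 2"
   using of_int_round_abs_le[of x] of_int_round_abs_le[of y] by (simp_all add: x'_def y'_def abs_minus_commute)
  define r where "r = z - (of_int (round x) * v1 + of_int (round y) * v2)"
  have rH: "r \<in> H" unfolding r_def using z v(1,2) H by (intro subspace_diff subspace_add subspace_of_int_mult) auto
  have r: "r = x' *\<^sub>R v1 + y' *\<^sub>R v2" by (simp add: r_def xy x'_def y'_def scaleR_conv_of_real algebra_simps)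
  have t: "\<bar>v1 \<bullet> v2\<bar> < u" by (rule inner_lt[OF v(3-5)])
  have sq: "x'\<^sup>2 \<le> 1 / 4" "y'\<^sup>2 \<le> 1 / 4" using b abs_le_square_iff[of x' "1 / 2"] abs_le_square_iff[of y' "1 / 2"] by (simp_all add: power2_eq_square)
  have "\<bar>x' * y'\<bar> \<le> (1 / 2) * (1 / 2)" unfolding abs_mult using b by (intro mult_mono) auto
  then have "\<bar>2 * x' * y' * (v1 \<bullet> v2)\<bar> \<le> (1 / 2) * \<bar>v1 \<bullet> v2\<bar>" unfolding abs_mult by (intro mult_right_mono) auto
  then have c: "2 * x' * y' * (v1 \<bullet> v2) \<le> (1 / 2) * \<bar>v1 \<bullet> v2\<bar>" by simp
  have "x'\<^sup>2 * u \<le> 1 / 4 * u" "y'\<^sup>2 * u \<le> 1 / 4 * u" using sq t by (intro mult_right_mono; simp)+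
  then have "r \<bullet> r < u" unfolding r inner_expand v(4,5) using c t by simp
  then have "r = 0" using min[OF rH] by force
  then show "z \<in> lat v1 v2" unfolding r_def using latI by simp
 qed
qed

text \<open>If \<open>k = \<bar>x y\<bar>\<close> is positive, the squared length exceeds
  \<open>u (x\<^sup>2 + y\<^sup>2 - k)\<close>, which is at least \<open>u k\<close>.\<close>

lemma minimal_vectors_two:
 assumes e: "e1 \<bullet> e1 = u" "e2 \<bullet> e2 = u" "u > 0" "\<bar>2 * (e1 \<bullet> e2)\<bar> < u"
 shows "{v \<in> lat e1 e2. v \<bullet> v = u} = {e1, - e1, e2, - e2}"
proof (intro equalityI subsetI)
 fix v assume "v \<in> {v \<in> lat e1 e2. v \<bullet> v = u}"
 then obtain x y :: int where v: "v = of_int x * e1 + of_int y * e2" "v \<bullet> v = u" by (auto elim: latE)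
 have n: "(of_int x)\<^sup>2 * u + 2 * of_int x * of_int y * (e1 \<bullet> e2) + (of_int y)\<^sup>2 * u = u"
  using v(2) unfolding v(1) lat_scaleR inner_expand e .
 have xy: "x * y = 0"
 proof (rule ccontr)
  assume nz: "x * y \<noteq> 0"
  define k where "k = \<bar>x * y\<bar>"
  have "k > 0" using nz by (simp add: k_def)
  then have k: "k \<ge> 1" by simp
  have "\<bar>2 * of_int x * of_int y * (e1 \<bullet> e2)\<bar> = of_int k * \<bar>2 * (e1 \<bullet> e2)\<bar>" by (simp add: k_def abs_mult)
  also have "\<dots> < of_int k * u" using e(4) k by (intro mult_strict_left_mono) auto
  finally have "(of_int x)\<^sup>2 * u + (of_int y)\<^sup>2 * u - of_int k * u < u" using n by simp
  then have "of_int (x\<^sup>2 + y\<^sup>2 - k) * u < 1 * u" by (simp add: algebra_simps)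
  then have "of_int (x\<^sup>2 + y\<^sup>2 - k) < (1::real)" using e(3) by simp
  then have "x\<^sup>2 + y\<^sup>2 - k < 1" by linarith
  moreover have "(\<bar>x\<bar> - \<bar>y\<bar>)\<^sup>2 = x\<^sup>2 + y\<^sup>2 - 2 * k" by (simp add: k_def square_simps abs_mult)
  then have "x\<^sup>2 + y\<^sup>2 - 2 * k \<ge> 0" by (metis zero_le_power2)
  ultimately show False using k by simp
 qed
 then consider "x = 0" | "y = 0" by auto
 then show "v \<in> {e1, - e1, e2, - e2}"
 proof cases
  case 1
  then have "(of_int y :: real)\<^sup>2 = 1" using n e(3) by simp
  then have "y = 1 \<or> y = -1" by (auto simp: power2_eq_1_iff)
  then show ?thesis using 1 v(1) by auto
 next
  case 2
  then have "(of_int x :: real)\<^sup>2 = 1" using n e(3) by simp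
  then have "x = 1 \<or> x = -1" by (auto simp: power2_eq_1_iff)
  then show ?thesis using 2 v(1) by auto
 qed
next
 fix v assume "v \<in> {e1, - e1, e2, - e2}"
 then show "v \<in> {v \<in> lat e1 e2. v \<bullet> v = u}" using e subspace_uminus[OF subspace_lat, of _ e1 e2] by auto
qed

text \<open>The form is \<open>u\<close> times \<open>x\<^sup>2 + x y + y\<^sup>2\<close>, which
  takes the value 1 at six integer points only.\<close>

lemma minimal_vectors_three:
 assumes e: "e1 \<bullet> e1 = u" "e2 \<bullet> e2 = u" "u > 0" "2 * (e1 \<bullet> e2) = u"
 shows "{v \<in> lat e1 e2. v \<bullet> v = u} = {e1, - e1, e2, - e2, e1 - e2, - (e1 - e2)}"
proof (intro equalityI subsetI)
 fix v assume "v \<in> {v \<in> lat e1 e2. v \<bullet> v = u}"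
 then obtain x y :: int where v: "v = of_int x * e1 + of_int y * e2" "v \<bullet> v = u" by (auto elim: latE)
 have "(of_int x)\<^sup>2 * u + 2 * of_int x * of_int y * (e1 \<bullet> e2) + (of_int y)\<^sup>2 * u = u"
  using v(2) unfolding v(1) lat_scaleR inner_expand e(1,2) .
 then have "(of_int x)\<^sup>2 * u + of_int x * of_int y * (2 * (e1 \<bullet> e2)) + (of_int y)\<^sup>2 * u = u" by simp
 then have "of_int (x\<^sup>2 + x * y + y\<^sup>2) * u = 1 * u" unfolding e(4) by (simp add: algebra_simps)
 then have "of_int (x\<^sup>2 + x * y + y\<^sup>2) = (1::real)" using e(3) by (simp only: mult_cancel_right) simp
 then have n: "x\<^sup>2 + x * y + y\<^sup>2 = 1" by blast
 have "3 * x\<^sup>2 + (x + 2 * y)\<^sup>2 = 4 * (x\<^sup>2 + x * y + y\<^sup>2)" "3 * y\<^sup>2 + (y + 2 * x)\<^sup>2 = 4 * (x\<^sup>2 + x * y + y\<^sup>2)"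
  by (simp_all add: square_simps)
 then have "3 * x\<^sup>2 + (x + 2 * y)\<^sup>2 = 4" "3 * y\<^sup>2 + (y + 2 * x)\<^sup>2 = 4" unfolding n by simp_all
 moreover have "(x + 2 * y)\<^sup>2 \<ge> 0" "(y + 2 * x)\<^sup>2 \<ge> 0" by simp_all
 ultimately have "3 * x\<^sup>2 \<le> 4" "3 * y\<^sup>2 \<le> 4" by linarith+
 then have "x\<^sup>2 \<le> 1" "y\<^sup>2 \<le> 1" by simp_all
 then have "x \<in> {-1, 0, 1}" "y \<in> {-1, 0, 1}" using abs_square_le_1[of x] abs_square_le_1[of y] by auto
 then show "v \<in> {e1, - e1, e2, - e2, e1 - e2, - (e1 - e2)}" using n v(1) by fastforce
next
 fix v assume v: "v \<in> {e1, - e1, e2, - e2, e1 - e2, - (e1 - e2)}"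
 have "(e1 - e2) \<bullet> (e1 - e2) = u" using e by (simp add: inner_diff_left inner_diff_right inner_commute[of e2 e1])
 moreover have "e1 - e2 \<in> lat e1 e2" by (rule subspace_diff[OF subspace_lat]) auto
 ultimately show "v \<in> {v \<in> lat e1 e2. v \<bullet> v = u}"
  using v e subspace_uminus[OF subspace_lat, of _ e1 e2] by (auto simp del: minus_diff_eq)
qed

lemma pairs_two:
 assumes "Im (a * cnj b) \<noteq> 0" shows "consists_of_pairs {a, - a, b, - b} 2"
proof -
 have "a \<noteq> b" "a \<noteq> - b" using assms by auto
 then have "{a, - a} \<noteq> {b, - b}" by blast
 moreover have "(\<lambda>v. {v, - v}) ` {a, - a, b, - b} = {{a, - a}, {b, - b}}" by fastforce
 ultimately show ?thesis by (auto simp: consists_of_pairs_def)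
qed

lemma pairs_three:
 assumes "Im (a * cnj b) \<noteq> 0" shows "consists_of_pairs {a, - a, b, - b, a - b, - (a - b)} 3"
proof -
 have "a \<noteq> b" "a \<noteq> - b" "a \<noteq> 0" "b \<noteq> 0" using assms by auto
 moreover have "a \<noteq> 2 * b" "b \<noteq> 2 * a" using assms by (auto simp: complex_eq_iff)
 ultimately have "{a, - a} \<noteq> {b, - b}" "{a, - a} \<noteq> {a - b, - (a - b)}" "{b, - b} \<noteq> {a - b, - (a - b)}"
  by (auto simp: doubleton_eq_iff algebra_simps add_eq_0_iff eq_diff_eq diff_eq_eq)
 moreover have "(\<lambda>v. {v, - v}) ` {a, - a, b, - b, a - b, - (a - b)} = {{a, - a}, {b, - b}, {a - b, - (a - b)}}"
  by (auto simp: insert_commute)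
 ultimately show ?thesis by (auto simp: consists_of_pairs_def)
qed

lemma form_unique:
 assumes e: "Im (e1 * cnj e2) \<noteq> 0" "bilinear \<beta>" "\<forall>x y. \<beta> x y = \<beta> y x" "\<forall>v. B v = \<beta> v v"
  and "\<beta> e1 e1 = e1 \<bullet> e1" "\<beta> e1 e2 = e1 \<bullet> e2" "\<beta> e2 e2 = e2 \<bullet> e2"
 shows "B = (\<lambda>v. v \<bullet> v)"
proof
 fix v
 obtain x y where v: "v = x *\<^sub>R e1 + y *\<^sub>R e2" using real_coordinates[OF e(1)] by blast
 show "B v = v \<bullet> v" unfolding e(4)[rule_format] v form_expand[OF e(2,3)] inner_expand assms(5-7) ..
qed

text \<open>Two well-rounded lattices in minimal bases, after scaling the larger one to minimum 1;
  \<open>u\<close> is the minimum of the sublattice.\<close>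

locale nested_lattices =
 fixes e1 e2 g1 g2 :: complex and u :: real
 assumes e: "Im (e1 * cnj e2) \<noteq> 0" "e1 \<bullet> e1 = 1" "e2 \<bullet> e2 = 1"
  and g: "Im (g1 * cnj g2) \<noteq> 0" "g1 \<bullet> g1 = u" "g2 \<bullet> g2 = u"
  and sub: "lat g1 g2 \<subseteq> lat e1 e2" "lat g1 g2 \<noteq> lat e1 e2"
  and minL: "\<And>z. z \<in> lat e1 e2 ==> z \<noteq> 0 ==> 1 \<le> z \<bullet> z"
  and minM: "\<And>z. z \<in> lat g1 g2 ==> z \<noteq> 0 ==> u \<le> z \<bullet> z"
begin

abbreviation "S \<equiv> {v \<in> lat e1 e2. v \<bullet> v = 1}"
abbreviation "S' \<equiv> {v \<in> lat g1 g2. v \<bullet> v = u}"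

text \<open>For \<open>u = 1\<close> the basis of the sublattice would consist of minimal vectors of
  the larger lattice and generate it. The strict inequality also keeps the minimal vectors of the
  larger lattice out of the sublattice.\<close>

lemma u_gt1: "u > 1"
proof (rule ccontr)
 assume "\<not> u > 1"
 moreover have gl: "g1 \<in> lat e1 e2" "g2 \<in> lat e1 e2" using sub(1) by auto
 moreover have "g1 \<noteq> 0" using g(1) by auto
 ultimately have "u = 1" using minL[of g1] g(2) by simp
 then have "lat e1 e2 = lat g1 g2" using minimal_generate[OF subspace_lat gl g(1)] g(2,3) minL by simp
 then show False using sub(2) by simp
qed

lemma minima: "tempered_minima (\<lambda>v. v \<bullet> v) (lat e1 e2) (lat g1 g2) S S' u"
 unfolding tempered_minima_def
proof (intro conjI ballI impI)
 fix v assume v: "v \<in> lat e1 e2 - lat g1 g2" "v \<notin> S"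
 then have "v \<noteq> 0" using subspace_zero[OF subspace_lat] by auto
 then show "v \<bullet> v > 1" using minL[of v] v by simp
next
 fix v assume "v \<in> lat g1 g2 - {0}" "v \<notin> S'"
 then show "v \<bullet> v > u" using minM[of v] by simp
qed (use u_gt1 in auto)

text \<open>A competing form agrees with the standard one at \<open>e1\<close> and
  \<open>e2\<close>; only the off-diagonal value \<open>\<beta> e1 e2\<close> is left open.\<close>

lemma perfectI:
 assumes "\<And>B \<beta> u'. bilinear \<beta> ==> \<forall>x y. \<beta> x y = \<beta> y x ==> \<forall>v. B v = \<beta> v v ==> \<forall>v\<in>S. B v = 1 ==> \<forall>v\<in>S'. B v = u' ==> \<beta> e1 e2 = e1 \<bullet> e2"
 shows "normalized_tempered_perfect (lat e1 e2) (lat g1 g2) S S'"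
proof -
 have eS: "e1 \<in> S" "e2 \<in> S" and gS: "g1 \<in> S'" "g2 \<in> S'" using e g by auto
 have "S \<subseteq> lat e1 e2 - lat g1 g2"
 proof
  fix v assume v: "v \<in> S"
  then have "v \<noteq> 0" by auto
  then have "v \<notin> lat g1 g2" using minM[of v] v u_gt1 by auto
  then show "v \<in> lat e1 e2 - lat g1 g2" using v by simp
 qed
 moreover have "S' \<subseteq> lat g1 g2 - {0}" using u_gt1 by auto
 moreover have "B = (\<lambda>v. v \<bullet> v) \<and> u' = u" if B: "pos_def_form B" "tempered_minima B (lat e1 e2) (lat g1 g2) S S' u'" for B u'
 proof -
  obtain \<beta> where \<beta>: "bilinear \<beta>" "\<forall>x y. \<beta> x y = \<beta> y x" "\<forall>v. B v = \<beta> v v" using B(1) unfolding pos_def_form_def quadratic_form_def by blast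
  have S: "\<forall>v\<in>S. B v = 1" and S': "\<forall>v\<in>S'. B v = u'" using B(2) unfolding tempered_minima_def by blast+
  have t: "\<beta> e1 e2 = e1 \<bullet> e2" by (rule assms[OF \<beta> S S'])
  have "B e1 = 1" "B e2 = 1" using S eS by blast+
  then have "\<beta> e1 e1 = e1 \<bullet> e1" "\<beta> e2 e2 = e2 \<bullet> e2" using \<beta>(3) e by auto
  from form_unique[OF e(1) \<beta> this(1) t this(2)] have BB: "B = (\<lambda>v. v \<bullet> v)" .
  moreover have "u' = u" using bspec[OF S' gS(1)] g(2) unfolding BB by simp
  ultimately show ?thesis ..
 qed
 ultimately show ?thesis unfolding normalized_tempered_perfect_def using minima eS gS by blast
qed

text \<open>The two equations for the values on the basis of the sublattice determine the form unless that basis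
 is \<open>p e1 + q e2\<close>, \<open>\<plusminus>(q e1 + p e2)\<close>. In this case the index is |p - q| |p + q|, and a prime index would make
 the sublattice too long to be well rounded.\<close>

lemma perfect_two:
 assumes t: "\<bar>2 * (e1 \<bullet> e2)\<bar> < 1" and l: "prime l" "\<bar>Im (g1 * cnj g2)\<bar> = real l * \<bar>Im (e1 * cnj e2)\<bar>"
 shows "normalized_tempered_perfect (lat e1 e2) (lat g1 g2) S S'"
proof (rule perfectI)
 fix B :: "complex => real" and \<beta> u'
 assume \<beta>: "bilinear \<beta>" "\<forall>x y. \<beta> x y = \<beta> y x" "\<forall>v. B v = \<beta> v v" and S: "\<forall>v\<in>S. B v = 1" and S': "\<forall>v\<in>S'. B v = u'"
 have "B e1 = 1" "B e2 = 1" "B g1 = u'" "B g2 = u'" using S S' e g by auto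
 then have b: "\<beta> e1 e1 = 1" "\<beta> e2 e2 = 1" "\<beta> g1 g1 = u'" "\<beta> g2 g2 = u'" using \<beta>(3) by auto
 define \<tau> where "\<tau> = e1 \<bullet> e2"
 obtain p q :: int where pq: "g1 = of_int p * e1 + of_int q * e2" using sub(1) by (meson latE lat_mem1 subsetD)
 obtain r s :: int where rs: "g2 = of_int r * e1 + of_int s * e2" using sub(1) by (meson latE lat_mem2 subsetD)
 have u1: "(of_int p)\<^sup>2 + 2 * of_int p * of_int q * \<tau> + (of_int q)\<^sup>2 = u"
  using g(2) unfolding pq lat_scaleR inner_expand e \<tau>_def by simp
 have u2: "(of_int r)\<^sup>2 + 2 * of_int r * of_int s * \<tau> + (of_int s)\<^sup>2 = u"
  using g(3) unfolding rs lat_scaleR inner_expand e \<tau>_def by simp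
 have b1: "(of_int p)\<^sup>2 + 2 * of_int p * of_int q * \<beta> e1 e2 + (of_int q)\<^sup>2 = u'"
  using b(3) unfolding pq lat_scaleR form_expand[OF \<beta>(1,2)] b by simp
 have b2: "(of_int r)\<^sup>2 + 2 * of_int r * of_int s * \<beta> e1 e2 + (of_int s)\<^sup>2 = u'"
  using b(4) unfolding rs lat_scaleR form_expand[OF \<beta>(1,2)] b by simp
 have "p * q \<noteq> r * s"
 proof
  assume eq: "p * q = r * s"
  then have eqr: "of_int p * of_int q = (of_int r * of_int s :: real)" by (metis of_int_mult)
  then have "(of_int p)\<^sup>2 + (of_int q)\<^sup>2 = ((of_int r)\<^sup>2 + (of_int s)\<^sup>2 :: real)" using u1 u2 by (simp add: mult.assoc)
  then have "of_int (p\<^sup>2 + q\<^sup>2) = (of_int (r\<^sup>2 + s\<^sup>2) :: real)" by simp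
  then have sq: "p\<^sup>2 + q\<^sup>2 = r\<^sup>2 + s\<^sup>2" by (simp only: of_int_eq_iff)
  \<comment> \<open>Equal products and equal sums of squares determine \<open>(r, s)\<close> up to
    order and a common sign; the nonzero determinant then excludes \<open>(p, q)\<close> and its
    negative.\<close>
  have "(p + q)\<^sup>2 = (r + s)\<^sup>2" "(p - q)\<^sup>2 = (r - s)\<^sup>2" using eq sq by (simp_all add: square_simps)
  then have pm: "p + q = r + s \<or> p + q = - (r + s)" "p - q = r - s \<or> p - q = - (r - s)" by (simp_all only: power2_eq_iff)
  have "\<bar>of_int (p * s - q * r) * Im (e1 * cnj e2)\<bar> = real l * \<bar>Im (e1 * cnj e2)\<bar>"
   using l(2) unfolding pq rs Im_mult_cnj_comb .
  then have "\<bar>real_of_int (p * s - q * r)\<bar> = real l" using e(1) by (simp add: abs_mult)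
  then have det: "\<bar>p * s - q * r\<bar> = int l" by linarith
  have "p * s - q * r \<noteq> 0" using det prime_gt_0_nat[OF l(1)] by simp
  then have "\<not> (r = p \<and> s = q)" "\<not> (r = - p \<and> s = - q)" by (auto simp: mult.commute)
  with pm have "r = q \<and> s = p \<or> r = - q \<and> s = - p" by linarith
  then have "\<exists>\<epsilon>::int. r = \<epsilon> * q \<and> s = \<epsilon> * p \<and> (\<epsilon> = 1 \<or> \<epsilon> = -1)"
  proof
   assume "r = q \<and> s = p" then show ?thesis by (intro exI[of _ 1]) simp
  next
   assume "r = - q \<and> s = - p" then show ?thesis by (intro exI[of _ "-1"]) simp
  qed
  then obtain \<epsilon> :: int where \<epsilon>: "r = \<epsilon> * q" "s = \<epsilon> * p" "\<epsilon> = 1 \<or> \<epsilon> = -1" by blast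
  define a b where "a = p + q" and "b = p - q"
  have ab: "\<bar>a * b\<bar> = int l" using det \<epsilon> by (auto simp: a_def b_def algebra_simps)
  \<comment> \<open>Half of \<open>X\<close> and half of \<open>Y\<close> are the squared lengths of
    the components of \<open>g1\<close> along the orthogonal vectors \<open>e1 + e2\<close> and
    \<open>e1 - e2\<close>.\<close>
  define X Y where "X = (of_int a)\<^sup>2 * (1 + \<tau>)" and "Y = (of_int b)\<^sup>2 * (1 - \<tau>)"
  have XY: "X + Y = 2 * u" unfolding u1[symmetric] by (simp add: X_def Y_def a_def b_def square_simps)
  have gg: "2 * (g1 \<bullet> g2) = of_int \<epsilon> * (X - Y)"
   unfolding pq rs \<epsilon> X_def Y_def a_def b_def lat_scaleR using e \<epsilon>(3)
   by (auto simp: inner_add_left inner_add_right inner_commute[of e2 e1] \<tau>_def square_simps)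
  have "g1 + g2 \<in> lat g1 g2" "g1 - g2 \<in> lat g1 g2" by (auto intro: subspace_add[OF subspace_lat] subspace_diff[OF subspace_lat])
  moreover have "g1 + g2 \<noteq> 0" "g1 - g2 \<noteq> 0" using g(1) by (auto simp: add_eq_0_iff2)
  ultimately have "u \<le> (g1 + g2) \<bullet> (g1 + g2)" "u \<le> (g1 - g2) \<bullet> (g1 - g2)" using minM by blast+
  then have "\<bar>2 * (g1 \<bullet> g2)\<bar> \<le> u" using g by (simp add: inner_add_left inner_add_right inner_diff_left inner_diff_right inner_commute[of g2 g1])
  then have "\<bar>X - Y\<bar> \<le> u" using gg \<epsilon>(3) by auto
  \<comment> \<open>From \<open>X + Y = 2 u\<close> and \<open>\<bar>X - Y\<bar> \<le> u\<close>
    neither is more than three times the other. But \<open>\<bar>a b\<bar>\<close> is prime, so one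
    of the squares is 1 and the other, by parity, at least 9.\<close>
  then have XY3: "X \<le> 3 * Y" "Y \<le> 3 * X" using XY by linarith+
  have "nat \<bar>a\<bar> * nat \<bar>b\<bar> = l" using ab by (simp add: abs_mult nat_mult_distrib[symmetric])
  then have "nat \<bar>a\<bar> = 1 \<and> nat \<bar>b\<bar> = l \<or> nat \<bar>a\<bar> = l \<and> nat \<bar>b\<bar> = 1" using l(1) by (metis prime_product mult.right_neutral mult_1)
  then have abs: "\<bar>a\<bar> = 1 \<and> \<bar>b\<bar> = int l \<or> \<bar>a\<bar> = int l \<and> \<bar>b\<bar> = 1" by auto
  have "even (a - b)" by (simp add: a_def b_def)
  then have "odd (int l)" using abs by presburger
  then have "odd l" by simp
  then have "l \<ge> 3" using prime_ge_2_nat[OF l(1)] by (cases "l = 2") auto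
  then have "3 * 3 \<le> (real l)\<^sup>2" unfolding power2_eq_square by (intro mult_mono) auto
  then have l9: "(real l)\<^sup>2 \<ge> 9" by simp
  have tt: "- 1 < 2 * \<tau>" "2 * \<tau> < 1" using t by (auto simp: \<tau>_def abs_less_iff)
  from abs show False
  proof
   assume "\<bar>a\<bar> = 1 \<and> \<bar>b\<bar> = int l"
   then have "a\<^sup>2 = 1" "b\<^sup>2 = (int l)\<^sup>2" by (metis power2_abs one_power2)+
   then have "(of_int a :: real)\<^sup>2 = 1" "(of_int b)\<^sup>2 = (real l)\<^sup>2" by (metis of_int_1 of_int_power, metis of_int_of_nat_eq of_int_power)
   then have "(real l)\<^sup>2 * (1 - \<tau>) \<le> 3 * (1 + \<tau>)" using XY3(2) by (simp add: X_def Y_def)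
   moreover have "9 * (1 - \<tau>) \<le> (real l)\<^sup>2 * (1 - \<tau>)" using l9 tt by (intro mult_right_mono) auto
   ultimately have "9 * (1 - \<tau>) \<le> 3 * (1 + \<tau>)" by simp
   then have "6 \<le> 12 * \<tau>" by simp
   then show False using tt(2) by simp
  next
   assume "\<bar>a\<bar> = int l \<and> \<bar>b\<bar> = 1"
   then have "a\<^sup>2 = (int l)\<^sup>2" "b\<^sup>2 = 1" by (metis power2_abs one_power2)+
   then have "(of_int a)\<^sup>2 = (real l)\<^sup>2" "(of_int b :: real)\<^sup>2 = 1" by (metis of_int_of_nat_eq of_int_power, metis of_int_1 of_int_power)
   then have "(real l)\<^sup>2 * (1 + \<tau>) \<le> 3 * (1 - \<tau>)" using XY3(1) by (simp add: X_def Y_def)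
   moreover have "9 * (1 + \<tau>) \<le> (real l)\<^sup>2 * (1 + \<tau>)" using l9 tt by (intro mult_right_mono) auto
   ultimately have "9 * (1 + \<tau>) \<le> 3 * (1 - \<tau>)" by simp
   then have "6 \<le> - (12 * \<tau>)" by simp
   then show False using tt(1) by simp
  qed
 qed
 then have "of_int p * of_int q - of_int r * of_int s \<noteq> (0::real)" by (metis of_int_eq_iff of_int_mult right_minus_eq)
 moreover have "(of_int p * of_int q - of_int r * of_int s) * (\<beta> e1 e2 - \<tau>) = 0"
 proof -
  have "2 * ((of_int p * of_int q - of_int r * of_int s) * (\<beta> e1 e2 - \<tau>)) = 0" using u1 u2 b1 b2 by (simp add: algebra_simps)
  then show ?thesis by simp
 qed
 ultimately show "\<beta> e1 e2 = e1 \<bullet> e2" by (simp add: \<tau>_def)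
qed

text \<open>In the hexagonal lattice the third pair of minimal vectors, that of
  \<open>e1 - e2\<close>, supplies the off-diagonal value.\<close>

lemma perfect_three:
 assumes t: "2 * (e1 \<bullet> e2) = 1"
 shows "normalized_tempered_perfect (lat e1 e2) (lat g1 g2) S S'"
proof (rule perfectI)
 fix B :: "complex => real" and \<beta> u'
 assume \<beta>: "bilinear \<beta>" "\<forall>x y. \<beta> x y = \<beta> y x" "\<forall>v. B v = \<beta> v v" and S: "\<forall>v\<in>S. B v = 1"
 have "S = {e1, - e1, e2, - e2, e1 - e2, - (e1 - e2)}" using minimal_vectors_three[of e1 1 e2] e t by simp
 then have "B e1 = 1" "B e2 = 1" "B (e1 - e2) = 1" using S by auto
 then have b: "\<beta> e1 e1 = 1" "\<beta> e2 e2 = 1" "\<beta> (1 *\<^sub>R e1 + (- 1) *\<^sub>R e2) (1 *\<^sub>R e1 + (- 1) *\<^sub>R e2) = 1" using \<beta>(3) by auto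
 from b(3) show "\<beta> e1 e2 = e1 \<bullet> e2" unfolding form_expand[OF \<beta>(1,2)] b(1,2) using t by simp
qed

end

section \<open>Quadratic reciprocity\<close>

lemma Legendre_values: "Legendre a p = 0 \<or> Legendre a p = 1 \<or> Legendre a p = -1"
 by (simp add: Legendre_def)

text \<open>Euler's criterion gives a congruence modulo \<open>p\<close>. Both sides are 0, 1 or -1,
  so \<open>p > 2\<close> turns it into an equation.\<close>

lemma Legendre_mult:
 assumes p: "prime p" "2 < p" shows "Legendre (a * b) (int p) = Legendre a (int p) * Legendre b (int p)"
proof -
 have "[Legendre a p * Legendre b p = a ^ ((p - 1) div 2) * b ^ ((p - 1) div 2)] (mod p)"
  by (intro cong_mult euler_criterion p)
 moreover have "[Legendre (a * b) p = a ^ ((p - 1) div 2) * b ^ ((p - 1) div 2)] (mod p)"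
  using euler_criterion[OF p, of "a * b"] by (simp only: power_mult_distrib)
 ultimately have "[Legendre (a * b) p = Legendre a p * Legendre b p] (mod p)" using cong_sym cong_trans by blast
 then have d: "int p dvd Legendre (a * b) p - Legendre a p * Legendre b p" by (simp add: cong_iff_dvd_diff)
 have "\<bar>Legendre (a * b) p - Legendre a p * Legendre b p\<bar> \<le> 2"
  using Legendre_values[of a p] Legendre_values[of b p] Legendre_values[of "a * b" p] by auto
 then have "Legendre (a * b) p - Legendre a p * Legendre b p = 0" using d p(2) zdvd_imp_le[of "int p" "\<bar>Legendre (a * b) p - Legendre a p * Legendre b p\<bar>"] by fastforce
 then show ?thesis by simp
qed

lemma Legendre_power:
 assumes "prime p" "2 < p" "\<not> int p dvd a" shows "Legendre (a ^ n) (int p) = Legendre a (int p) ^ n"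
proof (induction n)
 case 0
 have "[1\<^sup>2 = 1::int] (mod int p)" by simp
 then have "QuadRes (int p) 1" unfolding QuadRes_def by blast
 moreover have "\<not> [1 = 0] (mod int p)" using prime_gt_1_nat[OF assms(1)] by (auto simp: cong_0_iff)
 ultimately show ?case by (simp add: Legendre_def)
next
 case (Suc n) then show ?case by (simp add: Legendre_mult[OF assms(1,2)])
qed

lemma Legendre_cong: "[a = b] (mod p) ==> Legendre a p = Legendre b p"
proof -
 assume c: "[a = b] (mod p)"
 have 1: "[a = 0] (mod p) \<longleftrightarrow> [b = 0] (mod p)" using c cong_sym cong_trans by blast
 have 2: "QuadRes p a \<longleftrightarrow> QuadRes p b" unfolding QuadRes_def using c cong_sym cong_trans by blast
 show ?thesis unfolding Legendre_def 1 2 ..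
qed

lemma Legendre_square: "\<not> int p dvd a ==> Legendre a (int p) * Legendre a (int p) = 1"
 by (simp add: Legendre_def cong_0_iff)

lemma Legendre_minus_one:
 assumes p: "prime p" "2 < p" shows "Legendre (-1) (int p) = (-1) ^ ((p - 1) div 2)"
proof -
 have "[Legendre (-1) p = (-1) ^ ((p - 1) div 2)] (mod p)" by (rule euler_criterion[OF p])
 then have d: "int p dvd Legendre (-1) p - (-1) ^ ((p - 1) div 2)" by (simp add: cong_iff_dvd_diff)
 have "(-1::int) ^ ((p - 1) div 2) = 1 \<or> (-1::int) ^ ((p - 1) div 2) = -1" by (metis neg_one_even_power neg_one_odd_power)
 then have "\<bar>Legendre (-1) p - (-1) ^ ((p - 1) div 2)\<bar> \<le> 2" using Legendre_values[of "-1" p] by auto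
 then have "Legendre (-1) p - (-1) ^ ((p - 1) div 2) = 0" using d p(2) zdvd_imp_le[of "int p" "\<bar>Legendre (-1) p - (-1) ^ ((p - 1) div 2)\<bar>"] by fastforce
 then show ?thesis by simp
qed

text \<open>Gauss's lemma for 2: the doubled residues beyond the middle come from the
  \<open>x\<close> between \<open>(p - 1) / 4\<close> and \<open>(p - 1) / 2\<close>, and the parity
  of their number depends only on \<open>p\<close> modulo 8.\<close>

lemma Legendre_two_period:
 assumes p: "prime p" "2 < p" and q: "prime q" "2 < q" and c: "[int p = int q] (mod 8)"
 shows "Legendre 2 (int p) = Legendre 2 (int q)"
proof -
 have L: "Legendre 2 (int p) = (-1) ^ ((p - 1) div 2 - (p - 1) div 4)" if p: "prime p" "2 < p" for p :: nat
 proof -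
  have "\<not> int p dvd 2" using p(2) zdvd_imp_le[of "int p" 2] by auto
  then interpret GAUSS p 2 by unfold_locales (use p in \<open>auto simp: cong_0_iff\<close>)
  have op: "odd p" using p prime_odd_nat by simp
  have "E = (\<lambda>x. x * 2) ` {int ((p - 1) div 4) <.. int ((p - 1) div 2)}"
  proof (intro equalityI subsetI)
   fix y assume "y \<in> E"
   then obtain x where x: "0 < x" "x \<le> (int p - 1) div 2" "y = x * 2 mod int p" "(int p - 1) div 2 < y"
    by (auto simp: E_def C_def B_def A_def)
   have "x * 2 < int p" using x(2) p(2) by simp
   then have y: "y = x * 2" using x(1,3) by simp
   then have "x \<in> {int ((p - 1) div 4) <.. int ((p - 1) div 2)}" using x(2,4) p(2) op by fastforce
   then show "y \<in> (\<lambda>x. x * 2) ` {int ((p - 1) div 4) <.. int ((p - 1) div 2)}" using y by simp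
  next
   fix y assume "y \<in> (\<lambda>x. x * 2) ` {int ((p - 1) div 4) <.. int ((p - 1) div 2)}"
   then obtain x where x: "int ((p - 1) div 4) < x" "x \<le> int ((p - 1) div 2)" "y = x * 2" by auto
   have x0: "0 < x" using x(1) by simp
   have xh: "x \<le> (int p - 1) div 2" using x(2) p(2) by simp
   have "x * 2 < int p" using xh p(2) by simp
   then have "x * 2 mod int p = x * 2" using x0 by simp
   moreover have "(int p - 1) div 2 < x * 2" using x(1) p(2) op by simp
   ultimately show "y \<in> E" unfolding E_def C_def B_def A_def using x0 xh x(3) by force
  qed
  moreover have "inj (\<lambda>x::int. x * 2)" by (auto intro: injI)
  ultimately have "card E = (p - 1) div 2 - (p - 1) div 4" by (simp add: card_image inj_on_subset nat_diff_distrib')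
  then show ?thesis using gauss_lemma by simp
 qed
 have "int (p mod 8) = int (q mod 8)" using c unfolding cong_def by (simp add: zmod_int)
 then have m: "p mod 8 = q mod 8" by simp
 have par: "even ((p - 1) div 2 - (p - 1) div 4) \<longleftrightarrow> p mod 8 \<in> {1, 7}" if op: "odd p" for p :: nat
 proof -
  obtain i r where p: "p = 8 * i + r" "r < 8" using mod_less_divisor[of 8 p] by (metis mult_div_mod_eq zero_less_numeral)
  then have "r = 1 \<or> r = 3 \<or> r = 5 \<or> r = 7" using op by presburger
  then show ?thesis unfolding p(1) by (elim disjE) (simp_all, presburger+)
 qed
 have "odd p" "odd q" using p q prime_odd_nat by blast+
 then have "even ((p - 1) div 2 - (p - 1) div 4) \<longleftrightarrow> even ((q - 1) div 2 - (q - 1) div 4)" using m par by simp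
 then show ?thesis unfolding L[OF p] L[OF q] by fastforce
qed

text \<open>Jacobi's reciprocity for odd \<open>m\<close>, by induction over the prime factors of
  \<open>m\<close>. Multiplied by its sign, the symbol of a prime factor \<open>r\<close> becomes a
  symbol modulo \<open>r\<close>, which depends only on the residue of \<open>p\<close>.\<close>

lemma reciprocity_period:
 assumes p: "prime p" "2 < p" and q: "prime q" "2 < q"
 shows "odd m ==> coprime m p ==> coprime m q ==> [int p = int q] (mod int m) ==>
  Legendre (int m) p * (-1) ^ ((m - 1) div 2 * ((p - 1) div 2)) = Legendre (int m) q * (-1) ^ ((m - 1) div 2 * ((q - 1) div 2))"
proof (induction m rule: less_induct)
 case (less m)
 show ?case
 proof (cases "m = 1")
  case True
  have "\<not> int p dvd 1" "\<not> int q dvd 1" using p q by auto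
  then show ?thesis using Legendre_power[OF p, of 1 0] Legendre_power[OF q, of 1 0] True by simp
 next
  case False
  then obtain r where r: "prime r" "r dvd m" using prime_factor_nat by blast
  then obtain m' where m': "m = r * m'" by blast
  have odd: "odd r" "odd m'" using less.prems(1) m' by auto
  have r2: "2 < r" using r(1) odd(1) prime_ge_2_nat[of r] by (cases "r = 2") auto
  have "m' > 0" using odd(2) by (cases m') auto
  then have "m' < m" using m' r2 by simp
  have cop: "coprime m' p" "coprime m' q" "coprime r p" "coprime r q" using less.prems(2,3) m' by auto
  have ne: "r \<noteq> p" "r \<noteq> q" using cop(3,4) r2 by auto
  have c: "[int p = int q] (mod int m')" "[int p = int q] (mod int r)"
   using less.prems(4) unfolding m' by (auto intro: cong_modulus_mult simp: mult.commute)
  have IH: "Legendre (int m') p * (-1) ^ ((m' - 1) div 2 * ((p - 1) div 2)) = Legendre (int m') q * (-1) ^ ((m' - 1) div 2 * ((q - 1) div 2))"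
   by (rule less.IH[OF \<open>m' < m\<close> odd(2) cop(1,2) c(1)])
  have R: "Legendre (int r) t * (-1) ^ ((r - 1) div 2 * ((t - 1) div 2)) = Legendre t r" if t: "prime t" "2 < t" "r \<noteq> t" for t :: nat
  proof -
   have "\<not> int t dvd int r" using t r(1) r2 by (metis int_dvd_int_iff primes_dvd_imp_eq)
   then have sq: "Legendre (int r) t * Legendre (int r) t = 1" by (rule Legendre_square)
   have "Legendre (int r) t * Legendre t r = (-1) ^ ((r - 1) div 2 * ((t - 1) div 2))"
    using Quadratic_Reciprocity[OF r(1) r2 t] by simp
   then have "Legendre (int r) t * (-1) ^ ((r - 1) div 2 * ((t - 1) div 2)) = (Legendre (int r) t * Legendre (int r) t) * Legendre t r"
    by simp
   then show ?thesis using sq by simp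
  qed
  have "Legendre (int r) p * (-1) ^ ((r - 1) div 2 * ((p - 1) div 2)) = Legendre (int r) q * (-1) ^ ((r - 1) div 2 * ((q - 1) div 2))"
   unfolding R[OF p ne(1)] R[OF q ne(2)] by (rule Legendre_cong[OF c(2)])
  then have prod: "(Legendre (int r) p * Legendre (int m') p) * (-1) ^ (((r - 1) div 2 + (m' - 1) div 2) * ((p - 1) div 2))
   = (Legendre (int r) q * Legendre (int m') q) * (-1) ^ (((r - 1) div 2 + (m' - 1) div 2) * ((q - 1) div 2))" (is "?l = ?r")
  proof -
   assume Rr: "Legendre (int r) p * (-1) ^ ((r - 1) div 2 * ((p - 1) div 2)) = Legendre (int r) q * (-1) ^ ((r - 1) div 2 * ((q - 1) div 2))"
   have ex: "(X * Y) * (-1) ^ ((a + b) * k) = (X * (-1) ^ (a * k)) * (Y * (-1) ^ (b * k))" for X Y :: int and a b k :: nat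
    by (simp add: power_add distrib_right)
   show ?thesis unfolding ex Rr IH ..
  qed
  \<comment> \<open>The numbers \<open>(r m' - 1) / 2\<close> and
    \<open>(r - 1) / 2 + (m' - 1) / 2\<close> have the same parity, so the signs are multiplicative
    in \<open>m\<close> as well.\<close>
  obtain i j where ij: "r = 2 * i + 1" "m' = 2 * j + 1" using odd by (meson oddE)
  have "(m - 1) div 2 = 2 * i * j + (i + j)" unfolding m' ij by simp
  then have "(-1::int) ^ ((m - 1) div 2 * k) = (-1) ^ (((r - 1) div 2 + (m' - 1) div 2) * k)" for k
   by (simp add: ij power_add distrib_right power_mult)
  then show ?thesis using prod unfolding m' by (simp add: Legendre_mult[OF p] Legendre_mult[OF q])
 qed
qed

text \<open>Write \<open>D = - 2^e m\<close> with \<open>m\<close> odd. For odd \<open>D\<close>,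
  \<open>m\<close> is 3 modulo 4 and the sign of reciprocity cancels the symbol of -1. For even
  \<open>D\<close>, \<open>p\<close> and \<open>q\<close> agree modulo 4; if moreover
  \<open>e\<close> is odd, then \<open>e \<ge> 3\<close>, so they agree modulo 8 and the symbols of
  2 coincide.\<close>

lemma QuadRes_period:
 fixes D :: int
 assumes D: "D < 0" "D mod 4 = 0 \<or> D mod 4 = 1" and p: "prime p" "2 < p" "\<not> int p dvd D" and q: "prime q" "2 < q" "\<not> int q dvd D"
  and c: "[int p = int q] (mod D)"
 shows "QuadRes p D \<longleftrightarrow> QuadRes q D"
proof -
 have "nat (- D) > 0" using D(1) by simp
 then obtain e m where "odd m" "nat (- D) = m * 2 ^ e" using prime_power_canonical[of 2 "nat (- D)"] by auto
 then have em: "nat (- D) = 2 ^ e * m" "odd m" by (simp_all add: mult.commute)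
 have De: "D = (-1) * (2 ^ e * int m)" using em(1) D(1) by (metis int_nat_eq minus_minus mult_minus1 neg_0_le_iff_le nat_le_0 of_nat_mult of_nat_numeral of_nat_power order_less_imp_le)
 have cop: "coprime m t" if t: "prime t" "\<not> int t dvd D" for t :: nat
 proof -
  have "\<not> t dvd m" using t(2) unfolding De by fastforce
  then show ?thesis using t(1) prime_imp_coprime coprime_commute by blast
 qed
 have cm: "[int p = int q] (mod int m)" using c unfolding De by (simp add: cong_iff_dvd_diff) (meson dvd_mult_right)
 have R: "Legendre (int m) p * (-1) ^ ((m - 1) div 2 * ((p - 1) div 2)) = Legendre (int m) q * (-1) ^ ((m - 1) div 2 * ((q - 1) div 2))"
  by (rule reciprocity_period[OF p(1,2) q(1,2) em(2) cop[OF p(1,3)] cop[OF q(1,3)] cm])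
 have LD: "Legendre D t = (-1) ^ ((t - 1) div 2) * (Legendre 2 t ^ e * Legendre (int m) t)" if t: "prime t" "2 < t" "\<not> int t dvd D" for t :: nat
 proof -
  have "\<not> int t dvd 2" using t(2) zdvd_imp_le[of "int t" 2] by auto
  then show ?thesis
   unfolding De Legendre_mult[OF t(1,2)] Legendre_minus_one[OF t(1,2)] by (simp add: Legendre_power[OF t(1,2)])
 qed
 have "Legendre D p = Legendre D q"
 proof (cases "odd D")
  case True
  then have e0: "e = 0" using De by (cases e) auto
  then have "D mod 4 = (- int m) mod 4" using De by simp
  moreover have "D mod 4 = 1" using D(2) True by fastforce
  ultimately have "odd ((m - 1) div 2)" using em(2) by presburger
  then have pw: "(-1::int) ^ ((m - 1) div 2 * k) = (-1) ^ k" for k by (simp add: power_mult)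
  show ?thesis unfolding LD[OF p] LD[OF q] e0 using R[unfolded pw] by (simp add: mult.commute)
 next
  case False
  then have "4 dvd D" using D(2) by presburger
  then have "4 dvd int p - int q" using c by (meson cong_iff_dvd_diff dvd_trans)
  moreover have "odd p" "odd q" using p q prime_odd_nat by blast+
  ultimately have ev: "even ((p - 1) div 2) \<longleftrightarrow> even ((q - 1) div 2)" by presburger
  then have m1: "(-1::int) ^ ((p - 1) div 2) = (-1) ^ ((q - 1) div 2)" by fastforce
  then have "(-1::int) ^ ((m - 1) div 2 * ((p - 1) div 2)) = (-1) ^ ((m - 1) div 2 * ((q - 1) div 2))" by (metis power_mult mult.commute)
  then have Rm: "Legendre (int m) p = Legendre (int m) q" using R by simp
  have "Legendre 2 p ^ e = Legendre 2 q ^ e"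
  proof (cases "even e")
   case True
   then obtain k where k: "e = 2 * k" by blast
   have "Legendre 2 t ^ 2 = 1" if t: "2 < t" for t :: nat
   proof -
    have "\<not> int t dvd 2" using t zdvd_imp_le[of "int t" 2] by auto
    then show ?thesis using Legendre_square[of t 2] by (simp add: power2_eq_square)
   qed
   then show ?thesis using p(2) q(2) by (simp add: k power_mult)
  next
   case odd_e: False
   have "e \<noteq> 1"
   proof
    assume "e = 1"
    then have "4 dvd 2 * int m" using \<open>4 dvd D\<close> De by simp
    then have "2 dvd int m" by fastforce
    then show False using em(2) by simp
   qed
   then have "e \<ge> 3" using odd_e by presburger
   then have "(2::int) ^ 3 dvd 2 ^ e" by (rule le_imp_power_dvd)
   then have "8 dvd D" using De by simp
   then have "[int p = int q] (mod 8)" using c by (meson cong_dvd_modulus)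
   then show ?thesis using Legendre_two_period[OF p(1,2) q(1,2)] by simp
  qed
  then show ?thesis unfolding LD[OF p] LD[OF q] using m1 Rm by simp
 qed
 moreover have "QuadRes t D \<longleftrightarrow> Legendre D t = 1" if "\<not> int t dvd D" for t :: nat using that by (simp add: Legendre_def cong_0_iff)
 ultimately show ?thesis using p(3) q(3) by simp
qed

section \<open>Primes below a class and their residues modulo the discriminant\<close>

context quad
begin

text \<open>An ideal of norm \<open>p\<close> contains \<open>p\<close>, hence the product of
  \<open>P\<close> with its conjugate, hence one of the two.\<close>

lemma split_fibre:
 assumes "P \<in> split_primes" "Q \<in> split_primes" "nn Q = nn P" shows "Q = P \<or> Q = cnj ` P"
proof -
 have P: "integral P" "prime (nn P)" "\<not> int (nn P) dvd D" and Q: "integral Q" using assms by (auto simp: split_primes_def)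
 have cP: "cnj ` P \<in> split_primes" using P integral_cnj by (auto simp: split_primes_def)
 have "sc (of_nat (nn P)) O' \<subseteq> Q" using proper_smult[OF integral_proper[OF Q] _ nn_mem[OF Q]] assms(3) by (auto simp: mult.commute)
 then have "P \<odot> cnj ` P \<subseteq> Q" using cnj_ip_nn[OF P(1)] by simp
 moreover have pp: "P \<in> PP" "cnj ` P \<in> PP" "Q \<in> PP" using assms cP by (auto simp: PP_def)
 ultimately have "P \<subseteq> Q \<or> cnj ` P \<subseteq> Q" using PP_prime[OF pp(3) P(1) PP_integral[OF pp(2)]] by simp
 then show ?thesis using PP_sub_eq pp by metis
qed

text \<open>At most two split primes share a norm, so finitely many norms would leave a finite
  sum.\<close>

theorem infinite_primes_in_class:
 assumes ns: "\<not> (\<lambda>P. 1 / real (nn P)) summable_on {P \<in> split_primes. cl P = X}"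
 shows "infinite {l. prime l \<and> (\<exists>P. integral P \<and> nn P = l \<and> P \<in> X)}" (is "infinite ?A")
proof
 assume fin: "finite ?A"
 have "{P \<in> split_primes. cl P = X} \<subseteq> (\<Union>l\<in>?A. {P \<in> split_primes. nn P = l})"
 proof
  fix P assume P: "P \<in> {P \<in> split_primes. cl P = X}"
  then have "integral P" "prime (nn P)" "cl P = X" by (auto simp: split_primes_def)
  moreover from this have "P \<in> X" using mem_cl[of P P] by simp
  ultimately show "P \<in> (\<Union>l\<in>?A. {P \<in> split_primes. nn P = l})" using P by blast
 qed
 moreover have "finite {P \<in> split_primes. nn P = l}" for l
 proof (cases "\<exists>Q\<in>split_primes. nn Q = l")
  case True
  then obtain Q where "Q \<in> split_primes" "nn Q = l" by blast
  then have "{P \<in> split_primes. nn P = l} \<subseteq> {Q, cnj ` Q}" using split_fibre[of Q] by auto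
  then show ?thesis by (rule finite_subset) simp
 next
  case False
  then have "{P \<in> split_primes. nn P = l} = {}" by simp
  then show ?thesis by (simp only: finite.emptyI)
 qed
 ultimately have "finite {P \<in> split_primes. cl P = X}" using fin by (meson finite_UN_I finite_subset)
 then show False using ns by simp
qed

text \<open>Four times the norm of \<open>x + \<theta>\<close> is
  \<open>(2 x + D)\<^sup>2 - D\<close>, and an ideal of norm \<open>p\<close> contains some
  \<open>x + \<theta>\<close>.\<close>

lemma split_iff_QuadRes:
 assumes p: "prime p" "2 < p" "\<not> int p dvd D"
 shows "(\<exists>P. integral P \<and> nn P = p) \<longleftrightarrow> QuadRes p D"
proof
 assume "\<exists>P. integral P \<and> nn P = p"
 then obtain P where P: "integral P" "nn P = p" by blast
 have pP: "prime (nn P)" using P(2) p(1) by simp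
 obtain n x where x: "n = int (nn P)" "P = lat (of_int n) (of_int x + \<theta>)" by (rule prime_norm_hermite[OF P(1) pP])
 obtain q where q: "D * D - D = 4 * q" "(of_int x + \<theta>) * cnj (of_int x + \<theta>) = of_int (x * x + x * D + q)" by (rule theta_norm[of x])
 have xP: "of_int x + \<theta> \<in> P" unfolding x(2) by simp
 have "cnj (of_int x + \<theta>) \<in> O'" by (intro O_cnj O_add O_of_int O_theta)
 from proper_smult[OF integral_proper[OF P(1)] this xP] have "of_int (x * x + x * D + q) \<in> P" unfolding q(2)[symmetric] by (simp add: mult.commute)
 then have "int (nn P) dvd x * x + x * D + q" by (rule prime_norm_int_mem[OF P(1) pP, THEN iffD1])
 then have "int p dvd x * x + x * D + q" by (simp only: P(2))
 then have "int p dvd 4 * (x * x + x * D + q)" by fastforce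
 moreover have "4 * (x * x + x * D + q) = (2 * x + D)\<^sup>2 - D" using q(1) by (simp add: square_simps)
 ultimately show "QuadRes p D" unfolding QuadRes_def by (metis cong_iff_dvd_diff)
next
 assume "QuadRes p D"
 then obtain s where s: "int p dvd s\<^sup>2 - D" unfolding QuadRes_def cong_iff_dvd_diff by blast
 have op: "odd p" using p prime_odd_nat by simp
 \<comment> \<open>Adding the odd \<open>p\<close> if necessary gives the root the parity of
   \<open>D\<close>, so that it has the form \<open>2 x + D\<close>.\<close>
 define t where "t = (if even (s - D) then s else s + int p)"
 have "even (t - D)" using op by (auto simp: t_def)
 then obtain x where x: "t = 2 * x + D" by (metis evenE diff_eq_eq add.commute)
 have "int p dvd t\<^sup>2 - D"
 proof (cases "even (s - D)")
  case False
  have "(s + int p)\<^sup>2 - D = (s\<^sup>2 - D) + int p * (2 * s + int p)" by (simp add: square_simps)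
  then have "int p dvd (s + int p)\<^sup>2 - D" using s by fastforce
  then show ?thesis using False by (simp only: t_def if_False)
 qed (use s in \<open>simp add: t_def\<close>)
 moreover obtain q where q: "D * D - D = 4 * q" by (rule quarter)
 have "t\<^sup>2 - D = 4 * (x * x + x * D + q)" using q by (simp add: x square_simps)
 ultimately have "int p dvd 2 ^ 2 * (x * x + x * D + q)" by simp
 moreover have "coprime (int p) (2 ^ 2)" using op by (subst coprime_power_right_iff) simp
 ultimately have "int p dvd x * x + x * D + q" using coprime_dvd_mult_right_iff by blast
 moreover have "prime (int p)" using p(1) by simp
 ultimately show "\<exists>P. integral P \<and> nn P = p" using prime_lattice_ideal[OF _ p(3) q] by (metis nat_int)
qed

text \<open>If all classes have order at most 2, a prime and its conjugate are equivalent. So each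
  prime factor split off from \<open>I\<close> can be matched with an equivalent factor of
  \<open>J\<close> of the same norm.\<close>

lemma equal_norm_equal_class:
 assumes sq: "\<And>X. X \<in> carrier G ==> X \<cdot> X = 1\<^sub>G"
 shows "cop I ==> cop J ==> nn I = nn J ==> cl I = cl J"
proof (induction "nn I" arbitrary: I J rule: less_induct)
 case less
 have I: "integral I" "coprime (int (nn I)) D" and J: "integral J" "coprime (int (nn J)) D" using less.prems by (auto simp: cop_def)
 show ?case
 proof (cases "nn I = 1")
  case True
  then show ?thesis using integral_nn(4)[OF I(1)] integral_nn(4)[OF J(1)] less.prems(3) by simp
 next
  case False
  then obtain P where P: "P \<in> PP" "I \<subseteq> P" using ideal_sub_PP[OF less.prems(1)] by blast
  have iP: "integral P" by (rule PP_integral[OF P(1)])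
  from integral_divide[OF integral_proper[OF I(1)] integral_proper[OF iP] P(2)] obtain I' where I': "integral I'" "I = P \<odot> I'" .
  have nI: "nn I = nn P * nn I'" unfolding I'(2) by (rule integral_ip(2)[OF iP I'(1)])
  have "\<exists>Q. integral Q \<and> nn Q = nn P \<and> cl Q = cl P \<and> J \<subseteq> Q"
  proof (cases "P \<in> split_primes")
   case True
   then have p: "prime (nn P)" "\<not> int (nn P) dvd D" by (auto simp: split_primes_def)
   have "nn P dvd nn J" using nI less.prems(3) by simp
   from prime_divides_ideal[OF J(1) p(1) this p(2)] show ?thesis
   proof
    assume "J \<subseteq> sc (of_nat (nn P)) O'"
    also have "\<dots> = P \<odot> cnj ` P" using cnj_ip_nn[OF iP] by simp
    also have "\<dots> \<subseteq> P" by (rule ip_subset_left[OF integral_cnj(1)[OF iP] integral_proper[OF iP]])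
    finally show ?thesis using iP by blast
   next
    assume "\<exists>Q. integral Q \<and> nn Q = nn P \<and> J \<subseteq> Q"
    then obtain Q where Q: "integral Q" "nn Q = nn P" "J \<subseteq> Q" by blast
    then have "Q = P \<or> Q = cnj ` P" using split_fibre[OF True] p by (auto simp: split_primes_def)
    moreover have "cl (cnj ` P) = cl P"
    proof -
     have "cl (cnj ` P) = inv\<^bsub>G\<^esub> (cl P)" using inv_cl[OF integral_proper[OF iP]] by simp
     also have "\<dots> = cl P" using sq[of "cl P"] iP by (intro G.inv_equality) auto
     finally show ?thesis .
    qed
    ultimately show ?thesis using Q by blast
   qed
  next
   case False
   then have "P \<in> inert_primes" using P(1) by (simp add: PP_def)
   then obtain p where p: "P = sc (of_nat p) O'" "prime p" "\<not> int p dvd D" "\<nexists>Q. integral Q \<and> nn Q = p" "nn P = p * p" by (rule inertE)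
   have "p dvd nn J" using nI less.prems(3) p(5) by simp
   from prime_divides_ideal[OF J(1) p(2) this p(3)] have "J \<subseteq> P" using p(1,4) by blast
   then show ?thesis using iP by blast
  qed
  then obtain Q where Q: "integral Q" "nn Q = nn P" "cl Q = cl P" "J \<subseteq> Q" by blast
  from integral_divide[OF integral_proper[OF J(1)] integral_proper[OF Q(1)] Q(4)] obtain J' where J': "integral J'" "J = Q \<odot> J'" .
  have nJ: "nn J = nn Q * nn J'" unfolding J'(2) by (rule integral_ip(2)[OF Q(1) J'(1)])
  have "nn P \<ge> 2" by (rule PP_gt1[OF P(1)])
  then have eq: "nn I' = nn J'" using nI nJ less.prems(3) Q(2) by simp
  have "nn I' > 0" by (rule integral_nn(2)[OF I'(1)])
  then have lt: "nn I' < nn I" using nI \<open>nn P \<ge> 2\<close> by simp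
  have "cop I'" "cop J'" using I'(1) J'(1) I(2) J(2) nI nJ by (auto simp: cop_def)
  then have "cl I' = cl J'" using less.hyps[OF lt] eq by blast
  then show ?thesis unfolding I'(2) J'(2)
   using cl_mult[OF integral_proper[OF iP] integral_proper[OF I'(1)]] cl_mult[OF integral_proper[OF Q(1)] integral_proper[OF J'(1)]] Q(3) by simp
 qed
qed

text \<open>The zero of the ternary form is an element \<open>z + y sqrt D\<close> whose norm is
  \<open>nn I\<close> times a square coprime to \<open>D\<close>. Its principal ideal and the
  multiple of \<open>I\<close> by the root of that square have equal norms, hence equal
  classes.\<close>

lemma principal_class:
 assumes sq: "\<And>X. X \<in> carrier G ==> X \<cdot> X = 1\<^sub>G"
  and I: "cop I" and r: "[r\<^sup>2 = int (nn I)] (mod D)" and s: "[s\<^sup>2 = D] (mod int (nn I))" and e: "even D --> int (nn I) mod 8 = 1"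
 shows "cl I = 1\<^sub>G"
proof -
 have i: "integral I" "coprime (int (nn I)) D" using I by (auto simp: cop_def)
 have n0: "nn I > 0" by (rule integral_nn(2)[OF i(1)])
 have D1: "D < -1" using D_neg D_mod4 by presburger
 obtain x y z where xyz: "z\<^sup>2 - D * y\<^sup>2 = int (nn I) * x\<^sup>2" "coprime x D"
  by (rule ternary_zero_coprime[OF D1 D_mod4 _ e i(2) r s]) (use n0 in auto)
 define k where "k = nat \<bar>x\<bar>"
 have x0: "x \<noteq> 0" using xyz(2) D1 by auto
 have k: "k > 0" "int k * int k = x * x" using x0 by (simp_all add: k_def)
 define \<alpha> where "\<alpha> = of_int z + of_int y * rD"
 have "rD = 2 * \<theta> - of_int D" unfolding \<theta>_def by (simp add: field_simps)
 then have "rD \<in> O'" using O_diff[OF O_mult[OF O_of_int[of 2] O_theta] O_of_int[of D]] by simp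
 then have \<alpha>O: "\<alpha> \<in> O'" unfolding \<alpha>_def by (intro O_add O_mult O_of_int)
 have "\<alpha> * cnj \<alpha> = of_int (z * z) - of_int (y * y) * (rD * rD)" by (simp add: \<alpha>_def algebra_simps)
 also have "\<dots> = of_int (z\<^sup>2 - D * y\<^sup>2)" unfolding rD_sq by (simp add: power2_eq_square)
 also have "\<dots> = of_real (real (nn I) * real_of_int (x * x))" unfolding xyz(1) by (simp add: power2_eq_square)
 finally have "of_real ((cmod \<alpha>)\<^sup>2) = (of_real (real (nn I) * real_of_int (x * x)) :: complex)" by (simp only: complex_norm_square)
 then have N: "(cmod \<alpha>)\<^sup>2 = real (nn I) * real_of_int (x * x)" by (simp only: of_real_eq_iff)
 then have \<alpha>0: "\<alpha> \<noteq> 0" using n0 x0 by auto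
 have A: "integral (sc \<alpha> O')" "real (nn (sc \<alpha> O')) = real (nn I) * real_of_int (x * x)"
  using integral_sc[OF integral_O(1) \<alpha>O \<alpha>0] N integral_O(2) by simp_all
 have "real (nn (sc \<alpha> O')) = real (nn I * (k * k))" unfolding A(2) k(2)[symmetric] by simp
 then have A2: "nn (sc \<alpha> O') = nn I * (k * k)" by (simp only: of_nat_eq_iff)
 have B: "integral (sc (of_nat k) O')" "nn (sc (of_nat k) O') = k * k" by (rule sc_nat_integral[OF k(1)])+
 have C: "integral (I \<odot> sc (of_nat k) O')" "nn (I \<odot> sc (of_nat k) O') = nn I * (k * k)" using integral_ip[OF i(1) B(1)] B(2) by simp_all
 have "coprime (int k) D" using xyz(2) by (simp add: k_def)
 then have "coprime (int (nn I * (k * k))) D" using i(2) by simp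
 then have "cl (sc \<alpha> O') = cl (I \<odot> sc (of_nat k) O')" using equal_norm_equal_class[OF sq] A(1) A2 C by (simp add: cop_def)
 moreover have "cl (sc \<alpha> O') = cl O'" by (rule cl_sc[OF proper_O(1) O_K[OF \<alpha>O] \<alpha>0])
 moreover have "cl (sc (of_nat k) O') = cl O'" using k(1) by (intro cl_sc[OF proper_O(1)]) auto
 moreover have "cl (I \<odot> sc (of_nat k) O') = cl I \<cdot> cl (sc (of_nat k) O')" using cl_mult[OF integral_proper[OF i(1)] integral_proper[OF B(1)]] by simp
 ultimately show ?thesis using i(1) by (simp add: one_G[symmetric])
qed

text \<open>The norm of \<open>P \<odot> Q\<close> is congruent to the square of \<open>nn P\<close>
  modulo \<open>D\<close>, so only the residue modulo 8 can be missing for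
  \<open>principal_class\<close>. If the product is principal, its factors are equivalent, because
  classes have order at most 2.\<close>

theorem class_determined_mod_D:
 assumes sq: "\<And>X. X \<in> carrier G ==> X \<cdot> X = 1\<^sub>G"
  and P: "integral P" "prime (nn P)" "\<not> int (nn P) dvd 2 * D * (1 - D)" and Q: "integral Q" "prime (nn Q)" "\<not> int (nn Q) dvd 2 * D * (1 - D)"
  and c: "[int (nn P) = int (nn Q)] (mod D)"
 shows "cl P = cl Q"
proof -
 have red: "2 < nn R \<and> \<not> int (nn R) dvd D \<and> coprime (int (nn R)) D \<and> coprime (int (nn R)) (1 - D) \<and> R \<in> split_primes \<and> cop R \<and> odd (nn R)"
  if R: "integral R" "prime (nn R)" "\<not> int (nn R) dvd 2 * D * (1 - D)" for R
 proof -
  have nd: "\<not> int (nn R) dvd 2" "\<not> int (nn R) dvd D" "\<not> int (nn R) dvd 1 - D" using R(3) by (meson dvd_mult dvd_mult2)+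
  then have "nn R \<noteq> 2" by auto
  then have "2 < nn R" using prime_ge_2_nat[OF R(2)] by simp
  moreover have "prime (int (nn R))" using R(2) by simp
  then have "coprime (int (nn R)) D" "coprime (int (nn R)) (1 - D)" using prime_imp_coprime nd by blast+
  ultimately show ?thesis using nd R prime_odd_nat[OF R(2)] by (auto simp: split_primes_def cop_def)
 qed
 note rP = red[OF P] and rQ = red[OF Q]
 show ?thesis
 proof (cases "nn P = nn Q")
  case True
  then show ?thesis using equal_norm_equal_class[OF sq] rP rQ by simp
 next
  case ne: False
  define p q where "p = int (nn P)" and "q = int (nn Q)"
  have cpq: "coprime p q" using ne P(2) Q(2) by (simp add: p_def q_def primes_coprime)
  have QR: "\<exists>s. [s\<^sup>2 = D] (mod int (nn R))" if "integral R" "prime (nn R)" "2 < nn R" "\<not> int (nn R) dvd D" for R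
   using split_iff_QuadRes[OF that(2-4)] that(1) unfolding QuadRes_def by blast
  obtain s1 where s1: "[s1\<^sup>2 = D] (mod p)" using QR[OF P(1,2)] rP unfolding p_def by blast
  obtain s2 where s2: "[s2\<^sup>2 = D] (mod q)" using QR[OF Q(1,2)] rQ unfolding q_def by blast
  obtain s3 where s3: "[s3 = s1] (mod p)" "[s3 = s2] (mod q)" using binary_chinese_remainder_int[OF cpq] by blast
  have "[s3\<^sup>2 = D] (mod p)" "[s3\<^sup>2 = D] (mod q)" using s3 s1 s2 cong_pow cong_trans by blast+
  then have s: "[s3\<^sup>2 = D] (mod p * q)" using cpq by (intro coprime_cong_mult)
  have iPQ: "integral (P \<odot> Q)" "int (nn (P \<odot> Q)) = p * q" using integral_ip[OF P(1) Q(1)] by (simp_all add: p_def q_def)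
  have copPQ: "cop (P \<odot> Q)" using iPQ rP rQ by (simp add: cop_def p_def q_def)
  have r: "[p\<^sup>2 = p * q] (mod D)" using c unfolding p_def q_def power2_eq_square by (rule cong_scalar_left)
  have main: "cl (P \<odot> Q) = 1\<^sub>G"
  proof (cases "even D --> p * q mod 8 = 1")
   case True
   then show ?thesis using principal_class[OF sq copPQ, of p s3] r s iPQ(2) by simp
  next
   case False
   \<comment> \<open>Here \<open>D / 4\<close> is odd, and \<open>p q\<close> and
     \<open>1 - D\<close> are both 5 modulo 8. Multiplying by the principal ideal of
     \<open>1 + sqrt D\<close>, of norm \<open>1 - D\<close>, restores the residue 1; this is why
     prime factors of \<open>1 - D\<close> are excluded.\<close>
   then have ev: "even D" "p * q mod 8 \<noteq> 1" by auto
   have D4: "D mod 4 = 0" using D_mod4 ev(1) by presburger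
   have o: "odd p" using rP by (simp add: p_def)
   then obtain h where h: "p = 2 * h + 1" by (elim oddE)
   have "even (h * (h + 1))" by simp
   then obtain h2 where "h * (h + 1) = 2 * h2" by blast
   then have p2: "p\<^sup>2 = 8 * h2 + 1" unfolding h power2_eq_square by (simp add: algebra_simps)
   have "D dvd p\<^sup>2 - p * q" using r by (simp add: cong_iff_dvd_diff)
   then obtain j where j: "p\<^sup>2 - p * q = D * j" by blast
   obtain D' where D': "D = 4 * D'" using D4 by (metis dvd_def mod_0_imp_dvd)
   define y where "y = D' * j"
   have pq: "p * q = 8 * h2 + 1 - 4 * y" using j p2 D' by (simp add: y_def)
   have "odd y" using ev(2) unfolding pq by presburger
   then have "p * q mod 8 = 5" "odd D'" unfolding pq by (presburger, simp add: y_def)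
   then have "p * q mod 8 = 5" "(1 - D) mod 8 = 5" unfolding D' by (simp, presburger)
   then have m8: "(p * q * (1 - D)) mod 8 = 1" by (simp add: mod_mult_eq[of "p * q" 8 "1 - D", symmetric])
   define \<beta> where "\<beta> = 1 + rD"
   have "rD = 2 * \<theta> - of_int D" unfolding \<theta>_def by (simp add: field_simps)
   then have "rD \<in> O'" using O_diff[OF O_mult[OF O_of_int[of 2] O_theta] O_of_int[of D]] by simp
   then have \<beta>O: "\<beta> \<in> O'" unfolding \<beta>_def by (intro O_add O_1)
   have "\<beta> * cnj \<beta> = 1 - rD * rD" by (simp add: \<beta>_def algebra_simps)
   then have "\<beta> * cnj \<beta> = of_real (real_of_int (1 - D))" by (simp add: rD_sq)
   then have "of_real ((cmod \<beta>)\<^sup>2) = (of_real (real_of_int (1 - D)) :: complex)" by (simp only: complex_norm_square)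
   then have N: "(cmod \<beta>)\<^sup>2 = real_of_int (1 - D)" by (simp only: of_real_eq_iff)
   then have \<beta>0: "\<beta> \<noteq> 0" using D_neg by auto
   have Bi: "integral (sc \<beta> O')" "real (nn (sc \<beta> O')) = real_of_int (1 - D)" using integral_sc[OF integral_O(1) \<beta>O \<beta>0] N integral_O(2) by simp_all
   then have Bn: "int (nn (sc \<beta> O')) = 1 - D" by simp
   define I where "I = (P \<odot> Q) \<odot> sc \<beta> O'"
   have I: "integral I" "int (nn I) = p * q * (1 - D)" unfolding I_def using integral_ip[OF iPQ(1) Bi(1)] iPQ(2) Bn by simp_all
   have c1: "coprime (1 - D) D" using coprime_shift[of 1 D "-1"] by simp
   have "coprime (p * q) D" using rP rQ by (simp add: p_def q_def)
   then have "cop I" using I c1 by (simp add: cop_def)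
   moreover have "[p\<^sup>2 = int (nn I)] (mod D)"
   proof -
    have "[1 - D = 1] (mod D)" by (simp add: cong_iff_dvd_diff)
    then have "[p * q * (1 - D) = p * q * 1] (mod D)" by (rule cong_scalar_left)
    then show ?thesis unfolding I(2) using r by (metis cong_sym cong_trans mult.right_neutral)
   qed
   moreover have "\<exists>s. [s\<^sup>2 = D] (mod int (nn I))"
   proof -
    have cc: "coprime (p * q) (1 - D)" using rP rQ by (simp add: p_def q_def)
    obtain s4 where s4: "[s4 = s3] (mod p * q)" "[s4 = 1] (mod 1 - D)" using binary_chinese_remainder_int[OF cc] by blast
    have "[s4\<^sup>2 = D] (mod p * q)" using cong_pow[OF s4(1), of 2] s cong_trans by blast
    moreover have "[1\<^sup>2 = D] (mod 1 - D)" by (simp add: cong_iff_dvd_diff)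
    then have "[s4\<^sup>2 = D] (mod 1 - D)" using cong_pow[OF s4(2), of 2] cong_trans by blast
    ultimately show ?thesis unfolding I(2) using cc coprime_cong_mult by blast
   qed
   ultimately have "cl I = 1\<^sub>G" using principal_class[OF sq] m8 I(2) by metis
   moreover have "cl I = cl (P \<odot> Q) \<cdot> cl (sc \<beta> O')" unfolding I_def using cl_mult[OF integral_proper[OF iPQ(1)] integral_proper[OF Bi(1)]] by simp
   moreover have "cl (sc \<beta> O') = 1\<^sub>G" unfolding one_G by (rule cl_sc[OF proper_O(1) O_K[OF \<beta>O] \<beta>0])
   ultimately show ?thesis using iPQ(1) by simp
  qed
  have carr: "cl P \<in> carrier G" "cl Q \<in> carrier G" using P(1) Q(1) by simp_all
  have "cl P \<cdot> cl Q = 1\<^sub>G" using main cl_mult[OF integral_proper[OF P(1)] integral_proper[OF Q(1)]] by simp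
  also have "\<dots> = cl P \<cdot> cl P" using sq[OF carr(1)] by simp
  finally show ?thesis using carr by simp
 qed
qed

section \<open>Well-rounded ideals and their tempered forms\<close>

lemma well_rounded_basis:
 assumes L: "proper L" "well_rounded L"
 obtains v1 v2 where "L = lat v1 v2" "v1 \<in> K" "v2 \<in> K" "Im (v1 * cnj v2) \<noteq> 0" "v2 \<bullet> v2 = v1 \<bullet> v1"
  "\<forall>z\<in>L. z \<noteq> 0 --> v1 \<bullet> v1 \<le> z \<bullet> z"
proof -
 obtain B where B: "B \<subseteq> minimal_vectors L" "int_complex.span B = L" using L(2) unfolding well_rounded_def by blast
 obtain a b where ab: "a \<in> K" "b \<in> K" "Im (a * cnj b) \<noteq> 0" "L = lat a b"
  by (rule proper_lat[OF L(1)])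
 have sL: "int_complex.subspace L" using L(1) by (rule proper_subspace)
 have min: "v \<in> L" "v \<noteq> 0" "\<And>z. z \<in> L ==> z \<noteq> 0 ==> v \<bullet> v \<le> z \<bullet> z" if "v \<in> B" for v
  using that B(1) by (auto simp: minimal_vectors_def norm_le[symmetric])
 \<comment> \<open>If all vectors of \<open>B\<close> were parallel, the lattice they span would lie
   on a line.\<close>
 have "\<exists>v1\<in>B. \<exists>v2\<in>B. Im (v1 * cnj v2) \<noteq> 0"
 proof (rule ccontr)
  assume "\<not> ?thesis"
  then have col: "Im (v1 * cnj v2) = 0" if "v1 \<in> B" "v2 \<in> B" for v1 v2 using that by simp
  have "B \<noteq> {}"
  proof
   assume "B = {}"
   then have "L = {0}" using B(2) by simp
   moreover have "a \<in> L" "a \<noteq> 0" using ab(3) unfolding ab(4) by auto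
   ultimately show False by simp
  qed
  then obtain v where v: "v \<in> B" by blast
  have "Im ((x + y) * cnj v) = Im (x * cnj v) + Im (y * cnj v)" "Im ((of_int k * x) * cnj v) = of_int k * Im (x * cnj v)" for x y k
   by (simp_all add: algebra_simps)
  then have "int_complex.subspace {z. Im (z * cnj v) = 0}" unfolding int_complex.subspace_def by (simp only: mem_Collect_eq) simp
  then have "L \<subseteq> {z. Im (z * cnj v) = 0}" unfolding B(2)[symmetric] using col v by (intro int_complex.span_minimal) auto
  then have z: "Im (a * cnj v) = 0" "Im (b * cnj v) = 0" using ab(4) by auto
  have "(Re v * Re v + Im v * Im v) * Im (a * cnj b) = Im (a * cnj v) * Re (b * cnj v) - Re (a * cnj v) * Im (b * cnj v)"
   by (simp add: algebra_simps)
  then have "Re v * Re v + Im v * Im v = 0" using z ab(3) by simp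
  then show False using min(2)[OF v] by (simp add: complex_eq_iff sum_squares_eq_zero_iff)
 qed
 then obtain v1 v2 where v: "v1 \<in> B" "v2 \<in> B" "Im (v1 * cnj v2) \<noteq> 0" by blast
 have eq: "v2 \<bullet> v2 = v1 \<bullet> v1" using min(1,2)[OF v(1)] min(1,2)[OF v(2)] min(3)[OF v(1)] min(3)[OF v(2)] by fastforce
 show thesis
 proof (rule that[OF _ _ _ v(3) eq])
  show "L = lat v1 v2" by (rule minimal_generate[OF sL min(1)[OF v(1)] min(1)[OF v(2)] v(3) refl eq min(3)[OF v(1)]])
 qed (use min v L(1) proper_K in blast)+
qed

text \<open>The angle between the minimal vectors is 60 or 120 degrees exactly for the hexagonal lattice, whose
 form is \<open>(1, 1, 1)\<close> up to equivalence.\<close>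

lemma well_rounded_angle:
 assumes L: "proper L" "well_rounded L"
 obtains v1 v2 where "L = lat v1 v2" "v1 \<in> K" "v2 \<in> K" "Im (v1 * cnj v2) \<noteq> 0" "v2 \<bullet> v2 = v1 \<bullet> v1"
  "\<forall>z\<in>L. z \<noteq> 0 --> v1 \<bullet> v1 \<le> z \<bullet> z"
  "D = -3 --> 2 * (v1 \<bullet> v2) = v1 \<bullet> v1" "D \<noteq> -3 --> \<bar>2 * (v1 \<bullet> v2)\<bar> < v1 \<bullet> v1"
proof -
 obtain v1 v2 where v: "L = lat v1 v2" "v1 \<in> K" "v2 \<in> K" "Im (v1 * cnj v2) \<noteq> 0" "v2 \<bullet> v2 = v1 \<bullet> v1"
  "\<forall>z\<in>L. z \<noteq> 0 --> v1 \<bullet> v1 \<le> z \<bullet> z" by (rule well_rounded_basis[OF L])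
 obtain m A B C where f: "m > 0" "gcd A (gcd B C) = 1" "of_real m \<in> K"
  "v1 * cnj v1 = of_real m * of_int A" "v1 * cnj v2 + cnj v1 * v2 = of_real m * of_int B"
  "v2 * cnj v2 = of_real m * of_int C" "B * B - 4 * A * C = D" "\<bar>Im (v1 * cnj v2)\<bar> = m * (Im rD / 2)"
  "lat v1 v2 \<odot> cnj ` lat v1 v2 = sc (of_real m) O'"
  using proper_form[OF L(1)[unfolded v(1)] v(2-4)] by metis
 have in1: "z * cnj z = of_real (z \<bullet> z)" for z by (simp add: complex_eq_iff inner_complex_def)
 have "of_real (v1 \<bullet> v1) = (of_real (m * of_int A) :: complex)" "of_real (v2 \<bullet> v2) = (of_real (m * of_int C) :: complex)"
  using f(4,6) unfolding in1 by simp_all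
 then have a: "v1 \<bullet> v1 = m * of_int A" "v2 \<bullet> v2 = m * of_int C" by (simp_all only: of_real_eq_iff)
 have "v1 * cnj v2 + cnj v1 * v2 = of_real (2 * (v1 \<bullet> v2))" by (simp add: complex_eq_iff inner_complex_def)
 then have "of_real (2 * (v1 \<bullet> v2)) = (of_real (m * of_int B) :: complex)" using f(5) by simp
 then have b: "2 * (v1 \<bullet> v2) = m * of_int B" by (simp only: of_real_eq_iff)
 have CA: "C = A" using a v(5) f(1) by simp
 have "v1 \<noteq> 0" using v(4) by auto
 then have "v1 \<bullet> v1 > 0" by simp
 then have A0: "A > 0" using a(1) f(1) by (simp add: zero_less_mult_iff)
 \<comment> \<open>Minimality against \<open>v1 + v2\<close> and \<open>v1 - v2\<close> is the
   reduction condition \<open>\<bar>B\<bar> \<le> A\<close>.\<close>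
 have "v1 + v2 \<in> L" "v1 - v2 \<in> L" unfolding v(1) by (auto intro: subspace_add[OF subspace_lat] subspace_diff[OF subspace_lat])
 moreover have "v1 + v2 \<noteq> 0" "v1 - v2 \<noteq> 0" using v(4) by (auto simp: add_eq_0_iff2)
 ultimately have "v1 \<bullet> v1 \<le> (v1 + v2) \<bullet> (v1 + v2)" "v1 \<bullet> v1 \<le> (v1 - v2) \<bullet> (v1 - v2)" using v(6) by blast+
 then have le: "\<bar>2 * (v1 \<bullet> v2)\<bar> \<le> v1 \<bullet> v1"
  using v(5) by (simp add: inner_add_left inner_add_right inner_diff_left inner_diff_right inner_commute[of v2 v1] abs_le_iff)
 then have "m * \<bar>of_int B\<bar> \<le> m * of_int A" unfolding b a(1) using f(1) by (simp add: abs_mult)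
 then have BA: "\<bar>B\<bar> \<le> A" using f(1) by simp
 have Dq: "B * B - 4 * A * A = D" using f(7) CA by simp
 \<comment> \<open>With \<open>C = A\<close>, equality \<open>\<bar>B\<bar> = A\<close> makes
   \<open>A\<close> a common divisor of the primitive form, so \<open>A = 1\<close> and
   \<open>D = 1 - 4\<close>; conversely \<open>D = -3\<close> bounds \<open>A\<close> by 1.\<close>
 have iff: "D = -3 \<longleftrightarrow> \<bar>B\<bar> = A"
 proof
  assume "\<bar>B\<bar> = A"
  moreover have "gcd A B = 1" using f(2) CA by (simp add: gcd.commute gcd.left_commute)
  moreover have "A dvd B" using \<open>\<bar>B\<bar> = A\<close> by fastforce
  ultimately have "A dvd 1" by simp
  then have "A = 1" using A0 by simp
  then have "B = 1 \<or> B = -1" using \<open>\<bar>B\<bar> = A\<close> by auto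
  then show "D = -3" using Dq \<open>A = 1\<close> by auto
 next
  assume "D = -3"
  have "\<bar>B\<bar> * \<bar>B\<bar> \<le> A * A" using BA by (intro mult_mono) auto
  then have "B * B \<le> A * A" by simp
  then have "A * A \<le> 1 * 1" using Dq \<open>D = -3\<close> by simp
  then have "A \<le> 1" using A0 by (metis abs_le_square_iff abs_of_pos power2_eq_square zero_less_one)
  then have "A = 1" using A0 by simp
  then have "\<bar>B\<bar> * \<bar>B\<bar> = 1" using Dq \<open>D = -3\<close> by simp
  then show "\<bar>B\<bar> = A" using \<open>A = 1\<close> by (metis abs_ge_zero abs_mult_self_eq zmult_eq_1_iff abs_1 abs_idempotent abs_minus_cancel)
 qed
 have ne: "D \<noteq> -3 --> \<bar>2 * (v1 \<bullet> v2)\<bar> < v1 \<bullet> v1"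
 proof
  assume "D \<noteq> -3"
  then have "\<bar>B\<bar> < A" using iff BA by simp
  then have "\<bar>real_of_int B\<bar> < of_int A" by simp
  then show "\<bar>2 * (v1 \<bullet> v2)\<bar> < v1 \<bullet> v1" unfolding b a(1) using f(1) by (simp add: abs_mult)
 qed
 show thesis
 \<comment> \<open>An angle of 120 degrees becomes one of 60 degrees on changing the sign of
   \<open>v2\<close>.\<close>
 proof (cases "D = -3 \<and> B < 0")
  case True
  have "\<bar>B\<bar> = A" using iff True by simp
  then have "A = - B" using True by simp
  then have "2 * (v1 \<bullet> - v2) = v1 \<bullet> v1" using b a(1) by simp
  moreover have "L = lat v1 (- v2)"
  proof -
   have "- v2 \<in> lat v1 v2" "v2 \<in> lat v1 (- v2)"
    using subspace_uminus[OF subspace_lat lat_mem2[of v2 v1]] subspace_uminus[OF subspace_lat lat_mem2[of "- v2" v1]] by simp_all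
   then show ?thesis unfolding v(1) by (intro equalityI lat_subset subspace_lat) auto
  qed
  ultimately show ?thesis using that[of v1 "- v2"] v True by auto
 next
  case False
  have "2 * (v1 \<bullet> v2) = v1 \<bullet> v1" if "D = -3"
  proof -
   have "\<bar>B\<bar> = A" using iff that by simp
   then have "B = A" using False that by simp
   then show ?thesis using b a(1) by simp
  qed
  then show ?thesis using that[OF v] ne by simp
 qed
qed

text \<open>Both lattices are scaled by the length of a minimal vector of \<open>L\<close>. The
  prime index enters \<open>perfect_two\<close> as the ratio of covolumes; for \<open>D = -3\<close>
  both lattices are hexagonal and \<open>perfect_three\<close> takes over.\<close>

lemma tempered_form_exists:
 assumes L: "proper L" "well_rounded L" and P: "integral P" "nn P = l" "prime l" and M: "well_rounded (P \<odot> L)"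
  and s: "s = (if D = -3 then 3 else 2)"
 shows "tempered_form s s l L (P \<odot> L)"
proof -
 define M where "M = P \<odot> L"
 have pM: "proper M" "nrm M = real l * nrm L" unfolding M_def using proper_ip[OF integral_proper[OF P(1)] L(1)] integral_nn(1)[OF P(1)] P(2) by simp_all
 have MsubL: "M \<subseteq> L" unfolding M_def by (rule ip_subset_right[OF P(1) L(1)])
 have nL: "nrm L > 0" by (rule nrm_props(1)[OF L(1)])
 have idx: "lattice_index L M = l" using index_proper(1)[OF L(1) pM(1) MsubL] pM(2) nL by simp
 have ne: "M \<noteq> L"
 proof
  assume "M = L"
  then have "l = 1" using pM(2) nL by simp
  then show False using P(3) by simp
 qed
 obtain v1 v2 where v: "L = lat v1 v2" "v1 \<in> K" "v2 \<in> K" "Im (v1 * cnj v2) \<noteq> 0" "v2 \<bullet> v2 = v1 \<bullet> v1"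
  "\<forall>z\<in>L. z \<noteq> 0 --> v1 \<bullet> v1 \<le> z \<bullet> z"
  "D = -3 --> 2 * (v1 \<bullet> v2) = v1 \<bullet> v1" "D \<noteq> -3 --> \<bar>2 * (v1 \<bullet> v2)\<bar> < v1 \<bullet> v1" by (rule well_rounded_angle[OF L])
 obtain w1 w2 where w: "M = lat w1 w2" "w1 \<in> K" "w2 \<in> K" "Im (w1 * cnj w2) \<noteq> 0" "w2 \<bullet> w2 = w1 \<bullet> w1"
  "\<forall>z\<in>M. z \<noteq> 0 --> w1 \<bullet> w1 \<le> z \<bullet> z"
  "D = -3 --> 2 * (w1 \<bullet> w2) = w1 \<bullet> w1" "D \<noteq> -3 --> \<bar>2 * (w1 \<bullet> w2)\<bar> < w1 \<bullet> w1"
  by (rule well_rounded_angle[OF pM(1) assms(6)[folded M_def]])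
 have "v1 \<noteq> 0" using v(4) by auto
 then have v0: "v1 \<bullet> v1 > 0" by simp
 define c where "c = 1 / sqrt (v1 \<bullet> v1)"
 have c0: "c > 0" using v0 by (simp add: c_def)
 have c2: "c * c * (v1 \<bullet> v1) = 1" using v0 by (simp add: c_def)
 define u where "u = c * c * (w1 \<bullet> w1)"
 define e1 e2 g1 g2 where "e1 = c *\<^sub>R v1" and "e2 = c *\<^sub>R v2" and "g1 = c *\<^sub>R w1" and "g2 = c *\<^sub>R w2"
 have img: "(\<lambda>v. c *\<^sub>R v) ` lat a b = lat (c *\<^sub>R a) (c *\<^sub>R b)" for a b
  using image_mult_lat[of "of_real c" a b] by (simp only: scaleR_conv_of_real)
 have Lc: "(\<lambda>v. c *\<^sub>R v) ` L = lat e1 e2" and Mc: "(\<lambda>v. c *\<^sub>R v) ` M = lat g1 g2"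
  by (simp_all only: v(1) w(1) img e1_def e2_def g1_def g2_def)
 have Ims: "Im ((c *\<^sub>R a) * cnj (c *\<^sub>R b)) = c * c * Im (a * cnj b)" for a b by simp
 have ins: "(c *\<^sub>R a) \<bullet> (c *\<^sub>R b) = c * c * (a \<bullet> b)" for a b :: complex by simp
 interpret nested_lattices e1 e2 g1 g2 u
 proof
  show "Im (e1 * cnj e2) \<noteq> 0" "Im (g1 * cnj g2) \<noteq> 0" using v(4) w(4) c0 by (simp_all only: e1_def e2_def g1_def g2_def Ims mult_eq_0_iff) auto
  show "e1 \<bullet> e1 = 1" "e2 \<bullet> e2 = 1" "g1 \<bullet> g1 = u" "g2 \<bullet> g2 = u" unfolding e1_def e2_def g1_def g2_def ins u_def v(5) w(5) c2 by (rule refl)+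
  show "lat g1 g2 \<subseteq> lat e1 e2" unfolding Lc[symmetric] Mc[symmetric] using MsubL by blast
  have "inj (\<lambda>v::complex. c *\<^sub>R v)" using c0 by (auto intro: injI)
  then show "lat g1 g2 \<noteq> lat e1 e2" unfolding Lc[symmetric] Mc[symmetric] using ne by (simp only: inj_image_eq_iff not_False_eq_True)
  fix z assume "z \<in> lat e1 e2" "z \<noteq> 0"
  then obtain y where y: "y \<in> L" "z = c *\<^sub>R y" "y \<noteq> 0" unfolding Lc[symmetric] by auto
  have "c * c * (v1 \<bullet> v1) \<le> c * c * (y \<bullet> y)" using v(6) y(1,3) c0 by (intro mult_left_mono) auto
  then show "1 \<le> z \<bullet> z" unfolding y(2) ins c2 .
 next
  fix z assume "z \<in> lat g1 g2" "z \<noteq> 0"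
  then obtain y where y: "y \<in> M" "z = c *\<^sub>R y" "y \<noteq> 0" unfolding Mc[symmetric] by auto
  have "c * c * (w1 \<bullet> w1) \<le> c * c * (y \<bullet> y)" using w(6) y(1,3) c0 by (intro mult_left_mono) auto
  then show "u \<le> z \<bullet> z" unfolding y(2) ins u_def .
 qed
 have "normalized_tempered_perfect (lat e1 e2) (lat g1 g2) S S' \<and> consists_of_pairs S s \<and> consists_of_pairs S' s"
 proof (cases "D = -3")
  case True
  have t: "2 * (e1 \<bullet> e2) = 1" "2 * (g1 \<bullet> g2) = u"
   using v(7) w(7) True c2 unfolding e1_def e2_def g1_def g2_def ins u_def by (simp_all add: algebra_simps)
  show ?thesis
   using perfect_three[OF t(1)] pairs_three[OF e(1)] pairs_three[OF g(1)] minimal_vectors_three[OF e(2,3) _ t(1)]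
    minimal_vectors_three[OF g(2,3) _ t(2)] u_gt1 True s by simp
 next
  case False
  have sc: "\<bar>2 * (c * c * x)\<bar> = c * c * \<bar>2 * x\<bar>" for x by (simp add: abs_mult)
  have cc: "c * c > 0" using c0 by simp
  have "c * c * \<bar>2 * (v1 \<bullet> v2)\<bar> < c * c * (v1 \<bullet> v1)" "c * c * \<bar>2 * (w1 \<bullet> w2)\<bar> < c * c * (w1 \<bullet> w1)"
   using v(8) w(8) False by (simp_all only: mult_less_cancel_left_pos[OF cc] simp_thms)
  then have t: "\<bar>2 * (e1 \<bullet> e2)\<bar> < 1" "\<bar>2 * (g1 \<bullet> g2)\<bar> < u"
   unfolding e1_def e2_def g1_def g2_def ins u_def sc c2 by simp_all
  have cv: "\<bar>Im (v1 * cnj v2)\<bar> = nrm L * (Im rD / 2)" "\<bar>Im (w1 * cnj w2)\<bar> = nrm M * (Im rD / 2)"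
   unfolding v(1) w(1) by (rule covol[OF L(1)[unfolded v(1)] v(2-4)], rule covol[OF pM(1)[unfolded w(1)] w(2-4)])
  have "\<bar>Im (w1 * cnj w2)\<bar> = real l * \<bar>Im (v1 * cnj v2)\<bar>" unfolding cv pM(2) by simp
  then have i: "\<bar>Im (g1 * cnj g2)\<bar> = real l * \<bar>Im (e1 * cnj e2)\<bar>" unfolding e1_def e2_def g1_def g2_def Ims abs_mult by simp
  show ?thesis
   using perfect_two[OF t(1) P(3) i] pairs_two[OF e(1)] pairs_two[OF g(1)] minimal_vectors_two[OF e(2,3) _ t(1)]
    minimal_vectors_two[OF g(2,3) _ t(2)] u_gt1 False s by simp
 qed
 then have "\<exists>c>0. \<exists>S S'. normalized_tempered_perfect ((\<lambda>v. c *\<^sub>R v) ` L) ((\<lambda>v. c *\<^sub>R v) ` M) S S' \<and> consists_of_pairs S s \<and> consists_of_pairs S' s"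
  unfolding Lc[symmetric] Mc[symmetric] using c0 by blast
 moreover have "complex_lattice L" "complex_lattice M" using L(2) assms(6) unfolding well_rounded_def M_def by blast+
 ultimately show ?thesis unfolding tempered_form_def using P(3) MsubL idx by (simp only: M_def)
qed

text \<open>The subgroup of squares is itself one of the cosets, so it consists of the
  identity.\<close>

lemma one_class_per_genus_square:
 assumes "one_class_per_genus d0 f" "X \<in> carrier G" shows "X \<cdot> X = 1\<^sub>G"
proof -
 define H where "H = {X \<cdot> X | X. X \<in> carrier G}"
 have H: "H \<subseteq> carrier G" by (auto simp: H_def)
 have "H #>\<^bsub>G\<^esub> 1\<^sub>G \<in> rcosets\<^bsub>G\<^esub> H" using H by (rule G.rcosetsI) simp
 then have "H \<in> genera d0 f" using G.coset_mult_one[OF H] by (simp add: genera_def H_def)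
 then have "card H = 1" using assms(1) by (simp add: one_class_per_genus_def)
 then obtain h where h: "H = {h}" by (rule card_1_singletonE)
 have "1\<^sub>G \<cdot> 1\<^sub>G \<in> H" unfolding H_def by blast
 moreover have "X \<cdot> X \<in> H" unfolding H_def using assms(2) by blast
 ultimately show ?thesis unfolding h by simp
qed

lemma well_rounded_class_square:
 assumes X: "X \<in> carrier G" and wr: "well_rounded_class X" shows "X \<cdot> X = 1\<^sub>G"
proof -
 obtain L where L: "proper L" "X = cl L" using X by (auto simp: carrier_G)
 then have "L \<in> X" using mem_cl by simp
 then have "well_rounded L" using wr by (simp add: well_rounded_class_def)
 from well_rounded_basis[OF L(1) this] obtain v1 v2 where v: "L = lat v1 v2" "v1 \<in> K" "v2 \<in> K" "Im (v1 * cnj v2) \<noteq> 0" "v2 \<bullet> v2 = v1 \<bullet> v1"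
  by metis
 have in1: "z * cnj z = of_real (z \<bullet> z)" for z by (simp add: complex_eq_iff inner_complex_def)
 have z: "v1 * cnj v1 = of_real (v1 \<bullet> v1)" "v2 * cnj v2 = of_real (v1 \<bullet> v1)" using in1[of v1] in1[of v2] v(5) by simp_all
 have nz: "v1 \<noteq> 0" "v2 \<noteq> 0" using v(4) by auto
 define r where "r = v1 * v2 / of_real (v1 \<bullet> v1)"
 \<comment> \<open>Both equations hold because the two basis vectors have the same length; the
   conjugate basis is thus mapped to the basis in reversed order.\<close>
 have r: "r * cnj v1 = v2" "r * cnj v2 = v1" unfolding r_def using z nz by (simp_all add: field_simps)
 have "r = v1 / cnj v2" using r(2) nz by fastforce
 then have rK: "r \<in> K" "r \<noteq> 0" using v nz by (auto intro!: K_divide)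
 have "sc r (cnj ` L) = lat v2 v1" unfolding v(1) cnj_lat image_mult_lat r ..
 also have "\<dots> = L" unfolding v(1) by (intro equalityI lat_subset subspace_lat) auto
 finally have "L = sc r (cnj ` L)" ..
 then have "cl (cnj ` L) = cl L" using cl_sc[OF proper_cnj(1)[OF L(1)] rK] by simp
 then show ?thesis using cl_cnj_mult[OF L(1)] L(2) by (simp add: one_G)
qed

lemma main_theorem:
 assumes C: "C \<in> carrier G" "C' \<in> carrier G" and wr: "well_rounded_class C" "well_rounded_class C'"
 defines "star \<equiv> prime_ideal_in_class d0 f (inv\<^bsub>G\<^esub> C \<cdot> C')"
 shows "prime l ==> star l ==> \<exists>L\<in>C. \<exists>M\<in>C'. tempered_form (if D = -3 then 3 else 2) (if D = -3 then 3 else 2) l L M"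
  and "infinite {l. prime l \<and> star l}"
  and "one_class_per_genus d0 f ==>
   \<exists>R::int set. R \<noteq> {} \<and> finite {l. prime l \<and> \<not> (star l \<longleftrightarrow> (\<exists>r\<in>R. [int l = r] (mod D)))}"
proof -
 define X where "X = inv\<^bsub>G\<^esub> C \<cdot> C'"
 have X: "X \<in> carrier G" unfolding X_def using C by simp
 have sq: "C \<cdot> C = 1\<^sub>G" "C' \<cdot> C' = 1\<^sub>G" by (rule well_rounded_class_square[OF C(1) wr(1)], rule well_rounded_class_square[OF C(2) wr(2)])
 have invC: "inv\<^bsub>G\<^esub> C = C" by (rule G.inv_equality[OF sq(1) C(1) C(1)])
 have "X \<cdot> X = (C \<cdot> C) \<cdot> (C' \<cdot> C')" unfolding X_def invC using C by (simp only: G.m_ac G.m_closed)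
 then have XX: "X \<cdot> X = 1\<^sub>G" using sq by simp
 have star: "star l \<longleftrightarrow> (\<exists>P. integral P \<and> nn P = l \<and> P \<in> X)" if "prime l" for l
  unfolding star_def X_def by (rule prime_ideal_in_class_iff[OF that])
 have clX: "cl P = X \<longleftrightarrow> P \<in> X" if "proper P" for P
  using carrier_memD[OF X, of P] mem_cl[of P P] that by auto
 show "\<exists>L\<in>C. \<exists>M\<in>C'. tempered_form (if D = -3 then 3 else 2) (if D = -3 then 3 else 2) l L M" if l: "prime l" "star l"
 proof -
  obtain P where P: "integral P" "nn P = l" "P \<in> X" using star[OF l(1)] l(2) by blast
  obtain L where "L \<in> C" using carrier_nonempty[OF C(1)] by blast
  then have L: "L \<in> C" "proper L" "C = cl L" using carrier_memD[OF C(1)] by auto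
  have pM: "proper (P \<odot> L)" using proper_ip(1)[OF integral_proper[OF P(1)] L(2)] .
  have "cl (P \<odot> L) = X \<cdot> C" using cl_mult[OF integral_proper[OF P(1)] L(2)] clX[OF integral_proper[OF P(1)]] P(3) L(3) by simp
  also have "\<dots> = C'" unfolding X_def invC using C sq(1) G.m_comm[of C C'] G.m_assoc[of C' C C] by simp
  finally have M: "P \<odot> L \<in> C'" using pM mem_cl[of "P \<odot> L" "P \<odot> L"] by simp
  have "tempered_form (if D = -3 then 3 else 2) (if D = -3 then 3 else 2) l L (P \<odot> L)"
   using wr L(1) M unfolding well_rounded_class_def by (intro tempered_form_exists[OF L(2) _ P(1,2) l(1) _ refl]) blast+
  then show ?thesis using L(1) M by blast
 qed
 have "{l. prime l \<and> star l} = {l. prime l \<and> (\<exists>P. integral P \<and> nn P = l \<and> P \<in> X)}" using star by blast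
 then show inf: "infinite {l. prime l \<and> star l}"
  using infinite_primes_in_class[OF split_not_summable[OF X XX]] by simp
 show "\<exists>R::int set. R \<noteq> {} \<and> finite {l. prime l \<and> \<not> (star l \<longleftrightarrow> (\<exists>r\<in>R. [int l = r] (mod D)))}" if genus: "one_class_per_genus d0 f"
 proof -
  have Gsq: "Y \<cdot> Y = 1\<^sub>G" if "Y \<in> carrier G" for Y using one_class_per_genus_square[OF genus that] .
  \<comment> \<open>The exceptional primes: the factors 2 and \<open>D\<close> are excluded in the
    residue criterion for splitting, and \<open>1 - D\<close> in
    \<open>class_determined_mod_D\<close>.\<close>
  define E where "E = {l. int l dvd 2 * D * (1 - D)}"
  have nz: "2 * D * (1 - D) \<noteq> 0" using D_neg by simp
  have "E \<subseteq> {..nat \<bar>2 * D * (1 - D)\<bar>}"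
  proof
   fix l assume "l \<in> E"
   then have "int l \<le> \<bar>2 * D * (1 - D)\<bar>" using nz by (intro zdvd_imp_le) (simp_all add: E_def)
   then show "l \<in> {..nat \<bar>2 * D * (1 - D)\<bar>}" by simp
  qed
  then have fE: "finite E" by (rule finite_subset) simp
  \<comment> \<open>The congruence classes are those of the unexceptional primes that satisfy
    \<open>star\<close>, and infinitude makes the set nonempty. What remains is that one such prime
    speaks for all unexceptional primes of its congruence class.\<close>
  define S where "S = {l. prime l \<and> star l} - E"
  have S: "S \<noteq> {}" unfolding S_def using inf fE by (metis Diff_infinite_finite finite.emptyI)
  have "star l \<longleftrightarrow> (\<exists>r\<in>int ` S. [int l = r] (mod D))" if l: "prime l" "l \<notin> E" for l
  proof
   assume "star l"
   then have "int l \<in> int ` S" using l by (simp add: S_def)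
   then show "\<exists>r\<in>int ` S. [int l = r] (mod D)" by (intro bexI[of _ "int l"]) auto
  next
   assume "\<exists>r\<in>int ` S. [int l = r] (mod D)"
   then obtain k where k: "prime k" "star k" "k \<notin> E" "[int l = int k] (mod D)" by (auto simp: S_def)
   obtain Q where Q: "integral Q" "nn Q = k" "Q \<in> X" using star[OF k(1)] k(2) by blast
   have odd: "2 < t" "\<not> int t dvd D" if t: "prime t" "t \<notin> E" for t
   proof -
    have "\<not> int t dvd 2" "\<not> int t dvd D" using t(2) by (auto simp: E_def)
    then show "2 < t" "\<not> int t dvd D" using prime_ge_2_nat[OF t(1)] by (cases "t = 2"; simp)+
   qed
   have "QuadRes k D" using split_iff_QuadRes[OF k(1) odd[OF k(1,3)]] Q by blast
   then have "QuadRes l D" using QuadRes_period[OF D_neg D_mod4 l(1) odd[OF l] k(1) odd[OF k(1,3)] k(4)] by simp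
   then obtain P where P: "integral P" "nn P = l" using split_iff_QuadRes[OF l(1) odd[OF l]] by blast
   have "cl P = cl Q" by (rule class_determined_mod_D[OF Gsq]) (use P Q l k in \<open>auto simp: E_def\<close>)
   then have "P \<in> X" using clX[OF integral_proper[OF Q(1)]] clX[OF integral_proper[OF P(1)]] Q(3) by simp
   then show "star l" using star[OF l(1)] P by blast
  qed
  then have "{l. prime l \<and> \<not> (star l \<longleftrightarrow> (\<exists>r\<in>int ` S. [int l = r] (mod D)))} \<subseteq> E" by blast
  then show ?thesis using fE S by (intro exI[of _ "int ` S"]) (auto intro: finite_subset)
 qed
qed

end

theorem theorem3:
  fixes d0 D :: int and f :: nat and C C' :: "complex set set"
  defines "star \<equiv> prime_ideal_in_class d0 f (inv\<^bsub>class_group d0 f\<^esub> C \<otimes>\<^bsub>class_group d0 f\<^esub> C')"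
  assumes "fundamental_discriminant d0" and "d0 < 0" and "f \<ge> 1" and "D = (int f)\<^sup>2 * d0"
    and "C \<in> carrier (class_group d0 f)" and "C' \<in> carrier (class_group d0 f)"
    and "well_rounded_class C" and "well_rounded_class C'"
  shows "(D \<noteq> -3 \<longrightarrow> (\<forall>l. prime l \<and> star l \<longrightarrow> (\<exists>L\<in>C. \<exists>M\<in>C'. tempered_form 2 2 l L M)))
    \<and> (D = -3 \<longrightarrow> (\<forall>l. prime l \<and> star l \<longrightarrow> (\<exists>L\<in>C. \<exists>M\<in>C'. tempered_form 3 3 l L M)))
    \<and> infinite {l. prime l \<and> star l}
    \<and> (one_class_per_genus d0 f \<longrightarrow>
         (\<exists>R::int set. R \<noteq> {} \<and>
            finite {l. prime l \<and> \<not> (star l \<longleftrightarrow> (\<exists>r\<in>R. [int l = r] (mod D)))}))"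
proof -
  have q: "quad d0 f" using assms by unfold_locales
  have "D = quad.D d0 f" using assms by (simp add: quad.D_def[OF q])
  then show ?thesis using quad.main_theorem[OF q assms(6-9)] unfolding star_def by (cases "D = -3") auto
qed

end
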